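(* Let $A$ be a unital $C^*$-algebra, let $\delta$ be a (densely defined, possibly unbounded) closed derivation of $A$ with domain $\mathrm{Dom}(\delta)$, and let $h\in \mathrm{Dom}(\delta)$ be a selfadjoint element. (i) Let $f:\mathbb{R}\to\mathbb{C}$ be a smooth function. Then $f(h)\in\mathrm{Dom}(\delta)$ and $$\delta(f(h))=[h_{(0)},h_{(1)};f](\delta(h)).$$ (ii) Let $n\ge 1$, let $b_1,\dots,b_n\in \mathrm{Dom}(\delta)$ and let $f:\mathbb{R}^{n+1}\to\mathbb{C}$ be a smooth function. Then $f(h_{(0)},\dots,h_{(n)})(b_1\cdot b_2\cdots b_n)\in\mathrm{Dom}(\delta)$ and $$\delta\big(f(h_{(0)},\dots,h_{(n)})(b_1\cdot b_2\cdots b_n)\big)=\sum_{j=1}^{n} f(h_{(0)},\dots,h_{(n)})\big(b_1\cdots b_{j-1}\cdot\delta(b_j)\cdot b_{j+1}\cdots b_n\big)+\sum_{j=0}^{n} f_j(h_{(0)},\dots,h_{(n+1)})\big(b_1\cdots b_j\cdot\delta(h)\cdot b_{j+1}\cdots b_n\big),$$ where $f_j$ is the partial divided difference $$f_j(t_0,\dots,t_{n+1})=\big[t_j,t_{j+1};\ t\mapsto f(t_0,\dots,t_{j-1},t,t_{j+2},\dots,t_{n+1})\big].$$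
   Context: Divided differences: $[x_0;f]=f(x_0)$, $[x_0,\dots,x_n;f]=\dfrac{[x_1,\dots,x_n;f]-[x_0,\dots,x_{n-1};f]}{x_n-x_0}$ for distinct points, extended smoothly to coinciding points when $f$ is smooth; in particular $[x,y;f]=\frac{f(x)-f(y)}{x-y}$. Contraction form: let $A$ be a unital $C^*$-algebra, $h=h^*\in A$, $b_1,\dots,b_n\in A$, and let $F$ be a smooth function of $n+1$ real variables. Replace $F$ by a Schwartz function agreeing with $F$ on a neighbourhood of $\mathrm{spec}(h)^{n+1}$ and write $F(\lambda)=\int_{\mathbb{R}^{n+1}}\hat F(\xi)e^{i\sum_j\xi_j\lambda_j}d\xi$. Then $$F(h_{(0)},\dots,h_{(n)})(b_1\cdot b_2\cdots b_n):=\int_{\mathbb{R}^{n+1}}\hat F(\xi)\,e^{i\xi_0h}b_1e^{i\xi_1h}b_2\cdots b_ne^{i\xi_nh}\,d\xi\in A,$$ which does not depend on the choices (equivalently: apply the multiplication map to the functional calculus $F(h_{(0)},\dots,h_{(n)})$ in the projective tensor power $A^{\otimes_\gamma(n+1)}$ times $b_1\otimes\cdots\otimes b_n\otimes1$). The dots only separate the slots. The variable $t_j$ of a function corresponds to $h_{(j)}$; e.g. $[h_{(0)},h_{(1)};f](b)$ means $F(h_{(0)},h_{(1)})(b)$ with $F(t_0,t_1)=[t_0,t_1;f]$. *)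

theory Defs
  imports "HOL-Analysis.Analysis"
begin

section \<open>Unital C*-algebras and closed derivations\<close>

text \<open>The underlying real Banach algebra comes from the library, so \<open>1 \<noteq> 0\<close> and
  \<open>norm 1 = 1\<close>; the zero algebra is excluded.\<close>

class cstar_algebra = real_normed_algebra_1 + banach +
  fixes scaleC :: "complex \<Rightarrow> 'a \<Rightarrow> 'a"  (infixr "*\<^sub>C" 75)
    and star :: "'a \<Rightarrow> 'a"
  assumes scaleC_add_right: "c *\<^sub>C (x + y) = c *\<^sub>C x + c *\<^sub>C y"
    and scaleC_add_left: "(c + d) *\<^sub>C x = c *\<^sub>C x + d *\<^sub>C x"
    and scaleC_scaleC: "c *\<^sub>C (d *\<^sub>C x) = (c * d) *\<^sub>C x"
    and scaleC_of_real: "complex_of_real r *\<^sub>C x = r *\<^sub>R x"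
    and mult_scaleC_left: "(c *\<^sub>C x) * y = c *\<^sub>C (x * y)"
    and mult_scaleC_right: "x * (c *\<^sub>C y) = c *\<^sub>C (x * y)"
    and norm_scaleC: "norm (c *\<^sub>C x) = cmod c * norm x"
    and star_add: "star (x + y) = star x + star y"
    and star_scaleC: "star (c *\<^sub>C x) = cnj c *\<^sub>C star x"
    and star_mult: "star (x * y) = star y * star x"
    and star_star: "star (star x) = x"
    and cstar_identity: "norm (star x * x) = (norm x)\<^sup>2"

definition spectrum :: "'a::cstar_algebra \<Rightarrow> complex set" where
  "spectrum a = {z. \<not> (\<exists>b. (z *\<^sub>C 1 - a) * b = 1 \<and> b * (z *\<^sub>C 1 - a) = 1)}"

text \<open>The partial map is given by its domain \<open>D\<close> and a total function \<open>\<delta>\<close> whose values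
  outside \<open>D\<close> are irrelevant. Neither \<open>1 \<in> D\<close> nor any compatibility of \<open>D\<close> and \<open>\<delta>\<close> with the
  involution is required.\<close>

locale closed_derivation =
  fixes D :: "'a::cstar_algebra set" and \<delta> :: "'a \<Rightarrow> 'a"
  assumes dense: "closure D = UNIV"
    and zero_mem: "0 \<in> D"
    and add_mem: "x \<in> D \<Longrightarrow> y \<in> D \<Longrightarrow> x + y \<in> D"
    and scaleC_mem: "x \<in> D \<Longrightarrow> c *\<^sub>C x \<in> D"
    and mult_mem: "x \<in> D \<Longrightarrow> y \<in> D \<Longrightarrow> x * y \<in> D"
    and add: "x \<in> D \<Longrightarrow> y \<in> D \<Longrightarrow> \<delta> (x + y) = \<delta> x + \<delta> y"
    and scaleC: "x \<in> D \<Longrightarrow> \<delta> (c *\<^sub>C x) = c *\<^sub>C \<delta> x"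
    and leibniz: "x \<in> D \<Longrightarrow> y \<in> D \<Longrightarrow> \<delta> (x * y) = \<delta> x * y + x * \<delta> y"
    and closed_graph: "closed {(x, \<delta> x) | x. x \<in> D}"

section \<open>Smooth and Schwartz functions of \<open>m\<close> real variables\<close>

text \<open>A function on \<open>\<real>\<^sup>m\<close> is represented by a function of \<open>t :: nat \<Rightarrow> real\<close> that depends
  only on \<open>t 0, \<dots>, t (m - 1)\<close>; for such a function, continuity in the product topology on
  \<open>nat \<Rightarrow> real\<close> is continuity on \<open>\<real>\<^sup>m\<close>.\<close>

definition partial_deriv :: "nat \<Rightarrow> ((nat \<Rightarrow> real) \<Rightarrow> complex) \<Rightarrow> (nat \<Rightarrow> real) \<Rightarrow> complex" where
  "partial_deriv i F x = vector_derivative (\<lambda>t. F (x(i := t))) (at (x i))"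

definition smooth :: "nat \<Rightarrow> ((nat \<Rightarrow> real) \<Rightarrow> complex) \<Rightarrow> bool" where
  "smooth m F \<longleftrightarrow>
     (\<forall>x y. (\<forall>i<m. x i = y i) \<longrightarrow> F x = F y) \<and>
     (\<forall>is. set is \<subseteq> {..<m} \<longrightarrow>
        continuous_on UNIV (foldr partial_deriv is F) \<and>
        (\<forall>i<m. \<forall>x. (\<lambda>t. foldr partial_deriv is F (x(i := t))) differentiable (at (x i))))"

definition schwartz :: "nat \<Rightarrow> ((nat \<Rightarrow> real) \<Rightarrow> complex) \<Rightarrow> bool" where
  "schwartz m F \<longleftrightarrow> smooth m F \<and>
     (\<forall>is k. set is \<subseteq> {..<m} \<longrightarrow>
        (\<exists>C. \<forall>x. (1 + L2_set x {..<m}) ^ k * cmod (foldr partial_deriv is F x) \<le> C))"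

abbreviation lborel_n :: "nat \<Rightarrow> (nat \<Rightarrow> real) measure" where
  "lborel_n m \<equiv> PiM {..<m} (\<lambda>_. lborel)"

text \<open>Normalised so that \<open>F \<lambda> = \<integral> fourier m F \<xi> * exp (\<i> * (\<Sum>j<m. \<xi> j * \<lambda> j)) d\<xi>\<close> for
  Schwartz functions.\<close>

definition fourier :: "nat \<Rightarrow> ((nat \<Rightarrow> real) \<Rightarrow> complex) \<Rightarrow> (nat \<Rightarrow> real) \<Rightarrow> complex" where
  "fourier m F \<xi> = complex_of_real (1 / (2 * pi) ^ m) *
     (LINT x|lborel_n m. F x * exp (- \<i> * complex_of_real (\<Sum>j<m. \<xi> j * x j)))"

section \<open>The Bochner integral in arbitrary Banach spaces\<close>

text \<open>The library's \<open>has_bochner_integral\<close> is restricted to second countable spaces, which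
  would exclude nonseparable algebras. The following asks, as there, for integrable simple
  functions converging to \<open>f\<close> in \<open>L\<^sup>1\<close>, but it does not use Borel measurability
  of \<open>f\<close> itself.\<close>

definition has_vector_integral ::
    "'b measure \<Rightarrow> ('b \<Rightarrow> 'a::banach) \<Rightarrow> 'a \<Rightarrow> bool" where
  "has_vector_integral M f I \<longleftrightarrow>
     (\<exists>s. (\<forall>i. Bochner_Integration.simple_bochner_integrable M (s i)) \<and>
          (\<forall>i. (\<lambda>x. norm (f x - s i x)) \<in> borel_measurable M) \<and>
          (\<lambda>i. \<integral>\<^sup>+x. ennreal (norm (f x - s i x)) \<partial>M) \<longlonglongrightarrow> 0 \<and>
          (\<lambda>i::nat. Bochner_Integration.simple_bochner_integral M (s i)) \<longlonglongrightarrow> I)"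

section \<open>The contracted functional calculus\<close>

text \<open>\<open>exp_word h \<xi> [b\<^sub>1, \<dots>, b\<^sub>n]\<close> is
  \<open>e\<^bsup>i\<xi>\<^sub>0h\<^esup> b\<^sub>1 e\<^bsup>i\<xi>\<^sub>1h\<^esup> b\<^sub>2 \<cdots> b\<^sub>n e\<^bsup>i\<xi>\<^sub>nh\<^esup>\<close>; note that
  \<open>b\<^sub>j\<close> is \<open>bs ! (j - 1)\<close>.\<close>

definition exp_word :: "'a::cstar_algebra \<Rightarrow> (nat \<Rightarrow> real) \<Rightarrow> 'a list \<Rightarrow> 'a" where
  "exp_word h \<xi> bs =
     exp ((\<i> * complex_of_real (\<xi> 0)) *\<^sub>C h) *
     prod_list (map (\<lambda>k. bs ! k * exp ((\<i> * complex_of_real (\<xi> (Suc k))) *\<^sub>C h)) [0..<length bs])"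

text \<open>\<open>func_calc F h [b\<^sub>1, \<dots>, b\<^sub>n]\<close> is
  \<open>F(h\<^bsub>(0)\<^esub>, \<dots>, h\<^bsub>(n)\<^esub>)(b\<^sub>1 \<cdot> \<dots> \<cdot> b\<^sub>n)\<close>, so \<open>func_calc (\<lambda>t. f (t 0)) h []\<close> is \<open>f(h)\<close>.
  The definite description expresses that the value does not depend on the Schwartz
  function \<open>G\<close> replacing \<open>F\<close>.\<close>

definition func_calc ::
    "((nat \<Rightarrow> real) \<Rightarrow> complex) \<Rightarrow> 'a::cstar_algebra \<Rightarrow> 'a list \<Rightarrow> 'a" where
  "func_calc F h bs = (let m = Suc (length bs) in
     THE a. \<exists>G U. schwartz m G \<and>
       open U \<and> {t. \<forall>i<m. complex_of_real (t i) \<in> spectrum h} \<subseteq> U \<and> (\<forall>t\<in>U. G t = F t) \<and>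
       has_vector_integral (lborel_n m) (\<lambda>\<xi>. fourier m G \<xi> *\<^sub>C exp_word h \<xi> bs) a)"

section \<open>Divided differences\<close>

text \<open>The value at coinciding points is the continuous extension for differentiable \<open>f\<close>.\<close>

definition divided_diff :: "real \<Rightarrow> real \<Rightarrow> (real \<Rightarrow> complex) \<Rightarrow> complex" where
  "divided_diff x y f =
     (if x = y then vector_derivative f (at x) else (f x - f y) / complex_of_real (x - y))"

text \<open>\<open>f\<^sub>j(t\<^sub>0, \<dots>, t\<^bsub>n+1\<^esub>) = [t\<^sub>j, t\<^bsub>j+1\<^esub>; s \<mapsto> f(t\<^sub>0, \<dots>, t\<^bsub>j-1\<^esub>, s, t\<^bsub>j+2\<^esub>, \<dots>, t\<^bsub>n+1\<^esub>)]\<close>\<close>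

definition partial_divided_diff ::
    "nat \<Rightarrow> ((nat \<Rightarrow> real) \<Rightarrow> complex) \<Rightarrow> (nat \<Rightarrow> real) \<Rightarrow> complex" where
  "partial_divided_diff j f t =
     divided_diff (t j) (t (Suc j))
       (\<lambda>s. f (\<lambda>i. if i < j then t i else if i = j then s else t (Suc i)))"

end

theory Submission
  imports Defs "HOL-Probability.Probability"
begin

text \<open>For a Schwartz function \<open>G\<close> the contracted calculus is bounded by the \<open>L\<^sup>1\<close> norm of the
  Fourier transform of \<open>G\<close>, which is controlled by the \<open>L\<^sup>1\<close> norms of finitely many derivatives
  of \<open>G\<close>, and multiplying \<open>G\<close> by the variable \<open>t\<^sub>j\<close> amounts to inserting \<open>h\<close> in slot \<open>j\<close>.

  The value depends only on \<open>G\<close> near \<open>spec(h)\<close>: if \<open>\<lambda>\<close> is outside the spectrum and \<open>b\<close> is inverse to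
  \<open>h - \<lambda>\<close>, then the value for \<open>G\<close> with coefficient \<open>c\<^sub>j\<close> is the value for \<open>(t\<^sub>j - \<lambda>)\<^sup>n G\<close> with
  coefficient \<open>c\<^sub>j b\<^sup>n\<close>, which tends to \<open>0\<close> as \<open>n\<close> grows when \<open>G\<close> is supported where \<open>t\<^sub>j\<close> is close
  to \<open>\<lambda>\<close>. Dividing by \<open>(1 + t\<^sub>j\<^sup>2)\<^sup>n\<close> instead handles functions supported where \<open>\<bar>t\<^sub>j\<bar>\<close> exceeds the
  norm of \<open>h\<close>. Hence a smooth function may be multiplied by a cutoff of a cube containing
  \<open>spec(h)\<close>.

  For monomials the assertion is the Leibniz rule, since the divided difference of \<open>t\<^sup>k\<close> is
  \<open>\<Sum>\<^sub>p s\<^sup>p t\<^bsup>k-1-p\<^esup>\<close>. Polynomials approximate a smooth function on the cube together with all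
  derivatives, and so do their divided differences, because
  \<open>[s, t; f] = \<integral>\<^sub>0\<^sup>1 f'(u s + (1 - u) t) du\<close>. Closedness of the derivation passes the formula to the
  limit.\<close>

section \<open>Unital C*-algebras\<close>

text \<open>\<open>func_calc\<close> is a definite description, so nothing can be computed before
  independence of \<open>G\<close> is known. Slots cannot be merged, because arbitrary elements
  stand between the copies of \<open>h\<close>; but a tuple outside the relevant set has at least
  one coordinate off the spectrum, so vanishing is first obtained for \<open>G\<close> supported
  near one value of one coordinate. Bisection, one coordinate after the other, spreads this to all
  \<open>G\<close> that vanish near the spectral tuples. The bridge to algebra is the value on a
  cutoff. Dilating the cutoff does not change the value, lets all exponentials tend to 1, and keeps
  the total mass of the Fourier transform equal to the value of the cutoff at the origin, which is
  1. Hence the cutoff acts as the constant 1 and yields the plain product of the coefficients. To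
  iterate multiplication by \<open>t j\<close>, every slot gets a coefficient, also the first, where
  it is the unit. This is one reason why \<open>1 \<in> D\<close> and \<open>\<delta> 1 = 0\<close>
  are derived from density and closedness. The algebra may be nonseparable, so simple approximations
  come from rounding the finitely many real variables, not the values.\<close>

lemma scaleC_scaleR: "z *\<^sub>C (r *\<^sub>R (x::'a::cstar_algebra)) = r *\<^sub>R (z *\<^sub>C x)"
  by (metis scaleC_of_real scaleC_scaleC mult.commute)

lemma bounded_bilinear_scaleC: "bounded_bilinear (scaleC :: complex \<Rightarrow> 'a::cstar_algebra \<Rightarrow> 'a)"
proof
  fix a a' :: complex and b b' :: 'a and r :: real
  show "(a + a') *\<^sub>C b = a *\<^sub>C b + a' *\<^sub>C b" by (rule scaleC_add_left)
  show "a *\<^sub>C (b + b') = a *\<^sub>C b + a *\<^sub>C b'" by (rule scaleC_add_right)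
  show "(r *\<^sub>R a) *\<^sub>C b = r *\<^sub>R (a *\<^sub>C b)"
    by (metis scaleC_of_real scaleC_scaleC scaleR_conv_of_real)
  show "a *\<^sub>C (r *\<^sub>R b) = r *\<^sub>R (a *\<^sub>C b)" by (rule scaleC_scaleR)
  show "\<exists>K. \<forall>a (b::'a). norm (a *\<^sub>C b) \<le> norm a * norm b * K"
    by (intro exI[of _ 1]) (simp add: norm_scaleC)
qed

interpretation scaleC: bounded_bilinear "scaleC :: complex \<Rightarrow> 'a::cstar_algebra \<Rightarrow> 'a"
  by (rule bounded_bilinear_scaleC)

lemmas scaleC_simps = scaleC.zero_left scaleC.zero_right scaleC.minus_left scaleC.minus_right
  scaleC.diff_left scaleC.diff_right scaleC_add_left scaleC_add_right

lemma scaleC_one [simp]: "1 *\<^sub>C (x::'a::cstar_algebra) = x"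
  using scaleC_of_real[of 1 x] by simp

lemma norm_star: "norm (star (x::'a::cstar_algebra)) = norm x"
proof -
  have le: "norm y \<le> norm (star y)" for y :: 'a
  proof (cases "y = 0")
    case False
    have "norm y * norm y \<le> norm (star y) * norm y"
      using cstar_identity[of y] norm_mult_ineq[of "star y" y] by (simp add: power2_eq_square)
    then show ?thesis using False by (simp add: mult_right_le_imp_le)
  qed simp
  show ?thesis using le[of x] le[of "star x"] by (simp add: star_star)
qed

lemma bounded_linear_star: "bounded_linear (star :: 'a::cstar_algebra \<Rightarrow> 'a)"
proof (rule bounded_linear_intro[where K=1])
  show "star (r *\<^sub>R x) = r *\<^sub>R star x" for r and x :: 'a
    by (metis complex_cnj_complex_of_real scaleC_of_real star_scaleC)
qed (simp_all add: star_add norm_star)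

lemma star_one [simp]: "star (1::'a::cstar_algebra) = 1"
  by (metis mult_1 mult_1_right star_mult star_star)

lemma star_power: "star ((x::'a::cstar_algebra) ^ n) = star x ^ n"
  by (induction n) (simp_all add: star_mult power_commutes)

lemma star_exp: "star (exp (x::'a::cstar_algebra)) = exp (star x)"
proof -
  interpret star: bounded_linear "star :: 'a \<Rightarrow> 'a" by (rule bounded_linear_star)
  show ?thesis unfolding exp_def
    by (subst star.suminf[OF summable_exp_generic]) (simp add: star.scaleR star_power)
qed

definition uexp :: "'a::cstar_algebra \<Rightarrow> real \<Rightarrow> 'a" where
  "uexp h s = exp ((\<i> * complex_of_real s) *\<^sub>C h)"

lemma uexp_altdef: "uexp h s = exp (s *\<^sub>R (\<i> *\<^sub>C h))"
  unfolding uexp_def by (metis mult.commute scaleC_of_real scaleC_scaleC)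

lemma uexp_0 [simp]: "uexp h 0 = 1"
  by (simp add: uexp_altdef)

lemma uexp_add: "uexp h (s + t) = uexp h s * uexp h t"
  unfolding uexp_altdef scaleR_add_left by (rule exp_add_commuting) simp

text \<open>The adjoint of \<open>uexp h s\<close> is its inverse \<open>uexp h (- s)\<close>, so
  the C*-identity reduces the claim to \<open>norm 1 = 1\<close>. Selfadjointness enters the
  estimates here: exponentials do not enlarge the coefficients of a word.\<close>

lemma norm_uexp:
  assumes "star h = h"
  shows "norm (uexp h s) = 1"
proof -
  have "star (uexp h s) = uexp h (- s)"
    using assms by (simp add: uexp_def star_exp star_scaleC)
  then have "(norm (uexp h s))\<^sup>2 = norm (uexp h (- s) * uexp h s)"
    by (metis cstar_identity)
  also have "\<dots> = 1" by (simp flip: uexp_add)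
  finally show ?thesis by (simp add: power2_eq_1_iff) (smt (verit) norm_ge_zero)
qed

lemma uexp_has_vector_derivative:
  "(uexp h has_vector_derivative uexp h s * (\<i> *\<^sub>C h)) (at s within S)"
  unfolding uexp_altdef[abs_def] by (rule exp_scaleR_has_vector_derivative_right)

lemma continuous_on_uexp: "continuous_on S (uexp h)"
  by (rule continuous_on_vector_derivative) (rule uexp_has_vector_derivative)

text \<open>The derivative of the one-parameter group at 0; it serves to pass from multiplication by
  \<open>cis (s * x j)\<close> to multiplication by \<open>x j\<close>.\<close>

lemma uexp_quotient_tendsto:
  "((\<lambda>s. ((uexp h s - 1) /\<^sub>R s)) \<longlongrightarrow> \<i> *\<^sub>C h) (at 0)"
proof -
  have "((\<lambda>s. norm (uexp h (0 + s) - uexp h 0 - s *\<^sub>R (\<i> *\<^sub>C h)) / norm s) \<longlongrightarrow> 0) (at 0)"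
    using uexp_has_vector_derivative[of h 0 UNIV]
    unfolding has_vector_derivative_def has_derivative_at by simp
  moreover
  have "norm (uexp h (0 + s) - uexp h 0 - s *\<^sub>R (\<i> *\<^sub>C h)) / norm s
      = norm ((uexp h s - 1) /\<^sub>R s - \<i> *\<^sub>C h)" if "s \<noteq> 0" for s
  proof -
    have "(uexp h s - 1) /\<^sub>R s - \<i> *\<^sub>C h = (uexp h s - 1 - s *\<^sub>R (\<i> *\<^sub>C h)) /\<^sub>R s"
      using that by (simp add: scaleR_diff_right)
    then show ?thesis by (simp add: divide_inverse_commute)
  qed
  then have "eventually (\<lambda>s. norm (uexp h (0 + s) - uexp h 0 - s *\<^sub>R (\<i> *\<^sub>C h)) / norm s
      = norm ((uexp h s - 1) /\<^sub>R s - \<i> *\<^sub>C h)) (at 0)"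
    by (auto simp: eventually_at_filter simp del: norm_eq_zero)
  ultimately have "((\<lambda>s. norm ((uexp h s - 1) /\<^sub>R s - \<i> *\<^sub>C h)) \<longlongrightarrow> 0) (at 0)"
    by (rule Lim_transform_eventually)
  then show ?thesis by (rule LIM_zero_cancel[OF tendsto_norm_zero_cancel])
qed

text \<open>The inverse is the Neumann series.\<close>

lemma one_minus_invertible:
  fixes x :: "'a::{real_normed_algebra_1, banach}"
  assumes "norm x < 1"
  obtains b where "(1 - x) * b = 1" "b * (1 - x) = 1"
proof
  have s: "summable (\<lambda>i. x ^ i)" using assms by (rule complete_algebra_summable_geometric)
  have 1: "x * (\<Sum>i. x ^ i) = (\<Sum>i. x ^ i) - 1"
    using suminf_split_head[OF s] suminf_mult[OF s, of x] by simp
  have 2: "(\<Sum>i. x ^ i) * x = (\<Sum>i. x ^ i) - 1"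
    using suminf_split_head[OF s] suminf_mult2[OF s, of x] by (simp add: power_commutes)
  show "(1 - x) * (\<Sum>i. x ^ i) = 1" by (simp add: left_diff_distrib 1)
  show "(\<Sum>i. x ^ i) * (1 - x) = 1" by (simp add: right_diff_distrib 2)
qed

lemma spectrum_bound:
  assumes "z \<in> spectrum (h::'a::cstar_algebra)"
  shows "cmod z \<le> norm h"
proof (rule ccontr)
  assume "\<not> cmod z \<le> norm h"
  then have z: "norm h < cmod z" and z0: "z \<noteq> 0" by auto
  have "norm (inverse z *\<^sub>C h) < 1"
    using z z0 by (simp add: norm_scaleC norm_inverse inverse_eq_divide norm_divide)
  then obtain b where b: "(1 - inverse z *\<^sub>C h) * b = 1" "b * (1 - inverse z *\<^sub>C h) = 1"
    by (rule one_minus_invertible)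
  have eq: "z *\<^sub>C 1 - h = z *\<^sub>C (1 - inverse z *\<^sub>C h)"
    using z0 by (simp add: scaleC_simps scaleC_scaleC)
  have "(z *\<^sub>C 1 - h) * (inverse z *\<^sub>C b) = 1 \<and> (inverse z *\<^sub>C b) * (z *\<^sub>C 1 - h) = 1"
    unfolding eq using b z0 by (simp add: mult_scaleC_left mult_scaleC_right scaleC_scaleC)
  then show False using assms unfolding spectrum_def by blast
qed

section \<open>Integrals of vector-valued functions\<close>

abbreviation "sbi \<equiv> Bochner_Integration.simple_bochner_integrable"
abbreviation "sbint \<equiv> Bochner_Integration.simple_bochner_integral"

lemma norm_simple_bochner_integral_le:
  assumes "sbi M s"
  shows "ennreal (norm (sbint M s)) \<le> (\<integral>\<^sup>+x. ennreal (norm (s x)) \<partial>M)"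
proof -
  have "norm (sbint M s) \<le> sbint M (\<lambda>x. norm (s x))"
    by (rule simple_bochner_integral_norm_bound[OF assms])
  then have "ennreal (norm (sbint M s)) \<le> ennreal (sbint M (\<lambda>x. norm (s x)))"
    by (rule ennreal_leI)
  also have "\<dots> = (\<integral>\<^sup>+x. ennreal (norm (s x)) \<partial>M)"
    by (rule simple_bochner_integral_eq_nn_integral)
       (auto intro: simple_bochner_integrable_compose2[where p="\<lambda>x y. norm x"] assms)
  finally show ?thesis .
qed

lemma sbi_diff: "sbi M s \<Longrightarrow> sbi M t \<Longrightarrow> sbi M (\<lambda>x. s x - t x)"
  by (rule simple_bochner_integrable_compose2[where p="(-)"]) auto

lemma sbi_add: "sbi M s \<Longrightarrow> sbi M t \<Longrightarrow> sbi M (\<lambda>x. s x + t x)"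
  by (rule simple_bochner_integrable_compose2[where p="(+)"]) auto

text \<open>The three facts below compare approximating simple functions directly, because sums and
  linear images of the integrands need not have measurable norms in a nonseparable space.\<close>

lemma tendsto_ennreal_add3_zero:
  fixes a b c :: "nat \<Rightarrow> ennreal"
  assumes "a \<longlonglongrightarrow> 0" "b \<longlonglongrightarrow> 0" "c \<longlonglongrightarrow> 0"
  shows "(\<lambda>i. a i + b i + c i) \<longlonglongrightarrow> 0"
  using tendsto_add[OF tendsto_add[OF assms(1,2)] assms(3)] by simp

lemma tendsto_zero_if_ennreal_le:
  assumes "\<And>i. ennreal (norm (x i)) \<le> e i" "e \<longlonglongrightarrow> 0"
  shows "x \<longlonglongrightarrow> 0"
proof -
  have "(\<lambda>i. ennreal (norm (x i))) \<longlonglongrightarrow> 0"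
    by (rule tendsto_sandwich[OF _ _ tendsto_const assms(2)]) (use assms(1) in auto)
  then have "(\<lambda>i. norm (x i)) \<longlonglongrightarrow> 0"
    by (simp add: tendsto_ennreal_iff flip: ennreal_0)
  then show ?thesis by (rule tendsto_norm_zero_cancel)
qed

lemma has_vector_integral_add_unique:
  fixes f1 :: "'b \<Rightarrow> 'a::banach"
  assumes 1: "has_vector_integral M f1 I1" and 2: "has_vector_integral M f2 I2"
    and 3: "has_vector_integral M f3 I3"
    and eq: "\<And>x. x \<in> space M \<Longrightarrow> f3 x = f1 x + f2 x"
  shows "I3 = I1 + I2"
proof -
  obtain s1 where s1: "\<And>i. sbi M (s1 i)" "\<And>i. (\<lambda>x. norm (f1 x - s1 i x)) \<in> borel_measurable M"
    "(\<lambda>i. \<integral>\<^sup>+x. ennreal (norm (f1 x - s1 i x)) \<partial>M) \<longlonglongrightarrow> 0" "(\<lambda>i. sbint M (s1 i)) \<longlonglongrightarrow> I1"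
    using 1 unfolding has_vector_integral_def by blast
  obtain s2 where s2: "\<And>i. sbi M (s2 i)" "\<And>i. (\<lambda>x. norm (f2 x - s2 i x)) \<in> borel_measurable M"
    "(\<lambda>i. \<integral>\<^sup>+x. ennreal (norm (f2 x - s2 i x)) \<partial>M) \<longlonglongrightarrow> 0" "(\<lambda>i. sbint M (s2 i)) \<longlonglongrightarrow> I2"
    using 2 unfolding has_vector_integral_def by blast
  obtain s3 where s3: "\<And>i. sbi M (s3 i)" "\<And>i. (\<lambda>x. norm (f3 x - s3 i x)) \<in> borel_measurable M"
    "(\<lambda>i. \<integral>\<^sup>+x. ennreal (norm (f3 x - s3 i x)) \<partial>M) \<longlonglongrightarrow> 0" "(\<lambda>i. sbint M (s3 i)) \<longlonglongrightarrow> I3"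
    using 3 unfolding has_vector_integral_def by blast
  note [measurable] = s1(2) s2(2) s3(2)
  let ?e = "\<lambda>i. (\<integral>\<^sup>+x. ennreal (norm (f1 x - s1 i x)) \<partial>M) + (\<integral>\<^sup>+x. ennreal (norm (f2 x - s2 i x)) \<partial>M)
       + (\<integral>\<^sup>+x. ennreal (norm (f3 x - s3 i x)) \<partial>M)"
  \<comment> \<open>Since \<open>f3 = f1 + f2\<close>, the integrands cancel and \<open>?t\<close>
    is a combination of the three errors; only the norms of these errors, measurable by assumption,
    are integrated.\<close>
  let ?t = "\<lambda>i x. s1 i x + s2 i x - s3 i x"
  have "(\<lambda>i. sbint M (?t i)) \<longlonglongrightarrow> 0"
  proof (rule tendsto_zero_if_ennreal_le)
    fix i
    have "ennreal (norm (sbint M (?t i))) \<le> (\<integral>\<^sup>+x. ennreal (norm (?t i x)) \<partial>M)"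
      by (intro norm_simple_bochner_integral_le sbi_diff sbi_add s1 s2 s3)
    also have "\<dots> \<le> (\<integral>\<^sup>+x. ennreal (norm (f1 x - s1 i x)) + ennreal (norm (f2 x - s2 i x))
        + ennreal (norm (f3 x - s3 i x)) \<partial>M)"
    proof (rule nn_integral_mono)
      fix x assume "x \<in> space M"
      then have "?t i x = (f3 x - s3 i x) - (f1 x - s1 i x) - (f2 x - s2 i x)"
        using eq by (simp add: algebra_simps)
      then have "norm (?t i x) = norm ((f3 x - s3 i x) - (f1 x - s1 i x) - (f2 x - s2 i x))" by (rule arg_cong)
      then have "norm (?t i x) \<le> norm (f1 x - s1 i x) + norm (f2 x - s2 i x) + norm (f3 x - s3 i x)"
        using norm_triangle_ineq4[of "f3 x - s3 i x" "f1 x - s1 i x"]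
          norm_triangle_ineq4[of "(f3 x - s3 i x) - (f1 x - s1 i x)" "f2 x - s2 i x"] by linarith
      then show "ennreal (norm (?t i x)) \<le> ennreal (norm (f1 x - s1 i x)) + ennreal (norm (f2 x - s2 i x))
        + ennreal (norm (f3 x - s3 i x))" by (simp flip: ennreal_plus)
    qed
    also have "\<dots> = ?e i"
      by (simp add: nn_integral_add)
    finally show "ennreal (norm (sbint M (?t i))) \<le> ?e i" .
  next
    show "?e \<longlonglongrightarrow> 0" by (intro tendsto_ennreal_add3_zero s1 s2 s3)
  qed
  moreover have "sbint M (?t i) = sbint M (s1 i) + sbint M (s2 i) - sbint M (s3 i)" for i
    by (simp add: simple_bochner_integral_diff simple_bochner_integral_add s1 s2 s3 sbi_add)
  ultimately have "(\<lambda>i. sbint M (s1 i) + sbint M (s2 i) - sbint M (s3 i)) \<longlonglongrightarrow> 0" by simp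
  moreover have "(\<lambda>i. sbint M (s1 i) + sbint M (s2 i) - sbint M (s3 i)) \<longlonglongrightarrow> I1 + I2 - I3"
    by (intro tendsto_intros s1 s2 s3)
  ultimately show ?thesis by (auto dest: LIMSEQ_unique)
qed

lemma has_vector_integral_zero: "has_vector_integral M (\<lambda>x. 0::'a::banach) 0"
  unfolding has_vector_integral_def
  by (rule exI[of _ "\<lambda>_ _. 0"])
     (auto simp: simple_bochner_integrable.simps simple_bochner_integral_def image_constant_conv)

lemma has_vector_integral_unique:
  assumes "has_vector_integral M f I" "has_vector_integral M f J"
  shows "I = J"
  using has_vector_integral_add_unique[OF assms(2) has_vector_integral_zero assms(1)] by simp

lemma has_vector_integral_linear_unique:
  fixes f :: "'b \<Rightarrow> 'a::banach" and L :: "'a \<Rightarrow> 'c::banach"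
  assumes 1: "has_vector_integral M f I" and 2: "has_vector_integral M (\<lambda>x. L (f x)) J"
    and L: "bounded_linear L"
  shows "J = L I"
proof -
  interpret L: bounded_linear L by fact
  obtain s1 where s1: "\<And>i. sbi M (s1 i)" "\<And>i. (\<lambda>x. norm (f x - s1 i x)) \<in> borel_measurable M"
    "(\<lambda>i. \<integral>\<^sup>+x. ennreal (norm (f x - s1 i x)) \<partial>M) \<longlonglongrightarrow> 0" "(\<lambda>i. sbint M (s1 i)) \<longlonglongrightarrow> I"
    using 1 unfolding has_vector_integral_def by blast
  obtain s2 where s2: "\<And>i. sbi M (s2 i)" "\<And>i. (\<lambda>x. norm (L (f x) - s2 i x)) \<in> borel_measurable M"
    "(\<lambda>i. \<integral>\<^sup>+x. ennreal (norm (L (f x) - s2 i x)) \<partial>M) \<longlonglongrightarrow> 0" "(\<lambda>i. sbint M (s2 i)) \<longlonglongrightarrow> J"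
    using 2 unfolding has_vector_integral_def by blast
  note [measurable] = s1(2) s2(2)
  obtain K where K: "K > 0" "\<And>x. norm (L x) \<le> norm x * K" using L.pos_bounded by blast
  have Ls: "sbi M (\<lambda>x. L (s1 i x))" for i
    by (rule simple_bochner_integrable_compose2[where p="\<lambda>x y. L x", OF _ s1(1) s1(1)]) simp
  let ?e = "\<lambda>i. ennreal K * (\<integral>\<^sup>+x. ennreal (norm (f x - s1 i x)) \<partial>M) + (\<integral>\<^sup>+x. ennreal (norm (L (f x) - s2 i x)) \<partial>M)"
  let ?t = "\<lambda>i x. L (s1 i x) - s2 i x"
  have "(\<lambda>i. sbint M (?t i)) \<longlonglongrightarrow> 0"
  proof (rule tendsto_zero_if_ennreal_le)
    fix i
    have "ennreal (norm (sbint M (?t i))) \<le> (\<integral>\<^sup>+x. ennreal (norm (?t i x)) \<partial>M)"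
      by (intro norm_simple_bochner_integral_le sbi_diff Ls s2)
    also have "\<dots> \<le> (\<integral>\<^sup>+x. ennreal K * ennreal (norm (f x - s1 i x)) + ennreal (norm (L (f x) - s2 i x)) \<partial>M)"
    proof (rule nn_integral_mono)
      fix x assume "x \<in> space M"
      have "?t i x = (L (f x) - s2 i x) - L (f x - s1 i x)"
        by (simp add: L.diff)
      then have "norm (?t i x) = norm ((L (f x) - s2 i x) - L (f x - s1 i x))" by (rule arg_cong)
      then have "norm (?t i x) \<le> norm (L (f x - s1 i x)) + norm (L (f x) - s2 i x)"
        using norm_triangle_ineq4[of "L (f x) - s2 i x" "L (f x - s1 i x)"] by linarith
      also have "\<dots> \<le> K * norm (f x - s1 i x) + norm (L (f x) - s2 i x)"
        using K(2)[of "f x - s1 i x"] by (simp add: mult.commute)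
      finally show "ennreal (norm (?t i x)) \<le> ennreal K * ennreal (norm (f x - s1 i x)) + ennreal (norm (L (f x) - s2 i x))"
        using K(1) by (simp flip: ennreal_plus ennreal_mult)
    qed
    also have "\<dots> = ?e i"
      by (simp add: nn_integral_add nn_integral_cmult)
    finally show "ennreal (norm (sbint M (?t i))) \<le> ?e i" .
  next
    have "?e \<longlonglongrightarrow> ennreal K * 0 + 0"
      by (intro tendsto_add ennreal_tendsto_cmult s1 s2) auto
    then show "?e \<longlonglongrightarrow> 0" by simp
  qed
  moreover have "sbint M (?t i) = L (sbint M (s1 i)) - sbint M (s2 i)" for i
    by (simp add: simple_bochner_integral_diff Ls s2 simple_bochner_integral_linear[OF L.linear_axioms s1(1)])
  ultimately have "(\<lambda>i. L (sbint M (s1 i)) - sbint M (s2 i)) \<longlonglongrightarrow> 0" by simp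
  moreover have "(\<lambda>i. L (sbint M (s1 i)) - sbint M (s2 i)) \<longlonglongrightarrow> L I - J"
    by (intro tendsto_intros L.tendsto s1 s2)
  ultimately show ?thesis by (auto dest: LIMSEQ_unique)
qed

lemma has_vector_integral_norm_le:
  fixes f :: "'b \<Rightarrow> 'a::banach"
  assumes 1: "has_vector_integral M f I" and g: "integrable M g"
    and le: "\<And>x. x \<in> space M \<Longrightarrow> norm (f x) \<le> g x"
  shows "norm I \<le> (LINT x|M. g x)"
proof -
  obtain s where s: "\<And>i. sbi M (s i)" "\<And>i. (\<lambda>x. norm (f x - s i x)) \<in> borel_measurable M"
    "(\<lambda>i. \<integral>\<^sup>+x. ennreal (norm (f x - s i x)) \<partial>M) \<longlonglongrightarrow> 0" "(\<lambda>i. sbint M (s i)) \<longlonglongrightarrow> I"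
    using 1 unfolding has_vector_integral_def by blast
  note [measurable] = s(2) borel_measurable_integrable[OF g]
  have g0: "x \<in> space M \<Longrightarrow> 0 \<le> g x" for x using le[of x] norm_ge_zero order_trans by blast
  have "(\<lambda>i. ennreal (norm (sbint M (s i)))) \<longlonglongrightarrow> ennreal (norm I)"
    by (intro tendsto_ennrealI tendsto_norm s)
  moreover have "(\<lambda>i. (\<integral>\<^sup>+x. ennreal (norm (f x - s i x)) \<partial>M) + (\<integral>\<^sup>+x. ennreal (g x) \<partial>M))
      \<longlonglongrightarrow> 0 + (\<integral>\<^sup>+x. ennreal (g x) \<partial>M)"
    by (intro tendsto_add s tendsto_const)
  moreover have "ennreal (norm (sbint M (s i))) \<le>
     (\<integral>\<^sup>+x. ennreal (norm (f x - s i x)) \<partial>M) + (\<integral>\<^sup>+x. ennreal (g x) \<partial>M)" for i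
  proof -
    have "ennreal (norm (sbint M (s i))) \<le> (\<integral>\<^sup>+x. ennreal (norm (s i x)) \<partial>M)"
      by (intro norm_simple_bochner_integral_le s)
    also have "\<dots> \<le> (\<integral>\<^sup>+x. ennreal (norm (f x - s i x)) + ennreal (g x) \<partial>M)"
    proof (rule nn_integral_mono)
      fix x assume x: "x \<in> space M"
      have "norm (s i x) \<le> norm (f x - s i x) + norm (f x)"
        using norm_triangle_ineq4[of "f x" "f x - s i x"] by simp
      also have "\<dots> \<le> norm (f x - s i x) + g x" using le[OF x] by simp
      finally show "ennreal (norm (s i x)) \<le> ennreal (norm (f x - s i x)) + ennreal (g x)"
        using g0[OF x] by (simp flip: ennreal_plus)
    qed
    also have "\<dots> = (\<integral>\<^sup>+x. ennreal (norm (f x - s i x)) \<partial>M) + (\<integral>\<^sup>+x. ennreal (g x) \<partial>M)"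
      by (rule nn_integral_add) auto
    finally show ?thesis .
  qed
  ultimately have "ennreal (norm I) \<le> 0 + (\<integral>\<^sup>+x. ennreal (g x) \<partial>M)"
    by (meson LIMSEQ_le)
  also have "\<dots> = ennreal (LINT x|M. g x)"
    using g g0 by (simp add: nn_integral_eq_integral AE_I2)
  finally show ?thesis
    using g0 by (simp add: ennreal_le_iff Bochner_Integration.integral_nonneg)
qed

section \<open>Integrability of functions of finitely many coordinates\<close>

text \<open>Points of \<open>lborel_n m\<close> take the value \<open>undefined\<close> beyond
  \<open>m\<close>. Replacing it by 0 gives a measurable map into the Borel space of all sequences
  and does not change functions of the first \<open>m\<close> coordinates, so continuity on the full
  product can be used.\<close>

definition trunc :: "nat \<Rightarrow> (nat \<Rightarrow> real) \<Rightarrow> nat \<Rightarrow> real" where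
  "trunc m x = (\<lambda>i. if i < m then x i else 0)"

definition depends_on :: "nat \<Rightarrow> ((nat \<Rightarrow> real) \<Rightarrow> 'b) \<Rightarrow> bool" where
  "depends_on m F \<longleftrightarrow> (\<forall>x y. (\<forall>i<m. x i = y i) \<longrightarrow> F x = F y)"

lemma depends_onD: "depends_on m F \<Longrightarrow> (\<And>i. i < m \<Longrightarrow> x i = y i) \<Longrightarrow> F x = F y"
  unfolding depends_on_def by blast

lemma depends_on_trunc: "depends_on m F \<Longrightarrow> F (trunc m x) = F x"
  by (erule depends_onD) (simp add: trunc_def)

lemma measurable_trunc [measurable]: "trunc m \<in> borel_measurable (lborel_n m)"
proof (rule measurable_coordinatewise_then_product)
  fix i show "(\<lambda>x. trunc m x i) \<in> borel_measurable (lborel_n m)"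
    by (cases "i < m") (auto simp: trunc_def)
qed

lemma measurable_lborel_n:
  fixes F :: "(nat \<Rightarrow> real) \<Rightarrow> 'b::topological_space"
  assumes "continuous_on UNIV F" "depends_on m F"
  shows "F \<in> borel_measurable (lborel_n m)"
proof -
  have "(\<lambda>x. F (trunc m x)) \<in> borel_measurable (lborel_n m)"
    by (rule measurable_compose[OF measurable_trunc borel_measurable_continuous_onI[OF assms(1)]])
  then show ?thesis by (simp add: depends_on_trunc[OF assms(2)])
qed

text \<open>Assembles finitely many simple functions into one simple tuple, coordinate by
  coordinate, so that all coordinates of a point can be rounded at once.\<close>

lemma simple_function_fun_upd:
  assumes "finite I" "\<And>i. i \<in> I \<Longrightarrow> simple_function M (f i)"
  shows "simple_function M (\<lambda>x i. if i \<in> I then f i x else c)"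
  using assms
proof (induction I rule: finite_induct)
  case empty
  then show ?case by simp
next
  case (insert j I)
  have "simple_function M (\<lambda>x. (\<lambda>i. if i \<in> I then f i x else c)(j := f j x))"
    by (rule simple_function_compose2[where h="\<lambda>u v. u(j := v)"]) (use insert in auto)
  also have "(\<lambda>x. (\<lambda>i. if i \<in> I then f i x else c)(j := f j x)) =
      (\<lambda>x i. if i \<in> insert j I then f i x else c)"
    by (auto simp: fun_eq_iff)
  finally show ?case .
qed

text \<open>\<open>grid k r\<close> is \<open>r\<close> rounded down to a multiple of \<open>1/(k+1)\<close>, encoded by an integer; outside of
  \<open>[-k, k]\<close> it is an integer that does not occur otherwise.\<close>

definition grid :: "nat \<Rightarrow> real \<Rightarrow> int" where
  "grid k r = (if \<bar>r\<bar> \<le> real k then \<lfloor>real (Suc k) * r\<rfloor> else - (int k + 1) * (int k + 1) - 1)"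

text \<open>Rounded values on \<open>[-k, k]\<close> are at least \<open>- k * (k + 1)\<close>,
  which exceeds the sentinel.\<close>

lemma grid_bound: "\<bar>r\<bar> \<le> real k \<Longrightarrow> grid k r \<noteq> - (int k + 1) * (int k + 1) - 1"
proof -
  assume r: "\<bar>r\<bar> \<le> real k"
  then have "- real k \<le> r" by linarith
  then have "real (Suc k) * (- real k) \<le> real (Suc k) * r" by (intro mult_left_mono) auto
  then have "- ((int k + 1) * int k) \<le> \<lfloor>real (Suc k) * r\<rfloor>"
    by (simp add: le_floor_iff algebra_simps)
  moreover have "- (int k + 1) * (int k + 1) - 1 < - ((int k + 1) * int k)"
    by (simp add: algebra_simps)
  ultimately show ?thesis using r by (simp add: grid_def)
qed

lemma simple_function_grid: "i < m \<Longrightarrow> simple_function (lborel_n m) (\<lambda>x. grid k (x i))"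
proof -
  assume "i < m"
  then have "(\<lambda>x. x i) \<in> measurable (lborel_n m) borel"
    using measurable_component_singleton[of i "{..<m}" "\<lambda>_. lborel :: real measure"] by simp
  moreover have "grid k \<in> measurable borel (count_space UNIV)"
    unfolding grid_def[abs_def] by measurable
  ultimately have meas: "(\<lambda>x. grid k (x i)) \<in> measurable (lborel_n m) (count_space UNIV)"
    by (rule measurable_compose)
  have "range (grid k) \<subseteq> {\<lfloor>- real (Suc k) * real k\<rfloor> .. \<lfloor>real (Suc k) * real k\<rfloor>} \<union> {- (int k + 1) * (int k + 1) - 1}"
  proof (rule image_subsetI)
    fix r
    show "grid k r \<in> {\<lfloor>- real (Suc k) * real k\<rfloor> .. \<lfloor>real (Suc k) * real k\<rfloor>} \<union> {- (int k + 1) * (int k + 1) - 1}"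
    proof (cases "\<bar>r\<bar> \<le> real k")
      case True
      then have "real (Suc k) * (- real k) \<le> real (Suc k) * r" "real (Suc k) * r \<le> real (Suc k) * real k"
        by (intro mult_left_mono; auto)+
      then have "\<lfloor>- real (Suc k) * real k\<rfloor> \<le> \<lfloor>real (Suc k) * r\<rfloor>" "\<lfloor>real (Suc k) * r\<rfloor> \<le> \<lfloor>real (Suc k) * real k\<rfloor>"
        by (intro floor_mono; simp only: mult_minus_left mult_minus_right)+
      then show ?thesis
        using True by (simp add: grid_def)
    qed (simp add: grid_def)
  qed
  then have "finite (range (grid k))" by (rule finite_subset) simp
  then have "finite ((\<lambda>x. grid k (x i)) ` space (lborel_n m))"
    by (rule finite_subset[rotated]) auto
  moreover have "(\<lambda>x. grid k (x i)) -` {v} \<inter> space (lborel_n m) \<in> sets (lborel_n m)" for v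
    by (rule measurable_sets[OF meas]) simp
  ultimately show ?thesis by (simp add: simple_function_def)
qed

lemma grid_tendsto: "(\<lambda>k. real_of_int (grid k r) / real (Suc k)) \<longlonglongrightarrow> r"
proof -
  have "eventually (\<lambda>k. \<bar>real_of_int (grid k r) / real (Suc k) - r\<bar> \<le> 1 / real (Suc k)) sequentially"
    using eventually_ge_at_top[of "nat \<lceil>\<bar>r\<bar>\<rceil>"]
  proof eventually_elim
    case (elim k)
    then have "\<bar>r\<bar> \<le> real k" by linarith
    then have "real_of_int (grid k r) / real (Suc k) - r = (real_of_int \<lfloor>real (Suc k) * r\<rfloor> - real (Suc k) * r) / real (Suc k)"
      by (simp add: grid_def field_simps del: of_nat_Suc)
    also have "\<bar>\<dots>\<bar> \<le> 1 / real (Suc k)"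
      unfolding abs_divide by (intro divide_mono) (auto simp del: of_nat_Suc, linarith)
    finally show ?case .
  qed
  moreover have "(\<lambda>k. 1 / real (Suc k)) \<longlonglongrightarrow> 0" by (rule LIMSEQ_Suc[OF lim_inverse_n', unfolded inverse_eq_divide])
  ultimately have "(\<lambda>k. real_of_int (grid k r) / real (Suc k) - r) \<longlonglongrightarrow> 0"
    by (rule Lim_null_comparison[of "\<lambda>k. real_of_int (grid k r) / real (Suc k) - r", unfolded real_norm_def])
  then show ?thesis by (rule LIM_zero_cancel)
qed

lemma real_arch_simple_ex: "\<exists>N. \<forall>n\<ge>N. (r::real) \<le> real n"
  using real_arch_simple[of r] by (meson of_nat_mono order_trans)

lemma tendsto_funI:
  fixes f :: "'a \<Rightarrow> 'i \<Rightarrow> 'b::topological_space"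
  assumes "\<And>i. ((\<lambda>k. f k i) \<longlongrightarrow> l i) F"
  shows "(f \<longlongrightarrow> l) F"
  using limitin_componentwise[of "\<lambda>_. euclidean" UNIV f l F] assms
  by (simp add: euclidean_product_topology limitin_canonical_iff)

text \<open>\<open>W\<close> is evaluated at the rounded point, and set to 0 as soon as a coordinate
  shows the sentinel. There are finitely many integer codes, so the result is simple even when the
  range of \<open>W\<close> is nonseparable; pointwise convergence is continuity of
  \<open>W\<close>.\<close>

lemma simple_approximation:
  fixes W :: "(nat \<Rightarrow> real) \<Rightarrow> 'a::real_normed_vector"
  assumes W: "continuous_on UNIV W" "depends_on m W" and B: "\<And>x. norm (W x) \<le> B"
  obtains S where "\<And>k. simple_function (lborel_n m) (S k)"
    "\<And>x. (\<lambda>k. S k x) \<longlonglongrightarrow> W x" "\<And>k x. norm (S k x) \<le> B"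
proof
  define dec where "dec k v = (if \<exists>i<m. v i = - (int k + 1) * (int k + 1) - 1 then 0
      else W (\<lambda>i. real_of_int (v i) / real (Suc k)))" for k :: nat and v :: "nat \<Rightarrow> int"
  define S where "S k x = dec k (\<lambda>i. if i \<in> {..<m} then grid k (x i) else 0)" for k x
  show "simple_function (lborel_n m) (S k)" for k
    unfolding S_def
    by (rule simple_function_compose1[where g="dec k"], rule simple_function_fun_upd)
       (simp_all add: simple_function_grid)
  have B0: "0 \<le> B" using B norm_ge_zero order_trans by blast
  show "norm (S k x) \<le> B" for k x
    by (simp add: S_def dec_def B B0)
  show "(\<lambda>k. S k x) \<longlonglongrightarrow> W x" for x
  proof -
    let ?y = "\<lambda>k i. real_of_int (if i \<in> {..<m} then grid k (x i) else 0) / real (Suc k)"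
    have "?y \<longlonglongrightarrow> trunc m x"
    proof (rule tendsto_funI)
      fix i show "(\<lambda>k. ?y k i) \<longlonglongrightarrow> trunc m x i"
        using grid_tendsto by (cases "i < m") (auto simp: trunc_def)
    qed
    then have "(\<lambda>k. W (?y k)) \<longlonglongrightarrow> W (trunc m x)"
      using W(1) by (intro isCont_tendsto_compose[of "trunc m x" W]) (auto simp: continuous_on_eq_continuous_at)
    moreover have "eventually (\<lambda>k. \<forall>i<m. \<bar>x i\<bar> \<le> real k) sequentially"
    proof -
      have "eventually (\<lambda>k. \<forall>i\<in>{..<m}. \<bar>x i\<bar> \<le> real k) sequentially"
        by (intro eventually_ball_finite ballI) (simp_all add: eventually_sequentially real_arch_simple_ex)
      then show ?thesis by (simp only: Ball_def lessThan_iff)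
    qed
    then have "eventually (\<lambda>k. W (?y k) = S k x) sequentially"
      by eventually_elim (use grid_bound in \<open>auto simp: S_def dec_def\<close>)
    ultimately show ?thesis
      by (simp add: depends_on_trunc[OF W(2)] tendsto_cong)
  qed
qed

text \<open>For a fixed vector \<open>v\<close> in place of \<open>s x\<close>, the norm is a
  continuous real function of the pair \<open>(g x, trunc m x)\<close>, which lives in a second
  countable space. Since \<open>s\<close> has finitely many values, these cases are glued along a
  finite partition.\<close>

lemma measurable_norm_diff_simple:
  fixes W :: "(nat \<Rightarrow> real) \<Rightarrow> 'a::cstar_algebra" and g :: "(nat \<Rightarrow> real) \<Rightarrow> complex"
  assumes W: "continuous_on UNIV W" "depends_on m W" and g: "g \<in> borel_measurable (lborel_n m)"
    and s: "simple_function (lborel_n m) s"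
  shows "(\<lambda>x. norm (g x *\<^sub>C W x - s x)) \<in> borel_measurable (lborel_n m)"
proof -
  have v: "(\<lambda>x. norm (g x *\<^sub>C W x - v)) \<in> borel_measurable (lborel_n m)" for v
  proof -
    have W': "continuous_on UNIV (\<lambda>p::complex \<times> (nat \<Rightarrow> real). W (snd p))"
      by (rule continuous_on_compose2[OF W(1) continuous_on_snd[OF continuous_on_id]]) auto
    have "continuous_on UNIV (\<lambda>p::complex \<times> (nat \<Rightarrow> real). norm (fst p *\<^sub>C W (snd p) - v))"
      by (intro continuous_intros scaleC.continuous_on W')
    then have 1: "(\<lambda>p::complex \<times> (nat \<Rightarrow> real). norm (fst p *\<^sub>C W (snd p) - v)) \<in> borel_measurable borel"
      by (rule borel_measurable_continuous_onI)
    have 2: "(\<lambda>x. (g x, trunc m x)) \<in> borel_measurable (lborel_n m)"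
      using g by measurable
    have "(\<lambda>x. norm (g x *\<^sub>C W (trunc m x) - v)) \<in> borel_measurable (lborel_n m)"
      using measurable_compose[OF 2 1] by simp
    then show ?thesis by (simp add: depends_on_trunc[OF W(2)])
  qed
  have fin: "finite (s ` space (lborel_n m))" using s by (simp add: simple_function_def)
  have "s \<in> measurable (lborel_n m) (count_space (s ` space (lborel_n m)))"
    using fin s by (subst measurable_count_space_eq2) (auto simp: simple_functionD)
  then show ?thesis
    using measurable_compose_countable'[of "s ` space (lborel_n m)" "\<lambda>v x. norm (g x *\<^sub>C W x - v)"]
      v countable_finite[OF fin] by blast
qed

text \<open>Convergence in \<open>L^1\<close> makes the simple integrals a Cauchy sequence, and
  completeness supplies the value, which need not be known beforehand.\<close>

lemma has_vector_integralI:
  fixes f :: "'b \<Rightarrow> 'a::banach"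
  assumes s: "\<And>i. sbi M (s i)" "\<And>i. (\<lambda>x. norm (f x - s i x)) \<in> borel_measurable M"
    "(\<lambda>i. \<integral>\<^sup>+x. ennreal (norm (f x - s i x)) \<partial>M) \<longlonglongrightarrow> 0"
  shows "\<exists>I. has_vector_integral M f I"
proof -
  note [measurable] = s(2)
  let ?e = "\<lambda>i. \<integral>\<^sup>+x. ennreal (norm (f x - s i x)) \<partial>M"
  have le: "ennreal (dist (sbint M (s i)) (sbint M (s j))) \<le> ?e i + ?e j" for i j
  proof -
    have "ennreal (dist (sbint M (s i)) (sbint M (s j))) = ennreal (norm (sbint M (\<lambda>x. s i x - s j x)))"
      by (simp add: dist_norm simple_bochner_integral_diff s)
    also have "\<dots> \<le> (\<integral>\<^sup>+x. ennreal (norm (s i x - s j x)) \<partial>M)"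
      by (intro norm_simple_bochner_integral_le sbi_diff s)
    also have "\<dots> \<le> (\<integral>\<^sup>+x. ennreal (norm (f x - s i x)) + ennreal (norm (f x - s j x)) \<partial>M)"
    proof (rule nn_integral_mono)
      fix x
      have "norm (s i x - s j x) \<le> norm (f x - s i x) + norm (f x - s j x)"
        using norm_triangle_ineq4[of "f x - s j x" "f x - s i x"] by simp
      then show "ennreal (norm (s i x - s j x)) \<le> ennreal (norm (f x - s i x)) + ennreal (norm (f x - s j x))"
        by (simp flip: ennreal_plus)
    qed
    also have "\<dots> = ?e i + ?e j" by (rule nn_integral_add) auto
    finally show ?thesis .
  qed
  have "Cauchy (\<lambda>i. sbint M (s i))"
  proof (rule metric_CauchyI)
    fix e :: real assume "0 < e"
    then have "eventually (\<lambda>i. ?e i < ennreal (e / 2)) sequentially"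
      using s(3) by (intro order_tendstoD) auto
    then obtain N where N: "\<And>i. i \<ge> N \<Longrightarrow> ?e i < ennreal (e / 2)"
      by (auto simp: eventually_sequentially)
    have "dist (sbint M (s i)) (sbint M (s j)) < e" if "i \<ge> N" "j \<ge> N" for i j
    proof -
      have "ennreal (dist (sbint M (s i)) (sbint M (s j))) < ennreal (e / 2) + ennreal (e / 2)"
        using le[of i j] N[OF that(1)] N[OF that(2)] add_strict_mono order_le_less_trans by blast
      also have "\<dots> = ennreal e" using \<open>0 < e\<close> by (simp flip: ennreal_plus)
      finally show ?thesis by (simp add: ennreal_less_iff)
    qed
    then show "\<exists>N. \<forall>i\<ge>N. \<forall>j\<ge>N. dist (sbint M (s i)) (sbint M (s j)) < e" by blast
  qed
  then obtain I where "(\<lambda>i. sbint M (s i)) \<longlonglongrightarrow> I"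
    using Cauchy_convergent convergent_def by blast
  then show ?thesis unfolding has_vector_integral_def using s by blast
qed

text \<open>The approximants are products of simple \<open>u i\<close> tending to \<open>g\<close>
  in \<open>L^1\<close> and uniformly bounded simple \<open>S i\<close> tending to \<open>W\<close>
  pointwise. The error is at most \<open>norm g * norm (W - S i)\<close>, treated by dominated
  convergence, plus \<open>B * norm (g - u i)\<close>.\<close>

lemma has_vector_integral_exists:
  fixes W :: "(nat \<Rightarrow> real) \<Rightarrow> 'a::cstar_algebra" and g :: "(nat \<Rightarrow> real) \<Rightarrow> complex"
  assumes g: "integrable (lborel_n m) g"
    and W: "continuous_on UNIV W" "depends_on m W" and B: "\<And>x. norm (W x) \<le> B"
  shows "\<exists>I. has_vector_integral (lborel_n m) (\<lambda>x. g x *\<^sub>C W x) I"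
proof -
  let ?M = "lborel_n m"
  obtain S where S: "\<And>k. simple_function ?M (S k)"
    "\<And>x. (\<lambda>k. S k x) \<longlonglongrightarrow> W x" "\<And>k x. norm (S k x) \<le> B"
    using simple_approximation[OF W B] by metis
  have B0: "0 \<le> B" using B norm_ge_zero order_trans by blast
  obtain y where "has_bochner_integral ?M g y" using g by (auto simp: integrable.simps)
  then obtain u where u: "\<And>i. sbi ?M (u i)" "(\<lambda>i. \<integral>\<^sup>+x. norm (g x - u i x) \<partial>?M) \<longlonglongrightarrow> 0"
    by (auto simp: has_bochner_integral.simps)
  have gm [measurable]: "g \<in> borel_measurable ?M" using g by auto
  have us: "simple_function ?M (u i)" for i using u(1)[of i] by (auto elim: simple_bochner_integrable.cases)
  then have um [measurable]: "u i \<in> borel_measurable ?M" for i by (rule borel_measurable_simple_function)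
  have WSm [measurable]: "(\<lambda>x. norm (W x - S k x)) \<in> borel_measurable ?M" for k
    using measurable_norm_diff_simple[OF W, of "\<lambda>_. 1" "S k"] S(1) by simp
  define s where "s i x = u i x *\<^sub>C S i x" for i x
  show ?thesis
  proof (rule has_vector_integralI)
    have ss: "simple_function ?M (s i)" for i
      unfolding s_def by (intro simple_function_compose2[where h=scaleC] us S)
    fix i
    show "sbi ?M (s i)"
    proof (rule simple_bochner_integrable.intros)
      have "emeasure ?M {y \<in> space ?M. s i y \<noteq> 0} \<le> emeasure ?M {y \<in> space ?M. u i y \<noteq> 0}"
        by (intro emeasure_mono) (auto simp: s_def scaleC.zero_left)
      moreover have "emeasure ?M {y \<in> space ?M. u i y \<noteq> 0} \<noteq> \<infinity>"
        using u(1)[of i] by (auto elim: simple_bochner_integrable.cases)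
      ultimately show "emeasure ?M {y \<in> space ?M. s i y \<noteq> 0} \<noteq> \<infinity>" by (auto simp: top_unique)
    qed (rule ss)
    show "(\<lambda>x. norm (g x *\<^sub>C W x - s i x)) \<in> borel_measurable ?M"
      by (rule measurable_norm_diff_simple[OF W gm ss])
  next
    let ?a = "\<lambda>i. \<integral>\<^sup>+x. ennreal (norm (g x) * norm (W x - S i x)) \<partial>?M"
    let ?b = "\<lambda>i. ennreal B * (\<integral>\<^sup>+x. norm (g x - u i x) \<partial>?M)"
    have "?a \<longlonglongrightarrow> (\<integral>\<^sup>+x. ennreal 0 \<partial>?M)"
    proof (rule nn_integral_dominated_convergence[where w="\<lambda>x. ennreal (2 * B * norm (g x))"])
      show "(\<integral>\<^sup>+x. ennreal (2 * B * norm (g x)) \<partial>?M) < \<infinity>"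
        using g B0 by (simp add: integrable_iff_bounded ennreal_mult nn_integral_cmult ennreal_mult_less_top)
      show "AE x in ?M. ennreal (norm (g x) * norm (W x - S i x)) \<le> ennreal (2 * B * norm (g x))" for i
      proof (intro AE_I2 ennreal_leI)
        fix x
        have "norm (W x - S i x) \<le> 2 * B" using norm_triangle_ineq4[of "W x" "S i x"] B[of x] S(3)[of i x] by linarith
        then have "norm (g x) * norm (W x - S i x) \<le> norm (g x) * (2 * B)"
          by (rule mult_left_mono) simp
        then show "norm (g x) * norm (W x - S i x) \<le> 2 * B * norm (g x)"
          by (simp only: mult.commute)
      qed
      show "AE x in ?M. (\<lambda>i. ennreal (norm (g x) * norm (W x - S i x))) \<longlonglongrightarrow> ennreal 0"
      proof (intro AE_I2 tendsto_ennrealI)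
        fix x
        have "(\<lambda>i. norm (g x) * norm (W x - S i x)) \<longlonglongrightarrow> norm (g x) * norm (W x - W x)"
          by (intro tendsto_intros S)
        then show "(\<lambda>i. norm (g x) * norm (W x - S i x)) \<longlonglongrightarrow> 0" by simp
      qed
    qed auto
    moreover have "?b \<longlonglongrightarrow> ennreal B * 0"
      by (intro ennreal_tendsto_cmult u) auto
    ultimately have lim: "(\<lambda>i. ?a i + ?b i) \<longlonglongrightarrow> 0"
      using tendsto_add[of ?a 0 sequentially ?b 0] by simp
    show "(\<lambda>i. \<integral>\<^sup>+x. ennreal (norm (g x *\<^sub>C W x - s i x)) \<partial>?M) \<longlonglongrightarrow> 0"
    proof (rule tendsto_sandwich[OF _ _ tendsto_const lim])
      show "eventually (\<lambda>i. (\<integral>\<^sup>+x. ennreal (norm (g x *\<^sub>C W x - s i x)) \<partial>?M) \<le> ?a i + ?b i) sequentially"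
      proof (rule always_eventually, rule allI)
        fix i
        have "(\<integral>\<^sup>+x. ennreal (norm (g x *\<^sub>C W x - s i x)) \<partial>?M) \<le>
          (\<integral>\<^sup>+x. ennreal (norm (g x) * norm (W x - S i x)) + ennreal B * norm (g x - u i x) \<partial>?M)"
        proof (rule nn_integral_mono)
          fix x
          have "g x *\<^sub>C W x - s i x = g x *\<^sub>C (W x - S i x) + (g x - u i x) *\<^sub>C S i x"
            by (simp add: s_def scaleC_simps)
          then have "norm (g x *\<^sub>C W x - s i x) \<le> norm (g x *\<^sub>C (W x - S i x)) + norm ((g x - u i x) *\<^sub>C S i x)"
            by (metis norm_triangle_ineq)
          also have "\<dots> \<le> norm (g x) * norm (W x - S i x) + B * norm (g x - u i x)"
            using mult_left_mono[OF S(3)[of i x] norm_ge_zero[of "g x - u i x"]]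
            by (simp add: norm_scaleC mult.commute)
          finally show "ennreal (norm (g x *\<^sub>C W x - s i x)) \<le>
            ennreal (norm (g x) * norm (W x - S i x)) + ennreal B * norm (g x - u i x)"
            using B0 by (simp flip: ennreal_plus ennreal_mult)
        qed
        also have "\<dots> = ?a i + ?b i"
          by (simp add: nn_integral_add nn_integral_cmult)
        finally show "(\<integral>\<^sup>+x. ennreal (norm (g x *\<^sub>C W x - s i x)) \<partial>?M) \<le> ?a i + ?b i" .
      qed
    qed simp
  qed
qed

section \<open>Change of variables\<close>

text \<open>Composition with \<open>t\<close> keeps simple functions simple and multiplies the
  measure of each fibre by \<open>\<kappa>\<close>, hence also the integrals of the approximants and
  of their errors.\<close>

lemma has_vector_integral_compose:
  fixes f :: "'b \<Rightarrow> 'a::banach"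
  assumes f: "has_vector_integral M f I" and t [measurable]: "t \<in> measurable M M"
    and \<kappa>: "0 \<le> \<kappa>" and d: "distr M M t = density M (\<lambda>_. ennreal \<kappa>)"
  shows "has_vector_integral M (\<lambda>x. f (t x)) (\<kappa> *\<^sub>R I)"
proof -
  obtain s where s: "\<And>i. sbi M (s i)" "\<And>i. (\<lambda>x. norm (f x - s i x)) \<in> borel_measurable M"
    "(\<lambda>i. \<integral>\<^sup>+x. ennreal (norm (f x - s i x)) \<partial>M) \<longlonglongrightarrow> 0" "(\<lambda>i. sbint M (s i)) \<longlonglongrightarrow> I"
    using f unfolding has_vector_integral_def by blast
  note [measurable] = s(2)
  have nn: "(\<integral>\<^sup>+x. u (t x) \<partial>M) = ennreal \<kappa> * (\<integral>\<^sup>+x. u x \<partial>M)" if [measurable]: "u \<in> borel_measurable M" for u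
  proof -
    have "(\<integral>\<^sup>+x. u (t x) \<partial>M) = (\<integral>\<^sup>+x. u x \<partial>distr M M t)"
      by (rule nn_integral_distr[symmetric]) auto
    also have "\<dots> = ennreal \<kappa> * (\<integral>\<^sup>+x. u x \<partial>M)"
      by (simp add: d nn_integral_density nn_integral_cmult)
    finally show ?thesis .
  qed
  have em: "emeasure M (t -` A \<inter> space M) = ennreal \<kappa> * emeasure M A" if [measurable]: "A \<in> sets M" for A
    using emeasure_distr[OF t, of A] that by (simp add: d emeasure_density_const)
  have sbi_t: "sbi M (\<lambda>x. s i (t x))" for i
  proof (rule simple_bochner_integrable.intros)
    have fin: "finite (s i ` space M)" and ms: "\<And>v. s i -` {v} \<inter> space M \<in> sets M"
      using s(1)[of i] by (auto elim!: simple_bochner_integrable.cases dest: simple_functionD)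
    show "simple_function M (\<lambda>x. s i (t x))"
      unfolding simple_function_def
    proof (intro conjI ballI)
      show "finite ((\<lambda>x. s i (t x)) ` space M)"
        by (rule finite_subset[OF _ fin]) (use measurable_space[OF t] in auto)
      fix v
      have "(\<lambda>x. s i (t x)) -` {v} \<inter> space M = t -` (s i -` {v} \<inter> space M) \<inter> space M"
        using measurable_space[OF t] by auto
      then show "(\<lambda>x. s i (t x)) -` {v} \<inter> space M \<in> sets M"
        using measurable_sets[OF t ms[of v]] by simp
    qed
    have "{y \<in> space M. s i y \<noteq> 0} = space M - (s i -` {0} \<inter> space M)" by auto
    then have A: "{y \<in> space M. s i y \<noteq> 0} \<in> sets M" using ms[of 0] by simp
    have "{y \<in> space M. s i (t y) \<noteq> 0} = t -` {y \<in> space M. s i y \<noteq> 0} \<inter> space M"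
      using measurable_space[OF t] by auto
    then have "emeasure M {y \<in> space M. s i (t y) \<noteq> 0} = ennreal \<kappa> * emeasure M {y \<in> space M. s i y \<noteq> 0}"
      using em[OF A] by simp
    then show "emeasure M {y \<in> space M. s i (t y) \<noteq> 0} \<noteq> \<infinity>"
      using s(1)[of i] by (auto elim!: simple_bochner_integrable.cases simp: ennreal_mult_eq_top_iff)
  qed
  have int_t: "sbint M (\<lambda>x. s i (t x)) = \<kappa> *\<^sub>R sbint M (s i)" for i
  proof -
    have fin: "finite (s i ` space M)" and ms: "\<And>v. s i -` {v} \<inter> space M \<in> sets M"
      using s(1)[of i] by (auto elim!: simple_bochner_integrable.cases dest: simple_functionD)
    have m: "measure M {x \<in> space M. s i (t x) = v} = \<kappa> * measure M {x \<in> space M. s i x = v}" for v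
    proof -
      have "{x \<in> space M. s i (t x) = v} = t -` (s i -` {v} \<inter> space M) \<inter> space M"
        using measurable_space[OF t] by auto
      then have "emeasure M {x \<in> space M. s i (t x) = v} = ennreal \<kappa> * emeasure M (s i -` {v} \<inter> space M)"
        using em[OF ms[of v]] by simp
      also have "s i -` {v} \<inter> space M = {x \<in> space M. s i x = v}" by auto
      finally show ?thesis using \<kappa> by (simp add: measure_def enn2real_mult)
    qed
    have "sbint M (\<lambda>x. s i (t x)) = (\<Sum>v\<in>(\<lambda>x. s i (t x)) ` space M. measure M {x \<in> space M. s i (t x) = v} *\<^sub>R v)"
      by (simp add: simple_bochner_integral_def)
    also have "\<dots> = (\<Sum>v\<in>s i ` space M. measure M {x \<in> space M. s i (t x) = v} *\<^sub>R v)"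
    \<comment> \<open>A value of \<open>s i\<close> that is missed after composition with
      \<open>t\<close> has an empty fibre and contributes 0.\<close>
    proof (rule sum.mono_neutral_left[OF fin])
      show "(\<lambda>x. s i (t x)) ` space M \<subseteq> s i ` space M" using measurable_space[OF t] by auto
      show "\<forall>v\<in>s i ` space M - (\<lambda>x. s i (t x)) ` space M. measure M {x \<in> space M. s i (t x) = v} *\<^sub>R v = 0"
      proof
        fix v assume "v \<in> s i ` space M - (\<lambda>x. s i (t x)) ` space M"
        then have "v \<notin> (\<lambda>x. s i (t x)) ` space M" by blast
        then have "{x \<in> space M. s i (t x) = v} = {}" by (auto intro: rev_image_eqI)
        then show "measure M {x \<in> space M. s i (t x) = v} *\<^sub>R v = 0" by (simp only: measure_empty scaleR_zero_left)
      qed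
    qed
    also have "\<dots> = \<kappa> *\<^sub>R sbint M (s i)"
      by (simp add: simple_bochner_integral_def m scaleR_sum_right)
    finally show ?thesis .
  qed
  show ?thesis unfolding has_vector_integral_def
  proof (intro exI[of _ "\<lambda>i x. s i (t x)"] conjI allI)
    show "sbi M (\<lambda>x. s i (t x))" for i by (rule sbi_t)
    show "(\<lambda>x. norm (f (t x) - s i (t x))) \<in> borel_measurable M" for i
      using measurable_compose[OF t s(2)] .
    have *: "(\<lambda>i. ennreal \<kappa> * (\<integral>\<^sup>+x. ennreal (norm (f x - s i x)) \<partial>M)) \<longlonglongrightarrow> ennreal \<kappa> * 0"
      by (intro ennreal_tendsto_cmult s) auto
    show "(\<lambda>i. \<integral>\<^sup>+x. ennreal (norm (f (t x) - s i (t x))) \<partial>M) \<longlonglongrightarrow> 0"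
    proof -
      have "(\<integral>\<^sup>+x. ennreal (norm (f (t x) - s i (t x))) \<partial>M) = ennreal \<kappa> * (\<integral>\<^sup>+x. ennreal (norm (f x - s i x)) \<partial>M)" for i
        by (rule nn) (intro measurable_compose[OF s(2)] measurable_ennreal)
      then show ?thesis using * by simp
    qed
    show "(\<lambda>i. sbint M (\<lambda>x. s i (t x))) \<longlonglongrightarrow> \<kappa> *\<^sub>R I"
      unfolding int_t by (intro tendsto_intros s)
  qed
qed

text \<open>The restriction to \<open>{..<m}\<close> keeps the image extensional, as points of
  \<open>lborel_n m\<close> must be.\<close>

definition affine_n :: "nat \<Rightarrow> (nat \<Rightarrow> real) \<Rightarrow> real \<Rightarrow> (nat \<Rightarrow> real) \<Rightarrow> nat \<Rightarrow> real" where
  "affine_n m a c x = (\<lambda>i\<in>{..<m}. a i + c * x i)"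

lemma measurable_affine_n [measurable]: "affine_n m a c \<in> measurable (lborel_n m) (lborel_n m)"
  unfolding affine_n_def by measurable

interpretation lborel_product: product_sigma_finite "\<lambda>_::nat. lborel :: real measure"
  by standard

lemma distr_affine_n:
  assumes c: "c > 0"
  shows "distr (lborel_n m) (lborel_n m) (affine_n m a c) = density (lborel_n m) (\<lambda>_. ennreal ((1 / c) ^ m))"
proof -
  \<comment> \<open>Multiplying by \<open>c ^ m\<close> turns the claim into an equality with the
    product measure itself. That measure is determined on boxes, where the one-dimensional affine
    rule applies to each side.\<close>
  let ?P = "density (distr (lborel_n m) (lborel_n m) (affine_n m a c)) (\<lambda>_. ennreal (c ^ m))"
  have "?P = lborel_n m"
  proof (rule lborel_product.PiM_eqI)
    fix A assume A: "\<And>i. i \<in> {..<m} \<Longrightarrow> A i \<in> sets (lborel :: real measure)"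
    have box: "Pi\<^sub>E {..<m} A \<in> sets (lborel_n m)"
      by (intro sets_PiM_I_finite) (use A in auto)
    have "affine_n m a c -` (Pi\<^sub>E {..<m} A) \<inter> space (lborel_n m)
        = Pi\<^sub>E {..<m} (\<lambda>i. (\<lambda>x. a i + c * x) -` A i)"
      by (auto simp: affine_n_def space_PiM PiE_def Pi_def extensional_def)
    then have "emeasure ?P (Pi\<^sub>E {..<m} A) = ennreal (c ^ m) * emeasure (lborel_n m) (Pi\<^sub>E {..<m} (\<lambda>i. (\<lambda>x. a i + c * x) -` A i))"
      using box by (simp add: emeasure_density_const emeasure_distr)
    also have "\<dots> = ennreal (c ^ m) * (\<Prod>i<m. emeasure lborel ((\<lambda>x. a i + c * x) -` A i))"
    proof (subst lborel_product.emeasure_PiM)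
      fix i assume "i \<in> {..<m}"
      then show "(\<lambda>x. a i + c * x) -` A i \<in> sets lborel"
        using measurable_sets[of "\<lambda>x. a i + c * x" lborel lborel "A i"] A by simp
    qed auto
    also have "\<dots> = (\<Prod>i<m. ennreal c * emeasure lborel ((\<lambda>x. a i + c * x) -` A i))"
      using c by (simp add: prod.distrib ennreal_power)
    also have "\<dots> = (\<Prod>i<m. emeasure lborel (A i))"
    proof (rule prod.cong[OF refl])
      fix i assume i: "i \<in> {..<m}"
      have "emeasure lborel (A i) = emeasure (density (distr lborel borel (\<lambda>x. a i + c * x)) (\<lambda>_. ennreal (abs c))) (A i)"
        using lborel_real_affine[of c "a i"] c by simp
      also have "\<dots> = ennreal c * emeasure lborel ((\<lambda>x. a i + c * x) -` A i)"
        using A[OF i] c by (simp add: emeasure_density_const emeasure_distr)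
      finally show "ennreal c * emeasure lborel ((\<lambda>x. a i + c * x) -` A i) = emeasure lborel (A i)" by simp
    qed
    finally show "emeasure ?P (Pi\<^sub>E {..<m} A) = (\<Prod>i\<in>{..<m}. emeasure lborel (A i))" by simp
  qed (auto)
  then have "density (lborel_n m) (\<lambda>_. ennreal ((1 / c) ^ m)) = density ?P (\<lambda>_. ennreal ((1 / c) ^ m))" by simp
  also have "\<dots> = density (distr (lborel_n m) (lborel_n m) (affine_n m a c)) (\<lambda>_. ennreal (c ^ m) * ennreal ((1 / c) ^ m))"
    by (rule density_density_eq) auto
  also have "\<dots> = distr (lborel_n m) (lborel_n m) (affine_n m a c)"
    using c by (simp flip: ennreal_mult add: power_one_over density_1)
  finally show ?thesis by simp
qed

lemma has_vector_integral_affine: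
  assumes "c > 0" "has_vector_integral (lborel_n m) f I"
  shows "has_vector_integral (lborel_n m) (\<lambda>x. f (affine_n m a c x)) ((1 / c) ^ m *\<^sub>R I)"
  by (rule has_vector_integral_compose[OF assms(2) measurable_affine_n _ distr_affine_n]) (use assms in auto)

lemma integral_affine_n:
  fixes f :: "_ \<Rightarrow> complex"
  assumes c: "c > 0" and [measurable]: "f \<in> borel_measurable (lborel_n m)"
  shows "(LINT x|lborel_n m. f (affine_n m a c x)) = (1 / c) ^ m *\<^sub>R (LINT x|lborel_n m. f x)"
proof -
  have "(LINT x|lborel_n m. f (affine_n m a c x)) = (LINT x|distr (lborel_n m) (lborel_n m) (affine_n m a c). f x)"
    by (rule integral_distr[symmetric]) auto
  also have "\<dots> = (1 / c) ^ m *\<^sub>R (LINT x|lborel_n m. f x)"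
    unfolding distr_affine_n[OF c] using c by (subst integral_density) auto
  finally show ?thesis .
qed

section \<open>Smooth functions\<close>

abbreviation "pds \<equiv> foldr partial_deriv"

lemma pds_snoc: "pds (is @ [i]) F = pds is (partial_deriv i F)"
  by simp

lemma smooth_depends_on: "smooth m F \<Longrightarrow> depends_on m F"
  unfolding smooth_def depends_on_def by blast

lemma smooth_continuous: "smooth m F \<Longrightarrow> continuous_on UNIV F"
  unfolding smooth_def by (metis bot.extremum foldr.simps(1) id_apply list.set(1))

lemma smooth_has_vector_derivative:
  assumes "smooth m F" "i < m"
  shows "((\<lambda>t. F (x(i := t))) has_vector_derivative partial_deriv i F (x(i := s))) (at s)"
proof -
  have "(\<lambda>t. foldr partial_deriv [] F ((x(i := s))(i := t))) differentiable (at ((x(i := s)) i))"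
    using assms unfolding smooth_def by (metis bot.extremum list.set(1))
  then have "(\<lambda>t. F (x(i := t))) differentiable (at s)" by simp
  then show ?thesis by (simp add: partial_deriv_def flip: vector_derivative_works)
qed

lemma smooth_has_vector_derivative_at:
  assumes "smooth m F" "i < m"
  shows "((\<lambda>t. F (x(i := t))) has_vector_derivative partial_deriv i F x) (at (x i))"
  using smooth_has_vector_derivative[OF assms, of x "x i"] by simp

lemma partial_derivI:
  "((\<lambda>t. F (x(i := t))) has_vector_derivative D) (at (x i)) \<Longrightarrow> partial_deriv i F x = D"
  unfolding partial_deriv_def by (rule vector_derivative_at)

lemma depends_on_partial_deriv:
  assumes "depends_on m F"
  shows "depends_on m (partial_deriv i F)"
  unfolding depends_on_def
proof (intro allI impI)
  fix x y :: "nat \<Rightarrow> real" assume xy: "\<forall>j<m. x j = y j"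
  then have eq: "F (x(i := t)) = F (y(i := t))" for t
    by (intro depends_onD[OF assms]) auto
  show "partial_deriv i F x = partial_deriv i F y"
  proof (cases "i < m")
    case True
    then show ?thesis using xy eq by (simp add: partial_deriv_def)
  next
    case False
    then have "F (x(i := t)) = F x" "F (y(i := t)) = F y" for t
      by (auto intro!: depends_onD[OF assms])
    then show ?thesis by (simp add: partial_deriv_def)
  qed
qed

lemma smooth_partial_deriv:
  assumes "smooth m F" "i < m"
  shows "smooth m (partial_deriv i F)"
  unfolding smooth_def
proof (intro conjI allI impI)
  fix x y :: "nat \<Rightarrow> real" assume "\<forall>i<m. x i = y i"
  then show "partial_deriv i F x = partial_deriv i F y"
    using depends_on_partial_deriv[OF smooth_depends_on[OF assms(1)]] by (auto simp: depends_on_def)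
next
  fix "is" assume "set is \<subseteq> {..<m}"
  then have "set (is @ [i]) \<subseteq> {..<m}" using assms by auto
  then have *: "continuous_on UNIV (pds (is @ [i]) F) \<and>
        (\<forall>j<m. \<forall>x. (\<lambda>t. pds (is @ [i]) F (x(j := t))) differentiable (at (x j)))"
    using assms unfolding smooth_def by blast
  from * show "continuous_on UNIV (pds is (partial_deriv i F))" by simp
  fix j x assume "j < m"
  with * show "(\<lambda>t. pds is (partial_deriv i F) (x(j := t))) differentiable (at (x j))" by simp
qed

lemma smooth_pds: "smooth m F \<Longrightarrow> set is \<subseteq> {..<m} \<Longrightarrow> smooth m (pds is F)"
  by (induction "is") (auto intro: smooth_partial_deriv)

text \<open>Every iterated derivative of a member of \<open>X\<close> stays in \<open>X\<close>,
  hence is continuous and differentiable again. Smoothness is proved below by naming a family of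
  functions of some fixed shape that is closed under partial derivatives.\<close>

lemma smooth_coinduct:
  assumes F: "F \<in> X"
    and X: "\<And>F. F \<in> X \<Longrightarrow> depends_on m F \<and> continuous_on UNIV F"
    and D: "\<And>F i. F \<in> X \<Longrightarrow> i < m \<Longrightarrow>
      \<exists>G\<in>X. \<forall>x. ((\<lambda>t. F (x(i := t))) has_vector_derivative G x) (at (x i))"
  shows "smooth m F"
proof -
  have pd: "partial_deriv i F \<in> X" if "F \<in> X" "i < m" for F i
  proof -
    obtain G where G: "G \<in> X" "\<And>x. ((\<lambda>t. F (x(i := t))) has_vector_derivative G x) (at (x i))"
      using D[OF \<open>F \<in> X\<close> \<open>i < m\<close>] by auto
    then have "partial_deriv i F = G" by (intro ext partial_derivI)
    then show ?thesis using G by simp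
  qed
  have *: "pds is F \<in> X" if "set is \<subseteq> {..<m}" for "is"
    using that by (induction "is") (auto intro: pd F)
  have "(\<lambda>t. pds is F (x(i := t))) differentiable (at (x i))" if "set is \<subseteq> {..<m}" "i < m" for "is" i x
    using D[OF *[OF that(1)] that(2)] by (auto intro: differentiableI_vector)
  then show ?thesis
    unfolding smooth_def using X[OF F] X[OF *] by (auto simp: depends_on_def)
qed

lemma depends_on_comb:
  "depends_on m F \<Longrightarrow> depends_on m G \<Longrightarrow> depends_on m (\<lambda>x. p (F x) (G x))"
  unfolding depends_on_def by metis

lemma smooth_const [simp]: "smooth m (\<lambda>x. c)"
proof (rule smooth_coinduct)
  show "(\<lambda>x. c) \<in> {\<lambda>x. c | c. True}" by blast
next
  fix F :: "(nat \<Rightarrow> real) \<Rightarrow> complex" and i assume "F \<in> {\<lambda>x. c | c. True}"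
  then obtain c where F: "F = (\<lambda>x. c)" by blast
  then have "\<forall>x. ((\<lambda>t. F (x(i := t))) has_vector_derivative (\<lambda>x. 0) x) (at (x i))" by simp
  then show "\<exists>G\<in>{\<lambda>x. c | c. True}. \<forall>x. ((\<lambda>t. F (x(i := t))) has_vector_derivative G x) (at (x i))"
    by (intro bexI[of _ "\<lambda>x. 0"]) auto
qed (auto simp: depends_on_def)

lemma smooth_add:
  assumes "smooth m F" "smooth m G"
  shows "smooth m (\<lambda>x. F x + G x)"
proof (rule smooth_coinduct)
  let ?X = "{\<lambda>x. F x + G x | F G. smooth m F \<and> smooth m G}"
  show "(\<lambda>x. F x + G x) \<in> ?X" using assms by blast
  fix H assume "H \<in> ?X"
  then obtain F G where H: "H = (\<lambda>x. F x + G x)" "smooth m F" "smooth m G" by blast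
  then show "depends_on m H \<and> continuous_on UNIV H"
    using depends_on_comb[of m F G "(+)"] continuous_on_add[of UNIV F G]
    by (simp add: smooth_depends_on smooth_continuous)
  fix i assume i: "i < m"
  then have "(\<lambda>x. partial_deriv i F x + partial_deriv i G x) \<in> ?X"
    using H by (blast intro: smooth_partial_deriv)
  moreover have "\<forall>x. ((\<lambda>t. H (x(i := t))) has_vector_derivative
      (partial_deriv i F x + partial_deriv i G x)) (at (x i))"
    unfolding H(1) using H i by (auto intro!: has_vector_derivative_add smooth_has_vector_derivative_at)
  ultimately show "\<exists>K\<in>?X. \<forall>x. ((\<lambda>t. H (x(i := t))) has_vector_derivative K x) (at (x i))"
    by (intro bexI[of _ "\<lambda>x. partial_deriv i F x + partial_deriv i G x"])
qed

lemma partial_deriv_add: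
  "smooth m F \<Longrightarrow> smooth m G \<Longrightarrow> i < m \<Longrightarrow>
    partial_deriv i (\<lambda>x. F x + G x) = (\<lambda>x. partial_deriv i F x + partial_deriv i G x)"
  by (intro ext partial_derivI has_vector_derivative_add smooth_has_vector_derivative_at)

lemma pds_add:
  "smooth m F \<Longrightarrow> smooth m G \<Longrightarrow> set is \<subseteq> {..<m} \<Longrightarrow>
    pds is (\<lambda>x. F x + G x) = (\<lambda>x. pds is F x + pds is G x)"
  by (induction "is") (auto simp: partial_deriv_add[of m] smooth_pds)

text \<open>Products of two smooth functions are not closed under differentiation; finite sums of
  such products are, by the product rule. This is the family for
  \<open>smooth_coinduct\<close>.\<close>

inductive_set product_span :: "nat \<Rightarrow> ((nat \<Rightarrow> real) \<Rightarrow> complex) set" for m where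
  base: "smooth m F \<Longrightarrow> smooth m G \<Longrightarrow> (\<lambda>x. F x * G x) \<in> product_span m"
| add: "F \<in> product_span m \<Longrightarrow> G \<in> product_span m \<Longrightarrow> (\<lambda>x. F x + G x) \<in> product_span m"

lemma smooth_mult_has_vector_derivative:
  assumes "smooth m F" "smooth m G" "i < m"
  shows "((\<lambda>t. F (x(i := t)) * G (x(i := t))) has_vector_derivative
      F x * partial_deriv i G x + partial_deriv i F x * G x) (at (x i))"
  using has_vector_derivative_mult[OF smooth_has_vector_derivative_at[OF assms(1,3), of x]
      smooth_has_vector_derivative_at[OF assms(2,3), of x]] by simp

lemma smooth_mult:
  assumes "smooth m F" "smooth m G"
  shows "smooth m (\<lambda>x. F x * G x)"
proof (rule smooth_coinduct)
  show "(\<lambda>x. F x * G x) \<in> product_span m" using assms by (rule product_span.base)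
next
  fix H assume "H \<in> product_span m"
  then show "depends_on m H \<and> continuous_on UNIV H"
  proof induction
    case (base F G)
    then show ?case
      using depends_on_comb[of m F G "(*)"] continuous_on_mult[of UNIV F G]
      by (simp add: smooth_depends_on smooth_continuous)
  next
    case (add F G)
    then show ?case
      using depends_on_comb[of m F G "(+)"] continuous_on_add[of UNIV F G] by simp
  qed
next
  fix H i assume "H \<in> product_span m" and i: "i < m"
  then show "\<exists>K\<in>product_span m. \<forall>x. ((\<lambda>t. H (x(i := t))) has_vector_derivative K x) (at (x i))"
  proof induction
    case (base F G)
    have "(\<lambda>x. F x * partial_deriv i G x + partial_deriv i F x * G x) \<in> product_span m"
      using base i by (auto intro!: product_span.intros smooth_partial_deriv)
    then show ?case
      by (intro bexI[of _ "\<lambda>x. F x * partial_deriv i G x + partial_deriv i F x * G x"] allI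
          smooth_mult_has_vector_derivative[where m=m] base(1,2) i)
  next
    case (add F G)
    then obtain K L where KL: "K \<in> product_span m" "L \<in> product_span m"
      "\<forall>x. ((\<lambda>t. F (x(i := t))) has_vector_derivative K x) (at (x i))"
      "\<forall>x. ((\<lambda>t. G (x(i := t))) has_vector_derivative L x) (at (x i))" by blast
    then have "\<forall>x. ((\<lambda>t. F (x(i := t)) + G (x(i := t))) has_vector_derivative K x + L x) (at (x i))"
      by (auto intro: has_vector_derivative_add)
    then show ?case
      using product_span.add[OF KL(1,2)] by (intro bexI[of _ "\<lambda>x. K x + L x"])
  qed
qed

lemma partial_deriv_mult:
  "smooth m F \<Longrightarrow> smooth m G \<Longrightarrow> i < m \<Longrightarrow>
    partial_deriv i (\<lambda>x. F x * G x) = (\<lambda>x. F x * partial_deriv i G x + partial_deriv i F x * G x)"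
  by (intro ext partial_derivI smooth_mult_has_vector_derivative[where m=m])

lemma smooth_cmult: "smooth m F \<Longrightarrow> smooth m (\<lambda>x. c * F x)"
  by (rule smooth_mult) auto

lemma partial_deriv_const [simp]: "partial_deriv i (\<lambda>x. c) = (\<lambda>x. 0)"
  by (intro ext partial_derivI) simp

lemma partial_deriv_cmult:
  "smooth m F \<Longrightarrow> i < m \<Longrightarrow> partial_deriv i (\<lambda>x. c * F x) = (\<lambda>x. c * partial_deriv i F x)"
  using partial_deriv_mult[of m "\<lambda>_. c" F i] by simp

lemma pds_cmult:
  "smooth m F \<Longrightarrow> set is \<subseteq> {..<m} \<Longrightarrow> pds is (\<lambda>x. c * F x) = (\<lambda>x. c * pds is F x)"
  by (induction "is") (auto simp: partial_deriv_cmult[of m] smooth_pds)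

lemma smooth_diff: "smooth m F \<Longrightarrow> smooth m G \<Longrightarrow> smooth m (\<lambda>x. F x - G x)"
  using smooth_add[of m F "\<lambda>x. (-1) * G x"] smooth_cmult[of m G "-1"] by simp

lemma partial_deriv_diff:
  "smooth m F \<Longrightarrow> smooth m G \<Longrightarrow> i < m \<Longrightarrow>
    partial_deriv i (\<lambda>x. F x - G x) = (\<lambda>x. partial_deriv i F x - partial_deriv i G x)"
  by (intro ext partial_derivI has_vector_derivative_diff smooth_has_vector_derivative_at)

lemma smooth_prod:
  assumes "finite I" "\<And>i. i \<in> I \<Longrightarrow> smooth m (F i)"
  shows "smooth m (\<lambda>x. \<Prod>i\<in>I. F i x)"
  using assms by (induction I rule: finite_induct) (auto intro!: smooth_mult)

text \<open>Moving a coordinate other than \<open>j\<close> keeps \<open>x j\<close> in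
  \<open>U\<close>, so \<open>F\<close> is constantly 0 along that line; moving coordinate
  \<open>j\<close> itself stays in the open set \<open>U\<close> for a while.\<close>

lemma partial_deriv_vanish:
  assumes U: "open U" and F: "\<And>x. x j \<in> U \<Longrightarrow> F x = 0" and x: "x j \<in> U"
  shows "partial_deriv i F x = 0"
proof (rule partial_derivI)
  show "((\<lambda>t. F (x(i := t))) has_vector_derivative 0) (at (x i))"
  proof (cases "i = j")
    case True
    show ?thesis
      by (rule has_vector_derivative_transform_within_open[OF has_vector_derivative_const[of 0] U])
         (use True x F in auto)
  next
    case False
    then show ?thesis using F x by simp
  qed
qed

lemma pds_vanish:
  assumes "open U" "\<And>x. x j \<in> U \<Longrightarrow> F x = 0" "x j \<in> U"
  shows "pds is F x = 0"
  using assms(3)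
  by (induction "is" arbitrary: x) (auto simp: assms intro: partial_deriv_vanish[OF assms(1)])

section \<open>Functions of one variable with derivatives of polynomial growth\<close>

definition growth :: "(real \<Rightarrow> complex) \<Rightarrow> bool" where
  "growth f \<longleftrightarrow> (\<exists>C p. \<forall>t. cmod (f t) \<le> C * (1 + \<bar>t\<bar>) ^ p)"

lemma growthI: "(\<And>t. cmod (f t) \<le> C * (1 + \<bar>t\<bar>) ^ p) \<Longrightarrow> growth f"
  unfolding growth_def by blast

lemma growth_bounded: "(\<And>t. cmod (f t) \<le> C) \<Longrightarrow> growth f"
  by (rule growthI[where p=0]) simp

lemma growthE:
  assumes "growth f"
  obtains C p where "0 \<le> C" "\<And>t. cmod (f t) \<le> C * (1 + \<bar>t\<bar>) ^ p"
proof -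
  obtain C p where C: "\<And>t. cmod (f t) \<le> C * (1 + \<bar>t\<bar>) ^ p" using assms by (auto simp: growth_def)
  have "0 \<le> cmod (f 0)" by simp
  also have "\<dots> \<le> C" using C[of 0] by simp
  finally show ?thesis using that C by blast
qed

lemma growth_add: assumes "growth f" "growth g" shows "growth (\<lambda>t. f t + g t)"
proof -
  obtain C p where C: "0 \<le> C" "\<And>t. cmod (f t) \<le> C * (1 + \<bar>t\<bar>) ^ p" using assms(1) by (rule growthE) blast
  obtain D q where D: "0 \<le> D" "\<And>t. cmod (g t) \<le> D * (1 + \<bar>t\<bar>) ^ q" using assms(2) by (rule growthE) blast
  show ?thesis
  proof (rule growthI)
    fix t :: real
    have "C * (1 + \<bar>t\<bar>) ^ p \<le> C * (1 + \<bar>t\<bar>) ^ (p + q)" "D * (1 + \<bar>t\<bar>) ^ q \<le> D * (1 + \<bar>t\<bar>) ^ (p + q)"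
      using C(1) D(1) by (auto intro!: mult_left_mono power_increasing)
    then show "cmod (f t + g t) \<le> (C + D) * (1 + \<bar>t\<bar>) ^ (p + q)"
      using C(2)[of t] D(2)[of t] norm_triangle_ineq[of "f t" "g t"] by (simp add: distrib_right)
  qed
qed

lemma growth_mult: assumes "growth f" "growth g" shows "growth (\<lambda>t. f t * g t)"
proof -
  obtain C p where C: "0 \<le> C" "\<And>t. cmod (f t) \<le> C * (1 + \<bar>t\<bar>) ^ p" using assms(1) by (rule growthE) blast
  obtain D q where D: "0 \<le> D" "\<And>t. cmod (g t) \<le> D * (1 + \<bar>t\<bar>) ^ q" using assms(2) by (rule growthE) blast
  show ?thesis
  proof (rule growthI)
    fix t :: real
    have "cmod (f t) * cmod (g t) \<le> (C * (1 + \<bar>t\<bar>) ^ p) * (D * (1 + \<bar>t\<bar>) ^ q)"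
      using C D by (intro mult_mono) auto
    then show "cmod (f t * g t) \<le> (C * D) * (1 + \<bar>t\<bar>) ^ (p + q)"
      by (simp add: norm_mult power_add mult_ac)
  qed
qed

text \<open>\<open>n\<close>-fold differentiability with polynomial bounds, with the derivative
  existentially quantified so that closure under algebraic operations is an induction on
  \<open>n\<close>. The resulting \<open>moderate\<close> functions are the multipliers of the
  Schwartz space on the line.\<close>

fun md :: "nat \<Rightarrow> (real \<Rightarrow> complex) \<Rightarrow> bool" where
  "md 0 f = growth f"
| "md (Suc n) f = (growth f \<and> (\<exists>f'. (\<forall>t. (f has_vector_derivative f' t) (at t)) \<and> md n f'))"

definition moderate :: "(real \<Rightarrow> complex) \<Rightarrow> bool" where
  "moderate f \<longleftrightarrow> (\<forall>n. md n f)"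

lemma md_SucI: "growth f \<Longrightarrow> (\<And>t. (f has_vector_derivative f' t) (at t)) \<Longrightarrow> md n f' \<Longrightarrow> md (Suc n) f"
  by auto

lemma md_Suc: "md (Suc n) f \<Longrightarrow> md n f"
proof (induction n arbitrary: f)
  case (Suc n)
  from Suc.prems obtain f' where f': "growth f" "\<And>t. (f has_vector_derivative f' t) (at t)" "md (Suc n) f'"
    by (simp only: md.simps(2)) blast
  from f'(1,2) Suc.IH[OF f'(3)] show ?case by (rule md_SucI)
qed simp

lemma md_growth: "md n f \<Longrightarrow> growth f"
  by (cases n) auto

lemma md_add: "md n f \<Longrightarrow> md n g \<Longrightarrow> md n (\<lambda>t. f t + g t)"
proof (induction n arbitrary: f g)
  case (Suc n)
  then obtain f' g' where "\<And>t. (f has_vector_derivative f' t) (at t)" "md n f'"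
    "\<And>t. (g has_vector_derivative g' t) (at t)" "md n g'" by (simp only: md.simps(2)) blast
  with Suc show ?case
    by (intro md_SucI[where f'="\<lambda>t. f' t + g' t"] growth_add has_vector_derivative_add Suc.IH) auto
qed (simp add: growth_add)

lemma md_mult: "md n f \<Longrightarrow> md n g \<Longrightarrow> md n (\<lambda>t. f t * g t)"
proof (induction n arbitrary: f g)
  case (Suc n)
  then obtain f' g' where "\<And>t. (f has_vector_derivative f' t) (at t)" "md n f'"
    "\<And>t. (g has_vector_derivative g' t) (at t)" "md n g'" by (simp only: md.simps(2)) blast
  moreover have "md n f" "md n g" "growth f" "growth g"
    using Suc.prems by (simp_all only: md_Suc md_growth)
  ultimately show ?case
    by (intro md_SucI[where f'="\<lambda>t. f t * g' t + f' t * g t"] growth_mult has_vector_derivative_mult md_add Suc.IH)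
qed (simp add: growth_mult)

lemma moderate_add: "moderate f \<Longrightarrow> moderate g \<Longrightarrow> moderate (\<lambda>t. f t + g t)"
  unfolding moderate_def by (blast intro: md_add)

lemma moderate_mult: "moderate f \<Longrightarrow> moderate g \<Longrightarrow> moderate (\<lambda>t. f t * g t)"
  unfolding moderate_def by (blast intro: md_mult)

lemma md_const [simp]: "md n (\<lambda>t. c)"
  by (induction n arbitrary: c) (auto intro!: growth_bounded exI[of _ "\<lambda>t. 0"])

lemma moderate_const [simp]: "moderate (\<lambda>t. c)"
  by (simp add: moderate_def)

lemma moderate_diff: "moderate f \<Longrightarrow> moderate g \<Longrightarrow> moderate (\<lambda>t. f t - g t)"
  using moderate_add[of f "\<lambda>t. (-1) * g t"] moderate_mult[of "\<lambda>t. -1" g] by simp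

lemma moderate_power: "moderate f \<Longrightarrow> moderate (\<lambda>t. f t ^ n)"
  by (induction n) (auto intro: moderate_mult)

lemma moderateI_deriv:
  assumes "growth f" "\<And>t. (f has_vector_derivative f' t) (at t)" "moderate f'"
  shows "moderate f"
  unfolding moderate_def
proof
  fix n show "md n f" using assms by (cases n) (auto simp: moderate_def)
qed

lemma complex_of_real_has_vector_derivative: "(complex_of_real has_vector_derivative 1) (at t)"
  using bounded_linear.has_vector_derivative[OF bounded_linear_of_real has_vector_derivative_id] by simp

lemma moderate_of_real [simp]: "moderate complex_of_real"
proof (rule moderateI_deriv)
  show "growth complex_of_real" by (rule growthI[where C=1 and p=1]) simp
qed (auto intro: complex_of_real_has_vector_derivative)

text \<open>The witness in \<open>md (Suc n) f\<close> might depend on \<open>n\<close>; uniqueness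
  of derivatives makes it one function that serves all orders.\<close>

lemma moderate_deriv:
  assumes "moderate f"
  obtains f' where "moderate f'" "\<And>t. (f has_vector_derivative f' t) (at t)"
proof -
  obtain f' where f': "\<And>t. (f has_vector_derivative f' t) (at t)"
    using assms unfolding moderate_def by (metis md.simps(2))
  have "md n f'" for n
  proof -
    obtain g where "\<And>t. (f has_vector_derivative g t) (at t)" "md n g"
      using assms unfolding moderate_def by (metis md.simps(2))
    moreover have "g = f'"
      using \<open>\<And>t. (f has_vector_derivative g t) (at t)\<close> f' by (auto intro!: ext vector_derivative_unique_at)
    ultimately show ?thesis by simp
  qed
  then show ?thesis using that f' unfolding moderate_def by blast
qed

lemma moderate_growth: "moderate f \<Longrightarrow> growth f"
  unfolding moderate_def using md_growth by blast

lemma moderate_continuous: "moderate f \<Longrightarrow> continuous_on UNIV f"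
  by (metis continuous_on_vector_derivative moderate_deriv)

lemma growth_affine: assumes "growth f" shows "growth (\<lambda>t. f (a + b * t))"
proof -
  obtain C p where C: "0 \<le> C" "\<And>t. cmod (f t) \<le> C * (1 + \<bar>t\<bar>) ^ p" using assms(1) by (rule growthE) blast
  show ?thesis
  proof (rule growthI)
    fix t :: real
    have "1 + \<bar>a + b * t\<bar> \<le> 1 + (\<bar>a\<bar> + \<bar>b\<bar> * \<bar>t\<bar>)"
      using abs_triangle_ineq[of a "b * t"] by (simp add: abs_mult)
    also have "\<dots> \<le> (1 + \<bar>a\<bar> + \<bar>b\<bar>) * (1 + \<bar>t\<bar>)"
      by (simp add: algebra_simps)
    finally have "(1 + \<bar>a + b * t\<bar>) ^ p \<le> ((1 + \<bar>a\<bar> + \<bar>b\<bar>) * (1 + \<bar>t\<bar>)) ^ p"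
      by (intro power_mono) auto
    then have "C * (1 + \<bar>a + b * t\<bar>) ^ p \<le> C * ((1 + \<bar>a\<bar> + \<bar>b\<bar>) ^ p * (1 + \<bar>t\<bar>) ^ p)"
      unfolding power_mult_distrib using C(1) by (rule mult_left_mono)
    with C(2)[of "a + b * t"] have "cmod (f (a + b * t)) \<le> C * ((1 + \<bar>a\<bar> + \<bar>b\<bar>) ^ p * (1 + \<bar>t\<bar>) ^ p)"
      by (rule order_trans)
    then show "cmod (f (a + b * t)) \<le> (C * (1 + \<bar>a\<bar> + \<bar>b\<bar>) ^ p) * (1 + \<bar>t\<bar>) ^ p"
      by (simp only: mult.assoc)
  qed
qed

lemma moderate_affine:
  assumes "moderate f" shows "moderate (\<lambda>t. f (a + b * t))"
proof -
  have "md n f \<Longrightarrow> md n (\<lambda>t. f (a + b * t))" for n f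
  proof (induction n arbitrary: f)
    case (Suc n)
    then obtain f' where f': "\<And>t. (f has_vector_derivative f' t) (at t)" "md n f'"
      by (simp only: md.simps(2)) blast
    have "((\<lambda>t. f (a + b * t)) has_vector_derivative complex_of_real b * f' (a + b * t)) (at t)" for t
    proof -
      have "((\<lambda>t. a + b * t) has_vector_derivative b) (at t)"
        by (auto intro!: derivative_eq_intros simp flip: has_real_derivative_iff_has_vector_derivative)
      from vector_diff_chain_at[OF this f'(1)] show ?thesis
        by (simp add: comp_def scaleR_conv_of_real)
    qed
    moreover have "md n (\<lambda>t. complex_of_real b * f' (a + b * t))"
      by (rule md_mult[OF md_const Suc.IH[OF f'(2)]])
    moreover have "growth (\<lambda>t. f (a + b * t))" using Suc.prems by (intro growth_affine) auto
    ultimately show ?case by (intro md_SucI[where f'="\<lambda>t. complex_of_real b * f' (a + b * t)"])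
  qed (simp add: growth_affine)
  then show ?thesis using assms unfolding moderate_def by blast
qed

lemma moderate_cis: "moderate (\<lambda>t. cis (s * t))"
  unfolding moderate_def
proof
  fix n show "md n (\<lambda>t. cis (s * t))"
  proof (induction n)
    case 0
    then show ?case by (auto intro: growth_bounded[where C=1])
  next
    case (Suc n)
    have "((\<lambda>t. cis (s * t)) has_vector_derivative (\<i> * s) * cis (s * t)) (at t)" for t
    proof -
      have "((\<lambda>t. \<i> * s * complex_of_real t) has_vector_derivative \<i> * s * 1) (at t)"
        by (rule has_vector_derivative_mult_right[OF complex_of_real_has_vector_derivative])
      from field_vector_diff_chain_at[OF this DERIV_exp] show ?thesis
        by (simp add: comp_def cis_conv_exp mult_ac)
    qed
    moreover have "md n (\<lambda>t. (\<i> * s) * cis (s * t))"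
      by (intro md_mult Suc.IH) simp_all
    moreover have "growth (\<lambda>t. cis (s * t))" by (rule growth_bounded[where C=1]) simp
    ultimately show ?case by (intro md_SucI[where f'="\<lambda>t. (\<i> * s) * cis (s * t)"])
  qed
qed

text \<open>Induction on the order through \<open>(1/f)' = - f' * (1/f)^2\<close>; the lower bound
  on \<open>f\<close> bounds the reciprocal.\<close>

lemma moderate_inverse:
  assumes f: "moderate f" and c: "0 < c" "\<And>t. c \<le> cmod (f t)"
  shows "moderate (\<lambda>t. inverse (f t))"
  unfolding moderate_def
proof
  have gr: "growth (\<lambda>t. inverse (f t))"
    by (rule growth_bounded[where C="inverse c"]) (simp add: norm_inverse c le_imp_inverse_le)
  obtain f' where f': "moderate f'" "\<And>t. (f has_vector_derivative f' t) (at t)"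
    using f by (rule moderate_deriv) blast
  fix n show "md n (\<lambda>t. inverse (f t))"
  proof (induction n)
    case 0
    then show ?case using gr by simp
  next
    case (Suc n)
    have nz: "f t \<noteq> 0" for t using c(1) c(2)[of t] by auto
    have "((\<lambda>t. inverse (f t)) has_vector_derivative (-1) * f' t * inverse (f t) * inverse (f t)) (at t)" for t
      using field_vector_diff_chain_at[OF f'(2) DERIV_inverse'[OF DERIV_ident nz[of t]]] nz[of t]
      by (simp add: comp_def mult_ac)
    moreover have "md n (\<lambda>t. (-1) * f' t * inverse (f t) * inverse (f t))"
      by (intro md_mult Suc.IH) (use f'(1) in \<open>auto simp: moderate_def\<close>)
    ultimately show ?case using gr by (intro md_SucI) auto
  qed
qed

lemma moderate_cauchy: "moderate (\<lambda>t. complex_of_real (inverse (1 + t\<^sup>2) ^ n))"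
proof -
  have "moderate (\<lambda>t. inverse (1 + complex_of_real t ^ 2))"
  proof (rule moderate_inverse)
    show "moderate (\<lambda>t. 1 + complex_of_real t ^ 2)"
      by (intro moderate_add moderate_const moderate_power moderate_of_real)
    fix t :: real
    have "1 + complex_of_real t ^ 2 = complex_of_real (1 + t\<^sup>2)" by simp
    then show "1 \<le> cmod (1 + complex_of_real t ^ 2)" by (simp only: norm_of_real) simp
  qed simp
  from moderate_power[OF this, of n] show ?thesis by simp
qed

section \<open>A smooth cutoff of one variable\<close>

text \<open>Differentiating \<open>exp (- 1/x)\<close> creates powers of \<open>1/x\<close>, so
  these are built into the family: the derivative of \<open>flat n\<close> is a combination of
  \<open>flat (n + 2)\<close> and \<open>flat (n + 1)\<close>.\<close>

definition flat :: "nat \<Rightarrow> real \<Rightarrow> complex" where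
  "flat n x = (if x > 0 then complex_of_real (exp (- (1 / x)) / x ^ n) else 0)"

text \<open>One term of the exponential series is below the sum. With \<open>1/x\<close> in place of
  \<open>x\<close> this bounds \<open>flat n\<close> by \<open>fact n\<close>.\<close>

lemma power_div_fact_le_exp:
  assumes "0 \<le> (x::real)"
  shows "x ^ n \<le> fact n * exp x"
proof -
  have "(\<Sum>k\<in>{n}. x ^ k /\<^sub>R fact k) \<le> (\<Sum>k. x ^ k /\<^sub>R fact k)"
    by (rule sum_le_suminf[OF summable_exp_generic]) (use assms in auto)
  then have "x ^ n / fact n \<le> exp x" by (simp add: exp_def divide_inverse mult.commute)
  then show ?thesis by (simp add: pos_divide_le_eq mult.commute)
qed

lemma norm_flat_le: "cmod (flat n x) \<le> fact n"
proof (cases "x > 0")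
  case True
  have "(1 / x) ^ n \<le> fact n * exp (1 / x)"
    using True by (intro power_div_fact_le_exp) simp
  then have "(1 / x) ^ n / exp (1 / x) \<le> fact n"
    by (subst pos_divide_le_eq) auto
  moreover have "cmod (flat n x) = (1 / x) ^ n / exp (1 / x)"
    using True by (simp only: flat_def norm_of_real if_True)
      (simp add: power_inverse exp_minus divide_inverse mult.commute)
  ultimately show ?thesis by simp
qed (simp add: flat_def)

lemma flat_eq: "flat n x = complex_of_real (x ^ k) * flat (n + k) x"
  by (simp add: flat_def power_add)

lemma flat_has_vector_derivative:
  "(flat n has_vector_derivative flat (n + 2) x - of_nat n * flat (n + 1) x) (at x)"
proof -
  consider "x < 0" | "x = 0" | "x > 0" by linarith
  then show ?thesis
  proof cases
    case 1
    have "(flat n has_vector_derivative 0) (at x)"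
      by (rule has_vector_derivative_transform_within_open[OF has_vector_derivative_const[of 0], of "{..<0}"])
         (use 1 in \<open>auto simp: flat_def\<close>)
    then show ?thesis using 1 by (simp add: flat_def)
  next
    case 2
    \<comment> \<open>Since \<open>flat n y = y^2 * flat (n + 2) y\<close> and
      \<open>flat (n + 2)\<close> is bounded by \<open>fact (n + 2)\<close>, the difference quotient
      at 0 is of order \<open>y\<close>.\<close>
    have "((\<lambda>y. (flat n (0 + y) - flat n 0 - y *\<^sub>R 0) /\<^sub>R norm y) \<longlongrightarrow> 0) (at 0)"
    proof (rule Lim_null_comparison)
      show "eventually (\<lambda>y. norm ((flat n (0 + y) - flat n 0 - y *\<^sub>R 0) /\<^sub>R norm y) \<le> fact (n + 2) * \<bar>y\<bar>) (at (0::real))"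
      proof (rule always_eventually, rule allI)
        fix y :: real
        have "cmod (flat n y) \<le> y\<^sup>2 * fact (n + 2)"
          using mult_left_mono[OF norm_flat_le[of "n + 2" y], of "y\<^sup>2"]
          by (subst flat_eq[of _ _ 2]) (simp add: norm_mult norm_power del: fact_Suc)
        then have "cmod (flat n y) / \<bar>y\<bar> \<le> (y\<^sup>2 * fact (n + 2)) / \<bar>y\<bar>"
          by (rule divide_right_mono) simp
        also have "\<dots> = fact (n + 2) * \<bar>y\<bar>"
          by (cases "y = 0") (simp_all add: power2_eq_square abs_if del: fact_Suc)
        finally show "norm ((flat n (0 + y) - flat n 0 - y *\<^sub>R 0) /\<^sub>R norm y) \<le> fact (n + 2) * \<bar>y\<bar>"
          by (simp add: flat_def[of n 0] divide_inverse mult.commute del: fact_Suc)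
      qed
      show "((\<lambda>y. fact (n + 2) * \<bar>y\<bar>) \<longlongrightarrow> 0) (at (0::real))"
        by (rule tendsto_eq_intros refl tendsto_rabs_zero tendsto_mult_right_zero tendsto_ident_at)+
    qed
    then have "(flat n has_vector_derivative 0) (at 0)"
      unfolding has_vector_derivative_def has_derivative_def
      by (simp add: bounded_linear_zero)
    then show ?thesis using 2 by (simp add: flat_def)
  next
    case 3
    define g where "g y = exp (- (1 / y)) / y ^ n" for y :: real
    have "(g has_real_derivative exp (- (1 / x)) / x ^ (n + 2) - real n * (exp (- (1 / x)) / x ^ (n + 1))) (at x)"
    proof -
      have pw: "((\<lambda>y. inverse y ^ n) has_real_derivative - (real n * inverse x ^ (n + 1))) (at x)"
      proof (induction n)
        case (Suc n)
        have "((\<lambda>y. inverse y * inverse y ^ n) has_real_derivative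
            inverse x * - (real n * inverse x ^ (n + 1)) + - (inverse x * 1 * inverse x) * inverse x ^ n) (at x)"
          by (rule DERIV_mult'[OF DERIV_inverse'[OF DERIV_ident] Suc.IH]) (use 3 in simp)
        then show ?case by (simp add: algebra_simps)
      qed simp
      have "((\<lambda>y. exp (- inverse y)) has_real_derivative exp (- inverse x) * - (- (inverse x * 1 * inverse x))) (at x)"
        by (rule DERIV_fun_exp[OF DERIV_minus[OF DERIV_inverse'[OF DERIV_ident]]]) (use 3 in simp)
      from DERIV_mult'[OF this pw] show ?thesis
        unfolding g_def by (simp add: field_simps)
    qed
    then have "((\<lambda>y. complex_of_real (g y)) has_vector_derivative
        complex_of_real (exp (- (1 / x)) / x ^ (n + 2) - real n * (exp (- (1 / x)) / x ^ (n + 1)))) (at x)"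
      by (intro bounded_linear.has_vector_derivative[OF bounded_linear_of_real])
         (simp add: has_real_derivative_iff_has_vector_derivative)
    then have "(flat n has_vector_derivative
        complex_of_real (exp (- (1 / x)) / x ^ (n + 2) - real n * (exp (- (1 / x)) / x ^ (n + 1)))) (at x)"
      by (rule has_vector_derivative_transform_within_open[of _ _ _ "{0<..}"])
         (use 3 in \<open>auto simp: flat_def g_def\<close>)
    then show ?thesis using 3 by (simp add: flat_def)
  qed
qed

lemma moderate_flat: "moderate (flat n)"
  unfolding moderate_def
proof
  fix k show "md k (flat n)"
  proof (induction k arbitrary: n)
    case 0
    then show ?case using norm_flat_le by (auto intro: growth_bounded)
  next
    case (Suc k)
    have "md k (\<lambda>x. flat (n + 2) x + (- of_nat n) * flat (n + 1) x)"
      by (intro md_add md_mult Suc.IH md_const)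
    then show ?case
      using norm_flat_le[of n] flat_has_vector_derivative[of n]
      by (intro md_SucI[where f'="\<lambda>x. flat (n + 2) x - of_nat n * flat (n + 1) x"] growth_bounded[where C="fact n"]) auto
  qed
qed

text \<open>The standard smooth transition \<open>u(x) / (u(x) + u(1 - x))\<close>, where
  \<open>u(x)\<close> is \<open>exp (- 1/x)\<close> for positive \<open>x\<close> and 0
  otherwise.\<close>

definition step :: "real \<Rightarrow> complex" where
  "step x = flat 0 x * inverse (flat 0 x + flat 0 (1 - x))"

lemma moderate_step: "moderate step"
  unfolding step_def[abs_def]
proof (intro moderate_mult moderate_inverse moderate_add moderate_flat)
  show 1: "moderate (\<lambda>t. flat 0 (1 - t))" using moderate_affine[OF moderate_flat, of 0 1 "-1"] by simp
  \<comment> \<open>One of \<open>t\<close> and \<open>1 - t\<close> is at least 1/2, where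
    \<open>exp (- 1/x)\<close> is at least \<open>exp (- 2)\<close>; this keeps the denominator away
    from 0.\<close>
  show "0 < exp (- (2::real))" by simp
  fix t :: real
  have pos: "flat 0 x = complex_of_real (Re (flat 0 x))" "0 \<le> Re (flat 0 x)" for x
    by (auto simp: flat_def)
  have big: "exp (- (2::real)) \<le> Re (flat 0 x)" if "x \<ge> 1 / 2" for x
    using that by (simp add: flat_def field_simps)
  have "exp (- 2) \<le> Re (flat 0 t) + Re (flat 0 (1 - t))"
    using big[of t] big[of "1 - t"] pos(2)[of t] pos(2)[of "1 - t"] by (cases "t \<ge> 1 / 2") auto
  also have "\<dots> \<le> cmod (flat 0 t + flat 0 (1 - t))"
    using complex_Re_le_cmod[of "flat 0 t + flat 0 (1 - t)"] by simp
  finally show "exp (- 2) \<le> cmod (flat 0 t + flat 0 (1 - t))" .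
qed

lemma step_0: "x \<le> 0 \<Longrightarrow> step x = 0"
  by (simp add: step_def flat_def)

lemma step_1: "1 \<le> x \<Longrightarrow> step x = 1"
  by (simp add: step_def flat_def)

definition cutoff :: "real \<Rightarrow> real \<Rightarrow> real \<Rightarrow> complex" where
  "cutoff a b x = step ((b - x) / (b - a)) * step ((b + x) / (b - a))"

lemma moderate_cutoff: "moderate (cutoff a b)"
proof -
  have "moderate (\<lambda>x. step (b / (b - a) + (- 1 / (b - a)) * x) * step (b / (b - a) + (1 / (b - a)) * x))"
    by (rule moderate_mult[OF moderate_affine[OF moderate_step] moderate_affine[OF moderate_step]])
  also have "(\<lambda>x. step (b / (b - a) + (- 1 / (b - a)) * x) * step (b / (b - a) + (1 / (b - a)) * x)) = cutoff a b"
    by (simp add: cutoff_def fun_eq_iff diff_divide_distrib add_divide_distrib)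
  finally show ?thesis .
qed

lemma cutoff_1: "a < b \<Longrightarrow> \<bar>x\<bar> \<le> a \<Longrightarrow> cutoff a b x = 1"
  by (simp add: cutoff_def step_1 le_divide_eq)

lemma cutoff_0: "a < b \<Longrightarrow> b \<le> \<bar>x\<bar> \<Longrightarrow> cutoff a b x = 0"
  by (cases "x \<ge> 0") (simp_all add: cutoff_def step_0 divide_le_0_iff)

lemma smooth_coord:
  assumes "moderate f" "j < m"
  shows "smooth m (\<lambda>x. f (x j))"
proof (rule smooth_coinduct)
  let ?X = "{\<lambda>x. f (x j) | f. moderate f}"
  show "(\<lambda>x. f (x j)) \<in> ?X" using assms by blast
  fix H assume "H \<in> ?X"
  then obtain f where H: "H = (\<lambda>x. f (x j))" and f: "moderate f" by blast
  show "depends_on m H \<and> continuous_on UNIV H"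
    using assms(2) continuous_on_compose2[OF moderate_continuous[OF f] continuous_on_product_coordinates[of j]]
    by (auto simp: H depends_on_def)
  fix i assume "i < m"
  obtain f' where f': "moderate f'" "\<And>t. (f has_vector_derivative f' t) (at t)"
    using f by (rule moderate_deriv) blast
  show "\<exists>K\<in>?X. \<forall>x. ((\<lambda>t. H (x(i := t))) has_vector_derivative K x) (at (x i))"
  proof (cases "i = j")
    case True
    then have "\<forall>x. ((\<lambda>t. H (x(i := t))) has_vector_derivative (\<lambda>x. f' (x j)) x) (at (x i))"
      using f'(2) by (simp add: H)
    then show ?thesis using f'(1) by (intro bexI[of _ "\<lambda>x. f' (x j)"]) auto
  next
    case False
    then have "\<forall>x. ((\<lambda>t. H (x(i := t))) has_vector_derivative 0) (at (x i))"
      by (simp add: H)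
    moreover have "(\<lambda>x. 0) \<in> ?X" using moderate_const[of 0] by (intro CollectI exI[of _ "\<lambda>_. 0"]) simp
    ultimately show ?thesis by (intro bexI[of _ "\<lambda>x. 0"])
  qed
qed

lemma partial_deriv_coord:
  assumes "\<And>t. (f has_vector_derivative f' t) (at t)"
  shows "partial_deriv i (\<lambda>x. f (x j)) = (\<lambda>x. if i = j then f' (x j) else 0)"
  by (intro ext partial_derivI) (simp add: assms)

section \<open>Schwartz functions\<close>

definition rapid :: "nat \<Rightarrow> ((nat \<Rightarrow> real) \<Rightarrow> complex) \<Rightarrow> bool" where
  "rapid m H \<longleftrightarrow> (\<forall>k. \<exists>C. \<forall>x. (1 + L2_set x {..<m}) ^ k * cmod (H x) \<le> C)"

lemma schwartz_iff:
  "schwartz m F \<longleftrightarrow> smooth m F \<and> (\<forall>is. set is \<subseteq> {..<m} \<longrightarrow> rapid m (pds is F))"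
  unfolding schwartz_def rapid_def by blast

lemma schwartz_smooth: "schwartz m F \<Longrightarrow> smooth m F"
  by (simp add: schwartz_iff)

lemma schwartz_rapid: "schwartz m F \<Longrightarrow> rapid m F"
  unfolding schwartz_iff using spec[of "\<lambda>is. set is \<subseteq> {..<m} \<longrightarrow> rapid m (pds is F)" "[]"] by simp

lemma rapid_add: assumes "rapid m F" "rapid m G" shows "rapid m (\<lambda>x. F x + G x)"
  unfolding rapid_def
proof
  fix k
  obtain C D where C: "\<And>x. (1 + L2_set x {..<m}) ^ k * cmod (F x) \<le> C"
    and D: "\<And>x. (1 + L2_set x {..<m}) ^ k * cmod (G x) \<le> D"
    using assms unfolding rapid_def by metis
  have "(1 + L2_set x {..<m}) ^ k * cmod (F x + G x) \<le> C + D" for x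
  proof -
    have "(1 + L2_set x {..<m}) ^ k * cmod (F x + G x) \<le> (1 + L2_set x {..<m}) ^ k * (cmod (F x) + cmod (G x))"
      by (intro mult_left_mono norm_triangle_ineq zero_le_power) (simp add: L2_set_nonneg)
    then show ?thesis using C[of x] D[of x] by (simp add: distrib_left)
  qed
  then show "\<exists>C. \<forall>x. (1 + L2_set x {..<m}) ^ k * cmod (F x + G x) \<le> C" by blast
qed

lemma abs_le_L2_set: "(i::nat) < m \<Longrightarrow> \<bar>x i\<bar> \<le> L2_set x {..<m}"
  using member_le_L2_set[of "{..<m}" i "\<lambda>i. \<bar>x i\<bar>"] unfolding L2_set_def power2_abs by simp

lemma rapid_mult_growth:
  assumes "growth f" "rapid m G" "j < m" shows "rapid m (\<lambda>x. f (x j) * G x)"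
  unfolding rapid_def
proof
  fix k
  obtain C p where C: "0 \<le> C" "\<And>t. cmod (f t) \<le> C * (1 + \<bar>t\<bar>) ^ p" using assms(1) by (rule growthE) blast
  obtain D where D: "\<And>x. (1 + L2_set x {..<m}) ^ (k + p) * cmod (G x) \<le> D"
    using assms unfolding rapid_def by metis
  have "(1 + L2_set x {..<m}) ^ k * cmod (f (x j) * G x) \<le> C * D" for x
  proof -
    let ?w = "1 + L2_set x {..<m}"
    have w: "0 \<le> ?w" by (simp add: L2_set_nonneg)
    have "(1 + \<bar>x j\<bar>) ^ p \<le> ?w ^ p"
      using abs_le_L2_set[OF assms(3), of x] by (intro power_mono) auto
    then have "cmod (f (x j)) \<le> C * ?w ^ p"
      using C(2)[of "x j"] mult_left_mono[OF _ C(1)] order_trans by blast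
    then have "?w ^ k * (cmod (f (x j)) * cmod (G x)) \<le> ?w ^ k * ((C * ?w ^ p) * cmod (G x))"
      using w by (intro mult_left_mono mult_right_mono) auto
    also have "\<dots> = C * (?w ^ (k + p) * cmod (G x))" by (simp add: power_add mult_ac)
    also have "\<dots> \<le> C * D" using D[of x] C(1) by (rule mult_left_mono)
    finally show ?thesis by (simp add: norm_mult)
  qed
  then show "\<exists>C. \<forall>x. (1 + L2_set x {..<m}) ^ k * cmod (f (x j) * G x) \<le> C" by blast
qed

lemma schwartz_partial_deriv:
  assumes "schwartz m F" "i < m" shows "schwartz m (partial_deriv i F)"
  unfolding schwartz_iff
proof (intro conjI allI impI)
  show "smooth m (partial_deriv i F)" using assms by (auto simp: schwartz_iff smooth_partial_deriv)
  fix "is" assume "set is \<subseteq> {..<m}"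
  then have "set (is @ [i]) \<subseteq> {..<m}" using assms(2) by simp
  then have "rapid m (pds (is @ [i]) F)" using assms(1) unfolding schwartz_iff by blast
  then show "rapid m (pds is (partial_deriv i F))" by simp
qed

lemma schwartz_add: "schwartz m F \<Longrightarrow> schwartz m G \<Longrightarrow> schwartz m (\<lambda>x. F x + G x)"
  unfolding schwartz_iff by (auto simp: pds_add[of m] smooth_add intro: rapid_add)

lemma rapid_cmult: assumes "rapid m F" shows "rapid m (\<lambda>x. c * F x)"
  unfolding rapid_def
proof
  fix k
  obtain C where C: "\<And>x. (1 + L2_set x {..<m}) ^ k * cmod (F x) \<le> C"
    using assms unfolding rapid_def by metis
  have "(1 + L2_set x {..<m}) ^ k * cmod (c * F x) \<le> cmod c * C" for x
    using mult_left_mono[OF C[of x], of "cmod c"] by (simp add: norm_mult mult_ac)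
  then show "\<exists>C. \<forall>x. (1 + L2_set x {..<m}) ^ k * cmod (c * F x) \<le> C" by blast
qed

lemma schwartz_cmult: "schwartz m F \<Longrightarrow> schwartz m (\<lambda>x. c * F x)"
  unfolding schwartz_iff by (auto simp: pds_cmult[of m] smooth_cmult intro: rapid_cmult)

lemma schwartz_diff: "schwartz m F \<Longrightarrow> schwartz m G \<Longrightarrow> schwartz m (\<lambda>x. F x - G x)"
  using schwartz_add[of m F "\<lambda>x. (-1) * G x"] schwartz_cmult[of m G "-1"] by simp

text \<open>The product rule for the innermost derivative leaves two terms of the same shape, with a
  moderate \<open>f'\<close> or a Schwartz derivative of \<open>G\<close>. The induction therefore
  removes the last index and generalises over both factors.\<close>

lemma schwartz_mult_coord:
  assumes f: "moderate f" and G: "schwartz m G" and j: "j < m"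
  shows "schwartz m (\<lambda>x. f (x j) * G x)"
proof -
  have "rapid m (pds is (\<lambda>x. f (x j) * G x))" if "set is \<subseteq> {..<m}" for "is"
    using that f G
  proof (induction "is" arbitrary: f G rule: rev_induct)
    case Nil
    then show ?case using rapid_mult_growth[OF moderate_growth schwartz_rapid j] by simp
  next
    case (snoc i "is")
    then have i: "i < m" and "is": "set is \<subseteq> {..<m}" by auto
    obtain f' where f': "moderate f'" "\<And>t. (f has_vector_derivative f' t) (at t)"
      using snoc.prems(2) by (rule moderate_deriv) blast
    have sm: "smooth m (\<lambda>x. g (x j) * H x)" if "moderate g" "schwartz m H" for g H
      using that by (intro smooth_mult smooth_coord j schwartz_smooth)
    have pd: "partial_deriv i (\<lambda>x. f (x j) * G x) =
        (\<lambda>x. f (x j) * partial_deriv i G x + (if i = j then f' (x j) else 0) * G x)"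
      using partial_deriv_mult[OF smooth_coord[OF snoc.prems(2) j] schwartz_smooth[OF snoc.prems(3)] i]
        partial_deriv_coord[OF f'(2), of i j] by simp
    have 1: "rapid m (pds is (\<lambda>x. f (x j) * partial_deriv i G x))"
      by (rule snoc.IH[OF "is" snoc.prems(2) schwartz_partial_deriv[OF snoc.prems(3) i]])
    show ?case
    proof (cases "i = j")
      case True
      have "pds (is @ [i]) (\<lambda>x. f (x j) * G x) = pds is (\<lambda>x. f (x j) * partial_deriv i G x + f' (x j) * G x)"
        using pd True by simp
      also have "\<dots> = (\<lambda>x. pds is (\<lambda>x. f (x j) * partial_deriv i G x) x + pds is (\<lambda>x. f' (x j) * G x) x)"
        by (intro pds_add[of m] sm "is" snoc.prems f' schwartz_partial_deriv i)
      finally show ?thesis using rapid_add[OF 1 snoc.IH[OF "is" f'(1) snoc.prems(3)]] by simp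
    next
      case False
      then show ?thesis using pd 1 by simp
    qed
  qed
  then show ?thesis
    unfolding schwartz_iff using smooth_mult[OF smooth_coord[OF f j] schwartz_smooth[OF G]] by blast
qed

text \<open>Tychonoff, with one compact interval for each of infinitely many coordinates.\<close>

lemma compact_box: "compact {x :: nat \<Rightarrow> real. \<forall>i. x i \<in> {l i..u i}}"
proof -
  have "compactin (product_topology (\<lambda>_. euclidean) UNIV) (Pi\<^sub>E UNIV (\<lambda>i::nat. {l i..u i}))"
    by (subst compactin_PiE) auto
  then have "compact (Pi\<^sub>E UNIV (\<lambda>i::nat. {l i..u i}))"
    by (simp add: euclidean_product_topology)
  also have "Pi\<^sub>E UNIV (\<lambda>i::nat. {l i..u i}) = {x. \<forall>i. x i \<in> {l i..u i}}" by (auto simp: PiE_def)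
  finally show ?thesis .
qed

lemma bounded_on_cube:
  assumes "continuous_on UNIV F" "depends_on m F"
  obtains B where "0 \<le> B" "\<And>x. (\<And>i. i < m \<Longrightarrow> \<bar>x i\<bar> \<le> R) \<Longrightarrow> cmod (F x) \<le> B"
proof -
  let ?K = "{x :: nat \<Rightarrow> real. \<forall>i. x i \<in> {- \<bar>R\<bar>..\<bar>R\<bar>}}"
  have "compact (F ` ?K)"
    by (intro compact_continuous_image compact_box continuous_on_subset[OF assms(1)]) auto
  then obtain B where B: "\<And>z. z \<in> F ` ?K \<Longrightarrow> cmod z \<le> B"
    using compact_imp_bounded bounded_iff by metis
  show ?thesis
  proof (rule that[of "\<bar>B\<bar>"])
    fix x :: "nat \<Rightarrow> real" assume x: "\<And>i. i < m \<Longrightarrow> \<bar>x i\<bar> \<le> R"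
    have "trunc m x i \<in> {- \<bar>R\<bar>..\<bar>R\<bar>}" for i
      using x[of i] by (auto simp: trunc_def)
    then have "F (trunc m x) \<in> F ` ?K" by blast
    then show "cmod (F x) \<le> \<bar>B\<bar>" using B[of "F (trunc m x)"] depends_on_trunc[OF assms(2)] by simp
  qed simp
qed

lemma L2_set_le_cube: "(\<And>i. i < m \<Longrightarrow> \<bar>x i\<bar> \<le> R) \<Longrightarrow> L2_set x {..<m} \<le> real m * R"
  using L2_set_le_sum_abs[of x "{..<m}"] sum_bounded_above[of "{..<m}" "\<lambda>i. \<bar>x i\<bar>" R] by simp

lemma schwartz_compact_support:
  assumes F: "smooth m F" and v: "\<And>x i. i < m \<Longrightarrow> R < \<bar>x i\<bar> \<Longrightarrow> F x = 0"
  shows "schwartz m F"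
  unfolding schwartz_iff
proof (intro conjI allI impI F)
  fix "is" assume "is": "set is \<subseteq> {..<m}"
  have sm: "smooth m (pds is F)" using F "is" by (rule smooth_pds)
  obtain B where B: "0 \<le> B" "\<And>x. (\<And>i. i < m \<Longrightarrow> \<bar>x i\<bar> \<le> R) \<Longrightarrow> cmod (pds is F x) \<le> B"
    using bounded_on_cube[OF smooth_continuous[OF sm] smooth_depends_on[OF sm]] by metis
  show "rapid m (pds is F)"
    unfolding rapid_def
  proof
    fix k
    have "(1 + L2_set x {..<m}) ^ k * cmod (pds is F x) \<le> (1 + \<bar>real m * R\<bar>) ^ k * B" for x
    proof (cases "\<forall>i<m. \<bar>x i\<bar> \<le> R")
      case True
      then have "L2_set x {..<m} \<le> real m * R" by (intro L2_set_le_cube) auto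
      then have "L2_set x {..<m} \<le> \<bar>real m * R\<bar>" by linarith
      then show ?thesis using True B
        by (intro mult_mono power_mono) (auto simp: L2_set_nonneg)
    next
      case False
      then obtain i where i: "i < m" "R < \<bar>x i\<bar>" by auto
      have "open {t::real. R < \<bar>t\<bar>}" by (intro open_Collect_less continuous_intros)
      then have "pds is F x = 0"
        by (rule pds_vanish[where j=i]) (use v i in auto)
      then show ?thesis using B(1) by simp
    qed
    then show "\<exists>C. \<forall>x. (1 + L2_set x {..<m}) ^ k * cmod (pds is F x) \<le> C" by blast
  qed
qed

lemma integrable_cauchy: "integrable lborel (\<lambda>x::real. 1 / (1 + x\<^sup>2))"
  using integrable_inverse_1_plus_square
  by (simp add: set_integrable_def einterval_def inverse_eq_divide)

lemma integrable_cauchy_n: "integrable (lborel_n m) (\<lambda>x. \<Prod>i<m. 1 / (1 + (x i)\<^sup>2))"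
  by (rule lborel_product.product_integrable_prod) (auto intro: integrable_cauchy)

lemma integral_cauchy_n:
  "(LINT x|lborel_n m. (\<Prod>i<m. 1 / (1 + (x i)\<^sup>2))) = (LINT x|lborel. 1 / (1 + x\<^sup>2)) ^ m"
  by (subst lborel_product.product_integral_prod) (auto intro: integrable_cauchy)

text \<open>Each factor \<open>1 + (x i)^2\<close> is at most the square of
  \<open>1 + L2_set x {..<m}\<close>, so decay of order \<open>2 * m\<close> dominates the whole
  product. The bound is integrable one coordinate at a time.\<close>

lemma rapid_cauchy_bound:
  assumes "rapid m F"
  obtains C where "0 \<le> C" "\<And>x. cmod (F x) \<le> C * (\<Prod>i<m. 1 / (1 + (x i)\<^sup>2))"
proof -
  obtain C where C: "\<And>x. (1 + L2_set x {..<m}) ^ (2 * m) * cmod (F x) \<le> C"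
    using assms unfolding rapid_def by metis
  have le: "cmod (F x) \<le> C * (\<Prod>i<m. 1 / (1 + (x i)\<^sup>2))" for x
  proof -
    have "(\<Prod>i<m. 1 + (x i)\<^sup>2) \<le> (\<Prod>i<m. (1 + L2_set x {..<m})\<^sup>2)"
    proof (rule prod_mono, safe)
      fix i assume "i < m"
      then have "\<bar>x i\<bar> \<le> L2_set x {..<m}" by (rule abs_le_L2_set)
      then have "(x i)\<^sup>2 \<le> (L2_set x {..<m})\<^sup>2" by (metis L2_set_nonneg abs_le_square_iff abs_of_nonneg)
      then show "1 + (x i)\<^sup>2 \<le> (1 + L2_set x {..<m})\<^sup>2" 
      proof -
        obtain l where l: "L2_set x {..<m} = l" "0 \<le> l" using L2_set_nonneg by blast
        then show ?thesis using \<open>(x i)\<^sup>2 \<le> (L2_set x {..<m})\<^sup>2\<close> by (simp add: power2_sum)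
      qed
    qed simp
    then have "(\<Prod>i<m. 1 + (x i)\<^sup>2) * cmod (F x) \<le> (1 + L2_set x {..<m}) ^ (2 * m) * cmod (F x)"
      by (intro mult_right_mono) (simp_all add: power_mult)
    also have "\<dots> \<le> C" by (rule C)
    finally have "(\<Prod>i<m. 1 + (x i)\<^sup>2) * cmod (F x) \<le> C" .
    moreover have "0 < (\<Prod>i<m. 1 + (x i)\<^sup>2)" by (intro prod_pos) (auto simp: add_pos_nonneg)
    ultimately show ?thesis by (simp add: prod_dividef pos_le_divide_eq mult.commute)
  qed
  have "0 \<le> (1 + L2_set (\<lambda>_. 0) {..<m}) ^ (2 * m) * cmod (F (\<lambda>_. 0))"
    by (intro mult_nonneg_nonneg zero_le_power) (auto simp: L2_set_nonneg)
  then have "0 \<le> C" using C[of "\<lambda>_. 0"] by linarith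
  then show ?thesis using that le by blast
qed

lemma schwartz_measurable [measurable_dest]: "schwartz m F \<Longrightarrow> F \<in> borel_measurable (lborel_n m)"
  by (intro measurable_lborel_n smooth_continuous smooth_depends_on schwartz_smooth)

lemma schwartz_integrable:
  assumes "schwartz m F" shows "integrable (lborel_n m) F"
proof -
  obtain C where C: "0 \<le> C" "\<And>x. cmod (F x) \<le> C * (\<Prod>i<m. 1 / (1 + (x i)\<^sup>2))"
    using rapid_cauchy_bound[OF schwartz_rapid[OF assms]] by metis
  have nn: "0 \<le> (\<Prod>i<m. 1 / (1 + (x i)\<^sup>2))" for x :: "nat \<Rightarrow> real" by (intro prod_nonneg) auto
  show ?thesis
    by (rule Bochner_Integration.integrable_bound[OF integrable_mult_right[OF integrable_cauchy_n[of m], of C] schwartz_measurable[OF assms]])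
       (use C nn in \<open>auto intro!: AE_I2\<close>)
qed

lemma integral_derivative_zero:
  fixes f f' :: "real \<Rightarrow> complex"
  assumes d: "\<And>t. (f has_vector_derivative f' t) (at t)" and c: "continuous_on UNIV f'"
    and i: "integrable lborel f'" and l: "(f \<longlongrightarrow> 0) at_top" "(f \<longlongrightarrow> 0) at_bot"
  shows "(LINT t|lborel. f' t) = 0"
proof -
  have "(LBINT x=-\<infinity>..\<infinity>. f' x) = 0 - 0"
  proof (rule interval_integral_FTC_integrable)
    show "set_integrable lborel (einterval (- \<infinity>) \<infinity>) f'"
      using i by (simp add: set_integrable_def einterval_def)
    show "((f \<circ> real_of_ereal) \<longlongrightarrow> 0) (at_right (- \<infinity>))" "((f \<circ> real_of_ereal) \<longlongrightarrow> 0) (at_left \<infinity>)"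
      using l by (simp_all add: ereal_tendsto_simps1)
  qed (use d c in \<open>auto simp: continuous_on_eq_continuous_at\<close>)
  then show ?thesis
    by (simp add: interval_lebesgue_integral_def einterval_def set_lebesgue_integral_def)
qed

text \<open>Fubini isolates coordinate \<open>i\<close>; there the fundamental theorem on the whole
  line leaves the limits of \<open>K\<close> at both ends, which are 0 by decay. This is what
  integration by parts for the Fourier transform needs.\<close>

lemma integral_partial_deriv:
  assumes K: "schwartz m K" and i: "i < m"
  shows "(LINT x|lborel_n m. partial_deriv i K x) = 0"
proof -
  let ?I = "{..<m} - {i}"
  have ins: "insert i ?I = {..<m}" using i by auto
  have "(LINT x|lborel_n m. partial_deriv i K x) =
      (LINT x|Pi\<^sub>M ?I (\<lambda>_. lborel). (LINT y|lborel. partial_deriv i K (x(i := y))))"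
    using lborel_product.product_integral_insert[of ?I i "partial_deriv i K"]
      schwartz_integrable[OF schwartz_partial_deriv[OF K i]] unfolding ins by simp
  moreover have "(LINT y|lborel. partial_deriv i K (x(i := y))) = 0" for x :: "nat \<Rightarrow> real"
  proof (rule integral_derivative_zero)
    show "((\<lambda>t. K (x(i := t))) has_vector_derivative partial_deriv i K (x(i := t))) (at t)" for t
      by (rule smooth_has_vector_derivative[OF schwartz_smooth[OF K] i])
    have cu: "continuous_on UNIV (\<lambda>t. x(i := t))"
    proof (rule continuous_on_coordinatewise_then_product)
      show "continuous_on UNIV (\<lambda>t. (x(i := t)) l)" for l by (cases "l = i") auto
    qed
    show c: "continuous_on UNIV (\<lambda>t. partial_deriv i K (x(i := t)))"
      by (rule continuous_on_compose2[OF smooth_continuous[OF smooth_partial_deriv[OF schwartz_smooth[OF K] i]] cu]) auto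
    have wt: "1 + \<bar>t\<bar> \<le> 1 + L2_set (x(i := t)) {..<m}" for t
      using abs_le_L2_set[OF i, of "x(i := t)"] by simp
    obtain C where C: "\<And>x. (1 + L2_set x {..<m}) ^ 2 * cmod (partial_deriv i K x) \<le> C"
      using schwartz_rapid[OF schwartz_partial_deriv[OF K i]] unfolding rapid_def by metis
    have b: "cmod (partial_deriv i K (x(i := t))) \<le> C * (1 / (1 + t\<^sup>2))" for t
    proof -
      have "1 + t\<^sup>2 \<le> (1 + \<bar>t\<bar>)\<^sup>2" by (simp add: power2_sum)
      also have "\<dots> \<le> (1 + L2_set (x(i := t)) {..<m})\<^sup>2" using wt by (intro power_mono) auto
      finally have "(1 + t\<^sup>2) * cmod (partial_deriv i K (x(i := t))) \<le> C"
        using C[of "x(i := t)"] mult_right_mono[OF _ norm_ge_zero] order_trans by blast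
      then show ?thesis by (simp add: pos_le_divide_eq add_pos_nonneg mult.commute)
    qed
    show "integrable lborel (\<lambda>t. partial_deriv i K (x(i := t)))"
    proof (rule Bochner_Integration.integrable_bound[OF integrable_mult_right[OF integrable_cauchy, of C]])
      show "(\<lambda>t. partial_deriv i K (x(i := t))) \<in> borel_measurable lborel"
        using borel_measurable_continuous_onI[OF c] by simp
      show "AE t in lborel. norm (partial_deriv i K (x(i := t))) \<le> norm (C * (1 / (1 + t\<^sup>2)))"
        using b by (intro AE_I2) (metis abs_ge_self order_trans real_norm_def)
    qed
    obtain D where D: "\<And>x. (1 + L2_set x {..<m}) ^ 1 * cmod (K x) \<le> D"
      using schwartz_rapid[OF K] unfolding rapid_def by metis
    have k: "cmod (K (x(i := t))) \<le> D * inverse (1 + \<bar>t\<bar>)" for t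
    proof -
      have "(1 + \<bar>t\<bar>) * cmod (K (x(i := t))) \<le> (1 + L2_set (x(i := t)) {..<m}) * cmod (K (x(i := t)))"
        using wt by (intro mult_right_mono) auto
      also have "\<dots> \<le> D" using D[of "x(i := t)"] by simp
      finally show ?thesis by (simp add: divide_inverse[symmetric] pos_le_divide_eq mult.commute)
    qed
    have top: "filterlim (\<lambda>t::real. 1 + \<bar>t\<bar>) at_top at_top"
      by (rule filterlim_at_top_mono[OF filterlim_ident always_eventually]) auto
    have bot: "filterlim (\<lambda>t::real. 1 + \<bar>t\<bar>) at_top at_bot"
      by (rule filterlim_at_top_mono[OF filterlim_uminus_at_top_at_bot always_eventually]) auto
    have "((\<lambda>t. K (x(i := t))) \<longlongrightarrow> 0) F" if "filterlim (\<lambda>t::real. 1 + \<bar>t\<bar>) at_top F" for F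
    proof (rule Lim_null_comparison[OF always_eventually[OF allI[OF k]]])
      show "((\<lambda>t. D * inverse (1 + \<bar>t\<bar>)) \<longlongrightarrow> 0) F"
        by (rule tendsto_mult_right_zero[OF tendsto_inverse_0_at_top[OF that]])
    qed
    then show "((\<lambda>t. K (x(i := t))) \<longlongrightarrow> 0) at_top" "((\<lambda>t. K (x(i := t))) \<longlongrightarrow> 0) at_bot"
      using top bot by blast+
  qed
  ultimately show ?thesis by simp
qed

section \<open>The Fourier transform\<close>

definition ech :: "nat \<Rightarrow> (nat \<Rightarrow> real) \<Rightarrow> (nat \<Rightarrow> real) \<Rightarrow> complex" where
  "ech m \<xi> x = exp (- \<i> * complex_of_real (\<Sum>j<m. \<xi> j * x j))"

lemma fourier_altdef:
  "fourier m F \<xi> = complex_of_real (1 / (2 * pi) ^ m) * (LINT x|lborel_n m. F x * ech m \<xi> x)"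
  by (simp add: fourier_def ech_def)

lemma norm_ech [simp]: "cmod (ech m \<xi> x) = 1"
  by (simp add: ech_def norm_exp_eq_Re)

lemma ech_prod: "ech m \<xi> x = (\<Prod>j<m. cis (- \<xi> j * x j))"
  by (simp add: ech_def cis_conv_exp exp_sum[symmetric] sum_distrib_left sum_negf)

lemma schwartz_mult_ech:
  assumes "schwartz m F"
  shows "schwartz m (\<lambda>x. F x * ech m \<xi> x)"
proof -
  have "schwartz m (\<lambda>x. (\<Prod>j\<in>J. cis (- \<xi> j * x j)) * F x)" if "finite J" "J \<subseteq> {..<m}" for J
    using that
  proof (induction J rule: finite_induct)
    case empty
    then show ?case using assms by simp
  next
    case (insert j J)
    then have "schwartz m (\<lambda>x. cis (- \<xi> j * x j) * ((\<Prod>j\<in>J. cis (- \<xi> j * x j)) * F x))"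
      by (intro schwartz_mult_coord[OF moderate_cis]) auto
    then show ?case using insert by (simp add: mult.assoc)
  qed
  from this[of "{..<m}"] show ?thesis by (simp add: ech_prod mult.commute)
qed

lemma ech_has_vector_derivative:
  assumes i: "i < m"
  shows "((\<lambda>t. ech m \<xi> (x(i := t))) has_vector_derivative - (\<i> * \<xi> i) * ech m \<xi> x) (at (x i))"
proof -
  define c where "c = (\<Sum>j\<in>{..<m} - {i}. \<xi> j * x j)"
  have e: "ech m \<xi> (x(i := t)) = exp (- (\<i> * \<xi> i) * complex_of_real t + - \<i> * complex_of_real c)" for t
  proof -
    have "(\<Sum>j<m. \<xi> j * (x(i := t)) j) = \<xi> i * t + c"
      unfolding c_def by (subst sum.remove[of _ i]) (use i in \<open>auto intro!: sum.cong\<close>)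
    then show ?thesis unfolding ech_def by (simp add: algebra_simps)
  qed
  have "((\<lambda>t. - (\<i> * \<xi> i) * complex_of_real t + - \<i> * complex_of_real c) has_vector_derivative - (\<i> * \<xi> i) * 1 + 0) (at (x i))"
    by (intro has_vector_derivative_add has_vector_derivative_mult_right complex_of_real_has_vector_derivative has_vector_derivative_const)
  from field_vector_diff_chain_at[OF this DERIV_exp]
  have "((\<lambda>t. ech m \<xi> (x(i := t))) has_vector_derivative - (\<i> * \<xi> i) * ech m \<xi> (x(i := x i))) (at (x i))"
    by (simp add: comp_def e del: fun_upd_triv)
  then show ?thesis by simp
qed

lemma integrable_mult_ech: "schwartz m F \<Longrightarrow> integrable (lborel_n m) (\<lambda>x. F x * ech m \<xi> x)"
  by (intro schwartz_integrable schwartz_mult_ech)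

text \<open>The \<open>i\<close>-th derivative of \<open>F\<close> times the character has integral
  0, and the product rule moves the derivative from \<open>F\<close> to the character.\<close>

lemma fourier_partial_deriv:
  assumes F: "schwartz m F" and i: "i < m"
  shows "fourier m (partial_deriv i F) \<xi> = \<i> * \<xi> i * fourier m F \<xi>"
proof -
  have "partial_deriv i (\<lambda>x. F x * ech m \<xi> x) =
      (\<lambda>x. (- (\<i> * \<xi> i)) * (F x * ech m \<xi> x) + partial_deriv i F x * ech m \<xi> x)"
  proof (rule ext, rule partial_derivI)
    fix x
    show "((\<lambda>t. F (x(i := t)) * ech m \<xi> (x(i := t))) has_vector_derivative
        (- (\<i> * \<xi> i)) * (F x * ech m \<xi> x) + partial_deriv i F x * ech m \<xi> x) (at (x i))"
      using has_vector_derivative_mult[OF smooth_has_vector_derivative_at[OF schwartz_smooth[OF F] i, of x]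
          ech_has_vector_derivative[OF i, of \<xi> x]] by (simp add: mult_ac)
  qed
  then have "0 = (LINT x|lborel_n m. (- (\<i> * \<xi> i)) * (F x * ech m \<xi> x) + partial_deriv i F x * ech m \<xi> x)"
    using integral_partial_deriv[OF schwartz_mult_ech[OF F, of \<xi>] i] by simp
  also have "\<dots> = (- (\<i> * \<xi> i)) * (LINT x|lborel_n m. F x * ech m \<xi> x) + (LINT x|lborel_n m. partial_deriv i F x * ech m \<xi> x)"
    by (simp add: integrable_mult_ech F schwartz_partial_deriv[OF F i])
  finally show ?thesis by (simp add: fourier_altdef)
qed

lemma fourier_add:
  "schwartz m F \<Longrightarrow> schwartz m G \<Longrightarrow> fourier m (\<lambda>x. F x + G x) \<xi> = fourier m F \<xi> + fourier m G \<xi>"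
  by (simp add: fourier_altdef integrable_mult_ech distrib_right distrib_left)

lemma fourier_cmult: "fourier m (\<lambda>x. c * F x) \<xi> = c * fourier m F \<xi>"
  by (simp add: fourier_altdef mult.assoc mult.left_commute)

lemma fourier_diff:
  "schwartz m F \<Longrightarrow> schwartz m G \<Longrightarrow> fourier m (\<lambda>x. F x - G x) \<xi> = fourier m F \<xi> - fourier m G \<xi>"
  by (simp add: fourier_altdef integrable_mult_ech left_diff_distrib right_diff_distrib)

lemma norm_fourier_le:
  assumes "schwartz m F"
  shows "cmod (fourier m F \<xi>) \<le> (1 / (2 * pi) ^ m) * (LINT x|lborel_n m. cmod (F x))"
proof -
  have "cmod (LINT x|lborel_n m. F x * ech m \<xi> x) \<le> (LINT x|lborel_n m. cmod (F x * ech m \<xi> x))"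
    by (rule integral_norm_bound)
  also have "\<dots> = (LINT x|lborel_n m. cmod (F x))" by (simp add: norm_mult)
  finally have "(1 / (2 * pi) ^ m) * cmod (LINT x|lborel_n m. F x * ech m \<xi> x) \<le> (1 / (2 * pi) ^ m) * (LINT x|lborel_n m. cmod (F x))"
    by (rule mult_left_mono) simp
  then show ?thesis by (simp add: fourier_altdef norm_mult norm_divide norm_power)
qed

lemma sigma_finite_lborel_n: "sigma_finite_measure (lborel_n m)"
  by (rule lborel_product.sigma_finite) simp

lemma measurable_pair_coord:
  assumes "j < m"
  shows "(\<lambda>p. fst p j) \<in> borel_measurable (lborel_n m \<Otimes>\<^sub>M N)"
    "(\<lambda>p. snd p j) \<in> borel_measurable (N \<Otimes>\<^sub>M lborel_n m)"
proof -
  have c: "(\<lambda>x. x j) \<in> borel_measurable (lborel_n m)"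
    using measurable_component_singleton[of j "{..<m}" "\<lambda>_. lborel :: real measure"] assms by simp
  show "(\<lambda>p. fst p j) \<in> borel_measurable (lborel_n m \<Otimes>\<^sub>M N)"
    by (rule measurable_compose[OF measurable_fst c])
  show "(\<lambda>p. snd p j) \<in> borel_measurable (N \<Otimes>\<^sub>M lborel_n m)"
    by (rule measurable_compose[OF measurable_snd c])
qed

lemma measurable_ech: "(\<lambda>p. ech m (fst p) (snd p)) \<in> borel_measurable (lborel_n m \<Otimes>\<^sub>M lborel_n m)"
proof -
  have "(\<lambda>p. \<Sum>j<m. fst p j * snd p j) \<in> borel_measurable (lborel_n m \<Otimes>\<^sub>M lborel_n m)"
    by (intro borel_measurable_sum borel_measurable_times measurable_pair_coord) auto
  then show ?thesis unfolding ech_def by measurable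
qed

lemma measurable_fourier:
  assumes "schwartz m F"
  shows "fourier m F \<in> borel_measurable (lborel_n m)"
proof -
  interpret sigma_finite_measure "lborel_n m" by (rule sigma_finite_lborel_n)
  have [measurable]: "F \<in> borel_measurable (lborel_n m)" by (rule schwartz_measurable[OF assms])
  note measurable_ech[measurable]
  have "(\<lambda>p. F (snd p) * ech m (fst p) (snd p)) \<in> borel_measurable (lborel_n m \<Otimes>\<^sub>M lborel_n m)"
    by measurable
  then have "case_prod (\<lambda>\<xi> x. F x * ech m \<xi> x) \<in> borel_measurable (lborel_n m \<Otimes>\<^sub>M lborel_n m)"
    by (simp add: case_prod_unfold)
  then have "(\<lambda>\<xi>. LINT x|lborel_n m. F x * ech m \<xi> x) \<in> borel_measurable (lborel_n m)"
    by (rule borel_measurable_lebesgue_integral)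
  then show ?thesis unfolding fourier_altdef[abs_def] by measurable
qed

text \<open>The operator \<open>1 - \<partial>_i^2\<close>. On the Fourier side it multiplies by
  \<open>1 + (\<xi> i)^2\<close>, so one application in each variable yields an integrable bound for
  the transform.\<close>

definition Lop :: "nat \<Rightarrow> ((nat \<Rightarrow> real) \<Rightarrow> complex) \<Rightarrow> (nat \<Rightarrow> real) \<Rightarrow> complex" where
  "Lop i F = (\<lambda>x. F x - partial_deriv i (partial_deriv i F) x)"

lemma schwartz_Lop: "schwartz m F \<Longrightarrow> i < m \<Longrightarrow> schwartz m (Lop i F)"
  unfolding Lop_def by (intro schwartz_diff schwartz_partial_deriv)

lemma schwartz_Lops: "schwartz m F \<Longrightarrow> set is \<subseteq> {..<m} \<Longrightarrow> schwartz m (foldr Lop is F)"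
  by (induction "is") (auto intro: schwartz_Lop)

lemma fourier_Lop:
  assumes "schwartz m F" "i < m"
  shows "fourier m (Lop i F) \<xi> = (1 + (\<xi> i)\<^sup>2) * fourier m F \<xi>"
  using assms unfolding Lop_def
  by (simp add: fourier_diff fourier_partial_deriv schwartz_partial_deriv power2_eq_square algebra_simps)

lemma fourier_Lops:
  assumes "schwartz m F" "set is \<subseteq> {..<m}" "distinct is"
  shows "fourier m (foldr Lop is F) \<xi> = (\<Prod>i\<in>set is. 1 + (\<xi> i)\<^sup>2) * fourier m F \<xi>"
  using assms by (induction "is") (auto simp: fourier_Lop schwartz_Lops)

lemma fourier_bound:
  assumes F: "schwartz m F" and "is": "set is = {..<m}" "distinct is"
  shows "cmod (fourier m F \<xi>) \<le>
    (1 / (2 * pi) ^ m) * (LINT x|lborel_n m. cmod (foldr Lop is F x)) * (\<Prod>i<m. 1 / (1 + (\<xi> i)\<^sup>2))"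
proof -
  let ?p = "\<Prod>i<m. 1 + (\<xi> i)\<^sup>2"
  have p: "0 < ?p" by (intro prod_pos) (auto simp: add_pos_nonneg)
  have "?p * cmod (fourier m F \<xi>) = cmod (fourier m (foldr Lop is F) \<xi>)"
  proof -
    have "fourier m (foldr Lop is F) \<xi> = of_real ?p * fourier m F \<xi>"
      using fourier_Lops[OF F _ "is"(2), of \<xi>] "is"(1) by simp
    then show ?thesis using p by (simp add: norm_mult norm_of_real del: of_real_prod)
  qed
  also have "\<dots> \<le> (1 / (2 * pi) ^ m) * (LINT x|lborel_n m. cmod (foldr Lop is F x))" (is "_ \<le> ?C")
    by (rule norm_fourier_le[OF schwartz_Lops[OF F]]) (use "is" in simp)
  finally have "cmod (fourier m F \<xi>) \<le> ?C / ?p"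
    by (subst pos_le_divide_eq[OF p]) (simp only: mult.commute)
  then show ?thesis by (simp add: prod_dividef)
qed

lemma integrable_fourier:
  assumes F: "schwartz m F"
  shows "integrable (lborel_n m) (fourier m F)"
proof (rule Bochner_Integration.integrable_bound)
  let ?C = "(1 / (2 * pi) ^ m) * (LINT x|lborel_n m. cmod (foldr Lop [0..<m] F x))"
  show "integrable (lborel_n m) (\<lambda>\<xi>. ?C * (\<Prod>i<m. 1 / (1 + (\<xi> i)\<^sup>2)))"
    by (rule integrable_mult_right[OF integrable_cauchy_n])
  show "fourier m F \<in> borel_measurable (lborel_n m)" by (rule measurable_fourier[OF F])
  show "AE \<xi> in lborel_n m. norm (fourier m F \<xi>) \<le> norm (?C * (\<Prod>i<m. 1 / (1 + (\<xi> i)\<^sup>2)))"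
  proof (intro AE_I2)
    fix \<xi>
    have "cmod (fourier m F \<xi>) \<le> ?C * (\<Prod>i<m. 1 / (1 + (\<xi> i)\<^sup>2))"
      by (rule fourier_bound[OF F]) auto
    also have "\<dots> \<le> norm (?C * (\<Prod>i<m. 1 / (1 + (\<xi> i)\<^sup>2)))" unfolding real_norm_def by (rule abs_ge_self)
    finally show "norm (fourier m F \<xi>) \<le> norm (?C * (\<Prod>i<m. 1 / (1 + (\<xi> i)\<^sup>2)))" .
  qed
qed

definition fl1_const :: "nat \<Rightarrow> real" where
  "fl1_const m = (1 / (2 * pi) ^ m) * (LINT x|lborel. 1 / (1 + x\<^sup>2)) ^ m"

lemma fl1_const_nonneg: "0 \<le> fl1_const m"
  unfolding fl1_const_def by (intro mult_nonneg_nonneg zero_le_power Bochner_Integration.integral_nonneg) auto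

text \<open>The pointwise bound \<open>fourier_bound\<close> is integrated. The list may enumerate
  the variables in any order, which allows a chosen variable to be treated last.\<close>

lemma fourier_L1_le:
  assumes F: "schwartz m F" and "is": "set is = {..<m}" "distinct is"
  shows "(LINT \<xi>|lborel_n m. cmod (fourier m F \<xi>)) \<le>
    fl1_const m * (LINT x|lborel_n m. cmod (foldr Lop is F x))"
proof -
  let ?C = "(1 / (2 * pi) ^ m) * (LINT x|lborel_n m. cmod (foldr Lop is F x))"
  have "(LINT \<xi>|lborel_n m. cmod (fourier m F \<xi>)) \<le> (LINT \<xi>|lborel_n m. ?C * (\<Prod>i<m. 1 / (1 + (\<xi> i)\<^sup>2)))"
    by (intro integral_mono integrable_norm integrable_fourier F integrable_mult_right integrable_cauchy_n
        fourier_bound "is")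
  also have "\<dots> = ?C * (LINT x|lborel. 1 / (1 + x\<^sup>2)) ^ m"
    by (simp only: integral_mult_right_zero integral_cauchy_n)
  finally show ?thesis by (simp add: fl1_const_def mult_ac)
qed

text \<open>The point is that \<open>K\<close> does not depend on \<open>r\<close>; it is applied to powers of a fixed function.\<close>

definition mult_bound :: "nat \<Rightarrow> nat \<Rightarrow> ((nat \<Rightarrow> real) \<Rightarrow> complex) \<Rightarrow> real \<Rightarrow> bool" where
  "mult_bound m j G K \<longleftrightarrow> 0 \<le> K \<and> (\<forall>r r' r'' S c. moderate r \<longrightarrow>
      (\<forall>t. (r has_vector_derivative r' t) (at t)) \<longrightarrow> (\<forall>t. (r' has_vector_derivative r'' t) (at t)) \<longrightarrow>
      closed S \<longrightarrow> (\<forall>x. G x \<noteq> 0 \<longrightarrow> x j \<in> S) \<longrightarrow> 0 \<le> c \<longrightarrow>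
      (\<forall>t\<in>S. cmod (r t) \<le> c * (1 + t\<^sup>2) \<and> cmod (r' t) \<le> c * (1 + t\<^sup>2) \<and> cmod (r'' t) \<le> c * (1 + t\<^sup>2)) \<longrightarrow>
      (LINT \<xi>|lborel_n m. cmod (fourier m (\<lambda>x. r (x j) * G x) \<xi>)) \<le> K * c)"

lemma mult_boundD:
  assumes "mult_bound m j G K" "moderate r" "\<And>t. (r has_vector_derivative r' t) (at t)"
    "\<And>t. (r' has_vector_derivative r'' t) (at t)" "closed S" "\<And>x. G x \<noteq> 0 \<Longrightarrow> x j \<in> S" "0 \<le> c"
    "\<And>t. t \<in> S \<Longrightarrow> cmod (r t) \<le> c * (1 + t\<^sup>2)" "\<And>t. t \<in> S \<Longrightarrow> cmod (r' t) \<le> c * (1 + t\<^sup>2)"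
    "\<And>t. t \<in> S \<Longrightarrow> cmod (r'' t) \<le> c * (1 + t\<^sup>2)"
  shows "(LINT \<xi>|lborel_n m. cmod (fourier m (\<lambda>x. r (x j) * G x) \<xi>)) \<le> K * c"
proof -
  note * = assms(1)[unfolded mult_bound_def, THEN conjunct2, rule_format, of r r' r'' S c]
  show ?thesis by (rule *) (use assms(2-) in blast)+
qed

text \<open>The operators \<open>Lop i\<close> for \<open>i \<noteq> j\<close> commute with
  multiplication by \<open>r (x j)\<close> and turn \<open>G\<close> into a fixed Schwartz function
  \<open>Y\<close>. Applying \<open>Lop j\<close> last leaves \<open>r * Y\<close>,
  \<open>r * Y''\<close>, \<open>2 * r' * Y'\<close> and \<open>r'' * Y\<close> with derivatives in
  \<open>x j\<close>, whence the coefficients 2, 2, 1 in the constant. The weight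
  \<open>1 + t^2\<close> is absorbed by the decay of \<open>Y\<close>.\<close>

lemma mult_bound_exists:
  assumes G: "schwartz m G" and j: "j < m"
  shows "\<exists>K. mult_bound m j G K"
proof -
  let ?js = "filter (\<lambda>i. i \<noteq> j) [0..<m]"
  let ?w = "\<lambda>t::real. complex_of_real t * complex_of_real t + 1"
  define Y where "Y = foldr Lop ?js G"
  have js: "set ?js \<subseteq> {..<m}" by auto
  have Y: "schwartz m Y" unfolding Y_def by (rule schwartz_Lops[OF G js])
  note Y1 = schwartz_partial_deriv[OF Y j]
  note Y2 = schwartz_partial_deriv[OF Y1 j]
  have w: "moderate ?w" by (intro moderate_add moderate_mult) simp_all
  have wn: "cmod (?w t) = 1 + t\<^sup>2" for t
  proof -
    have "?w t = complex_of_real (1 + t\<^sup>2)" by (simp add: power2_eq_square)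
    then show ?thesis by (simp only: norm_of_real) (simp add: add_nonneg_nonneg)
  qed
  have int: "integrable (lborel_n m) (\<lambda>x. cmod (?w (x j) * H x))" if "schwartz m H" for H
    by (intro integrable_norm schwartz_integrable schwartz_mult_coord[OF w that j])
  define N where "N H = (LINT x|lborel_n m. cmod (?w (x j) * H x))" for H
  have N0: "0 \<le> N H" for H unfolding N_def by (rule Bochner_Integration.integral_nonneg) simp
  show ?thesis
    unfolding mult_bound_def
  proof (intro exI[of _ "fl1_const m * (2 * N Y + 2 * N (partial_deriv j Y) + N (partial_deriv j (partial_deriv j Y)))"]
      conjI allI impI)
    show "0 \<le> fl1_const m * (2 * N Y + 2 * N (partial_deriv j Y) + N (partial_deriv j (partial_deriv j Y)))"
      using N0 fl1_const_nonneg by (intro mult_nonneg_nonneg add_nonneg_nonneg) auto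
  next
    fix r r' r'' :: "real \<Rightarrow> complex" and S c
    assume r: "moderate r" and r1': "\<forall>t. (r has_vector_derivative r' t) (at t)"
      and r2': "\<forall>t. (r' has_vector_derivative r'' t) (at t)" and S: "closed S"
      and GS': "\<forall>x. G x \<noteq> 0 \<longrightarrow> x j \<in> S" and c: "0 \<le> c"
      and b': "\<forall>t\<in>S. cmod (r t) \<le> c * (1 + t\<^sup>2) \<and> cmod (r' t) \<le> c * (1 + t\<^sup>2) \<and> cmod (r'' t) \<le> c * (1 + t\<^sup>2)"
    note r1 = r1'[rule_format] and r2 = r2'[rule_format] and GS = GS'[rule_format] and b = bspec[OF b']
    have uniq: "g = g'" if "\<And>t. (f has_vector_derivative g t) (at t)" "\<And>t. (f has_vector_derivative g' t) (at t)"
      for f g g' :: "real \<Rightarrow> complex"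
      using that by (auto intro!: ext vector_derivative_unique_at)
    have r'm: "moderate r'"
      using moderate_deriv[OF r] uniq[OF r1] by metis
    have sr: "smooth m (\<lambda>x. r (x j))" "smooth m (\<lambda>x. r' (x j))"
      by (auto intro: smooth_coord r r'm j)
    have Lrest: "foldr Lop is (\<lambda>x. r (x j) * G x) = (\<lambda>x. r (x j) * foldr Lop is G x)"
      if "j \<notin> set is" "set is \<subseteq> {..<m}" for "is"
      using that
    proof (induction "is")
      case (Cons i "is")
      then have i: "i < m" "i \<noteq> j" and "is": "set is \<subseteq> {..<m}" by auto
      have sH: "smooth m H \<Longrightarrow> partial_deriv i (\<lambda>x. r (x j) * H x) = (\<lambda>x. r (x j) * partial_deriv i H x)" for H
        using partial_deriv_mult[OF sr(1) _ i(1)] partial_deriv_coord[OF r1, of i j] i(2) by simp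
      have sm: "smooth m (foldr Lop is G)" by (rule schwartz_smooth[OF schwartz_Lops[OF G "is"]])
      have "foldr Lop (i # is) (\<lambda>x. r (x j) * G x) = Lop i (\<lambda>x. r (x j) * foldr Lop is G x)"
        using Cons by simp
      also have "\<dots> = (\<lambda>x. r (x j) * Lop i (foldr Lop is G) x)"
        by (simp add: Lop_def sH[OF sm] sH[OF smooth_partial_deriv[OF sm i(1)]] right_diff_distrib)
      finally show ?case by simp
    qed simp
    have set1: "set (j # ?js) = {..<m}" "distinct (j # ?js)" using j by auto
    let ?F = "\<lambda>x. r (x j) * G x"
    have F: "schwartz m ?F" by (rule schwartz_mult_coord[OF r G j])
    have eq: "foldr Lop (j # ?js) ?F = (\<lambda>x. r (x j) * Y x - (r (x j) * partial_deriv j (partial_deriv j Y) x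
        + 2 * (r' (x j) * partial_deriv j Y x) + r'' (x j) * Y x))"
    proof -
      have 1: "foldr Lop (j # ?js) ?F = Lop j (\<lambda>x. r (x j) * Y x)"
        using Lrest[of ?js] unfolding Y_def by (simp add: subset_eq)
      have 2: "partial_deriv j (\<lambda>x. r (x j) * Y x) = (\<lambda>x. r (x j) * partial_deriv j Y x + r' (x j) * Y x)"
        using partial_deriv_mult[OF sr(1) schwartz_smooth[OF Y] j] partial_deriv_coord[OF r1, of j j] by simp
      have 3: "partial_deriv j (\<lambda>x. r (x j) * partial_deriv j Y x + r' (x j) * Y x) =
         (\<lambda>x. (r (x j) * partial_deriv j (partial_deriv j Y) x + r' (x j) * partial_deriv j Y x)
            + (r' (x j) * partial_deriv j Y x + r'' (x j) * Y x))"
        using partial_deriv_mult[OF sr(1) schwartz_smooth[OF Y1] j] partial_deriv_coord[OF r1, of j j]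
          partial_deriv_mult[OF sr(2) schwartz_smooth[OF Y] j] partial_deriv_coord[OF r2, of j j]
          partial_deriv_add[OF smooth_mult[OF sr(1) schwartz_smooth[OF Y1]] smooth_mult[OF sr(2) schwartz_smooth[OF Y]] j]
        by simp
      show ?thesis unfolding 1 Lop_def 2 3 by (simp add: algebra_simps)
    qed
    \<comment> \<open>Vanishing of \<open>G\<close> over the open complement of \<open>S\<close>
      passes to all derivatives, so bounds on \<open>r\<close> that hold on \<open>S\<close> only
      are enough.\<close>
    have v: "Y x = 0 \<and> partial_deriv j Y x = 0 \<and> partial_deriv j (partial_deriv j Y) x = 0" if "x j \<notin> S" for x
    proof -
      have o: "open (- S)" using S by (simp add: open_Compl)
      have "foldr Lop is G x = 0" if "x j \<in> - S" for x "is"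
        using that
      proof (induction "is" arbitrary: x)
        case Nil
        then show ?case using GS by auto
      next
        case (Cons i "is")
        have "partial_deriv i (foldr Lop is G) x = 0" if "x j \<in> - S" for x
          by (rule partial_deriv_vanish[OF o, of j]) (use that Cons.IH in auto)
        then have "partial_deriv i (partial_deriv i (foldr Lop is G)) x = 0"
          by - (rule partial_deriv_vanish[OF o, of j], use Cons.prems in auto)
        then show ?case using Cons.IH[of x] Cons.prems by (simp add: Lop_def[of i "foldr Lop is G"])
      qed
      then have y: "Y x = 0" if "x j \<in> - S" for x using that unfolding Y_def by blast
      have y1: "partial_deriv j Y x = 0" if "x j \<in> - S" for x 
        by (rule partial_deriv_vanish[OF o, of j]) (use that y in auto)
      have y2: "partial_deriv j (partial_deriv j Y) x = 0" if "x j \<in> - S" for x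
        by (rule partial_deriv_vanish[OF o, of j]) (use that y1 in auto)
      show ?thesis using y y1 y2 that by simp
    qed
    let ?B = "\<lambda>x. c * (2 * cmod (?w (x j) * Y x) + 2 * cmod (?w (x j) * partial_deriv j Y x)
        + cmod (?w (x j) * partial_deriv j (partial_deriv j Y) x))"
    have le: "cmod (foldr Lop (j # ?js) ?F x) \<le> ?B x" for x
    proof (cases "x j \<in> S")
      case False
      then show ?thesis unfolding eq using v[of x] c by simp
    next
      case True
      have m: "cmod (u * z) \<le> c * cmod (?w (x j) * z)" if "cmod u \<le> c * (1 + (x j)\<^sup>2)" for u z
        using mult_right_mono[OF that norm_ge_zero[of z]] by (simp add: norm_mult wn mult.assoc)
      have tri: "cmod (a - (b + 2 * d + e)) \<le> cmod a + cmod b + 2 * cmod d + cmod e" for a b d e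
        using norm_triangle_ineq4[of a "b + 2 * d + e"] norm_triangle_ineq[of "b + 2 * d" e]
          norm_triangle_ineq[of b "2 * d"] norm_mult[of 2 d] by simp
      note b = b[OF True]
      have "cmod (foldr Lop (j # ?js) ?F x) \<le> c * cmod (?w (x j) * Y x)
        + c * cmod (?w (x j) * partial_deriv j (partial_deriv j Y) x)
        + 2 * (c * cmod (?w (x j) * partial_deriv j Y x)) + c * cmod (?w (x j) * Y x)"
        unfolding eq
        by (rule order_trans[OF tri]) (intro add_mono mult_left_mono m b[THEN conjunct1]
            b[THEN conjunct2, THEN conjunct1] b[THEN conjunct2, THEN conjunct2], simp)
      then show ?thesis by (simp add: algebra_simps)
    qed
    have "(LINT \<xi>|lborel_n m. cmod (fourier m ?F \<xi>)) \<le> fl1_const m * (LINT x|lborel_n m. cmod (foldr Lop (j # ?js) ?F x))"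
      by (rule fourier_L1_le[OF F set1])
    also have "\<dots> \<le> fl1_const m * (LINT x|lborel_n m. ?B x)"
    proof (rule mult_left_mono[OF integral_mono fl1_const_nonneg])
      show "integrable (lborel_n m) (\<lambda>x. cmod (foldr Lop (j # ?js) ?F x))"
        by (intro integrable_norm schwartz_integrable schwartz_Lops F) (use set1 in simp)
      show "integrable (lborel_n m) ?B"
        by (intro integrable_mult_right Bochner_Integration.integrable_add int Y Y1 Y2)
    qed (rule le)
    also have "(LINT x|lborel_n m. ?B x) = c * (2 * N Y + 2 * N (partial_deriv j Y) + N (partial_deriv j (partial_deriv j Y)))"
    proof -
      have "(LINT x|lborel_n m. c * (2 * a x + 2 * b x + d x)) =
          c * (2 * (LINT x|lborel_n m. a x) + 2 * (LINT x|lborel_n m. b x) + (LINT x|lborel_n m. d x))"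
        if "integrable (lborel_n m) a" "integrable (lborel_n m) b" "integrable (lborel_n m) d" for a b d :: "(nat \<Rightarrow> real) \<Rightarrow> real"
        using that by simp
      from this[OF int[OF Y] int[OF Y1] int[OF Y2]] show ?thesis unfolding N_def .
    qed
    finally show "(LINT \<xi>|lborel_n m. cmod (fourier m ?F \<xi>)) \<le> fl1_const m * (2 * N Y + 2 * N (partial_deriv j Y) + N (partial_deriv j (partial_deriv j Y))) * c"
      by (simp add: mult_ac)
  qed
qed

section \<open>Fourier inversion at the origin\<close>

text \<open>The left-hand side is the characteristic function of the standard normal
  distribution.\<close>

lemma integral_std_normal_cis:
  "(LINT y|lborel. complex_of_real (std_normal_density y) * cis (t * y)) = complex_of_real (exp (- t\<^sup>2 / 2))"
proof -
  have "char std_normal_distribution t = complex_of_real (exp (- t\<^sup>2 / 2))"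
    by (simp add: char_std_normal_distribution)
  moreover have "char std_normal_distribution t = (LINT y|lborel. std_normal_density y *\<^sub>R iexp (t * y))"
    unfolding char_def by (subst integral_density) (auto simp: normal_density_nonneg)
  ultimately show ?thesis by (simp add: scaleR_conv_of_real cis_conv_exp)
qed

lemma integrable_std_normal_complex: "integrable lborel (\<lambda>y. complex_of_real (std_normal_density y))"
  by (rule integrable_of_real) simp

lemma gauss_eq: "exp (- ((\<epsilon>::real) * \<xi>)\<^sup>2 / 2) = sqrt (2 * pi) * std_normal_density (\<epsilon> * \<xi>)"
  by (simp add: std_normal_density_def)

lemma integrable_gauss: "\<epsilon> > 0 \<Longrightarrow> integrable lborel (\<lambda>\<xi>. complex_of_real (exp (- (\<epsilon> * \<xi>)\<^sup>2 / 2)))"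
  using lborel_integrable_real_affine[OF integrable_std_normal_complex, of \<epsilon> 0]
  unfolding gauss_eq by simp

lemma integral_gauss_cis:
  assumes "\<epsilon> > 0"
  shows "(LINT \<xi>|lborel. complex_of_real (exp (- (\<epsilon> * \<xi>)\<^sup>2 / 2)) * cis (- \<xi> * x)) =
    complex_of_real (2 * pi / \<epsilon> * std_normal_density (x / \<epsilon>))"
proof -
  have "(LINT \<xi>|lborel. complex_of_real (exp (- (\<epsilon> * \<xi>)\<^sup>2 / 2)) * cis (- \<xi> * x)) =
     \<bar>1 / \<epsilon>\<bar> *\<^sub>R (LINT y|lborel. complex_of_real (exp (- (\<epsilon> * (0 + (1 / \<epsilon>) * y))\<^sup>2 / 2)) * cis (- (0 + (1 / \<epsilon>) * y) * x))"
    by (rule lborel_integral_real_affine) (use assms in simp)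
  also have "(LINT y|lborel. complex_of_real (exp (- (\<epsilon> * (0 + (1 / \<epsilon>) * y))\<^sup>2 / 2)) * cis (- (0 + (1 / \<epsilon>) * y) * x))
     = (LINT y|lborel. complex_of_real (sqrt (2 * pi)) * (complex_of_real (std_normal_density y) * cis ((- x / \<epsilon>) * y)))"
  proof (rule Bochner_Integration.integral_cong[OF refl])
    fix y :: real
    have e: "\<epsilon> * (0 + (1 / \<epsilon>) * y) = y" "- (0 + (1 / \<epsilon>) * y) * x = (- x / \<epsilon>) * y"
      using assms by simp_all
    have g: "exp (- y\<^sup>2 / 2) = sqrt (2 * pi) * std_normal_density y"
      by (simp add: std_normal_density_def)
    show "complex_of_real (exp (- (\<epsilon> * (0 + (1 / \<epsilon>) * y))\<^sup>2 / 2)) * cis (- (0 + (1 / \<epsilon>) * y) * x)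
        = complex_of_real (sqrt (2 * pi)) * (complex_of_real (std_normal_density y) * cis ((- x / \<epsilon>) * y))"
      by (simp only: e g of_real_mult mult.assoc)
  qed
  also have "\<dots> = complex_of_real (sqrt (2 * pi)) * complex_of_real (exp (- (- x / \<epsilon>)\<^sup>2 / 2))"
    by (simp only: integral_mult_right_zero integral_std_normal_cis)
  also have "\<bar>1 / \<epsilon>\<bar> *\<^sub>R \<dots> = complex_of_real (2 * pi / \<epsilon> * std_normal_density (x / \<epsilon>))"
    using assms by (simp add: std_normal_density_def scaleR_conv_of_real field_simps flip: of_real_mult real_sqrt_mult)
  finally show ?thesis .
qed

text \<open>Damping by the Gaussians \<open>\<gamma> n\<close> makes the double integral absolutely
  convergent. After Fubini the transform of \<open>\<gamma> n\<close> is a rescaled normal density,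
  and the substitution \<open>x = \<epsilon> n * y\<close> leaves the mean of
  \<open>G (\<epsilon> n * y)\<close> under the normal law, which tends to the value of
  \<open>G\<close> at 0.\<close>

lemma integral_fourier:
  assumes G: "schwartz m G"
  shows "(LINT \<xi>|lborel_n m. fourier m G \<xi>) = G (\<lambda>_. 0)"
proof -
  let ?M = "lborel_n m"
  interpret M: sigma_finite_measure ?M by (rule sigma_finite_lborel_n)
  interpret MM: pair_sigma_finite ?M ?M ..
  define \<epsilon> where "\<epsilon> n = 1 / real (Suc n)" for n
  have \<epsilon>0: "\<epsilon> n > 0" for n by (simp add: \<epsilon>_def)
  have \<epsilon>lim: "\<epsilon> \<longlonglongrightarrow> 0"
    unfolding \<epsilon>_def by (rule LIMSEQ_Suc[OF lim_inverse_n', unfolded inverse_eq_divide])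
  define \<gamma> where "\<gamma> n \<xi> = (\<Prod>j<m. complex_of_real (exp (- (\<epsilon> n * \<xi> j)\<^sup>2 / 2)))" for n and \<xi> :: "nat \<Rightarrow> real"
  define \<phi> where "\<phi> y = (\<Prod>j<m. complex_of_real (std_normal_density (y j)))" for y :: "nat \<Rightarrow> real"
  have Gm [measurable]: "G \<in> borel_measurable ?M" by (rule schwartz_measurable[OF G])
  have \<gamma>i: "integrable ?M (\<gamma> n)" for n
    unfolding \<gamma>_def by (rule lborel_product.product_integrable_prod) (simp, rule integrable_gauss[OF \<epsilon>0])
  have \<gamma>m [measurable]: "\<gamma> n \<in> borel_measurable ?M" for n using \<gamma>i by auto
  have \<phi>i: "integrable ?M \<phi>"
    unfolding \<phi>_def by (rule lborel_product.product_integrable_prod) (auto intro: integrable_std_normal_complex)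
  have \<phi>m [measurable]: "\<phi> \<in> borel_measurable ?M" using \<phi>i by auto
  have \<phi>1: "(LINT y|?M. \<phi> y) = 1"
  proof -
    have "(LINT y|?M. \<phi> y) = (\<Prod>j<m. LINT y|lborel. complex_of_real (std_normal_density y))"
      unfolding \<phi>_def by (rule lborel_product.product_integral_prod) (auto intro: integrable_std_normal_complex)
    then show ?thesis by simp
  qed
  note fi = integrable_fourier[OF G]
  have lim1: "(\<lambda>n. LINT \<xi>|?M. fourier m G \<xi> * \<gamma> n \<xi>) \<longlonglongrightarrow> (LINT \<xi>|?M. fourier m G \<xi>)"
  proof (rule integral_dominated_convergence[where w="\<lambda>\<xi>. cmod (fourier m G \<xi>)"])
    show "integrable ?M (\<lambda>\<xi>. cmod (fourier m G \<xi>))" using fi by simp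
    show "fourier m G \<in> borel_measurable ?M" using fi by simp
    then show "(\<lambda>\<xi>. fourier m G \<xi> * \<gamma> n \<xi>) \<in> borel_measurable ?M" for n by measurable
    show "AE \<xi> in ?M. (\<lambda>n. fourier m G \<xi> * \<gamma> n \<xi>) \<longlonglongrightarrow> fourier m G \<xi>"
    proof (rule AE_I2)
      fix \<xi> :: "nat \<Rightarrow> real"
      have "(\<lambda>n. fourier m G \<xi> * \<gamma> n \<xi>) \<longlonglongrightarrow> fourier m G \<xi> * (\<Prod>j<m. complex_of_real (exp (- (0 * \<xi> j)\<^sup>2 / 2)))"
        unfolding \<gamma>_def by (intro tendsto_intros \<epsilon>lim) auto
      then show "(\<lambda>n. fourier m G \<xi> * \<gamma> n \<xi>) \<longlonglongrightarrow> fourier m G \<xi>" by simp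
    qed
    show "AE \<xi> in ?M. norm (fourier m G \<xi> * \<gamma> n \<xi>) \<le> cmod (fourier m G \<xi>)" for n
    proof (rule AE_I2)
      fix \<xi> :: "nat \<Rightarrow> real"
      have "cmod (\<gamma> n \<xi>) \<le> 1"
        unfolding \<gamma>_def prod_norm[symmetric] by (intro prod_le_1) auto
      then show "norm (fourier m G \<xi> * \<gamma> n \<xi>) \<le> cmod (fourier m G \<xi>)"
        using mult_left_mono[of "cmod (\<gamma> n \<xi>)" 1 "cmod (fourier m G \<xi>)"] by (simp add: norm_mult)
    qed
  qed
  have eq: "(LINT \<xi>|?M. fourier m G \<xi> * \<gamma> n \<xi>) = (LINT y|?M. G (affine_n m (\<lambda>_. 0) (\<epsilon> n) y) * \<phi> y)" for n
  proof -
    let ?k = "\<lambda>x \<xi>. G x * (\<gamma> n \<xi> * ech m \<xi> x)"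
    have Gi: "integrable ?M G" by (rule schwartz_integrable[OF G])
    have "integrable (?M \<Otimes>\<^sub>M ?M) (\<lambda>p. G (fst p) * \<gamma> n (snd p))"
    proof (rule MM.Fubini_integrable)
      show "(\<lambda>p. G (fst p) * \<gamma> n (snd p)) \<in> borel_measurable (?M \<Otimes>\<^sub>M ?M)" by measurable
      show "integrable ?M (\<lambda>x. LINT y|?M. norm (G (fst (x, y)) * \<gamma> n (snd (x, y))))"
        using Gi by (simp add: norm_mult)
      show "AE x in ?M. integrable ?M (\<lambda>y. G (fst (x, y)) * \<gamma> n (snd (x, y)))"
        using \<gamma>i by simp
    qed
    moreover have ech': "(\<lambda>p. ech m (snd p) (fst p)) \<in> borel_measurable (?M \<Otimes>\<^sub>M ?M)"
    proof -
      have "(\<lambda>p. (snd p, fst p)) \<in> measurable (?M \<Otimes>\<^sub>M ?M) (?M \<Otimes>\<^sub>M ?M)" by measurable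
      from measurable_compose[OF this measurable_ech] show ?thesis by simp
    qed
    ultimately have int: "integrable (?M \<Otimes>\<^sub>M ?M) (case_prod ?k)"
    proof (rule_tac Bochner_Integration.integrable_bound[where f="\<lambda>p. G (fst p) * \<gamma> n (snd p)"])
      note [measurable] = ech'
      have "(\<lambda>p. G (fst p) * (\<gamma> n (snd p) * ech m (snd p) (fst p))) \<in> borel_measurable (?M \<Otimes>\<^sub>M ?M)"
        by measurable
      then show "case_prod ?k \<in> borel_measurable (?M \<Otimes>\<^sub>M ?M)" by (simp add: case_prod_unfold)
    qed (auto simp: norm_mult)
    \<comment> \<open>The Gaussian integral factors over the coordinates. The power of
      \<open>2 * pi\<close> will cancel the normalisation of \<open>fourier\<close>, and the power
      of \<open>1 / \<epsilon> n\<close> is the Jacobian of the substitution.\<close>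
    have inner: "(LINT \<xi>|?M. \<gamma> n \<xi> * ech m \<xi> x) = complex_of_real ((2 * pi) ^ m) * (complex_of_real ((1 / \<epsilon> n) ^ m) * \<phi> (\<lambda>j. x j / \<epsilon> n))" for x
    proof -
      have "(LINT \<xi>|?M. \<gamma> n \<xi> * ech m \<xi> x) =
          (LINT \<xi>|?M. (\<Prod>j<m. complex_of_real (exp (- (\<epsilon> n * \<xi> j)\<^sup>2 / 2)) * cis (- \<xi> j * x j)))"
        by (simp add: \<gamma>_def ech_prod prod.distrib)
      also have "\<dots> = (\<Prod>j<m. LINT \<xi>|lborel. complex_of_real (exp (- (\<epsilon> n * \<xi>)\<^sup>2 / 2)) * cis (- \<xi> * x j))"
      proof (rule lborel_product.product_integral_prod)
        fix j
        show "integrable lborel (\<lambda>\<xi>. complex_of_real (exp (- (\<epsilon> n * \<xi>)\<^sup>2 / 2)) * cis (- \<xi> * x j))"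
        proof (rule Bochner_Integration.integrable_bound[OF integrable_gauss[OF \<epsilon>0]])
          show "(\<lambda>\<xi>. complex_of_real (exp (- (\<epsilon> n * \<xi>)\<^sup>2 / 2)) * cis (- \<xi> * x j)) \<in> borel_measurable lborel"
            unfolding cis_conv_exp by measurable
        qed (auto simp: norm_mult)
      qed simp
      also have "\<dots> = (\<Prod>j<m. complex_of_real (2 * pi) * ((1 / \<epsilon> n) * std_normal_density (x j / \<epsilon> n)))"
        unfolding integral_gauss_cis[OF \<epsilon>0] by simp
      also have "\<dots> = complex_of_real ((2 * pi) ^ m) * (complex_of_real ((1 / \<epsilon> n) ^ m) * \<phi> (\<lambda>j. x j / \<epsilon> n))"
        by (simp only: prod.distrib prod_constant card_lessThan \<phi>_def of_real_mult of_real_power of_real_divide of_real_1 power_mult_distrib)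
      finally show ?thesis .
    qed
    have "(LINT \<xi>|?M. fourier m G \<xi> * \<gamma> n \<xi>) = (LINT \<xi>|?M. complex_of_real (1 / (2 * pi) ^ m) * (LINT x|?M. ?k x \<xi>))"
    proof (rule Bochner_Integration.integral_cong[OF refl])
      fix \<xi>
      have "(LINT x|?M. ?k x \<xi>) = (LINT x|?M. \<gamma> n \<xi> * (G x * ech m \<xi> x))"
        by (simp add: mult_ac)
      also have "\<dots> = \<gamma> n \<xi> * (LINT x|?M. G x * ech m \<xi> x)" by (rule integral_mult_right_zero)
      finally show "fourier m G \<xi> * \<gamma> n \<xi> = complex_of_real (1 / (2 * pi) ^ m) * (LINT x|?M. ?k x \<xi>)"
        by (simp only: fourier_altdef mult_ac)
    qed
    also have "\<dots> = complex_of_real (1 / (2 * pi) ^ m) * (LINT x|?M. LINT \<xi>|?M. ?k x \<xi>)"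
      by (simp only: integral_mult_right_zero MM.Fubini_integral[OF int])
    also have "(LINT x|?M. LINT \<xi>|?M. ?k x \<xi>) =
        complex_of_real ((2 * pi) ^ m) * (complex_of_real ((1 / \<epsilon> n) ^ m) * (LINT x|?M. G x * \<phi> (\<lambda>j. x j / \<epsilon> n)))"
    proof -
      have "(LINT \<xi>|?M. ?k x \<xi>) = complex_of_real ((2 * pi) ^ m) * (complex_of_real ((1 / \<epsilon> n) ^ m) * (G x * \<phi> (\<lambda>j. x j / \<epsilon> n)))" for x
        by (simp only: integral_mult_right_zero inner mult_ac)
      then show ?thesis by (simp only: integral_mult_right_zero)
    qed
    also have "complex_of_real (1 / (2 * pi) ^ m) * \<dots> = (1 / \<epsilon> n) ^ m *\<^sub>R (LINT x|?M. G x * \<phi> (\<lambda>j. x j / \<epsilon> n))"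
      by (simp add: scaleR_conv_of_real)
    also have "\<dots> = (LINT y|?M. G (affine_n m (\<lambda>_. 0) (\<epsilon> n) y) * \<phi> (\<lambda>j. affine_n m (\<lambda>_. 0) (\<epsilon> n) y j / \<epsilon> n))"
    proof (rule integral_affine_n[OF \<epsilon>0, symmetric])
      have "(\<lambda>x. \<phi> (\<lambda>j. x j / \<epsilon> n)) \<in> borel_measurable ?M"
        unfolding \<phi>_def by measurable
      then show "(\<lambda>x. G x * \<phi> (\<lambda>j. x j / \<epsilon> n)) \<in> borel_measurable ?M" by measurable
    qed
    finally have *: "(LINT \<xi>|?M. fourier m G \<xi> * \<gamma> n \<xi>) =
      (LINT y|?M. G (affine_n m (\<lambda>_. 0) (\<epsilon> n) y) * \<phi> (\<lambda>j. affine_n m (\<lambda>_. 0) (\<epsilon> n) y j / \<epsilon> n))" .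
    have "\<phi> (\<lambda>j. affine_n m (\<lambda>_. 0) (\<epsilon> n) y j / \<epsilon> n) = \<phi> y" for y
      unfolding \<phi>_def using \<epsilon>0[of n] by (intro prod.cong) (auto simp: affine_n_def)
    with * show ?thesis by (simp only:)
  qed
  obtain B where B: "\<And>x. cmod (G x) \<le> B"
    using spec[OF schwartz_rapid[OF G, unfolded rapid_def], of 0] by auto
  have lim2: "(\<lambda>n. LINT y|?M. G (affine_n m (\<lambda>_. 0) (\<epsilon> n) y) * \<phi> y) \<longlonglongrightarrow> (LINT y|?M. G (\<lambda>_. 0) * \<phi> y)"
  proof (rule integral_dominated_convergence[where w="\<lambda>y. B * cmod (\<phi> y)"])
    show "integrable ?M (\<lambda>y. B * cmod (\<phi> y))" using \<phi>i by simp
    show "(\<lambda>y. G (\<lambda>_. 0) * \<phi> y) \<in> borel_measurable ?M" by measurable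
    show "(\<lambda>y. G (affine_n m (\<lambda>_. 0) (\<epsilon> n) y) * \<phi> y) \<in> borel_measurable ?M" for n by measurable
    show "AE y in ?M. norm (G (affine_n m (\<lambda>_. 0) (\<epsilon> n) y) * \<phi> y) \<le> B * cmod (\<phi> y)" for n
      by (intro AE_I2) (auto simp: norm_mult intro!: mult_right_mono B)
    show "AE y in ?M. (\<lambda>n. G (affine_n m (\<lambda>_. 0) (\<epsilon> n) y) * \<phi> y) \<longlonglongrightarrow> G (\<lambda>_. 0) * \<phi> y"
    proof (intro AE_I2 tendsto_mult tendsto_const)
      fix y :: "nat \<Rightarrow> real"
      have "(\<lambda>n i. \<epsilon> n * y i) \<longlonglongrightarrow> (\<lambda>_. 0)"
        by (rule tendsto_funI) (rule tendsto_mult_left_zero[OF \<epsilon>lim])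
      then have "(\<lambda>n. G (\<lambda>i. \<epsilon> n * y i)) \<longlonglongrightarrow> G (\<lambda>_. 0)"
        using smooth_continuous[OF schwartz_smooth[OF G]]
        by (intro isCont_tendsto_compose[of "\<lambda>_. 0" G]) (auto simp: continuous_on_eq_continuous_at)
      moreover have "G (affine_n m (\<lambda>_. 0) (\<epsilon> n) y) = G (\<lambda>i. \<epsilon> n * y i)" for n
        by (rule depends_onD[OF smooth_depends_on[OF schwartz_smooth[OF G]]]) (simp add: affine_n_def)
      ultimately show "(\<lambda>n. G (affine_n m (\<lambda>_. 0) (\<epsilon> n) y)) \<longlonglongrightarrow> G (\<lambda>_. 0)" by simp
    qed
  qed
  have "(LINT y|?M. G (\<lambda>_. 0) * \<phi> y) = G (\<lambda>_. 0)" by (simp add: \<phi>1)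
  then show ?thesis using LIMSEQ_unique[OF lim1] lim2 eq by simp
qed

section \<open>The functional calculus for Schwartz functions\<close>

text \<open>A coefficient stands in front of every exponential, also the first. Functions of
  \<open>x j\<close> alone then act by right multiplication on \<open>c j\<close>, uniformly in
  \<open>j\<close>; for lists the coefficient of slot 0 is 1.\<close>

primrec word :: "nat \<Rightarrow> 'a::cstar_algebra \<Rightarrow> (nat \<Rightarrow> 'a) \<Rightarrow> (nat \<Rightarrow> real) \<Rightarrow> 'a" where
  "word 0 h c \<xi> = 1"
| "word (Suc m) h c \<xi> = word m h c \<xi> * (c m * uexp h (\<xi> m))"

lemma word_prod_list: "word m h c \<xi> = prod_list (map (\<lambda>k. c k * uexp h (\<xi> k)) [0..<m])"
  by (induction m) simp_all

definition slot_coeffs :: "'a::cstar_algebra list \<Rightarrow> nat \<Rightarrow> 'a" where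
  "slot_coeffs bs k = (if k = 0 then 1 else bs ! (k - 1))"

lemma exp_word_eq: "exp_word h \<xi> bs = word (Suc (length bs)) h (slot_coeffs bs) \<xi>"
proof -
  have "[0..<Suc (length bs)] = 0 # map Suc [0..<length bs]"
    by (simp only: map_Suc_upt upt_conv_Cons[of 0 "Suc (length bs)"] zero_less_Suc)
  then show ?thesis
    by (simp only: word_prod_list exp_word_def) (simp add: slot_coeffs_def uexp_def comp_def)
qed

lemma word_cong:
  "(\<And>k. k < m \<Longrightarrow> c k = c' k) \<Longrightarrow> (\<And>k. k < m \<Longrightarrow> \<xi> k = \<xi>' k) \<Longrightarrow> word m h c \<xi> = word m h c' \<xi>'"
  by (induction m) simp_all

lemma depends_on_word: "depends_on m (word m h c)"
  unfolding depends_on_def by (auto intro: word_cong)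

lemma continuous_on_word: "continuous_on UNIV (word m h c)"
proof (induction m)
  case (Suc m)
  have "continuous_on UNIV (\<lambda>\<xi>. uexp h (\<xi> m))"
    by (rule continuous_on_compose2[OF continuous_on_uexp continuous_on_product_coordinates]) auto
  then show ?case using Suc by (auto intro!: continuous_intros)
qed simp

definition csize :: "nat \<Rightarrow> (nat \<Rightarrow> 'a::real_normed_vector) \<Rightarrow> real" where
  "csize m c = (\<Prod>k<m. norm (c k))"

lemma csize_nonneg [simp]: "0 \<le> csize m c"
  by (simp add: csize_def prod_nonneg)

lemma norm_word_le:
  assumes "star h = h" shows "norm (word m h c \<xi>) \<le> csize m c"
proof (induction m)
  case (Suc m)
  have "norm (word (Suc m) h c \<xi>) \<le> norm (word m h c \<xi>) * norm (c m * uexp h (\<xi> m))"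
    by (simp add: norm_mult_ineq)
  also have "\<dots> \<le> csize m c * (norm (c m) * 1)"
    using norm_mult_ineq[of "c m" "uexp h (\<xi> m)"] Suc
    by (intro mult_mono) (auto simp: norm_uexp[OF assms])
  finally show ?case by (simp add: csize_def)
qed (simp add: csize_def)

lemma word_add:
  "j < m \<Longrightarrow> word m h (c(j := x + y)) \<xi> = word m h (c(j := x)) \<xi> + word m h (c(j := y)) \<xi>"
proof (induction m)
  case (Suc m)
  show ?case
  proof (cases "j = m")
    case True
    have "word m h (c(m := z)) \<xi> = word m h c \<xi>" for z by (intro word_cong) auto
    then show ?thesis by (simp only: True word.simps fun_upd_same distrib_right distrib_left)
  next
    case False
    then show ?thesis using Suc by (simp add: distrib_right)
  qed
qed simp

lemma word_scaleC: "j < m \<Longrightarrow> word m h (c(j := z *\<^sub>C x)) \<xi> = z *\<^sub>C word m h (c(j := x)) \<xi>"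
proof (induction m)
  case (Suc m)
  show ?case
  proof (cases "j = m")
    case True
    have "word m h (c(m := z)) \<xi> = word m h c \<xi>" for z by (intro word_cong) auto
    then show ?thesis by (simp only: True word.simps fun_upd_same mult_scaleC_left mult_scaleC_right)
  next
    case False
    then show ?thesis using Suc by (simp add: mult_scaleC_left)
  qed
qed simp

text \<open>\<open>e^{i(s + \<xi>)h}\<close> is \<open>e^{ish}\<close> times
  \<open>e^{i\<xi>h}\<close>, and the first factor is absorbed by the coefficient to its
  left.\<close>

lemma word_shift:
  assumes "j < m"
  shows "word m h c (\<lambda>i. if i = j then s + \<xi> i else \<xi> i) = word m h (c(j := c j * uexp h s)) \<xi>"
  using assms
proof (induction m)
  case (Suc m)
  show ?case
  proof (cases "j = m")
    case True
    have "word m h (c(m := z)) \<xi> = word m h c \<xi>" for z by (intro word_cong) auto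
    moreover have "word m h c (\<lambda>i. if i = m then s + \<xi> i else \<xi> i) = word m h c \<xi>"
      by (intro word_cong) auto
    ultimately show ?thesis by (simp only: True word.simps fun_upd_same uexp_add mult.assoc if_True refl)
  next
    case False
    then show ?thesis using Suc by simp
  qed
qed simp

text \<open>Setting slot \<open>j\<close> to 1 leaves the product of the other norms, because
  \<open>norm 1 = 1\<close>.\<close>

lemma csize_upd: "j < m \<Longrightarrow> csize m (c(j := y)) = norm y * csize m (c(j := 1))"
  for c :: "nat \<Rightarrow> 'b::real_normed_algebra_1"
  unfolding csize_def by (simp add: prod.remove[of "{..<m}" j])

lemma fourier_cis:
  assumes "j < m"
  shows "fourier m (\<lambda>x. cis (s * x j) * G x) (\<lambda>i. if i = j then s + \<xi> i else \<xi> i) = fourier m G \<xi>"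
proof -
  have "ech m (\<lambda>i. if i = j then s + \<xi> i else \<xi> i) x = cis (- s * x j) * ech m \<xi> x" for x
  proof -
    have "(\<Prod>i<m. cis (- (if i = j then s + \<xi> i else \<xi> i) * x i)) =
        (\<Prod>i<m. (if i = j then cis (- s * x i) else 1) * cis (- \<xi> i * x i))"
      by (intro prod.cong) (auto simp: cis_mult algebra_simps)
    also have "\<dots> = cis (- s * x j) * (\<Prod>i<m. cis (- \<xi> i * x i))"
      using assms by (simp add: prod.distrib)
    finally show ?thesis by (simp only: ech_prod)
  qed
  then have "cis (s * x j) * G x * ech m (\<lambda>i. if i = j then s + \<xi> i else \<xi> i) x = G x * ech m \<xi> x" for x
    by (simp add: mult_ac cis_mult flip: mult.assoc[of "cis _" "cis _"])
  then show ?thesis by (simp only: fourier_altdef)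
qed

lemma depends_on_fourier: "depends_on m (fourier m G)"
  unfolding depends_on_def by (auto simp: fourier_def intro!: arg_cong[where f="\<lambda>g. _ * integral\<^sup>L _ g"])

definition scalc :: "nat \<Rightarrow> 'a::cstar_algebra \<Rightarrow> ((nat \<Rightarrow> real) \<Rightarrow> complex) \<Rightarrow> (nat \<Rightarrow> 'a) \<Rightarrow> 'a" where
  "scalc m h G c = (THE I. has_vector_integral (lborel_n m) (\<lambda>\<xi>. fourier m G \<xi> *\<^sub>C word m h c \<xi>) I)"

context
  fixes h :: "'a::cstar_algebra"
  assumes h: "star h = h"
begin

lemma scalc_has_integral:
  assumes "schwartz m G"
  shows "has_vector_integral (lborel_n m) (\<lambda>\<xi>. fourier m G \<xi> *\<^sub>C word m h c \<xi>) (scalc m h G c)"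
proof -
  obtain I where I: "has_vector_integral (lborel_n m) (\<lambda>\<xi>. fourier m G \<xi> *\<^sub>C word m h c \<xi>) I"
    using has_vector_integral_exists[OF integrable_fourier[OF assms] continuous_on_word depends_on_word norm_word_le[OF h]]
    by blast
  then show ?thesis
    unfolding scalc_def by (rule theI) (rule has_vector_integral_unique[OF _ I])
qed

lemma scalc_unique:
  assumes "schwartz m G" "has_vector_integral (lborel_n m) (\<lambda>\<xi>. fourier m G \<xi> *\<^sub>C word m h c \<xi>) I"
  shows "I = scalc m h G c"
  using has_vector_integral_unique[OF assms(2) scalc_has_integral[OF assms(1)]] .

lemma norm_scalc_le:
  assumes G: "schwartz m G"
  shows "norm (scalc m h G c) \<le> csize m c * (LINT \<xi>|lborel_n m. cmod (fourier m G \<xi>))"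
proof -
  have "norm (scalc m h G c) \<le> (LINT \<xi>|lborel_n m. csize m c * cmod (fourier m G \<xi>))"
  proof (rule has_vector_integral_norm_le[OF scalc_has_integral[OF G]])
    show "integrable (lborel_n m) (\<lambda>\<xi>. csize m c * cmod (fourier m G \<xi>))"
      using integrable_fourier[OF G] by simp
    show "norm (fourier m G \<xi> *\<^sub>C word m h c \<xi>) \<le> csize m c * cmod (fourier m G \<xi>)" for \<xi>
      using mult_left_mono[OF norm_word_le[OF h, of m c \<xi>] norm_ge_zero[of "fourier m G \<xi>"]]
      by (simp add: norm_scaleC mult.commute)
  qed
  then show ?thesis by simp
qed

lemma scalc_add:
  assumes "schwartz m F" "schwartz m G"
  shows "scalc m h (\<lambda>x. F x + G x) c = scalc m h F c + scalc m h G c"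
  by (rule has_vector_integral_add_unique[OF scalc_has_integral[OF assms(1)] scalc_has_integral[OF assms(2)]
      scalc_has_integral[OF schwartz_add[OF assms]]])
     (simp add: fourier_add[OF assms] scaleC_add_left)

lemma scalc_cmult:
  assumes "schwartz m G"
  shows "scalc m h (\<lambda>x. z * G x) c = z *\<^sub>C scalc m h G c"
proof (rule has_vector_integral_linear_unique[OF scalc_has_integral[OF assms]])
  show "has_vector_integral (lborel_n m) (\<lambda>\<xi>. z *\<^sub>C fourier m G \<xi> *\<^sub>C word m h c \<xi>) (scalc m h (\<lambda>x. z * G x) c)"
    using scalc_has_integral[OF schwartz_cmult[OF assms, of z], of c] by (simp add: fourier_cmult scaleC_scaleC)
qed (rule scaleC.bounded_linear_right)

lemma scalc_diff:
  assumes "schwartz m F" "schwartz m G"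
  shows "scalc m h (\<lambda>x. F x - G x) c = scalc m h F c - scalc m h G c"
  using scalc_add[OF schwartz_diff[OF assms] assms(2), of c] by simp

lemma scalc_cong: "(\<And>k. k < m \<Longrightarrow> c k = c' k) \<Longrightarrow> scalc m h G c = scalc m h G c'"
proof -
  assume "\<And>k. k < m \<Longrightarrow> c k = c' k"
  then have "word m h c = word m h c'" by (intro ext word_cong) auto
  then show ?thesis by (simp only: scalc_def)
qed

lemma scalc_add_coeff:
  assumes "schwartz m G" "j < m"
  shows "scalc m h G (c(j := x + y)) = scalc m h G (c(j := x)) + scalc m h G (c(j := y))"
  by (rule has_vector_integral_add_unique[OF scalc_has_integral[OF assms(1)] scalc_has_integral[OF assms(1)]
      scalc_has_integral[OF assms(1)]])
     (simp add: word_add[OF assms(2)] scaleC_add_right)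

lemma scalc_scaleC_coeff:
  assumes "schwartz m G" "j < m"
  shows "scalc m h G (c(j := z *\<^sub>C x)) = z *\<^sub>C scalc m h G (c(j := x))"
proof (rule has_vector_integral_linear_unique[OF scalc_has_integral[OF assms(1)]])
  show "has_vector_integral (lborel_n m) (\<lambda>\<xi>. z *\<^sub>C fourier m G \<xi> *\<^sub>C word m h (c(j := x)) \<xi>) (scalc m h G (c(j := z *\<^sub>C x)))"
    using scalc_has_integral[OF assms(1), of "c(j := z *\<^sub>C x)"]
    by (simp add: word_scaleC[OF assms(2)] scaleC_scaleC mult.commute)
qed (rule scaleC.bounded_linear_right)

lemma scalc_diff_coeff:
  assumes "schwartz m G" "j < m"
  shows "scalc m h G (c(j := x - y)) = scalc m h G (c(j := x)) - scalc m h G (c(j := y))"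
  using scalc_add_coeff[OF assms, of c "x - y" y] by simp

text \<open>Needed for slot 0, whose coefficient 1 has derivative 0.\<close>

lemma scalc_zero_coeff:
  assumes "schwartz m G" "j < m" "c j = 0"
  shows "scalc m h G c = 0"
  using scalc_diff_coeff[OF assms(1,2), of c 0 0] assms(3) by (simp add: fun_upd_idem)

lemma scalc_zero [simp]: "scalc m h (\<lambda>x. 0) c = 0"
  using scalc_cmult[of m "\<lambda>x. 0" 0 c] schwartz_compact_support[OF smooth_const[of m 0]] by (simp add: scaleC.zero_left)

text \<open>Modulating \<open>G\<close> by a character of \<open>x j\<close> translates its
  transform in \<open>\<xi> j\<close>. Translation invariance of the integral moves the shift to the
  word, where it becomes the factor \<open>uexp h s\<close>.\<close>

lemma scalc_cis:
  assumes G: "schwartz m G" and j: "j < m"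
  shows "scalc m h (\<lambda>x. cis (s * x j) * G x) c = scalc m h G (c(j := c j * uexp h s))"
proof -
  let ?F = "\<lambda>x. cis (s * x j) * G x" and ?a = "\<lambda>i. if i = j then s else 0"
  have F: "schwartz m ?F" by (rule schwartz_mult_coord[OF moderate_cis G j])
  have "has_vector_integral (lborel_n m) (\<lambda>\<xi>. fourier m ?F (affine_n m ?a 1 \<xi>) *\<^sub>C word m h c (affine_n m ?a 1 \<xi>)) (scalc m h ?F c)"
    using has_vector_integral_affine[OF zero_less_one scalc_has_integral[OF F, of c], of ?a] by simp
  moreover have "fourier m ?F (affine_n m ?a 1 \<xi>) *\<^sub>C word m h c (affine_n m ?a 1 \<xi>) =
      fourier m G \<xi> *\<^sub>C word m h (c(j := c j * uexp h s)) \<xi>" for \<xi>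
  proof -
    have e: "i < m \<Longrightarrow> affine_n m ?a 1 \<xi> i = (if i = j then s + \<xi> i else \<xi> i)" for i
      by (simp add: affine_n_def)
    have "fourier m ?F (affine_n m ?a 1 \<xi>) = fourier m ?F (\<lambda>i. if i = j then s + \<xi> i else \<xi> i)"
      by (rule depends_onD[OF depends_on_fourier e])
    moreover have "word m h c (affine_n m ?a 1 \<xi>) = word m h c (\<lambda>i. if i = j then s + \<xi> i else \<xi> i)"
      by (rule depends_onD[OF depends_on_word e])
    ultimately show ?thesis by (simp only: fourier_cis[OF j] word_shift[OF j])
  qed
  ultimately show ?thesis using scalc_unique[OF G] by simp
qed

text \<open>Multiplication by \<open>x j\<close> is the limit of multiplication by
  \<open>- \<i> / s * (cis (s * x j) - 1)\<close>, whose effect is known from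
  \<open>scalc_cis\<close>. The same quotient formed with \<open>uexp h s\<close> tends to
  \<open>h\<close>. The estimate \<open>mult_bound\<close> controls the error for small
  \<open>s\<close>.\<close>

lemma scalc_mult_coord:
  assumes G: "schwartz m G" and j: "j < m"
  shows "scalc m h (\<lambda>x. complex_of_real (x j) * G x) c = scalc m h G (c(j := c j * h))"
proof -
  obtain K where K: "mult_bound m j G K" using mult_bound_exists[OF G j] by blast
  define L where "L = (LINT \<xi>|lborel_n m. cmod (fourier m G \<xi>))"
  define y where "y s = (- \<i>) *\<^sub>C ((uexp h s - 1) /\<^sub>R s)" for s
  let ?T = "scalc m h (\<lambda>x. complex_of_real (x j) * G x) c" and ?N = "csize m (c(j := 1))"
  have tG: "schwartz m (\<lambda>x. complex_of_real (x j) * G x)" by (rule schwartz_mult_coord[OF moderate_of_real G j])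
  have le: "norm (?T - scalc m h G (c(j := c j * h))) \<le> csize m c * (K * \<bar>s\<bar>) + norm (c j) * norm (y s - h) * ?N * L"
    if s: "s \<noteq> 0" for s
  proof -
    \<comment> \<open>\<open>r\<close> is the error of the difference quotient as a function of the
      variable; the aim is to bound it and two derivatives by
      \<open>\<bar>s\<bar> * (1 + t^2)\<close>.\<close>
    define r where "r t = (- \<i> / complex_of_real s) * (cis (s * t) - 1) - complex_of_real t" for t
    have rm: "moderate r"
      unfolding r_def by (intro moderate_diff moderate_mult moderate_cis moderate_const moderate_of_real)
    have cisd: "((\<lambda>t. cis (s * t)) has_vector_derivative (\<i> * s) * cis (s * t)) (at t)" for t
    proof -
      have "((\<lambda>t. \<i> * s * complex_of_real t) has_vector_derivative \<i> * s * 1) (at t)"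
        by (rule has_vector_derivative_mult_right[OF complex_of_real_has_vector_derivative])
      from field_vector_diff_chain_at[OF this DERIV_exp] show ?thesis
        by (simp add: comp_def cis_conv_exp mult_ac)
    qed
    have r1: "(r has_vector_derivative cis (s * t) - 1) (at t)" for t
    proof -
      have "(r has_vector_derivative (- \<i> / complex_of_real s) * ((\<i> * s) * cis (s * t) - 0) - 1) (at t)"
        unfolding r_def by (intro has_vector_derivative_diff has_vector_derivative_mult_right cisd
            has_vector_derivative_const complex_of_real_has_vector_derivative)
      then show ?thesis using s by simp
    qed
    have r2: "((\<lambda>t. cis (s * t) - 1) has_vector_derivative (\<i> * s) * cis (s * t)) (at t)" for t
      using has_vector_derivative_diff[OF cisd has_vector_derivative_const[of 1]] by simp
    \<comment> \<open>Taylor's remainder \<open>(s * t)^2 / 2\<close> for the exponential, divided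
      by \<open>s\<close>, still has a factor \<open>\<bar>s\<bar>\<close>.\<close>
    have b0: "cmod (r t) \<le> \<bar>s\<bar> * (1 + t\<^sup>2)" for t
    proof -
      have "cmod (cis (s * t) - (1 + \<i> * complex_of_real (s * t))) \<le> \<bar>s * t\<bar>\<^sup>2 / 2"
        using iexp_approx1[of "s * t" 1] by (simp add: cis_conv_exp numeral_2_eq_2)
      moreover have "r t = (- \<i> / complex_of_real s) * (cis (s * t) - (1 + \<i> * complex_of_real (s * t)))"
        using s by (simp add: r_def field_simps)
      ultimately have "cmod (r t) \<le> (1 / \<bar>s\<bar>) * (\<bar>s * t\<bar>\<^sup>2 / 2)"
        by (simp only: norm_mult norm_divide norm_minus_cancel norm_ii norm_of_real) (intro mult_left_mono, auto)
      also have "\<dots> = \<bar>s\<bar> * (t\<^sup>2 / 2)"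
        using s by (simp add: abs_mult power_mult_distrib power2_eq_square[of s] field_simps)
      also have "\<dots> \<le> \<bar>s\<bar> * (1 + t\<^sup>2)"
      proof (rule mult_left_mono)
        have "0 \<le> t\<^sup>2" by simp
        then show "t\<^sup>2 / 2 \<le> 1 + t\<^sup>2" by linarith
      qed simp
      finally show ?thesis .
    qed
    have b1: "cmod (cis (s * t) - 1) \<le> \<bar>s\<bar> * (1 + t\<^sup>2)" for t
    proof -
      have "cmod (cis (s * t) - 1) \<le> \<bar>s * t\<bar>"
        using iexp_approx1[of "s * t" 0] by (simp add: cis_conv_exp)
      also have "\<dots> \<le> \<bar>s\<bar> * (1 + t\<^sup>2)"
      proof -
        have "0 \<le> (\<bar>t\<bar> - 1)\<^sup>2" by simp
        then have "\<bar>t\<bar> \<le> 1 + t\<^sup>2" by (simp add: power2_diff)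
        then show ?thesis by (simp add: abs_mult mult_left_mono)
      qed
      finally show ?thesis .
    qed
    have b2: "cmod ((\<i> * s) * cis (s * t)) \<le> \<bar>s\<bar> * (1 + t\<^sup>2)" for t
      using mult_left_mono[of 1 "1 + t\<^sup>2" "\<bar>s\<bar>"] by (simp add: norm_mult)
    have cG: "schwartz m (\<lambda>x. cis (s * x j) * G x)" by (rule schwartz_mult_coord[OF moderate_cis G j])
    have "scalc m h (\<lambda>x. r (x j) * G x) c = scalc m h (\<lambda>x. (- \<i> / complex_of_real s) * (cis (s * x j) * G x - G x) - complex_of_real (x j) * G x) c"
      by (simp add: r_def algebra_simps)
    also have "\<dots> = (- \<i> / complex_of_real s) *\<^sub>C (scalc m h G (c(j := c j * uexp h s)) - scalc m h G (c(j := c j))) - ?T"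
      by (simp only: scalc_diff[OF schwartz_cmult[OF schwartz_diff[OF cG G]] tG] scalc_cmult[OF schwartz_diff[OF cG G]]
          scalc_diff[OF cG G] scalc_cis[OF G j] fun_upd_triv)
    also have "\<dots> = scalc m h G (c(j := (- \<i> / complex_of_real s) *\<^sub>C (c j * uexp h s - c j))) - ?T"
      by (simp only: scalc_diff_coeff[OF G j, symmetric] scalc_scaleC_coeff[OF G j, symmetric])
    also have "(- \<i> / complex_of_real s) *\<^sub>C (c j * uexp h s - c j) = c j * y s"
    proof -
      have "(- \<i> / complex_of_real s) *\<^sub>C (c j * uexp h s - c j) = c j * ((- \<i> * complex_of_real (inverse s)) *\<^sub>C (uexp h s - 1))"
        by (simp add: mult_scaleC_right right_diff_distrib divide_inverse)
      also have "\<dots> = c j * y s" by (simp only: y_def scaleC_scaleC[symmetric] scaleC_of_real)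
      finally show ?thesis .
    qed
    finally have eq: "scalc m h (\<lambda>x. r (x j) * G x) c = scalc m h G (c(j := c j * y s)) - ?T" .
    have "norm (scalc m h (\<lambda>x. r (x j) * G x) c) \<le> csize m c * (LINT \<xi>|lborel_n m. cmod (fourier m (\<lambda>x. r (x j) * G x) \<xi>))"
      by (rule norm_scalc_le[OF schwartz_mult_coord[OF rm G j]])
    also have "\<dots> \<le> csize m c * (K * \<bar>s\<bar>)"
      by (rule mult_left_mono[OF mult_boundD[OF K rm r1 r2 closed_UNIV]]) (use b0 b1 b2 in auto)
    finally have 1: "norm (scalc m h G (c(j := c j * y s)) - ?T) \<le> csize m c * (K * \<bar>s\<bar>)" unfolding eq .
    have "norm (scalc m h G (c(j := c j * (y s - h)))) \<le> csize m (c(j := c j * (y s - h))) * L"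
      unfolding L_def by (rule norm_scalc_le[OF G])
    also have "\<dots> \<le> (norm (c j) * norm (y s - h) * ?N) * L"
    proof (rule mult_right_mono)
      show "csize m (c(j := c j * (y s - h))) \<le> norm (c j) * norm (y s - h) * ?N"
        using norm_mult_ineq[of "c j" "y s - h"] by (subst csize_upd[OF j]) (intro mult_right_mono, auto)
      show "0 \<le> L" unfolding L_def by (rule Bochner_Integration.integral_nonneg) simp
    qed
    finally have 2: "norm (scalc m h G (c(j := c j * y s)) - scalc m h G (c(j := c j * h))) \<le> norm (c j) * norm (y s - h) * ?N * L"
      by (simp only: right_diff_distrib scalc_diff_coeff[OF G j])
    show ?thesis
      using 1 2 norm_triangle_ineq4[of "scalc m h G (c(j := c j * y s)) - scalc m h G (c(j := c j * h))"
          "scalc m h G (c(j := c j * y s)) - ?T"] by simp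
  qed
  have y: "(y \<longlongrightarrow> h) (at 0)"
  proof -
    have "(y \<longlongrightarrow> (- \<i>) *\<^sub>C (\<i> *\<^sub>C h)) (at 0)"
      unfolding y_def by (intro scaleC.tendsto tendsto_const uexp_quotient_tendsto)
    then show ?thesis by (simp add: scaleC_scaleC)
  qed
  have "((\<lambda>s. csize m c * (K * \<bar>s\<bar>) + norm (c j) * norm (y s - h) * ?N * L) \<longlongrightarrow>
      csize m c * (K * \<bar>0\<bar>) + norm (c j) * norm (h - h) * ?N * L) (at 0)"
    by (intro tendsto_intros y)
  then have "((\<lambda>s. csize m c * (K * \<bar>s\<bar>) + norm (c j) * norm (y s - h) * ?N * L) \<longlongrightarrow> 0) (at 0)" by simp
  then have "norm (?T - scalc m h G (c(j := c j * h))) \<le> 0"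
    by (rule tendsto_lowerbound) (auto simp: eventually_at_filter le)
  then show ?thesis by simp
qed

end

section \<open>Dependence on the spectrum\<close>

lemma of_real_has_vector_derivative:
  "(f has_real_derivative f') (at t) \<Longrightarrow> ((\<lambda>t. complex_of_real (f t)) has_vector_derivative complex_of_real f') (at t)"
  by (rule bounded_linear.has_vector_derivative[OF bounded_linear_of_real])
     (simp add: has_real_derivative_iff_has_vector_derivative)

text \<open>\<open>n^2 * q^n\<close> is the square of \<open>n * sqrt q ^ n\<close>, which tends to
  0. The factor \<open>n^2\<close> arises because \<open>mult_bound\<close> involves two derivatives
  of an \<open>n\<close>-th power.\<close>

lemma eq_zero_if_geometric_bound:
  fixes X :: "'a::real_normed_vector"
  assumes q: "0 \<le> q" "q < 1" and b: "\<And>n. n \<ge> 2 \<Longrightarrow> norm X \<le> C * ((real n)\<^sup>2 * q ^ n)"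
  shows "X = 0"
proof -
  have "(\<lambda>n. real n * sqrt q ^ n) \<longlonglongrightarrow> 0"
    by (rule powser_times_n_limit_0) (use q in auto)
  then have "(\<lambda>n. C * (real n * sqrt q ^ n)\<^sup>2) \<longlonglongrightarrow> C * 0\<^sup>2" by (intro tendsto_intros)
  moreover have "(real n * sqrt q ^ n)\<^sup>2 = (real n)\<^sup>2 * q ^ n" for n
    using q by (simp add: power_mult_distrib flip: power_mult) (simp add: mult.commute[of n 2] power_mult)
  ultimately have "(\<lambda>n. C * ((real n)\<^sup>2 * q ^ n)) \<longlonglongrightarrow> 0" by simp
  then have "norm X \<le> 0"
    by (rule tendsto_lowerbound) (auto simp: eventually_sequentially intro!: exI[of _ 2] b)
  then show ?thesis by simp
qed

text \<open>A basic open set of the product topology may restrict coordinates beyond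
  \<open>m\<close> as well, so \<open>t\<close> is required to agree with \<open>x\<close> there;
  among the first \<open>m\<close> a minimum of radii works.\<close>

lemma open_fun_box:
  fixes U :: "(nat \<Rightarrow> real) set"
  assumes "open U" "x \<in> U"
  obtains \<epsilon> where "\<epsilon> > 0" "\<And>t. (\<And>l. l < m \<Longrightarrow> \<bar>t l - x l\<bar> \<le> \<epsilon>) \<Longrightarrow> (\<And>l. m \<le> l \<Longrightarrow> t l = x l) \<Longrightarrow> t \<in> U"
proof -
  have "openin (product_topology (\<lambda>_. euclidean) UNIV) U"
    using assms(1) by (simp add: euclidean_product_topology)
  from product_topology_open_contains_basis[OF this assms(2)]
  obtain X where X': "x \<in> Pi\<^sub>E UNIV X \<and> (\<forall>i. openin euclidean (X i)) \<and>
      finite {i. X i \<noteq> topspace euclidean} \<and> Pi\<^sub>E UNIV X \<subseteq> U" by (rule exE)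
  note X = X'[THEN conjunct1] X'[THEN conjunct2, THEN conjunct1, rule_format]
    X'[THEN conjunct2, THEN conjunct2, THEN conjunct2]
  have "\<exists>e>0. \<forall>s. \<bar>s - x l\<bar> \<le> e \<longrightarrow> s \<in> X l" for l
  proof -
    have "open (X l)" using X(2)[of l] by (simp only: open_openin)
    moreover have "x l \<in> X l" using X(1) by (simp add: PiE_iff)
    ultimately
    obtain e where e: "e > 0" "cball (x l) e \<subseteq> X l" using open_contains_cball by blast
    have "s \<in> X l" if "\<bar>s - x l\<bar> \<le> e" for s
    proof -
      have "s \<in> cball (x l) e" using that by (simp add: dist_real_def abs_minus_commute)
      then show ?thesis using e(2) by blast
    qed
    then show ?thesis using e(1) by blast
  qed
  then have "\<exists>e. \<forall>l. e l > 0 \<and> (\<forall>s. \<bar>s - x l\<bar> \<le> e l \<longrightarrow> s \<in> X l)" by (intro choice allI)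
  then obtain e where e: "\<And>l. e l > 0" "\<And>l s. \<bar>s - x l\<bar> \<le> e l \<Longrightarrow> s \<in> X l" by blast
  let ?\<epsilon> = "Min (insert 1 (e ` {..<m}))"
  show ?thesis
  proof (rule that[of ?\<epsilon>])
    show "?\<epsilon> > 0" using e(1) by (subst Min_gr_iff) auto
    fix t assume t: "\<And>l. l < m \<Longrightarrow> \<bar>t l - x l\<bar> \<le> ?\<epsilon>" "\<And>l. m \<le> l \<Longrightarrow> t l = x l"
    have "t l \<in> X l" for l
    proof (cases "l < m")
      case True
      then have "?\<epsilon> \<le> e l" by (intro Min_le) auto
      then show ?thesis using t(1)[OF True] by (intro e(2)) linarith
    next
      case False
      then show ?thesis using t(2)[of l] e(1)[of l] by (intro e(2)) auto
    qed
    then have "t \<in> Pi\<^sub>E UNIV X" by (simp add: PiE_iff)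
    then show "t \<in> U" using X(3) by (rule rev_subsetD)
  qed
qed

lemma power_left_inverse:
  fixes a b :: "'a::monoid_mult"
  assumes "b * a = 1" shows "b ^ n * a ^ n = 1"
proof (induction n)
  case (Suc n)
  have "b ^ Suc n * a ^ Suc n = b ^ n * (b * a) * a ^ n"
    by (simp only: power_Suc2[of b] power_Suc[of a] mult.assoc)
  then show ?case using Suc assms by simp
qed simp

context
  fixes h :: "'a::cstar_algebra"
  assumes h: "star h = h"
begin

text \<open>Iterates \<open>scalc_mult_coord\<close>. The Schwartz property is carried along because
  each step needs it for the previous product, and \<open>c\<close> is generalised because each step
  changes slot \<open>j\<close>.\<close>

lemma scalc_shift_power:
  assumes G: "schwartz m G" and j: "j < m"
  shows "scalc m h (\<lambda>x. complex_of_real ((x j - x0) ^ n) * G x) c = scalc m h G (c(j := c j * (h - of_real x0) ^ n))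
    \<and> schwartz m (\<lambda>x. complex_of_real ((x j - x0) ^ n) * G x)"
proof (induction n arbitrary: c)
  case 0
  then show ?case using G by simp
next
  case (Suc n)
  let ?H = "\<lambda>x. complex_of_real ((x j - x0) ^ n) * G x"
  have H: "schwartz m ?H" using Suc by blast
  have tH: "schwartz m (\<lambda>x. complex_of_real (x j) * ?H x)" by (rule schwartz_mult_coord[OF moderate_of_real H j])
  have eq: "(\<lambda>x. complex_of_real ((x j - x0) ^ Suc n) * G x) = (\<lambda>x. complex_of_real (x j) * ?H x - complex_of_real x0 * ?H x)"
    by (simp add: algebra_simps)
  have "scalc m h (\<lambda>x. complex_of_real ((x j - x0) ^ Suc n) * G x) c =
      scalc m h (\<lambda>x. complex_of_real (x j) * ?H x) c - complex_of_real x0 *\<^sub>C scalc m h ?H (c(j := c j))"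
    unfolding eq by (simp only: scalc_diff[OF h tH schwartz_cmult[OF H]] scalc_cmult[OF h H] fun_upd_triv)
  also have "\<dots> = scalc m h ?H (c(j := c j * h)) - scalc m h ?H (c(j := complex_of_real x0 *\<^sub>C c j))"
    by (simp only: scalc_mult_coord[OF h H j] scalc_scaleC_coeff[OF h H j])
  also have "\<dots> = scalc m h ?H (c(j := c j * h - complex_of_real x0 *\<^sub>C c j))"
    by (simp only: scalc_diff_coeff[OF h H j])
  also have "c j * h - complex_of_real x0 *\<^sub>C c j = c j * (h - of_real x0)"
    by (simp add: right_diff_distrib scaleC_of_real of_real_def[of x0, where 'a='a])
  also have "scalc m h ?H (c(j := c j * (h - of_real x0))) = scalc m h G (c(j := c j * (h - of_real x0) ^ Suc n))"
    using Suc[of "c(j := c j * (h - of_real x0))", THEN conjunct1]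
    by (simp only: fun_upd_same fun_upd_upd mult.assoc power_Suc)
  finally show ?case unfolding eq using schwartz_diff[OF tH schwartz_cmult[OF H]] by blast
qed

text \<open>The radius is chosen from the inverse of \<open>h - x0\<close> alone, before
  \<open>G\<close>. A neighbourhood that works for every \<open>G\<close> is what the bisection in
  \<open>scalc_vanish\<close> requires.\<close>

lemma scalc_local:
  assumes j: "j < m" and x0: "complex_of_real x0 \<notin> spectrum h"
  obtains \<epsilon> where "\<epsilon> > 0" "\<And>G. schwartz m G \<Longrightarrow> (\<And>x. G x \<noteq> 0 \<Longrightarrow> \<bar>x j - x0\<bar> \<le> \<epsilon>) \<Longrightarrow> scalc m h G c = 0"
proof -
  obtain b0 where b0: "(complex_of_real x0 *\<^sub>C 1 - h) * b0 = 1" "b0 * (complex_of_real x0 *\<^sub>C 1 - h) = 1"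
    using x0 unfolding spectrum_def by blast
  \<comment> \<open>The spectrum is defined through \<open>x0 - h\<close>, while the powers below
    are those of \<open>h - x0\<close>; hence the sign.\<close>
  define b where "b = - b0"
  let ?a = "h - of_real x0"
  have ba: "b * ?a = 1"
  proof -
    have "b * ?a = b0 * (complex_of_real x0 *\<^sub>C 1 - h)"
      by (simp add: b_def scaleC_of_real of_real_def[of x0, where 'a='a] right_diff_distrib)
    then show ?thesis using b0 by simp
  qed
  \<comment> \<open>This makes \<open>norm b * \<epsilon>\<close> smaller than 1/2, the ratio of the
    geometric bound, and \<open>\<epsilon> \<le> 1\<close>, so that higher powers of
    \<open>\<epsilon>\<close> are smaller.\<close>
  define \<epsilon> where "\<epsilon> = 1 / (2 * (1 + norm b))"
  have \<epsilon>: "\<epsilon> > 0" "\<epsilon> \<le> 1" unfolding \<epsilon>_def by (auto simp: add_pos_nonneg divide_le_eq_1)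
  have q: "norm b * \<epsilon> < 1"
  proof -
    have "norm b * \<epsilon> = norm b / (2 * (1 + norm b))" by (simp add: \<epsilon>_def)
    also have "\<dots> < 1" by (subst divide_less_eq_1_pos) (auto simp: add_pos_nonneg intro: add_strict_increasing2)
    finally show ?thesis .
  qed
  show ?thesis
  proof (rule that[OF \<epsilon>(1)])
    fix G assume G: "schwartz m G" and supp: "\<And>x. G x \<noteq> 0 \<Longrightarrow> \<bar>x j - x0\<bar> \<le> \<epsilon>"
    obtain K where K: "mult_bound m j G K" using mult_bound_exists[OF G j] by blast
    then have K0: "0 \<le> K" by (simp add: mult_bound_def)
    let ?N = "csize m (c(j := 1))"
    show "scalc m h G c = 0"
    proof (rule eq_zero_if_geometric_bound[of "norm b * \<epsilon>"])
      show "0 \<le> norm b * \<epsilon>" "norm b * \<epsilon> < 1" using \<epsilon> q by auto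
      fix n :: nat assume n: "n \<ge> 2"
      let ?r = "\<lambda>t. complex_of_real ((t - x0) ^ n)"
      let ?H = "\<lambda>x. ?r (x j) * G x" and ?c = "c(j := c j * b ^ n)"
      \<comment> \<open>The second derivative of the \<open>n\<close>-th power has coefficient
        \<open>n * (n - 1)\<close> and exponent \<open>n - 2\<close>; the function and its first
        derivative satisfy the same bound.\<close>
      let ?B = "(real n)\<^sup>2 * \<epsilon> ^ (n - 2)"
      have eq: "scalc m h G c = scalc m h ?H ?c"
      proof -
        have "scalc m h ?H ?c = scalc m h G (?c(j := ?c j * ?a ^ n))"
          using scalc_shift_power[OF G j] by blast
        also have "?c(j := ?c j * ?a ^ n) = c"
          using power_left_inverse[OF ba, of n] by (simp add: mult.assoc fun_eq_iff)
        finally show ?thesis ..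
      qed
      have H: "schwartz m ?H" using scalc_shift_power[OF G j] by blast
      have m: "moderate ?r"
        by (simp only: of_real_power of_real_diff) (intro moderate_power moderate_diff moderate_of_real moderate_const)
      have L: "(LINT \<xi>|lborel_n m. cmod (fourier m ?H \<xi>)) \<le> K * ?B"
      proof (rule mult_boundD[OF K m, where S="{t. \<bar>t - x0\<bar> \<le> \<epsilon>}"])
        show "(?r has_vector_derivative complex_of_real (real n * (t - x0) ^ (n - 1))) (at t)" for t
          by (rule of_real_has_vector_derivative) (auto intro!: derivative_eq_intros)
        show "((\<lambda>t. complex_of_real (real n * (t - x0) ^ (n - 1))) has_vector_derivative
            complex_of_real (real n * (real (n - 1) * (t - x0) ^ (n - 2)))) (at t)" for t
          by (rule of_real_has_vector_derivative) (auto intro!: derivative_eq_intros simp: numeral_2_eq_2)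
        show "closed {t. \<bar>t - x0\<bar> \<le> \<epsilon>}" by (intro closed_Collect_le continuous_intros)
        show "0 \<le> ?B" using \<epsilon> by simp
        show "G x \<noteq> 0 \<Longrightarrow> x j \<in> {t. \<bar>t - x0\<bar> \<le> \<epsilon>}" for x using supp by simp
        fix t assume t: "t \<in> {t. \<bar>t - x0\<bar> \<le> \<epsilon>}"
        have p: "\<bar>t - x0\<bar> ^ k \<le> \<epsilon> ^ (n - 2)" if "k \<ge> n - 2" for k
        proof -
          have "\<bar>t - x0\<bar> ^ k \<le> \<epsilon> ^ k" using t by (intro power_mono) auto
          also have "\<dots> \<le> \<epsilon> ^ (n - 2)" using \<epsilon> that by (intro power_decreasing) auto
          finally show ?thesis .
        qed
        have k: "cmod (complex_of_real (d * (t - x0) ^ k)) \<le> ?B * (1 + t\<^sup>2)" if "0 \<le> d" "d \<le> (real n)\<^sup>2" "k \<ge> n - 2" for d k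
        proof -
          have "cmod (complex_of_real (d * (t - x0) ^ k)) = d * \<bar>t - x0\<bar> ^ k"
            using that by (simp only: norm_of_real abs_mult power_abs abs_of_nonneg)
          also have "\<dots> \<le> ?B" using that p[of k] \<epsilon> by (intro mult_mono) auto
          also have "\<dots> \<le> ?B * (1 + t\<^sup>2)" using \<open>0 \<le> ?B\<close> mult_left_mono[of 1 "1 + t\<^sup>2" ?B] by simp
          finally show ?thesis .
        qed
        have n2: "1 \<le> (real n)\<^sup>2" "real n \<le> (real n)\<^sup>2" "real n * real (n - 1) \<le> (real n)\<^sup>2"
          using n by (auto simp: power2_eq_square intro!: mult_mono one_le_power[of "real n" 2, unfolded power2_eq_square])
        show "cmod (?r t) \<le> ?B * (1 + t\<^sup>2)" using k[of 1 n] n2 by simp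
        show "cmod (complex_of_real (real n * (t - x0) ^ (n - 1))) \<le> ?B * (1 + t\<^sup>2)"
          by (rule k) (use n2 in auto)
        show "cmod (complex_of_real (real n * (real (n - 1) * (t - x0) ^ (n - 2)))) \<le> ?B * (1 + t\<^sup>2)"
          unfolding mult.assoc[symmetric] by (rule k) (use n2 in auto)
      qed
      have "norm (scalc m h G c) \<le> csize m ?c * (K * ?B)"
        unfolding eq by (rule order_trans[OF norm_scalc_le[OF h H] mult_left_mono[OF L csize_nonneg]])
      also have "\<dots> \<le> (norm (c j) * norm b ^ n * ?N) * (K * ?B)"
      proof (rule mult_right_mono)
        have "norm (c j * b ^ n) \<le> norm (c j) * norm b ^ n"
          using norm_mult_ineq[of "c j" "b ^ n"] mult_left_mono[OF norm_power_ineq[of b n] norm_ge_zero[of "c j"]] by linarith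
        then show "csize m ?c \<le> norm (c j) * norm b ^ n * ?N"
          by (subst csize_upd[OF j]) (intro mult_right_mono csize_nonneg)
        show "0 \<le> K * ?B" using K0 \<epsilon> by simp
      qed
      also have "\<dots> = norm (c j) * ?N * K / \<epsilon>\<^sup>2 * ((real n)\<^sup>2 * (norm b * \<epsilon>) ^ n)"
        using \<epsilon> n by (simp add: power_mult_distrib power_diff field_simps)
      finally show "norm (scalc m h G c) \<le> norm (c j) * ?N * K / \<epsilon>\<^sup>2 * ((real n)\<^sup>2 * (norm b * \<epsilon>) ^ n)" .
    qed
  qed
qed

lemma scalc_one_plus_square_power:
  assumes G: "schwartz m G" and j: "j < m"
  shows "scalc m h (\<lambda>x. complex_of_real ((1 + (x j)\<^sup>2) ^ n) * G x) c = scalc m h G (c(j := c j * (1 + h * h) ^ n))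
    \<and> schwartz m (\<lambda>x. complex_of_real ((1 + (x j)\<^sup>2) ^ n) * G x)"
proof (induction n arbitrary: c)
  case 0
  then show ?case using G by simp
next
  case (Suc n)
  let ?H = "\<lambda>x. complex_of_real ((1 + (x j)\<^sup>2) ^ n) * G x"
  have H: "schwartz m ?H" using Suc by blast
  have tH: "schwartz m (\<lambda>x. complex_of_real (x j) * ?H x)" by (rule schwartz_mult_coord[OF moderate_of_real H j])
  have ttH: "schwartz m (\<lambda>x. complex_of_real (x j) * (complex_of_real (x j) * ?H x))" by (rule schwartz_mult_coord[OF moderate_of_real tH j])
  have eq: "(\<lambda>x. complex_of_real ((1 + (x j)\<^sup>2) ^ Suc n) * G x) = (\<lambda>x. ?H x + complex_of_real (x j) * (complex_of_real (x j) * ?H x))"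
    by (simp add: algebra_simps power2_eq_square)
  have "scalc m h (\<lambda>x. complex_of_real ((1 + (x j)\<^sup>2) ^ Suc n) * G x) c =
      scalc m h ?H (c(j := c j)) + scalc m h ?H (c(j := c j * h * h))"
    unfolding eq by (simp only: scalc_add[OF h H ttH] scalc_mult_coord[OF h tH j] scalc_mult_coord[OF h H j]
        fun_upd_triv fun_upd_same fun_upd_upd)
  also have "\<dots> = scalc m h ?H (c(j := c j + c j * h * h))"
    by (simp only: scalc_add_coeff[OF h H j])
  also have "c j + c j * h * h = c j * (1 + h * h)"
    by (simp add: distrib_left mult.assoc)
  also have "scalc m h ?H (c(j := c j * (1 + h * h))) = scalc m h G (c(j := c j * (1 + h * h) ^ Suc n))"
    using Suc[of "c(j := c j * (1 + h * h))", THEN conjunct1]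
    by (simp only: fun_upd_same fun_upd_upd mult.assoc power_Suc)
  finally show ?case unfolding eq using schwartz_add[OF H ttH] by blast
qed

text \<open>The \<open>n\<close>-th power of \<open>1 / (1 + t^2)\<close> is moderate on the whole
  line and is undone by \<open>(1 + h * h) ^ n\<close> in slot \<open>j\<close>. On the support it
  is at most the \<open>n\<close>-th power of \<open>1 / (1 + R^2)\<close>, so each factor
  contributes the ratio \<open>(1 + (norm h)^2) / (1 + R^2)\<close>, which is below 1.\<close>

lemma scalc_tail:
  assumes j: "j < m" and R: "norm h < R" and G: "schwartz m G" and supp: "\<And>x. G x \<noteq> 0 \<Longrightarrow> R \<le> \<bar>x j\<bar>"
  shows "scalc m h G c = 0"
proof -
  obtain K where K: "mult_bound m j G K" using mult_bound_exists[OF G j] by blast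
  then have K0: "0 \<le> K" by (simp add: mult_bound_def)
  let ?N = "csize m (c(j := 1))" and ?p = "inverse (1 + R\<^sup>2)" and ?s = "1 + (norm h)\<^sup>2"
  have R0: "0 < R" using R norm_ge_zero[of h] by linarith
  have pp: "0 < ?p" by (simp add: add_pos_nonneg)
  have hs: "norm (1 + h * h) \<le> ?s"
    using norm_triangle_ineq[of 1 "h * h"] norm_mult_ineq[of h h] by (simp add: power2_eq_square)
  show ?thesis
  proof (rule eq_zero_if_geometric_bound[of "?s * ?p"])
    show "0 \<le> ?s * ?p" using pp by simp
    have "(norm h)\<^sup>2 < R\<^sup>2" using R by (intro power_strict_mono) auto
    then show "?s * ?p < 1" by (simp add: divide_inverse[symmetric] divide_less_eq_1_pos add_pos_nonneg)
    fix n :: nat assume n: "n \<ge> 2"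
    let ?g = "\<lambda>t::real. inverse (1 + t\<^sup>2)"
    let ?r = "\<lambda>t. complex_of_real (?g t ^ n)"
    let ?H = "\<lambda>x. ?r (x j) * G x" and ?c = "c(j := c j * (1 + h * h) ^ n)"
    \<comment> \<open>The second derivative is at most
      \<open>2 * n + 4 * n * (n + 1) = 6 * n + 4 * n^2\<close> times \<open>?p ^ n\<close>, and this
      is at most \<open>10 * n^2\<close> times that power. The factors \<open>t * ?g t\<close> and
      \<open>t^2 * ?g t ^ 2\<close> created by differentiation have modulus at most 1.\<close>
    let ?B = "10 * (real n)\<^sup>2 * ?p ^ n"
    have H: "schwartz m ?H" by (rule schwartz_mult_coord[OF moderate_cauchy G j])
    have nz: "1 + t\<^sup>2 \<noteq> 0" "0 < 1 + t\<^sup>2" for t :: real by (auto simp: add_pos_nonneg add_nonneg_eq_0_iff)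
    have eq: "scalc m h G c = scalc m h ?H ?c"
    proof -
      have "(\<lambda>x. complex_of_real ((1 + (x j)\<^sup>2) ^ n) * ?H x) = G"
      proof
        fix x
        have "complex_of_real ((1 + (x j)\<^sup>2) ^ n) * ?r (x j) = 1"
          using nz[of "x j"] by (simp only: of_real_mult[symmetric] power_mult_distrib[symmetric]) simp
        then show "complex_of_real ((1 + (x j)\<^sup>2) ^ n) * ?H x = G x" by (simp only: mult.assoc[symmetric]) simp
      qed
      then show ?thesis using scalc_one_plus_square_power[OF H j, of n c] by simp
    qed
    have gd: "(?g has_real_derivative - 2 * t * ?g t ^ 2) (at t)" for t
      using nz[of t] by (auto intro!: derivative_eq_intros simp: power2_eq_square)
    have L: "(LINT \<xi>|lborel_n m. cmod (fourier m ?H \<xi>)) \<le> K * ?B"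
    proof (rule mult_boundD[OF K moderate_cauchy, where S="{t. R \<le> \<bar>t\<bar>}"])
      show "(?r has_vector_derivative complex_of_real (- 2 * real n * t * ?g t ^ (n + 1))) (at t)" for t
      proof (rule of_real_has_vector_derivative)
        have "((\<lambda>t. ?g t ^ n) has_real_derivative real n * ?g t ^ (n - 1) * (- 2 * t * ?g t ^ 2)) (at t)"
          using DERIV_power[OF gd[of t], of n] by (simp add: mult_ac)
        moreover have "real n * ?g t ^ (n - 1) * (- 2 * t * ?g t ^ 2) = - 2 * real n * t * ?g t ^ (n + 1)"
        proof -
          have "n - 1 + 2 = n + 1" using n by simp
          then have "?g t ^ (n + 1) = ?g t ^ (n - 1) * ?g t ^ 2" by (simp only: power_add[symmetric])
          then show ?thesis by (simp only: mult_ac)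
        qed
        ultimately show "((\<lambda>t. ?g t ^ n) has_real_derivative - 2 * real n * t * ?g t ^ (n + 1)) (at t)"
          by (rule DERIV_cong)
      qed
      show "((\<lambda>t. complex_of_real (- 2 * real n * t * ?g t ^ (n + 1))) has_vector_derivative
         complex_of_real (- 2 * real n * ?g t ^ (n + 1) + 4 * real n * real (n + 1) * (t\<^sup>2 * ?g t ^ 2) * ?g t ^ n)) (at t)" for t
      proof (rule of_real_has_vector_derivative)
        have "((\<lambda>t. ?g t ^ (n + 1)) has_real_derivative real (n + 1) * ?g t ^ n * (- 2 * t * ?g t ^ 2)) (at t)"
          using DERIV_power[OF gd[of t], of "n + 1"] by (simp add: mult_ac)
        from DERIV_mult'[OF DERIV_cmult[OF DERIV_ident, of "- 2 * real n"] this]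
        show "((\<lambda>t. - 2 * real n * t * ?g t ^ (n + 1)) has_real_derivative
            - 2 * real n * ?g t ^ (n + 1) + 4 * real n * real (n + 1) * (t\<^sup>2 * ?g t ^ 2) * ?g t ^ n) (at t)"
          by (rule DERIV_cong) (simp add: algebra_simps power2_eq_square)
      qed
      show "closed {t. R \<le> \<bar>t\<bar>}" by (intro closed_Collect_le continuous_intros)
      show "0 \<le> ?B" using pp by simp
      show "G x \<noteq> 0 \<Longrightarrow> x j \<in> {t. R \<le> \<bar>t\<bar>}" for x using supp by simp
      fix t assume "t \<in> {t. R \<le> \<bar>t\<bar>}"
      then have t: "R \<le> \<bar>t\<bar>" by simp
      then have "R\<^sup>2 \<le> t\<^sup>2" using R0 by (metis abs_le_square_iff abs_of_pos)
      then have "?g t \<le> ?p" using nz(2)[of R] by (intro le_imp_inverse_le) auto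
      have g0: "0 \<le> ?g t" "?g t \<le> 1" using nz(2)[of t] by (auto simp: inverse_le_1_iff)
      have gp: "?g t ^ n \<le> ?p ^ n" using \<open>?g t \<le> ?p\<close> g0 by (intro power_mono) auto
      have gs: "?g t ^ (n + 1) \<le> ?p ^ n"
        using mult_mono[OF g0(2) gp] g0 pp by simp
      have "\<bar>t\<bar> \<le> 1 + t\<^sup>2"
      proof -
        have "0 \<le> (\<bar>t\<bar> - 1)\<^sup>2" by simp
        then show ?thesis by (simp add: power2_diff)
      qed
      then have tg: "\<bar>t\<bar> * ?g t \<le> 1" using nz(2)[of t] by (simp add: divide_inverse[symmetric])
      have tg2: "t\<^sup>2 * ?g t ^ 2 \<le> 1"
        using power_mono[OF tg, of 2] g0 by (simp add: power_mult_distrib)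
      have n1: "1 \<le> real n" "real n \<le> (real n)\<^sup>2" "1 \<le> (real n)\<^sup>2"
        using n by (auto simp: power2_eq_square intro: one_le_power[of "real n" 2, unfolded power2_eq_square])
      have pn: "0 \<le> ?p ^ n" using pp by simp
      have B: "X \<le> ?B * (1 + t\<^sup>2)" if "X \<le> ?B" for X
        using that \<open>0 \<le> ?B\<close> mult_left_mono[of 1 "1 + t\<^sup>2" ?B] by simp
      show "cmod (?r t) \<le> ?B * (1 + t\<^sup>2)"
      proof (rule B)
        have "cmod (?r t) = ?g t ^ n" using g0 by (simp only: norm_of_real) simp
        also have "\<dots> \<le> 1 * ?p ^ n" using gp by simp
        also have "\<dots> \<le> ?B" using n1 by (intro mult_right_mono pn) linarith
        finally show "cmod (?r t) \<le> ?B" .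
      qed
      show "cmod (complex_of_real (- 2 * real n * t * ?g t ^ (n + 1))) \<le> ?B * (1 + t\<^sup>2)"
      proof (rule B)
        have "cmod (complex_of_real (- 2 * real n * t * ?g t ^ (n + 1))) = 2 * real n * ((\<bar>t\<bar> * ?g t) * ?g t ^ n)"
          using g0 by (simp only: norm_of_real abs_mult) simp
        also have "\<dots> \<le> 2 * real n * (1 * ?p ^ n)"
          using tg gp g0 by (intro mult_left_mono mult_mono) auto
        also have "\<dots> \<le> ?B" unfolding mult_1 using n1 by (intro mult_right_mono pn) linarith
        finally show "cmod (complex_of_real (- 2 * real n * t * ?g t ^ (n + 1))) \<le> ?B" .
      qed
      show "cmod (complex_of_real (- 2 * real n * ?g t ^ (n + 1) + 4 * real n * real (n + 1) * (t\<^sup>2 * ?g t ^ 2) * ?g t ^ n)) \<le> ?B * (1 + t\<^sup>2)"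
      proof (rule B)
        have "cmod (complex_of_real (- 2 * real n * ?g t ^ (n + 1) + 4 * real n * real (n + 1) * (t\<^sup>2 * ?g t ^ 2) * ?g t ^ n))
            \<le> 2 * real n * ?g t ^ (n + 1) + 4 * real n * real (n + 1) * ((t\<^sup>2 * ?g t ^ 2) * ?g t ^ n)"
          unfolding norm_of_real by (rule order_trans[OF abs_triangle_ineq]) (use g0 in \<open>simp add: abs_mult\<close>)
        also have "\<dots> \<le> 2 * real n * ?p ^ n + 4 * real n * real (n + 1) * (1 * ?p ^ n)"
          using tg2 gp gs g0 by (intro add_mono mult_left_mono mult_mono) auto
        also have "\<dots> = (6 * real n + 4 * (real n)\<^sup>2) * ?p ^ n" by (simp add: algebra_simps power2_eq_square)
        also have "\<dots> \<le> ?B" using n1 by (intro mult_right_mono pn) linarith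
        finally show "cmod (complex_of_real (- 2 * real n * ?g t ^ (n + 1) + 4 * real n * real (n + 1) * (t\<^sup>2 * ?g t ^ 2) * ?g t ^ n)) \<le> ?B" .
      qed
    qed
    have "norm (scalc m h G c) \<le> csize m ?c * (K * ?B)"
      unfolding eq by (rule order_trans[OF norm_scalc_le[OF h H] mult_left_mono[OF L csize_nonneg]])
    also have "\<dots> \<le> (norm (c j) * ?s ^ n * ?N) * (K * ?B)"
    proof (rule mult_right_mono)
      have "norm ((1 + h * h) ^ n) \<le> ?s ^ n"
        using norm_power_ineq[of "1 + h * h" n] power_mono[OF hs norm_ge_zero, of n] by linarith
      then have "norm (c j * (1 + h * h) ^ n) \<le> norm (c j) * ?s ^ n"
        using norm_mult_ineq[of "c j" "(1 + h * h) ^ n"] mult_left_mono[OF _ norm_ge_zero[of "c j"]] order_trans by blast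
      then show "csize m ?c \<le> norm (c j) * ?s ^ n * ?N"
        by (subst csize_upd[OF j]) (intro mult_right_mono csize_nonneg)
      show "0 \<le> K * ?B" using K0 pp by simp
    qed
    also have "\<dots> = 10 * norm (c j) * ?N * K * ((real n)\<^sup>2 * (?s * ?p) ^ n)"
      by (simp only: power_mult_distrib mult_ac)
    finally show "norm (scalc m h G c) \<le> 10 * norm (c j) * ?N * K * ((real n)\<^sup>2 * (?s * ?p) ^ n)" .
  qed
qed

text \<open>\<open>Z X\<close> is the claim for functions supported in \<open>X\<close>. It holds
  for small boxes around every point: either the box lies in \<open>U\<close>, where
  \<open>G\<close> is 0, or some coordinate of its centre is off the spectrum and
  \<open>scalc_local\<close> applies. The boxes are then enlarged to the whole space, one coordinate
  at a time, by smooth splittings of \<open>G\<close>.\<close>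

lemma scalc_vanish:
  assumes U: "open U" "{t. \<forall>i<m. complex_of_real (t i) \<in> spectrum h} \<subseteq> U"
    and G: "schwartz m G" and GU: "\<And>t. t \<in> U \<Longrightarrow> G t = 0"
  shows "scalc m h G c = 0"
proof -
  define Z where "Z X \<longleftrightarrow> (\<forall>G. schwartz m G \<longrightarrow> (\<forall>t\<in>U. G t = 0) \<longrightarrow> (\<forall>t. G t \<noteq> 0 \<longrightarrow> X t) \<longrightarrow> scalc m h G c = 0)"
    for X :: "(nat \<Rightarrow> real) \<Rightarrow> bool"
  have Z_mono: "Z Y" if "Z X" "\<And>t. Y t \<Longrightarrow> X t" for X Y using that unfolding Z_def by blast
  have Z_split: "Z W" if XY: "Z X" "Z Y" and i: "i < m" and \<sigma>: "moderate \<sigma>"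
    "\<And>t. W t \<Longrightarrow> \<sigma> (t i) \<noteq> 0 \<Longrightarrow> X t" "\<And>t. W t \<Longrightarrow> \<sigma> (t i) \<noteq> 1 \<Longrightarrow> Y t" for X Y W i \<sigma>
    unfolding Z_def
  proof (intro allI impI)
    fix G assume G: "schwartz m G" and GU: "\<forall>t\<in>U. G t = 0" and GW: "\<forall>t. G t \<noteq> 0 \<longrightarrow> W t"
    let ?A = "\<lambda>x. \<sigma> (x i) * G x" and ?B = "\<lambda>x. (1 - \<sigma> (x i)) * G x"
    have A: "schwartz m ?A" by (rule schwartz_mult_coord[OF \<sigma>(1) G i])
    have B: "schwartz m ?B" by (rule schwartz_mult_coord[OF moderate_diff[OF moderate_const \<sigma>(1)] G i])
    have "scalc m h ?A c = 0"
      using XY(1)[unfolded Z_def, rule_format, of ?A] A GU GW \<sigma>(2) by auto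
    moreover have "scalc m h ?B c = 0"
      using XY(2)[unfolded Z_def, rule_format, of ?B] B GU GW \<sigma>(3) by auto
    moreover have "G = (\<lambda>x. ?A x + ?B x)" by (simp add: algebra_simps)
    ultimately show "scalc m h G c = 0" using scalc_add[OF h A B, of c] by simp
  qed
  \<comment> \<open>\<open>inc_induct\<close> runs from \<open>i = m\<close> down to
    \<open>i = 0\<close>; each step frees the coordinate \<open>i\<close>, and at 0 no restriction
    is left.\<close>
  have claim: "\<exists>\<epsilon>>0. Z (\<lambda>t. \<forall>l<i. \<bar>t l - x l\<bar> \<le> \<epsilon>)" if "i \<le> m" for i and x :: "nat \<Rightarrow> real"
    using that
  proof (induction i arbitrary: x rule: inc_induct)
    case base
    show ?case
    proof (cases "\<forall>l<m. complex_of_real (x l) \<in> spectrum h")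
      case True
      then have "x \<in> U" using U(2) by blast
      then obtain \<epsilon> where \<epsilon>: "\<epsilon> > 0" "\<And>t. (\<And>l. l < m \<Longrightarrow> \<bar>t l - x l\<bar> \<le> \<epsilon>) \<Longrightarrow> (\<And>l. m \<le> l \<Longrightarrow> t l = x l) \<Longrightarrow> t \<in> U"
        using open_fun_box[OF U(1), of x m] by metis
      have "Z (\<lambda>t. \<forall>l<m. \<bar>t l - x l\<bar> \<le> \<epsilon>)"
        unfolding Z_def
      proof (intro allI impI)
        fix G assume G: "schwartz m G" and GU: "\<forall>t\<in>U. G t = 0" and GW: "\<forall>t. G t \<noteq> 0 \<longrightarrow> (\<forall>l<m. \<bar>t l - x l\<bar> \<le> \<epsilon>)"
        have "G t = 0" for t
        proof (rule ccontr)
          assume nz: "G t \<noteq> 0"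
          \<comment> \<open>The box says nothing about coordinates from \<open>m\<close> on, while
            \<open>U\<close> is reached only if they agree with \<open>x\<close>; \<open>G\<close>
            does not see the change.\<close>
          let ?t = "\<lambda>l. if l < m then t l else x l"
          have "?t \<in> U" using GW nz by (intro \<epsilon>(2)) auto
          then have "G ?t = 0" using GU by blast
          moreover have "G ?t = G t" by (rule depends_onD[OF smooth_depends_on[OF schwartz_smooth[OF G]]]) simp
          ultimately show False using nz by simp
        qed
        then have "G = (\<lambda>x. 0)" by blast
        then show "scalc m h G c = 0" using scalc_zero[OF h] by simp
      qed
      then show ?thesis using \<epsilon>(1) by blast
    next
      case False
      then obtain l where l: "l < m" "complex_of_real (x l) \<notin> spectrum h" by blast
      obtain \<epsilon> where \<epsilon>: "\<epsilon> > 0" "\<And>G. schwartz m G \<Longrightarrow> (\<And>t. G t \<noteq> 0 \<Longrightarrow> \<bar>t l - x l\<bar> \<le> \<epsilon>) \<Longrightarrow> scalc m h G c = 0"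
        using scalc_local[OF l] by metis
      then have "Z (\<lambda>t. \<forall>l<m. \<bar>t l - x l\<bar> \<le> \<epsilon>)" unfolding Z_def using l(1) by blast
      then show ?thesis using \<epsilon>(1) by blast
    qed
  next
    case (step i)
    \<comment> \<open>A property of intervals for coordinate \<open>i\<close> that is suited to
      bisection; the margin on both sides lets adjacent intervals overlap.\<close>
    define P where "P a b \<longleftrightarrow> (\<exists>\<epsilon>>0. Z (\<lambda>t. (\<forall>l<i. \<bar>t l - x l\<bar> \<le> \<epsilon>) \<and> a - \<epsilon> \<le> t i \<and> t i \<le> b + \<epsilon>))" for a b
    define R where "R = norm h + 1"
    have "P (- R - 1) (R + 1)"
    proof (rule Bolzano)
      show "- R - 1 \<le> R + 1" using norm_ge_zero[of h] by (simp add: R_def)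
    next
      fix a b c' assume ab: "P a b" and bc: "P b c'" and le: "a \<le> b" "b \<le> c'"
      obtain e1 where e1: "e1 > 0" "Z (\<lambda>t. (\<forall>l<i. \<bar>t l - x l\<bar> \<le> e1) \<and> a - e1 \<le> t i \<and> t i \<le> b + e1)"
        using ab unfolding P_def by blast
      obtain e2 where e2: "e2 > 0" "Z (\<lambda>t. (\<forall>l<i. \<bar>t l - x l\<bar> \<le> e2) \<and> b - e2 \<le> t i \<and> t i \<le> c' + e2)"
        using bc unfolding P_def by blast
      define e where "e = min e1 e2"
      have e: "e > 0" "e \<le> e1" "e \<le> e2" using e1 e2 by (auto simp: e_def)
      \<comment> \<open>A step rising from 0 at \<open>b - e\<close> to 1 at \<open>b + e\<close>
        splits \<open>G\<close> inside the overlap of the two intervals at \<open>b\<close>.\<close>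
      let ?\<sigma> = "\<lambda>t. step ((e - b) / (2 * e) + (1 / (2 * e)) * t)"
      have s: "(e - b) / (2 * e) + (1 / (2 * e)) * t = (t - (b - e)) / (2 * e)" for t
        by (simp add: add_divide_distrib[symmetric])
      have \<sigma>0: "?\<sigma> t = 0" if "t \<le> b - e" for t
        unfolding s using that e(1) by (intro step_0) (simp add: divide_le_0_iff)
      have \<sigma>1: "?\<sigma> t = 1" if "t \<ge> b + e" for t
        unfolding s using that e(1) by (intro step_1) (simp add: le_divide_eq)
      have "Z (\<lambda>t. (\<forall>l<i. \<bar>t l - x l\<bar> \<le> e) \<and> a - e \<le> t i \<and> t i \<le> c' + e)"
      proof (rule Z_split[OF e2(2) e1(2) step.hyps(2) moderate_affine[OF moderate_step]])
        fix t assume W: "(\<forall>l<i. \<bar>t l - x l\<bar> \<le> e) \<and> a - e \<le> t i \<and> t i \<le> c' + e"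
        show "(\<forall>l<i. \<bar>t l - x l\<bar> \<le> e2) \<and> b - e2 \<le> t i \<and> t i \<le> c' + e2" if "?\<sigma> (t i) \<noteq> 0"
          using W that \<sigma>0[of "t i"] e by force
        show "(\<forall>l<i. \<bar>t l - x l\<bar> \<le> e1) \<and> a - e1 \<le> t i \<and> t i \<le> b + e1" if "?\<sigma> (t i) \<noteq> 1"
          using W that \<sigma>1[of "t i"] e by force
      qed
      then show "P a c'" unfolding P_def using e(1) by blast
    next
      fix y
      \<comment> \<open>The induction hypothesis is used at \<open>x\<close> with coordinate
        \<open>i\<close> moved to \<open>y\<close>. Half of its radius pays for the length of the
        interval, the other half for the margin.\<close>
      obtain e where e: "e > 0" "Z (\<lambda>t. \<forall>l<Suc i. \<bar>t l - (x(i := y)) l\<bar> \<le> e)"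
        using step.IH[of "x(i := y)"] by blast
      have "P a b" if "a \<le> y" "y \<le> b" "b - a < e / 2" for a b
      proof -
        have "Z (\<lambda>t. (\<forall>l<i. \<bar>t l - x l\<bar> \<le> e / 2) \<and> a - e / 2 \<le> t i \<and> t i \<le> b + e / 2)"
        proof (rule Z_mono[OF e(2)])
          fix t assume t: "(\<forall>l<i. \<bar>t l - x l\<bar> \<le> e / 2) \<and> a - e / 2 \<le> t i \<and> t i \<le> b + e / 2"
          show "\<forall>l<Suc i. \<bar>t l - (x(i := y)) l\<bar> \<le> e"
          proof (intro allI impI)
            fix l assume "l < Suc i"
            then consider "l < i" | "l = i" by linarith
            then show "\<bar>t l - (x(i := y)) l\<bar> \<le> e"
            proof cases
              case 1
              then have "\<bar>t l - x l\<bar> \<le> e / 2" using t by blast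
              then show ?thesis using 1 e(1) by simp
            next
              case 2
              then show ?thesis using t that e(1) by (simp add: abs_le_iff)
            qed
          qed
        qed
        then show ?thesis unfolding P_def using e(1) half_gt_zero by blast
      qed
      then show "\<exists>d>0. \<forall>a b. a \<le> y \<and> y \<le> b \<and> b - a < d \<longrightarrow> P a b"
        using e(1) by (intro exI[of _ "e / 2"]) auto
    qed
    then obtain e where e: "e > 0" "Z (\<lambda>t. (\<forall>l<i. \<bar>t l - x l\<bar> \<le> e) \<and> - R - 1 - e \<le> t i \<and> t i \<le> R + 1 + e)"
      unfolding P_def by blast
    \<comment> \<open>Bisection covers a bounded interval only. Beyond the norm of \<open>h\<close>
      the tail estimate applies, and a cutoff between \<open>R\<close> and \<open>R + 1\<close>
      joins the two regions.\<close>
    have "Z (\<lambda>t. R \<le> \<bar>t i\<bar>)"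
      unfolding Z_def
    proof (intro allI impI)
      fix G assume "schwartz m G" "\<forall>t. G t \<noteq> 0 \<longrightarrow> R \<le> \<bar>t i\<bar>"
      then show "scalc m h G c = 0" using step.hyps(2) by (intro scalc_tail[of i m R]) (auto simp: R_def)
    qed
    then have "Z (\<lambda>t. \<forall>l<i. \<bar>t l - x l\<bar> \<le> e)"
    proof (rule Z_split[OF e(2) _ step.hyps(2) moderate_cutoff[of R "R + 1"]])
      fix t assume W: "\<forall>l<i. \<bar>t l - x l\<bar> \<le> e"
      show "(\<forall>l<i. \<bar>t l - x l\<bar> \<le> e) \<and> - R - 1 - e \<le> t i \<and> t i \<le> R + 1 + e" if "cutoff R (R + 1) (t i) \<noteq> 0"
      proof -
        have "\<not> R + 1 \<le> \<bar>t i\<bar>" using that cutoff_0[of R "R + 1" "t i"] by auto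
        then show ?thesis using W e(1) by auto
      qed
      show "R \<le> \<bar>t i\<bar>" if "cutoff R (R + 1) (t i) \<noteq> 1"
        using that cutoff_1[of R "R + 1" "t i"] by (cases "\<bar>t i\<bar> \<le> R") auto
    qed
    then show ?case using e(1) by blast
  qed
  obtain \<epsilon> where "Z (\<lambda>t. \<forall>l<0. \<bar>t l - 0\<bar> \<le> \<epsilon>)" using claim[of 0 "\<lambda>_. 0"] by auto
  then show ?thesis unfolding Z_def using G GU by simp
qed

end

section \<open>Cutoffs of cubes, well-definedness of the calculus and its value on monomials\<close>

text \<open>The transition ends at \<open>R + 1\<close>, which is therefore the radius of the cube
  on which polynomials must approximate later.\<close>

definition chi :: "nat \<Rightarrow> real \<Rightarrow> (nat \<Rightarrow> real) \<Rightarrow> complex" where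
  "chi m R x = (\<Prod>i<m. cutoff R (R + 1) (x i))"

lemma smooth_chi: "smooth m (chi m R)"
  unfolding chi_def[abs_def] by (intro smooth_prod smooth_coord moderate_cutoff) auto

lemma chi_1: "(\<And>i. i < m \<Longrightarrow> \<bar>x i\<bar> \<le> R) \<Longrightarrow> chi m R x = 1"
  unfolding chi_def by (intro prod.neutral ballI cutoff_1) auto

lemma chi_0: "i < m \<Longrightarrow> R + 1 \<le> \<bar>x i\<bar> \<Longrightarrow> chi m R x = 0"
  unfolding chi_def by (rule prod_zero) (auto intro!: bexI[of _ i] cutoff_0)

lemma schwartz_chi_mult:
  assumes "smooth m F" shows "schwartz m (\<lambda>x. chi m R x * F x)"
  by (rule schwartz_compact_support[where R="R + 1"])
     (auto intro: smooth_mult smooth_chi assms simp: chi_0)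

lemma schwartz_chi: "schwartz m (chi m R)"
  using schwartz_chi_mult[OF smooth_const[of m 1], of R] by simp

lemma open_cube: "open {x :: nat \<Rightarrow> real. \<forall>i<m. \<bar>x i\<bar> < R}"
proof -
  have "{x :: nat \<Rightarrow> real. \<forall>i<m. \<bar>x i\<bar> < R} = (\<Inter>i\<in>{..<m}. {x. \<bar>x i\<bar> < R})" by auto
  moreover have "open {x :: nat \<Rightarrow> real. \<bar>x i\<bar> < R}" for i
    by (intro open_Collect_less continuous_on_rabs continuous_on_product_coordinates continuous_on_const)
  ultimately show ?thesis by (simp add: open_INT)
qed

lemma spectrum_cube:
  assumes "norm h < R"
  shows "{t. \<forall>i<m. complex_of_real (t i) \<in> spectrum h} \<subseteq> {x. \<forall>i<m. \<bar>x i\<bar> < R}"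
proof (rule subsetI, rule CollectI, intro allI impI)
  fix t i assume "t \<in> {t. \<forall>i<m. complex_of_real (t i) \<in> spectrum h}" "i < m"
  then have "cmod (complex_of_real (t i)) \<le> norm h" by (intro spectrum_bound) auto
  then show "\<bar>t i\<bar> < R" using assms by simp
qed

text \<open>A constant vector leaves the integral by linearity in the scalar factor. This evaluates
  the limiting case in \<open>scalc_chi\<close>, where the word is constant.\<close>

lemma has_vector_integral_scaleC:
  fixes v :: "'a::cstar_algebra" and g :: "'b \<Rightarrow> complex"
  assumes g: "integrable M g" and ex: "has_vector_integral M (\<lambda>x. g x *\<^sub>C v) I"
  shows "I = (LINT x|M. g x) *\<^sub>C v"
proof -
  have "has_bochner_integral M g (LINT x|M. g x)" using g by (rule has_bochner_integral_integrable)
  then obtain s where s: "g \<in> borel_measurable M" "\<And>i. sbi M (s i)"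
    "(\<lambda>i. \<integral>\<^sup>+x. norm (g x - s i x) \<partial>M) \<longlonglongrightarrow> 0" "(\<lambda>i. sbint M (s i)) \<longlonglongrightarrow> (LINT x|M. g x)"
    by (auto simp: has_bochner_integral.simps)
  have "simple_function M (s i)" for i using s(2)[of i] by (auto elim: simple_bochner_integrable.cases)
  then have [measurable]: "s i \<in> borel_measurable M" for i by (rule borel_measurable_simple_function)
  note [measurable] = s(1)
  have "(\<lambda>x. norm (g x - s i x)) \<in> borel_measurable M" for i by measurable
  then have "has_vector_integral M g (LINT x|M. g x)"
    unfolding has_vector_integral_def using s(2-4) by blast
  then show ?thesis
    using has_vector_integral_linear_unique[of M g "LINT x|M. g x" "\<lambda>z. z *\<^sub>C v" I] ex
      scaleC.bounded_linear_left by blast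
qed

definition monomial :: "nat \<Rightarrow> (nat \<Rightarrow> nat) \<Rightarrow> (nat \<Rightarrow> real) \<Rightarrow> complex" where
  "monomial m \<alpha> x = (\<Prod>i<m. complex_of_real (x i ^ \<alpha> i))"

text \<open>The value that the calculus turns out to give to a monomial: the powers of
  \<open>h\<close> interlaced with the coefficients.\<close>

primrec wmono :: "nat \<Rightarrow> 'b::monoid_mult \<Rightarrow> (nat \<Rightarrow> nat) \<Rightarrow> (nat \<Rightarrow> 'b) \<Rightarrow> 'b" where
  "wmono 0 g \<alpha> c = 1"
| "wmono (Suc m) g \<alpha> c = wmono m g \<alpha> c * (c m * g ^ \<alpha> m)"

lemma word_eq_wmono: "word m h (\<lambda>k. c k * h ^ \<alpha> k) (\<lambda>_. 0) = wmono m h \<alpha> c"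
  by (induction m) simp_all

context
  fixes h :: "'a::cstar_algebra"
  assumes h: "star h = h"
begin

lemma scalc_cong_spectrum:
  assumes U: "open U" "{t. \<forall>i<m. complex_of_real (t i) \<in> spectrum h} \<subseteq> U"
    and FG: "schwartz m F" "schwartz m G" "\<And>t. t \<in> U \<Longrightarrow> F t = G t"
  shows "scalc m h F c = scalc m h G c"
proof -
  have "scalc m h (\<lambda>x. F x - G x) c = 0"
    by (rule scalc_vanish[OF h U schwartz_diff[OF FG(1,2)]]) (simp add: FG)
  then show ?thesis using scalc_diff[OF h FG(1,2)] by simp
qed

lemma scalc_chi:
  assumes R: "norm h < R"
  shows "scalc m h (chi m R) c = word m h c (\<lambda>_. 0)"
proof -
  \<comment> \<open>The value is that of the dilated cutoff \<open>chi m R (s x)\<close> for all \<open>0 < s \<le> 1\<close>; let \<open>s\<close> tend to \<open>0\<close>.\<close>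
  let ?M = "lborel_n m" and ?w = "word m h c (\<lambda>_. 0)" and ?g = "fourier m (chi m R)" and ?T = "scalc m h (chi m R) c"
  have R0: "0 < R" using R norm_ge_zero[of h] by linarith
  have g: "integrable ?M ?g" by (rule integrable_fourier[OF schwartz_chi])
  have W: "continuous_on UNIV (\<lambda>\<xi>. word m h c (\<lambda>i. s * \<xi> i))" "depends_on m (\<lambda>\<xi>. word m h c (\<lambda>i. s * \<xi> i))" for s
  proof -
    have "continuous_on UNIV (\<lambda>\<xi> i. s * \<xi> i :: real)"
      by (intro continuous_on_coordinatewise_then_product continuous_on_mult continuous_on_const continuous_on_product_coordinates)
    from continuous_on_compose2[OF continuous_on_word this] show "continuous_on UNIV (\<lambda>\<xi>. word m h c (\<lambda>i. s * \<xi> i))" by simp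
    show "depends_on m (\<lambda>\<xi>. word m h c (\<lambda>i. s * \<xi> i))" unfolding depends_on_def by (auto intro: word_cong)
  qed
  have J: "has_vector_integral ?M (\<lambda>\<xi>. ?g \<xi> *\<^sub>C word m h c (\<lambda>i. s * \<xi> i)) ?T" if s: "0 < s" "s \<le> 1" for s
  proof -
    let ?G = "\<lambda>x. chi m R (\<lambda>i. s * x i)"
    have G: "schwartz m ?G"
    proof (rule schwartz_compact_support[where R="(R + 1) / s"])
      have "moderate (\<lambda>t. cutoff R (R + 1) (s * t))" using moderate_affine[OF moderate_cutoff, of R "R + 1" 0 s] by simp
      then show "smooth m ?G" unfolding chi_def by (intro smooth_prod smooth_coord[where f="\<lambda>t. cutoff R (R + 1) (s * t)"]) auto
      fix x i assume "i < m" "(R + 1) / s < \<bar>x i\<bar>"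
      then show "?G x = 0" using s by (intro chi_0[of i]) (auto simp: abs_mult pos_divide_less_eq mult.commute)
    qed
    \<comment> \<open>As \<open>s \<le> 1\<close>, both cutoffs equal 1 on the open cube of radius
      \<open>R\<close>, which contains all tuples of spectral values.\<close>
    have TG: "scalc m h ?G c = ?T"
    proof (rule scalc_cong_spectrum[OF open_cube spectrum_cube[OF R] G schwartz_chi])
      fix t assume "t \<in> {x. \<forall>i<m. \<bar>x i\<bar> < R}"
      then have t: "\<And>i. i < m \<Longrightarrow> \<bar>t i\<bar> < R" by simp
      have "chi m R t = 1" using t by (intro chi_1) (simp add: less_imp_le)
      moreover have "?G t = 1"
      proof (rule chi_1)
        fix i assume "i < m"
        have "\<bar>s * t i\<bar> \<le> 1 * \<bar>t i\<bar>" unfolding abs_mult using s by (intro mult_right_mono) auto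
        then show "\<bar>s * t i\<bar> \<le> R" using t[OF \<open>i < m\<close>] by simp
      qed
      ultimately show "?G t = chi m R t" by simp
    qed
    have FG: "fourier m ?G \<xi> = complex_of_real ((1 / s) ^ m) * ?g (\<lambda>i. \<xi> i / s)" for \<xi>
    proof -
      let ?f = "\<lambda>x. chi m R x * ech m (\<lambda>i. \<xi> i / s) x"
      have "?f (affine_n m (\<lambda>_. 0) s x) = ?G x * ech m \<xi> x" for x
      proof -
        have "chi m R (affine_n m (\<lambda>_. 0) s x) = chi m R (\<lambda>i. s * x i)"
          by (rule depends_onD[OF smooth_depends_on[OF smooth_chi]]) (simp add: affine_n_def)
        moreover have "ech m (\<lambda>i. \<xi> i / s) (affine_n m (\<lambda>_. 0) s x) = ech m \<xi> x"
          unfolding ech_def using s by (simp add: affine_n_def)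
        ultimately show ?thesis by simp
      qed
      then have "(LINT x|?M. ?G x * ech m \<xi> x) = (1 / s) ^ m *\<^sub>R (LINT x|?M. ?f x)"
        using integral_affine_n[OF s(1), of ?f m "\<lambda>_. 0"] schwartz_measurable[OF schwartz_mult_ech[OF schwartz_chi]] by simp
      then show ?thesis by (simp add: fourier_altdef scaleR_conv_of_real mult_ac)
    qed
    \<comment> \<open>Substituting \<open>s * \<xi>\<close> for \<open>\<xi>\<close> moves the
      dilation from the transform into the word; the Jacobian appears on both sides and is cancelled
      below.\<close>
    have "has_vector_integral ?M (\<lambda>\<xi>. fourier m ?G (affine_n m (\<lambda>_. 0) s \<xi>) *\<^sub>C word m h c (affine_n m (\<lambda>_. 0) s \<xi>)) ((1 / s) ^ m *\<^sub>R ?T)"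
      using has_vector_integral_affine[OF s(1) scalc_has_integral[OF h G, of c]] unfolding TG .
    moreover have "fourier m ?G (affine_n m (\<lambda>_. 0) s \<xi>) *\<^sub>C word m h c (affine_n m (\<lambda>_. 0) s \<xi>) =
        (1 / s) ^ m *\<^sub>R (?g \<xi> *\<^sub>C word m h c (\<lambda>i. s * \<xi> i))" for \<xi>
    proof -
      have "?g (\<lambda>i. affine_n m (\<lambda>_. 0) s \<xi> i / s) = ?g \<xi>"
        by (rule depends_onD[OF depends_on_fourier]) (use s in \<open>simp add: affine_n_def\<close>)
      moreover have "word m h c (affine_n m (\<lambda>_. 0) s \<xi>) = word m h c (\<lambda>i. s * \<xi> i)"
        by (rule word_cong) (simp_all add: affine_n_def)
      ultimately show ?thesis by (simp only: FG scaleC_scaleC[symmetric] scaleC_of_real)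
    qed
    ultimately have I: "has_vector_integral ?M (\<lambda>\<xi>. (1 / s) ^ m *\<^sub>R (?g \<xi> *\<^sub>C word m h c (\<lambda>i. s * \<xi> i))) ((1 / s) ^ m *\<^sub>R ?T)" by simp
    obtain J where J: "has_vector_integral ?M (\<lambda>\<xi>. ?g \<xi> *\<^sub>C word m h c (\<lambda>i. s * \<xi> i)) J"
      using has_vector_integral_exists[OF g W norm_word_le[OF h]] by blast
    have "(1 / s) ^ m *\<^sub>R ?T = (1 / s) ^ m *\<^sub>R J"
      by (rule has_vector_integral_linear_unique[OF J I bounded_linear_scaleR_right])
    then have "?T = J" using s by simp
    then show ?thesis using J by simp
  qed
  \<comment> \<open>At \<open>s = 0\<close> the word is constant, and by Fourier inversion the
    integral of \<open>?g\<close> is the value of the cutoff at the origin, namely 1.\<close>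
  have I0: "has_vector_integral ?M (\<lambda>\<xi>. ?g \<xi> *\<^sub>C ?w) ?w"
  proof -
    obtain I where I: "has_vector_integral ?M (\<lambda>\<xi>. ?g \<xi> *\<^sub>C ?w) I"
      using has_vector_integral_exists[OF g, of "\<lambda>_. ?w" "norm ?w"] by (auto simp: depends_on_def)
    have "chi m R (\<lambda>_. 0) = 1" by (rule chi_1) (use R0 in simp)
    then have "I = ?w" using has_vector_integral_scaleC[OF g I] integral_fourier[OF schwartz_chi, of m R] by simp
    then show ?thesis using I by simp
  qed
  define s where "s n = 1 / real (Suc n)" for n
  have s: "0 < s n" "s n \<le> 1" for n by (auto simp: s_def)
  have slim: "s \<longlonglongrightarrow> 0"
    unfolding s_def by (rule LIMSEQ_Suc[OF lim_inverse_n', unfolded inverse_eq_divide])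
  define d where "d n \<xi> = word m h c (\<lambda>i. s n * \<xi> i) - ?w" for n \<xi>
  have dc: "continuous_on UNIV (d n)" "depends_on m (d n)" for n
    unfolding d_def using W[of "s n"] by (auto intro: continuous_intros simp: depends_on_def)
  have db: "norm (d n \<xi>) \<le> 2 * csize m c" for n \<xi>
    unfolding d_def using norm_triangle_ineq4[of "word m h c (\<lambda>i. s n * \<xi> i)" ?w]
      norm_word_le[OF h, of m c "\<lambda>i. s n * \<xi> i"] norm_word_le[OF h, of m c "\<lambda>_. 0"] by linarith
  have gd: "cmod (?g \<xi>) * norm (d n \<xi>) \<le> 2 * csize m c * cmod (?g \<xi>)" for n \<xi>
    using mult_left_mono[OF db[of n \<xi>] norm_ge_zero[of "?g \<xi>"]] by (subst mult.commute[of "2 * csize m c"])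
  have dm: "(\<lambda>\<xi>. norm (d n \<xi>)) \<in> borel_measurable ?M" for n
    by (rule measurable_lborel_n[OF continuous_on_norm[OF dc(1)]])
       (use dc(2)[of n] in \<open>unfold depends_on_def, metis\<close>)
  have le: "norm (?T - ?w) \<le> (LINT \<xi>|?M. cmod (?g \<xi>) * norm (d n \<xi>))" for n
  proof -
    obtain I where I: "has_vector_integral ?M (\<lambda>\<xi>. ?g \<xi> *\<^sub>C d n \<xi>) I"
      using has_vector_integral_exists[OF g dc db] by blast
    have "?T = I + ?w"
      by (rule has_vector_integral_add_unique[OF I I0 J[OF s[of n]]]) (simp add: d_def scaleC_simps)
    moreover have "norm I \<le> (LINT \<xi>|?M. cmod (?g \<xi>) * norm (d n \<xi>))"
    proof (rule has_vector_integral_norm_le[OF I])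
      show "integrable ?M (\<lambda>\<xi>. cmod (?g \<xi>) * norm (d n \<xi>))"
      proof (rule Bochner_Integration.integrable_bound[OF integrable_mult_right[OF integrable_norm[OF g], of "2 * csize m c"]])
        show "(\<lambda>\<xi>. cmod (?g \<xi>) * norm (d n \<xi>)) \<in> borel_measurable ?M" using g dm[of n] by measurable
        show "AE \<xi> in ?M. norm (cmod (?g \<xi>) * norm (d n \<xi>)) \<le> norm (2 * csize m c * cmod (?g \<xi>))"
          using gd[of _ n] by (intro AE_I2) (simp add: abs_mult)
      qed
    qed (simp add: norm_scaleC)
    ultimately show ?thesis by simp
  qed
  have "(\<lambda>n. LINT \<xi>|?M. cmod (?g \<xi>) * norm (d n \<xi>)) \<longlonglongrightarrow> (LINT \<xi>|?M. 0)"
  proof (rule integral_dominated_convergence[where w="\<lambda>\<xi>. 2 * csize m c * cmod (?g \<xi>)"])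
    show "integrable ?M (\<lambda>\<xi>. 2 * csize m c * cmod (?g \<xi>))" using g by simp
    show "(\<lambda>\<xi>. cmod (?g \<xi>) * norm (d n \<xi>)) \<in> borel_measurable ?M" for n using g dm[of n] by measurable
    show "AE \<xi> in ?M. norm (cmod (?g \<xi>) * norm (d n \<xi>)) \<le> 2 * csize m c * cmod (?g \<xi>)" for n
      using gd[of _ n] by (intro AE_I2) (simp add: abs_mult)
    show "AE \<xi> in ?M. (\<lambda>n. cmod (?g \<xi>) * norm (d n \<xi>)) \<longlonglongrightarrow> 0"
    proof (rule AE_I2)
      fix \<xi> :: "nat \<Rightarrow> real"
      have "(\<lambda>n i. s n * \<xi> i) \<longlonglongrightarrow> (\<lambda>_. 0)"
        by (rule tendsto_funI) (rule tendsto_mult_left_zero[OF slim])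
      then have "(\<lambda>n. word m h c (\<lambda>i. s n * \<xi> i)) \<longlonglongrightarrow> ?w"
        using continuous_on_word[of m h c]
        by (intro isCont_tendsto_compose[of "\<lambda>_. 0" "word m h c"]) (auto simp: continuous_on_eq_continuous_at)
      then have "(\<lambda>n. d n \<xi>) \<longlonglongrightarrow> 0" unfolding d_def by (rule LIM_zero)
      then show "(\<lambda>n. cmod (?g \<xi>) * norm (d n \<xi>)) \<longlonglongrightarrow> 0"
        by (intro tendsto_mult_right_zero tendsto_norm_zero)
    qed
  qed simp
  then have "norm (?T - ?w) \<le> 0"
    using le by (intro LIMSEQ_le_const[of "\<lambda>n. LINT \<xi>|?M. cmod (?g \<xi>) * norm (d n \<xi>)"]) auto
  then show ?thesis by simp
qed

text \<open>Any other admissible \<open>G'\<close> agrees with \<open>G\<close> on the intersection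
  of the two neighbourhoods, which is again a neighbourhood of the spectral tuples. So the definite
  description has exactly one candidate.\<close>

lemma func_calc_eq:
  assumes G: "schwartz (Suc (length bs)) G" and U: "open U"
    "{t. \<forall>i<Suc (length bs). complex_of_real (t i) \<in> spectrum h} \<subseteq> U" "\<And>t. t \<in> U \<Longrightarrow> G t = F t"
  shows "func_calc F h bs = scalc (Suc (length bs)) h G (slot_coeffs bs)"
  unfolding func_calc_def Let_def exp_word_eq
proof (rule the_equality)
  let ?m = "Suc (length bs)"
  show "\<exists>G' U. schwartz ?m G' \<and> open U \<and> {t. \<forall>i<?m. complex_of_real (t i) \<in> spectrum h} \<subseteq> U \<and> (\<forall>t\<in>U. G' t = F t) \<and>
    has_vector_integral (lborel_n ?m) (\<lambda>\<xi>. fourier ?m G' \<xi> *\<^sub>C word ?m h (slot_coeffs bs) \<xi>) (scalc ?m h G (slot_coeffs bs))"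
    using scalc_has_integral[OF h G] G U by blast
  fix a
  assume "\<exists>G U. schwartz ?m G \<and> open U \<and> {t. \<forall>i<?m. complex_of_real (t i) \<in> spectrum h} \<subseteq> U \<and> (\<forall>t\<in>U. G t = F t) \<and>
    has_vector_integral (lborel_n ?m) (\<lambda>\<xi>. fourier ?m G \<xi> *\<^sub>C word ?m h (slot_coeffs bs) \<xi>) a"
  then obtain G' U' where G': "schwartz ?m G'" "open U'" "{t. \<forall>i<?m. complex_of_real (t i) \<in> spectrum h} \<subseteq> U'"
    "\<forall>t\<in>U'. G' t = F t" "has_vector_integral (lborel_n ?m) (\<lambda>\<xi>. fourier ?m G' \<xi> *\<^sub>C word ?m h (slot_coeffs bs) \<xi>) a"
    by blast
  have "a = scalc ?m h G' (slot_coeffs bs)" by (rule scalc_unique[OF h G'(1,5)])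
  also have "\<dots> = scalc ?m h G (slot_coeffs bs)"
    by (rule scalc_cong_spectrum[OF open_Int[OF U(1) G'(2)] _ G'(1) G]) (use U G' in auto)
  finally show "a = scalc ?m h G (slot_coeffs bs)" .
qed

lemma func_calc_chi:
  assumes "norm h < R" "smooth (Suc (length bs)) F"
  shows "func_calc F h bs = scalc (Suc (length bs)) h (\<lambda>x. chi (Suc (length bs)) R x * F x) (slot_coeffs bs)"
proof (rule func_calc_eq[OF schwartz_chi_mult[OF assms(2)] open_cube spectrum_cube[OF assms(1)]])
  fix t assume t: "t \<in> {x. \<forall>i<Suc (length bs). \<bar>x i\<bar> < R}"
  have "chi (Suc (length bs)) R t = 1" by (rule chi_1) (use t in \<open>auto simp: less_imp_le\<close>)
  then show "chi (Suc (length bs)) R t * F t = F t" by simp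
qed

text \<open>The powers are moved into the coefficients one variable at a time, as powers of
  \<open>x n - 0\<close>; what remains is the bare cutoff, whose value is the product of the
  coefficients.\<close>

lemma scalc_chi_monomial:
  assumes R: "norm h < R"
  shows "scalc m h (\<lambda>x. chi m R x * monomial m \<alpha> x) c = wmono m h \<alpha> c"
proof -
  have "scalc m h (\<lambda>x. (\<Prod>i<n. complex_of_real (x i ^ \<alpha> i)) * chi m R x) c =
      scalc m h (chi m R) (\<lambda>k. if k < n then c k * h ^ \<alpha> k else c k) \<and>
      schwartz m (\<lambda>x. (\<Prod>i<n. complex_of_real (x i ^ \<alpha> i)) * chi m R x)" if "n \<le> m" for n
    using that
  proof (induction n arbitrary: c)
    case 0
    then show ?case using schwartz_chi by simp
  next
    case (Suc n)
    let ?G = "\<lambda>x. (\<Prod>i<n. complex_of_real (x i ^ \<alpha> i)) * chi m R x"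
    have G: "schwartz m ?G" and n: "n < m" using Suc by auto
    have eq: "(\<lambda>x. (\<Prod>i<Suc n. complex_of_real (x i ^ \<alpha> i)) * chi m R x) = (\<lambda>x. complex_of_real ((x n - 0) ^ \<alpha> n) * ?G x)"
      by (simp add: mult_ac)
    have "scalc m h (\<lambda>x. complex_of_real ((x n - 0) ^ \<alpha> n) * ?G x) c = scalc m h ?G (c(n := c n * (h - of_real 0) ^ \<alpha> n))"
      using scalc_shift_power[OF h G n, of 0 "\<alpha> n" c] by blast
    also have "\<dots> = scalc m h (chi m R) (\<lambda>k. if k < n then (c(n := c n * (h - of_real 0) ^ \<alpha> n)) k * h ^ \<alpha> k else (c(n := c n * (h - of_real 0) ^ \<alpha> n)) k)"
      by (rule Suc.IH[THEN conjunct1]) (use n in simp)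
    also have "\<dots> = scalc m h (chi m R) (\<lambda>k. if k < Suc n then c k * h ^ \<alpha> k else c k)"
      by (intro scalc_cong[OF h]) (auto simp: less_Suc_eq)
    finally show ?case unfolding eq using scalc_shift_power[OF h G n, of 0 "\<alpha> n" c] by blast
  qed
  from this[of m] have "scalc m h (\<lambda>x. chi m R x * monomial m \<alpha> x) c =
      scalc m h (chi m R) (\<lambda>k. if k < m then c k * h ^ \<alpha> k else c k)"
    by (simp add: monomial_def mult.commute)
  also have "\<dots> = scalc m h (chi m R) (\<lambda>k. c k * h ^ \<alpha> k)" by (intro scalc_cong[OF h]) simp
  finally show ?thesis by (simp add: scalc_chi[OF R] word_eq_wmono)
qed

end

section \<open>Approximation by polynomials together with all derivatives\<close>

lemma pd_fun_upd_commute: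
  assumes "j \<noteq> i"
  shows "partial_deriv i (\<lambda>x. F (x(j := a))) x = partial_deriv i F (x(j := a))"
  unfolding partial_deriv_def using assms by (simp add: fun_upd_twist)

lemma pds_fun_upd:
  assumes "j \<notin> set is"
  shows "pds is (\<lambda>x. F (x(j := a))) = (\<lambda>x. pds is F (x(j := a)))"
  using assms
proof (induction "is")
  case (Cons i "is")
  then have IH: "pds is (\<lambda>x. F (x(j := a))) = (\<lambda>x. pds is F (x(j := a)))"
    by (intro Cons.IH) simp
  have "pds (i # is) (\<lambda>x. F (x(j := a))) = partial_deriv i (\<lambda>x. pds is F (x(j := a)))"
    by (simp only: foldr_Cons comp_apply IH)
  also have "\<dots> = (\<lambda>x. partial_deriv i (pds is F) (x(j := a)))"
    using Cons.prems by (intro ext pd_fun_upd_commute) auto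
  finally show ?case by (simp only: foldr_Cons comp_apply)
qed simp

lemma smooth_restrict:
  assumes "smooth m F" "j < m"
  shows "smooth m (\<lambda>x. F (x(j := 0)))"
proof (rule smooth_coinduct)
  let ?X = "{\<lambda>x. F (x(j := 0)) | F. smooth m F}"
  show "(\<lambda>x. F (x(j := 0))) \<in> ?X" using assms by blast
  fix H assume "H \<in> ?X"
  then obtain F where H: "H = (\<lambda>x. F (x(j := 0)))" and F: "smooth m F" by blast
  have "continuous_on UNIV (\<lambda>x :: nat \<Rightarrow> real. x(j := 0))"
  proof (rule continuous_on_coordinatewise_then_product)
    show "continuous_on UNIV (\<lambda>x :: nat \<Rightarrow> real. (x(j := 0)) l)" for l by (cases "l = j") auto
  qed
  from continuous_on_compose2[OF smooth_continuous[OF F] this]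
  show "depends_on m H \<and> continuous_on UNIV H"
    using smooth_depends_on[OF F] unfolding H depends_on_def by auto
  fix i assume i: "i < m"
  show "\<exists>G\<in>?X. \<forall>x. ((\<lambda>t. H (x(i := t))) has_vector_derivative G x) (at (x i))"
  proof (cases "i = j")
    case True
    have "(\<lambda>x. 0) \<in> ?X" using smooth_const[of m 0] by (intro CollectI exI[of _ "\<lambda>x. 0"]) simp
    moreover have "\<forall>x. ((\<lambda>t. H (x(i := t))) has_vector_derivative 0) (at (x i))"
      using True by (simp add: H)
    ultimately show ?thesis by (intro bexI[of _ "\<lambda>x. 0"])
  next
    case False
    have "(\<lambda>x. partial_deriv i F (x(j := 0))) \<in> ?X" using smooth_partial_deriv[OF F i] by blast
    moreover have "\<forall>x. ((\<lambda>t. H (x(i := t))) has_vector_derivative partial_deriv i F (x(j := 0))) (at (x i))"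
    proof
      fix x
      have "(\<lambda>t. H (x(i := t))) = (\<lambda>t. F ((x(j := 0))(i := t)))" unfolding H using False by (simp only: fun_upd_twist not_False_eq_True)
      then show "((\<lambda>t. H (x(i := t))) has_vector_derivative partial_deriv i F (x(j := 0))) (at (x i))"
        using smooth_has_vector_derivative_at[OF F i, of "x(j := 0)"] False by simp
    qed
    ultimately show ?thesis by (intro bexI[of _ "\<lambda>x. partial_deriv i F (x(j := 0))"])
  qed
qed

lemma continuous_on_fun_upd2: "continuous_on S (\<lambda>p. (x(i := fst p))(j := snd p) :: nat \<Rightarrow> real)"
proof (rule continuous_on_coordinatewise_then_product)
  show "continuous_on S (\<lambda>p. ((x(i := fst p))(j := snd p)) l)" for l
    by (cases "l = j"; cases "l = i") (auto intro!: continuous_intros)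
qed

lemma continuous_on_fun_upd: "continuous_on S (\<lambda>t. x(i := t) :: nat \<Rightarrow> real)"
proof (rule continuous_on_coordinatewise_then_product)
  show "continuous_on S (\<lambda>t. (x(i := t)) l)" for l by (cases "l = i") auto
qed

text \<open>Recover \<open>F\<close> from its \<open>j\<close>-th derivative by integrating in
  \<open>x j\<close>, differentiate under the integral sign in \<open>x i\<close>, and then
  differentiate in the upper limit.\<close>

lemma partial_deriv_commute:
  assumes F: "smooth m F" and ij: "i < m" "j < m"
  shows "partial_deriv i (partial_deriv j F) = partial_deriv j (partial_deriv i F)"
proof (cases "i = j")
  case ne: False
  note Fj = smooth_partial_deriv[OF F ij(2)] and Fi = smooth_partial_deriv[OF F ij(1)]
  note Fij = smooth_partial_deriv[OF Fj ij(1)]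
  show ?thesis
  proof
    fix x :: "nat \<Rightarrow> real"
    \<comment> \<open>The base point of the integration; any point strictly left of
      \<open>x j\<close> would do, so that \<open>x j\<close> is interior to the interval.\<close>
    define b where "b = x j - 1"
    have cont: "continuous_on S (\<lambda>v. H (y(j := v)))" if "smooth m H" for S H and y :: "nat \<Rightarrow> real"
      by (rule continuous_on_compose2[OF smooth_continuous[OF that] continuous_on_fun_upd]) auto
    have ftc: "F (y(j := t)) = F (y(j := b)) + integral {b..t} (\<lambda>v. partial_deriv j F (y(j := v)))" if "b \<le> t" for y t
    proof -
      have "((\<lambda>v. partial_deriv j F (y(j := v))) has_integral (F (y(j := t)) - F (y(j := b)))) {b..t}"
        by (rule fundamental_theorem_of_calculus[OF that])
           (rule has_vector_derivative_at_within[OF smooth_has_vector_derivative[OF F ij(2)]])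
      then show ?thesis by (simp add: integral_unique)
    qed
    have key: "partial_deriv i F (x(j := t)) = partial_deriv i F (x(j := b)) +
        integral {b..t} (\<lambda>v. partial_deriv i (partial_deriv j F) (x(j := v)))" if t: "b \<le> t" for t
    proof (rule partial_derivI)
      let ?f = "\<lambda>s v. partial_deriv j F ((x(i := s))(j := v))"
      have L: "((\<lambda>s. integral (cbox b t) (?f s)) has_vector_derivative
          integral (cbox b t) (\<lambda>v. partial_deriv i (partial_deriv j F) ((x(i := x i))(j := v)))) (at (x i) within UNIV)"
      proof (rule leibniz_rule_vector_derivative[where fx="\<lambda>s v. partial_deriv i (partial_deriv j F) ((x(i := s))(j := v))"])
        fix s v
        have "((\<lambda>s. partial_deriv j F ((x(j := v))(i := s))) has_vector_derivative
            partial_deriv i (partial_deriv j F) ((x(j := v))(i := s))) (at s)"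
          by (rule smooth_has_vector_derivative[OF Fj ij(1)])
        then show "((\<lambda>s. ?f s v) has_vector_derivative partial_deriv i (partial_deriv j F) ((x(i := s))(j := v))) (at s within UNIV)"
          using ne by (simp add: fun_upd_twist[of i j])
      next
        fix s show "?f s integrable_on cbox b t"
          by (simp add: integrable_continuous_real cont[OF Fj])
      next
        have "continuous_on (UNIV \<times> cbox b t) (\<lambda>p. partial_deriv i (partial_deriv j F) ((x(i := fst p))(j := snd p)))"
          by (rule continuous_on_compose2[OF smooth_continuous[OF Fij] continuous_on_fun_upd2]) auto
        then show "continuous_on (UNIV \<times> cbox b t) (\<lambda>(s, v). partial_deriv i (partial_deriv j F) ((x(i := s))(j := v)))"
          by (simp add: case_prod_unfold)
      qed auto
      have D: "((\<lambda>s. F ((x(i := s))(j := b)) + integral {b..t} (?f s)) has_vector_derivative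
         partial_deriv i F (x(j := b)) + integral {b..t} (\<lambda>v. partial_deriv i (partial_deriv j F) (x(j := v)))) (at (x i))"
      proof (rule has_vector_derivative_add)
        show "((\<lambda>s. F ((x(i := s))(j := b))) has_vector_derivative partial_deriv i F (x(j := b))) (at (x i))"
          using smooth_has_vector_derivative[OF F ij(1), of "x(j := b)" "x i"] ne
          by (simp add: fun_upd_twist[of i j]) (metis fun_upd_triv fun_upd_twist)
        show "((\<lambda>s. integral {b..t} (?f s)) has_vector_derivative integral {b..t} (\<lambda>v. partial_deriv i (partial_deriv j F) (x(j := v)))) (at (x i))"
          using L by (simp only: cbox_interval fun_upd_triv)
      qed
      have "(\<lambda>s. F ((x(j := t))(i := s))) = (\<lambda>s. F ((x(i := s))(j := b)) + integral {b..t} (?f s))"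
      proof
        fix s
        have "(x(j := t))(i := s) = (x(i := s))(j := t)" by (rule fun_upd_twist) (use ne in simp)
        then show "F ((x(j := t))(i := s)) = F ((x(i := s))(j := b)) + integral {b..t} (?f s)"
          by (simp only: ftc[OF t])
      qed
      then show "((\<lambda>s. F ((x(j := t))(i := s))) has_vector_derivative
         partial_deriv i F (x(j := b)) + integral {b..t} (\<lambda>v. partial_deriv i (partial_deriv j F) (x(j := v)))) (at ((x(j := t)) i))"
        using D ne by simp
    qed
    have I: "((\<lambda>t. integral {b..t} (\<lambda>v. partial_deriv i (partial_deriv j F) (x(j := v)))) has_vector_derivative
        partial_deriv i (partial_deriv j F) (x(j := x j))) (at (x j) within {b..x j + 1})"
      by (rule integral_has_vector_derivative[OF cont[OF Fij]]) (simp add: b_def)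
    then have I': "((\<lambda>t. integral {b..t} (\<lambda>v. partial_deriv i (partial_deriv j F) (x(j := v)))) has_vector_derivative
        partial_deriv i (partial_deriv j F) x) (at (x j))"
      by (simp add: at_within_Icc_at b_def)
    have "((\<lambda>t. partial_deriv i F (x(j := t))) has_vector_derivative 0 + partial_deriv i (partial_deriv j F) x) (at (x j))"
    proof (rule has_vector_derivative_transform_within_open[OF has_vector_derivative_add[OF has_vector_derivative_const I']])
      show "open {b<..}" "x j \<in> {b<..}" by (auto simp: b_def)
      fix t assume "t \<in> {b<..}"
      then show "partial_deriv i F (x(j := b)) + integral {b..t} (\<lambda>v. partial_deriv i (partial_deriv j F) (x(j := v))) = partial_deriv i F (x(j := t))"
        using key[of t] by simp
    qed
    then have "partial_deriv j (partial_deriv i F) x = 0 + partial_deriv i (partial_deriv j F) x"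
      by (rule partial_derivI)
    then show "partial_deriv i (partial_deriv j F) x = partial_deriv j (partial_deriv i F) x" by simp
  qed
qed simp

lemma partial_deriv_pds_commute:
  assumes "smooth m F" "set is \<subseteq> {..<m}" "j < m"
  shows "partial_deriv j (pds is F) = pds is (partial_deriv j F)"
  using assms(2)
proof (induction "is")
  case (Cons i "is")
  then have i: "i < m" and "is": "set is \<subseteq> {..<m}" by auto
  have "partial_deriv j (pds (i # is) F) = partial_deriv i (partial_deriv j (pds is F))"
    using partial_deriv_commute[OF smooth_pds[OF assms(1) "is"] assms(3) i] by simp
  then show ?case using Cons.IH[OF "is"] by simp
qed simp

text \<open>Derivatives commute, so an occurrence of \<open>j\<close> can be carried to the
  innermost place.\<close>

lemma pds_remove1:
  assumes "smooth m F" "set is \<subseteq> {..<m}" "j \<in> set is"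
  shows "pds is F = pds (remove1 j is) (partial_deriv j F)"
  using assms(2,3)
proof (induction "is")
  case (Cons i "is")
  then have "is": "set is \<subseteq> {..<m}" and i: "i < m" by auto
  show ?case
  proof (cases "i = j")
    case True
    then show ?thesis using partial_deriv_pds_commute[OF assms(1) "is" i] by simp
  next
    case False
    then show ?thesis using Cons "is" by simp
  qed
qed simp

inductive_set polyfun :: "nat \<Rightarrow> ((nat \<Rightarrow> real) \<Rightarrow> complex) set" for m where
  mono: "(\<lambda>x. a * monomial m \<alpha> x) \<in> polyfun m"
| add: "P \<in> polyfun m \<Longrightarrow> Q \<in> polyfun m \<Longrightarrow> (\<lambda>x. P x + Q x) \<in> polyfun m"

lemma smooth_monomial: "smooth m (monomial m \<alpha>)"
proof -
  have "moderate (\<lambda>t. complex_of_real (t ^ n))" for n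
    using moderate_power[OF moderate_of_real, of n] by simp
  then show ?thesis
    unfolding monomial_def[abs_def] by (intro smooth_prod smooth_coord[where f="\<lambda>t. complex_of_real (t ^ _)"]) auto
qed

lemma smooth_polyfun: "P \<in> polyfun m \<Longrightarrow> smooth m P"
  by (induction rule: polyfun.induct) (auto intro: smooth_cmult smooth_monomial smooth_add)

lemma monomial_mult: "monomial m \<alpha> x * monomial m \<beta> x = monomial m (\<lambda>i. \<alpha> i + \<beta> i) x"
  by (simp add: monomial_def power_add prod.distrib)

lemma polyfun_const: "(\<lambda>x. a) \<in> polyfun m"
  using polyfun.mono[of a m "\<lambda>_. 0"] by (simp add: monomial_def)

lemma monomial_single: "j < m \<Longrightarrow> monomial m (\<lambda>i. if i = j then n else 0) x = complex_of_real (x j ^ n)"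
proof -
  assume "j < m"
  have "(\<Prod>i<m. complex_of_real (x i ^ (if i = j then n else 0))) = (\<Prod>i<m. if i = j then complex_of_real (x j ^ n) else 1)"
    by (rule prod.cong) auto
  then show ?thesis using \<open>j < m\<close> by (simp add: monomial_def)
qed

lemma polyfun_coord: "j < m \<Longrightarrow> (\<lambda>x. complex_of_real (x j)) \<in> polyfun m"
  using polyfun.mono[of 1 m "\<lambda>i. if i = j then 1 else 0"] monomial_single[of j m 1] by simp

lemma polyfun_mult: "P \<in> polyfun m \<Longrightarrow> Q \<in> polyfun m \<Longrightarrow> (\<lambda>x. P x * Q x) \<in> polyfun m"
proof (induction rule: polyfun.induct)
  case (mono a \<alpha>)
  show ?case using mono
  proof (induction rule: polyfun.induct)
    case (mono b \<beta>)
    have "(\<lambda>x. a * monomial m \<alpha> x * (b * monomial m \<beta> x)) = (\<lambda>x. a * b * monomial m (\<lambda>i. \<alpha> i + \<beta> i) x)"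
      by (simp add: monomial_mult[symmetric] mult_ac)
    then show ?case using polyfun.mono by metis
  next
    case (add P Q)
    then show ?case using polyfun.add[OF add.IH] by (simp add: distrib_left)
  qed
next
  case (add P1 P2)
  then show ?case using polyfun.add[of "\<lambda>x. P1 x * Q x" m "\<lambda>x. P2 x * Q x"] by (simp add: distrib_right)
qed

lemma monomial_remove:
  assumes "j < m"
  shows "monomial m \<alpha> x = complex_of_real (x j ^ \<alpha> j) * (\<Prod>i\<in>{..<m} - {j}. complex_of_real (x i ^ \<alpha> i))"
  unfolding monomial_def by (rule prod.remove) (use assms in auto)

lemma polyfun_restrict:
  assumes "P \<in> polyfun m" "j < m" shows "(\<lambda>x. P (x(j := 0))) \<in> polyfun m"
  using assms(1)
proof (induction rule: polyfun.induct)
  case (mono a \<alpha>)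
  have "monomial m \<alpha> (x(j := 0)) = (if \<alpha> j = 0 then 1 else 0) * monomial m \<alpha> x" for x
    by (simp add: monomial_remove[OF assms(2)])
  then have "(\<lambda>x. a * monomial m \<alpha> (x(j := 0))) = (\<lambda>x. a * (if \<alpha> j = 0 then 1 else 0) * monomial m \<alpha> x)"
    by (simp add: mult.assoc)
  then show ?case using polyfun.mono by metis
next
  case (add P Q)
  then show ?case by (intro polyfun.add)
qed

text \<open>Normalising the antiderivative to vanish on the hyperplane \<open>x j = 0\<close> leaves
  the values there free to be prescribed by another polynomial.\<close>

lemma polyfun_antiderivative:
  assumes "P \<in> polyfun m" "j < m"
  shows "\<exists>Q\<in>polyfun m. partial_deriv j Q = P \<and> (\<forall>x. x j = 0 \<longrightarrow> Q x = 0)"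
  using assms(1)
proof (induction rule: polyfun.induct)
  case (mono a \<alpha>)
  let ?\<beta> = "\<alpha>(j := Suc (\<alpha> j))"
  let ?Q = "\<lambda>x. a / of_nat (Suc (\<alpha> j)) * monomial m ?\<beta> x"
  have mb: "monomial m ?\<beta> x = complex_of_real (x j ^ Suc (\<alpha> j)) * (\<Prod>i\<in>{..<m} - {j}. complex_of_real (x i ^ \<alpha> i))" for x
    by (subst monomial_remove[OF assms(2)]) simp
  have "partial_deriv j ?Q = (\<lambda>x. a * monomial m \<alpha> x)"
  proof (rule ext, rule partial_derivI)
    fix x :: "nat \<Rightarrow> real"
    let ?r = "\<Prod>i\<in>{..<m} - {j}. complex_of_real (x i ^ \<alpha> i)"
    have e: "?Q (x(j := t)) = (a / of_nat (Suc (\<alpha> j)) * ?r) * complex_of_real (t ^ Suc (\<alpha> j))" for t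
      unfolding mb by (simp add: mult_ac)
    have "((\<lambda>t. t ^ Suc (\<alpha> j)) has_real_derivative real (Suc (\<alpha> j)) * x j ^ \<alpha> j) (at (x j))"
      using DERIV_pow[of "Suc (\<alpha> j)" "x j"] by simp
    from has_vector_derivative_mult_right[OF of_real_has_vector_derivative[OF this], of "a / of_nat (Suc (\<alpha> j)) * ?r"]
    show "((\<lambda>t. ?Q (x(j := t))) has_vector_derivative a * monomial m \<alpha> x) (at (x j))"
      unfolding e monomial_remove[OF assms(2), of \<alpha> x] by (simp add: mult_ac del: of_nat_Suc)
  qed
  moreover have "?Q x = 0" if "x j = 0" for x unfolding mb using that by simp
  ultimately show ?case using polyfun.mono[of _ m ?\<beta>] by blast
next
  case (add P Q)
  then obtain A B where AB: "A \<in> polyfun m" "partial_deriv j A = P" "\<forall>x. x j = 0 \<longrightarrow> A x = 0"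
    "B \<in> polyfun m" "partial_deriv j B = Q" "\<forall>x. x j = 0 \<longrightarrow> B x = 0" by blast
  have "partial_deriv j (\<lambda>x. A x + B x) = (\<lambda>x. P x + Q x)"
    using partial_deriv_add[OF smooth_polyfun[OF AB(1)] smooth_polyfun[OF AB(4)] assms(2)] AB by simp
  then show ?case using polyfun.add[OF AB(1,4)] AB(3,6) by (intro bexI[of _ "\<lambda>x. A x + B x"]) auto
qed

text \<open>Stone-Weierstrass for real and imaginary part separately. Polynomials separate points by
  the first \<open>m\<close> coordinates only, so the compact box is reduced to 0 in all the others
  and \<open>trunc\<close> transfers the result.\<close>

lemma polyfun_dense:
  assumes F: "continuous_on UNIV F" "depends_on m F" and e: "0 < e"
  shows "\<exists>P\<in>polyfun m. \<forall>x. (\<forall>i<m. \<bar>x i\<bar> \<le> R) \<longrightarrow> cmod (P x - F x) \<le> e"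
proof -
  let ?K = "{x :: nat \<Rightarrow> real. \<forall>i. x i \<in> {(if i < m then - R else 0)..(if i < m then R else 0)}}"
  let ?P = "{f. (\<lambda>x. complex_of_real (f x)) \<in> polyfun m}"
  have "\<exists>f\<in>?P. \<forall>x\<in>?K. \<bar>g x - f x\<bar> < e / 2" if g: "continuous_on ?K g" for g
  proof -
    interpret function_ring_on ?P ?K
    proof
      show "compact ?K" by (rule compact_box)
      show "continuous_on ?K f" if "f \<in> ?P" for f
      proof -
        have "continuous_on UNIV (\<lambda>x. complex_of_real (f x))" using that smooth_polyfun smooth_continuous by blast
        from continuous_on_Re[OF this] have "continuous_on UNIV f" by simp
        then show ?thesis by (rule continuous_on_subset) simp
      qed
      show "(\<lambda>x. f x + g x) \<in> ?P" if "f \<in> ?P" "g \<in> ?P" for f g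
        using polyfun.add[of "\<lambda>x. complex_of_real (f x)" m "\<lambda>x. complex_of_real (g x)"] that by simp
      show "(\<lambda>x. f x * g x) \<in> ?P" if "f \<in> ?P" "g \<in> ?P" for f g
        using polyfun_mult[of "\<lambda>x. complex_of_real (f x)" m "\<lambda>x. complex_of_real (g x)"] that by simp
      show "(\<lambda>_. c) \<in> ?P" for c using polyfun_const by simp
      fix x y assume xy: "x \<in> ?K" "y \<in> ?K" "x \<noteq> y"
      then obtain i where i: "x i \<noteq> y i" by blast
      have "i < m"
      proof (rule ccontr)
        assume ni: "\<not> i < m"
        have "x i \<in> {(if i < m then - R else 0)..(if i < m then R else 0)}" using xy(1) by blast
        moreover have "y i \<in> {(if i < m then - R else 0)..(if i < m then R else 0)}" using xy(2) by blast
        ultimately show False using i ni by simp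
      qed
      then show "\<exists>f\<in>?P. f x \<noteq> f y" using polyfun_coord[of i m] i by (intro bexI[of _ "\<lambda>x. x i"]) auto
    qed
    show ?thesis by (rule Stone_Weierstrass_basic[OF g]) (use e in simp)
  qed
  note sw = this
  have "continuous_on ?K (\<lambda>x. Re (F x))" "continuous_on ?K (\<lambda>x. Im (F x))"
    by (auto intro!: continuous_intros continuous_on_subset[OF F(1)])
  from sw[OF this(1)] sw[OF this(2)] obtain f g where fg: "f \<in> ?P" "\<forall>x\<in>?K. \<bar>Re (F x) - f x\<bar> < e / 2"
    "g \<in> ?P" "\<forall>x\<in>?K. \<bar>Im (F x) - g x\<bar> < e / 2" by blast
  let ?Q = "\<lambda>x. complex_of_real (f x) + \<i> * complex_of_real (g x)"
  have Q: "?Q \<in> polyfun m" using fg by (intro polyfun.add polyfun_mult polyfun_const) auto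
  have le: "cmod (?Q x - F x) \<le> e" if x: "\<forall>i<m. \<bar>x i\<bar> \<le> R" for x
  proof -
    have xK: "trunc m x \<in> ?K" using x by (auto simp: trunc_def abs_le_iff)
    have "\<bar>Re (F (trunc m x)) - f (trunc m x)\<bar> < e / 2" "\<bar>Im (F (trunc m x)) - g (trunc m x)\<bar> < e / 2"
      using fg xK by blast+
    then have "cmod (?Q (trunc m x) - F (trunc m x)) \<le> e"
      using cmod_le[of "?Q (trunc m x) - F (trunc m x)"] by (simp, linarith)
    then show ?thesis
      using depends_on_trunc[OF F(2)] depends_on_trunc[OF smooth_depends_on[OF smooth_polyfun[OF Q]], of x] by simp
  qed
  show ?thesis by (rule bexI[of _ ?Q], intro allI impI, rule le, assumption, rule Q)
qed

section \<open>Simultaneous approximation of derivatives\<close>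

text \<open>The order is limited in each variable separately, because integrating an approximation
  in variable \<open>j\<close> raises exactly \<open>\<alpha> j\<close> by one.\<close>

definition close :: "nat \<Rightarrow> real \<Rightarrow> (nat \<Rightarrow> nat) \<Rightarrow> real \<Rightarrow> ((nat \<Rightarrow> real) \<Rightarrow> complex) \<Rightarrow> bool" where
  "close m R \<alpha> e E \<longleftrightarrow> (\<forall>is x. set is \<subseteq> {..<m} \<longrightarrow> (\<forall>i. count_list is i \<le> \<alpha> i) \<longrightarrow> (\<forall>i<m. \<bar>x i\<bar> \<le> R) \<longrightarrow>
     cmod (pds is E x) \<le> e)"

lemma closeD:
  "close m R \<alpha> e E \<Longrightarrow> set is \<subseteq> {..<m} \<Longrightarrow> (\<And>i. count_list is i \<le> \<alpha> i) \<Longrightarrow> (\<And>i. i < m \<Longrightarrow> \<bar>x i\<bar> \<le> R) \<Longrightarrow>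
     cmod (pds is E x) \<le> e"
  unfolding close_def by blast

text \<open>A list containing \<open>j\<close> differentiates the \<open>j\<close>-th derivative,
  which is small by assumption. For other lists the mean value inequality along coordinate
  \<open>j\<close>, starting on the hyperplane \<open>x j = 0\<close>, costs \<open>e * R\<close> on
  top of \<open>e\<close>.\<close>

lemma close_step:
  assumes E: "smooth m E" and j: "j < m" and R: "0 \<le> R"
    and 1: "close m R \<alpha> e (partial_deriv j E)"
    and 2: "close m R \<alpha> e (\<lambda>x. E (x(j := 0)))"
  shows "close m R (\<alpha>(j := Suc (\<alpha> j))) (e * (1 + R)) E"
  unfolding close_def
proof (intro allI impI)
  fix "is" and x :: "nat \<Rightarrow> real"
  assume "is": "set is \<subseteq> {..<m}" and cnt: "\<forall>i. count_list is i \<le> (\<alpha>(j := Suc (\<alpha> j))) i" and x: "\<forall>i<m. \<bar>x i\<bar> \<le> R"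
  have "cmod (pds [] (partial_deriv j E) (\<lambda>_. 0)) \<le> e" by (rule closeD[OF 1]) (use R in auto)
  then have e0: "0 \<le> e" by (rule order_trans[OF norm_ge_zero])
  show "cmod (pds is E x) \<le> e * (1 + R)"
  proof (cases "j \<in> set is")
    case True
    have c: "count_list (remove1 j is) i \<le> \<alpha> i" for i
      using cnt[rule_format, of i] True by (cases "i = j") (auto simp: count_list_remove1)
    have "cmod (pds (remove1 j is) (partial_deriv j E) x) \<le> e"
      by (rule closeD[OF 1]) (use c x "is" set_remove1_subset[of j "is"] in auto)
    then have "cmod (pds is E x) \<le> e" by (simp add: pds_remove1[OF E "is" True])
    also have "\<dots> \<le> e * (1 + R)" using mult_left_mono[of 1 "1 + R" e] e0 R by simp
    finally show ?thesis .
  next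
    case False
    have c: "count_list is i \<le> \<alpha> i" for i
      using cnt[rule_format, of i] False by (cases "i = j") (auto simp: count_list_0_iff)
    have xs: "\<forall>i<m. \<bar>(x(j := s)) i\<bar> \<le> R" if "\<bar>s\<bar> \<le> R" for s using x that by simp
    have d: "((\<lambda>s. pds is E (x(j := s))) has_derivative (\<lambda>u. u *\<^sub>R partial_deriv j (pds is E) (x(j := s)))) (at s within {- R..R})" for s
      using smooth_has_vector_derivative[OF smooth_pds[OF E "is"] j]
      by (auto simp: has_vector_derivative_def intro: has_derivative_at_withinI)
    have b: "onorm (\<lambda>u. u *\<^sub>R partial_deriv j (pds is E) (x(j := s))) \<le> e" if "s \<in> {- R..R}" for s
    proof (rule onorm_le)
      fix u :: real
      have "cmod (pds is (partial_deriv j E) (x(j := s))) \<le> e"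
        by (rule closeD[OF 1 "is"]) (use c x that in auto)
      from mult_right_mono[OF this abs_ge_zero[of u]]
      show "norm (u *\<^sub>R partial_deriv j (pds is E) (x(j := s))) \<le> e * norm u"
        by (simp add: partial_deriv_pds_commute[OF E "is" j] mult.commute[of "\<bar>u\<bar>"])
    qed
    have "norm (pds is E (x(j := x j)) - pds is E (x(j := 0))) \<le> e * norm (x j - 0)"
      by (rule differentiable_bound[OF convex_real_interval(5) d b]) (use x j R in auto)
    moreover have "cmod (pds is E (x(j := 0))) \<le> e"
    proof -
      have "cmod (pds is (\<lambda>x. E (x(j := 0))) x) \<le> e" by (rule closeD[OF 2 "is"]) (use c x in auto)
      then show ?thesis by (simp only: pds_fun_upd[OF False])
    qed
    moreover have "e * norm (x j - 0) \<le> e * R" using x j e0 by (intro mult_left_mono) auto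
    ultimately show ?thesis
      using norm_triangle_sub[of "pds is E x" "pds is E (x(j := 0))"] by (simp add: distrib_left)
  qed
qed

text \<open>Induction on the total order. One polynomial approximates the \<open>j\<close>-th
  derivative and another approximates \<open>F\<close>; the antiderivative of the first plus the
  restriction of the second to \<open>x j = 0\<close> approximates \<open>F\<close> with one more
  derivative in \<open>x j\<close>.\<close>

lemma polyfun_close:
  assumes R: "0 \<le> R"
  shows "\<forall>\<alpha>. (\<Sum>i<m. \<alpha> i) = n \<longrightarrow> (\<forall>i\<ge>m. \<alpha> i = 0) \<longrightarrow>
    (\<forall>F e. smooth m F \<longrightarrow> 0 < e \<longrightarrow> (\<exists>P\<in>polyfun m. close m R \<alpha> e (\<lambda>x. P x - F x)))"
proof (induction n)
  case 0
  show ?case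
  proof (intro allI impI)
    fix \<alpha> :: "nat \<Rightarrow> nat" and F e
    assume a: "(\<Sum>i<m. \<alpha> i) = 0" "\<forall>i\<ge>m. \<alpha> i = 0" and F: "smooth m F" and e: "0 < (e::real)"
    have "\<alpha> i = 0" for i using a by (cases "i < m") auto
    then have nil: "is = []" if "\<forall>i. count_list is i \<le> \<alpha> i" for "is"
    proof (cases "is")
      case (Cons a l)
      then have "1 \<le> count_list is a" by simp
      with that[rule_format, of a] \<open>\<alpha> a = 0\<close> show ?thesis by simp
    qed
    obtain P where P: "P \<in> polyfun m" "\<forall>x. (\<forall>i<m. \<bar>x i\<bar> \<le> R) \<longrightarrow> cmod (P x - F x) \<le> e"
      using polyfun_dense[OF smooth_continuous[OF F] smooth_depends_on[OF F] e] by blast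
    have "close m R \<alpha> e (\<lambda>x. P x - F x)"
      unfolding close_def
    proof (intro allI impI)
      fix "is" and x :: "nat \<Rightarrow> real"
      assume "\<forall>i. count_list is i \<le> \<alpha> i" and x: "\<forall>i<m. \<bar>x i\<bar> \<le> R"
      then have "is = []" by (intro nil)
      then show "cmod (pds is (\<lambda>x. P x - F x) x) \<le> e" using P(2) x by simp
    qed
    then show "\<exists>P\<in>polyfun m. close m R \<alpha> e (\<lambda>x. P x - F x)" using P(1) by blast
  qed
next
  case (Suc n)
  show ?case
  proof (intro allI impI)
    fix \<alpha> :: "nat \<Rightarrow> nat" and F e
    assume a: "(\<Sum>i<m. \<alpha> i) = Suc n" "\<forall>i\<ge>m. \<alpha> i = 0" and F: "smooth m F" and e: "0 < (e::real)"
    then obtain j where j: "j < m" "\<alpha> j \<noteq> 0"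
      by (metis (no_types, lifting) lessThan_iff nat.simps(3) sum.neutral)
    define \<beta> where "\<beta> = \<alpha>(j := \<alpha> j - 1)"
    have \<alpha>: "\<alpha> = \<beta>(j := Suc (\<beta> j))" using j by (simp add: \<beta>_def)
    have "(\<Sum>i<m. \<alpha> i) = Suc (\<Sum>i<m. \<beta> i)"
      using j(1) by (simp add: \<alpha> sum.remove[of "{..<m}" j])
    then have \<beta>: "(\<Sum>i<m. \<beta> i) = n" "\<forall>i\<ge>m. \<beta> i = 0" using a by (auto simp: \<beta>_def)
    \<comment> \<open>Compensates the factor \<open>1 + R\<close> lost in
      \<open>close_step\<close>.\<close>
    define d where "d = e / (1 + R)"
    have d: "0 < d" "d * (1 + R) = e" using e R by (auto simp: d_def)
    obtain P where P: "P \<in> polyfun m" "close m R \<beta> d (\<lambda>x. P x - partial_deriv j F x)"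
      using Suc[rule_format, OF \<beta>(1) _ smooth_partial_deriv[OF F j(1)] d(1)] \<beta>(2) by blast
    obtain p where p: "p \<in> polyfun m" "close m R \<beta> d (\<lambda>x. p x - F x)"
      using Suc[rule_format, OF \<beta>(1) _ F d(1)] \<beta>(2) by blast
    obtain A where A: "A \<in> polyfun m" "partial_deriv j A = P" "\<forall>x. x j = 0 \<longrightarrow> A x = 0"
      using polyfun_antiderivative[OF P(1) j(1)] by blast
    let ?p = "\<lambda>x. p (x(j := 0))"
    have p': "?p \<in> polyfun m" by (rule polyfun_restrict[OF p(1) j(1)])
    define Q where "Q x = ?p x + A x" for x
    have Q: "Q \<in> polyfun m" unfolding Q_def[abs_def] by (rule polyfun.add[OF p' A(1)])
    let ?E = "\<lambda>x. Q x - F x"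
    have E: "smooth m ?E" by (intro smooth_diff smooth_polyfun Q F)
    have "partial_deriv j ?p = (\<lambda>x. 0)" by (intro ext partial_derivI) simp
    then have "partial_deriv j ?E = (\<lambda>x. P x - partial_deriv j F x)"
      using partial_deriv_diff[OF smooth_polyfun[OF Q] F j(1)]
        partial_deriv_add[OF smooth_polyfun[OF p'] smooth_polyfun[OF A(1)] j(1)] A(2) by (simp add: Q_def[abs_def])
    then have 1: "close m R \<beta> d (partial_deriv j ?E)" using P(2) by simp
    have "(\<lambda>x. ?E (x(j := 0))) = (\<lambda>x. (\<lambda>x. p x - F x) (x(j := 0)))" using A(3) by (simp add: Q_def)
    \<comment> \<open>The restricted error does not vary with \<open>x j\<close>: lists containing
      \<open>j\<close> give 0, and all others commute with the restriction.\<close>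
    moreover have "close m R \<beta> d (\<lambda>x. (\<lambda>x. p x - F x) (x(j := 0)))"
      unfolding close_def
    proof (intro allI impI)
      fix "is" and x :: "nat \<Rightarrow> real"
      assume "is": "set is \<subseteq> {..<m}" and cnt: "\<forall>i. count_list is i \<le> \<beta> i" and x: "\<forall>i<m. \<bar>x i\<bar> \<le> R"
      show "cmod (pds is (\<lambda>x. (\<lambda>x. p x - F x) (x(j := 0))) x) \<le> d"
      proof (cases "j \<in> set is")
        case True
        have sm: "smooth m (\<lambda>x. (\<lambda>x. p x - F x) (x(j := 0)))"
          using smooth_restrict[OF smooth_diff[OF smooth_polyfun[OF p(1)] F] j(1)] by simp
        have "partial_deriv j (\<lambda>x. (\<lambda>x. p x - F x) (x(j := 0))) = (\<lambda>x. 0)" by (intro ext partial_derivI) simp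
        then have "pds is (\<lambda>x. (\<lambda>x. p x - F x) (x(j := 0))) = pds (remove1 j is) (\<lambda>x. 0)"
          by (subst pds_remove1[OF sm "is" True]) simp
        moreover have "pds l (\<lambda>x. 0) = (\<lambda>x. 0)" for l by (induction l) auto
        ultimately show ?thesis using d(1) by simp
      next
        case False
        have "\<forall>i<m. \<bar>(x(j := 0)) i\<bar> \<le> R" using x R by simp
        then have "cmod (pds is (\<lambda>x. p x - F x) (x(j := 0))) \<le> d"
          using cnt by (intro closeD[OF p(2) "is"]) auto
        then show ?thesis by (simp only: pds_fun_upd[OF False, of "\<lambda>x. p x - F x" 0])
      qed
    qed
    ultimately have 2: "close m R \<beta> d (\<lambda>x. ?E (x(j := 0)))" by simp
    have "close m R \<alpha> e ?E" using close_step[OF E j(1) R 1 2] d(2) by (simp only: \<alpha>[symmetric])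
    then show "\<exists>P\<in>polyfun m. close m R \<alpha> e (\<lambda>x. P x - F x)" using Q by blast
  qed
qed

definition uconv :: "nat \<Rightarrow> real \<Rightarrow> (nat \<Rightarrow> (nat \<Rightarrow> real) \<Rightarrow> complex) \<Rightarrow> bool" where
  "uconv m R H \<longleftrightarrow> (\<forall>is e. set is \<subseteq> {..<m} \<longrightarrow> 0 < e \<longrightarrow>
     (\<exists>N. \<forall>n\<ge>N. \<forall>x. (\<forall>i<m. \<bar>x i\<bar> \<le> R) \<longrightarrow> cmod (pds is (H n) x) \<le> e))"

text \<open>A diagonal choice: the \<open>n\<close>-th polynomial controls up to \<open>n\<close>
  derivatives in each variable with error \<open>1 / (n + 1)\<close>, so a given list of derivatives
  is covered from its length on.\<close>

lemma polyfun_uconv: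
  assumes R: "0 \<le> R" and F: "smooth m F"
  obtains P where "\<And>n. P n \<in> polyfun m" "uconv m R (\<lambda>n x. P n x - F x)"
proof -
  have "\<exists>P\<in>polyfun m. close m R (\<lambda>i. if i < m then n else 0) (1 / real (Suc n)) (\<lambda>x. P x - F x)" for n
    using polyfun_close[OF R, of m "\<Sum>i<m. (if i < m then n else 0)"] F by simp
  then obtain P where P: "\<And>n. P n \<in> polyfun m"
    "\<And>n. close m R (\<lambda>i. if i < m then n else 0) (1 / real (Suc n)) (\<lambda>x. P n x - F x)" by metis
  have "uconv m R (\<lambda>n x. P n x - F x)"
    unfolding uconv_def
  proof (intro allI impI)
    fix "is" and e :: real assume "is": "set is \<subseteq> {..<m}" and e: "0 < e"
    obtain N0 where N0: "1 / real (Suc N0) < e" using e nat_approx_posE by blast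
    have "cmod (pds is (\<lambda>x. P n x - F x) x) \<le> e" if n: "n \<ge> max N0 (length is)" and x: "\<forall>i<m. \<bar>x i\<bar> \<le> R" for n x
    proof -
      have "\<forall>i. count_list is i \<le> (if i < m then n else 0)"
      proof
        fix i show "count_list is i \<le> (if i < m then n else 0)"
          using n "is" count_le_length[of "is" i] by (auto simp: count_list_0_iff)
      qed
      then have "cmod (pds is (\<lambda>x. P n x - F x) x) \<le> 1 / real (Suc n)"
        using x by (intro closeD[OF P(2) "is"]) auto
      also have "\<dots> \<le> 1 / real (Suc N0)" using n by (intro divide_left_mono) auto
      finally show ?thesis using N0 by simp
    qed
    then show "\<exists>N. \<forall>n\<ge>N. \<forall>x. (\<forall>i<m. \<bar>x i\<bar> \<le> R) \<longrightarrow> cmod (pds is (\<lambda>x. P n x - F x) x) \<le> e" by blast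
  qed
  then show ?thesis using that P(1) by blast
qed

lemma uconv_partial_deriv: "uconv m R H \<Longrightarrow> i < m \<Longrightarrow> uconv m R (\<lambda>n. partial_deriv i (H n))"
  unfolding uconv_def
proof (intro allI impI)
  fix "is" and e :: real
  assume u: "\<forall>is e. set is \<subseteq> {..<m} \<longrightarrow> 0 < e \<longrightarrow> (\<exists>N. \<forall>n\<ge>N. \<forall>x. (\<forall>i<m. \<bar>x i\<bar> \<le> R) \<longrightarrow> cmod (pds is (H n) x) \<le> e)"
    and i: "i < m" and "is": "set is \<subseteq> {..<m}" and e: "0 < e"
  have "set (is @ [i]) \<subseteq> {..<m}" using i "is" by simp
  from u[rule_format, OF this e] show "\<exists>N. \<forall>n\<ge>N. \<forall>x. (\<forall>i<m. \<bar>x i\<bar> \<le> R) \<longrightarrow> cmod (pds is (partial_deriv i (H n)) x) \<le> e"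
    by simp
qed

lemma uconv_sum_aux:
  fixes A B :: "nat \<Rightarrow> 'x \<Rightarrow> complex"
  assumes "\<exists>N. \<forall>n\<ge>N. \<forall>x. Q x \<longrightarrow> cmod (A n x) \<le> (e::real) / 2" "\<exists>N. \<forall>n\<ge>N. \<forall>x. Q x \<longrightarrow> cmod (B n x) \<le> e / 2"
  shows "\<exists>N. \<forall>n\<ge>N. \<forall>x. Q x \<longrightarrow> cmod (A n x + B n x) \<le> e"
proof -
  from assms(1) obtain N1 where N1: "\<forall>n\<ge>N1. \<forall>x. Q x \<longrightarrow> cmod (A n x) \<le> e / 2" by (rule exE)
  from assms(2) obtain N2 where N2: "\<forall>n\<ge>N2. \<forall>x. Q x \<longrightarrow> cmod (B n x) \<le> e / 2" by (rule exE)
  show ?thesis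
  proof (intro exI[of _ "max N1 N2"] allI impI)
    fix n x assume "max N1 N2 \<le> n" and x: "Q x"
    then have n: "N1 \<le> n" "N2 \<le> n" by auto
    have "cmod (A n x) \<le> e / 2" using N1[rule_format, OF n(1) x] .
    moreover have "cmod (B n x) \<le> e / 2" using N2[rule_format, OF n(2) x] .
    ultimately show "cmod (A n x + B n x) \<le> e" using norm_triangle_ineq[of "A n x" "B n x"] by linarith
  qed
qed

lemma uconv_add:
  assumes "uconv m R A" "uconv m R B" "\<And>n. smooth m (A n)" "\<And>n. smooth m (B n)"
  shows "uconv m R (\<lambda>n x. A n x + B n x)"
  unfolding uconv_def
proof (intro allI impI)
  fix "is" and e :: real assume "is": "set is \<subseteq> {..<m}" and e: "0 < e"
  have "pds is (\<lambda>x. A n x + B n x) = (\<lambda>x. pds is (A n) x + pds is (B n) x)" for n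
    by (rule pds_add[OF assms(3,4) "is"])
  then show "\<exists>N. \<forall>n\<ge>N. \<forall>x. (\<forall>i<m. \<bar>x i\<bar> \<le> R) \<longrightarrow> cmod (pds is (\<lambda>x. A n x + B n x) x) \<le> e"
    using uconv_sum_aux[of "\<lambda>x. \<forall>i<m. \<bar>x i\<bar> \<le> R" "\<lambda>n. pds is (A n)" e "\<lambda>n. pds is (B n)"]
      assms(1,2)[unfolded uconv_def, rule_format, OF "is", of "e / 2"] e by simp
qed

text \<open>Induction from the innermost derivative with both factors generalised; in the base case
  \<open>F\<close> is bounded on the cube.\<close>

lemma uconv_mult:
  assumes "uconv m R H" "\<And>n. smooth m (H n)" "smooth m F"
  shows "uconv m R (\<lambda>n x. F x * H n x)"
  unfolding uconv_def
proof (intro allI impI)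
  fix "is" and e :: real assume "set is \<subseteq> {..<m}" and "0 < e"
  then show "\<exists>N. \<forall>n\<ge>N. \<forall>x. (\<forall>i<m. \<bar>x i\<bar> \<le> R) \<longrightarrow> cmod (pds is (\<lambda>x. F x * H n x) x) \<le> e"
    using assms
  proof (induction "is" arbitrary: F H e rule: rev_induct)
    case Nil
    obtain B where B: "0 \<le> B" "\<And>x. (\<And>i. i < m \<Longrightarrow> \<bar>x i\<bar> \<le> R) \<Longrightarrow> cmod (F x) \<le> B"
      using bounded_on_cube[OF smooth_continuous[OF Nil(5)] smooth_depends_on[OF Nil(5)]] by metis
    have "0 < e / (1 + B)" using Nil B by simp
    then obtain N where N: "\<forall>n\<ge>N. \<forall>x. (\<forall>i<m. \<bar>x i\<bar> \<le> R) \<longrightarrow> cmod (H n x) \<le> e / (1 + B)"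
      using Nil(3)[unfolded uconv_def, rule_format, of "[]" "e / (1 + B)"] by auto
    have "cmod (F x * H n x) \<le> e" if "n \<ge> N" "\<forall>i<m. \<bar>x i\<bar> \<le> R" for n x
    proof -
      have "cmod (F x) * cmod (H n x) \<le> (1 + B) * (e / (1 + B))"
        using B(2)[of x] N that B(1) by (intro mult_mono) (auto intro: order_trans[of _ B])
      then show ?thesis using B(1) by (simp add: norm_mult)
    qed
    then show ?case by auto
  next
    case (snoc i "is")
    then have i: "i < m" and "is": "set is \<subseteq> {..<m}" by auto
    have e2: "0 < e / 2" using snoc.prems by simp
    note sF = snoc.prems(5) and sH = snoc.prems(4)
    have "pds (is @ [i]) (\<lambda>x. F x * H n x) =
        (\<lambda>x. pds is (\<lambda>x. F x * partial_deriv i (H n) x) x + pds is (\<lambda>x. partial_deriv i F x * H n x) x)" for n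
      unfolding pds_snoc partial_deriv_mult[OF sF sH i]
      by (rule pds_add[OF smooth_mult[OF sF smooth_partial_deriv[OF sH i]] smooth_mult[OF smooth_partial_deriv[OF sF i] sH] "is"])
    moreover have "\<exists>N. \<forall>n\<ge>N. \<forall>x. (\<forall>i<m. \<bar>x i\<bar> \<le> R) \<longrightarrow> cmod (pds is (\<lambda>x. F x * partial_deriv i (H n) x) x) \<le> e / 2"
      by (rule snoc.IH[OF "is" e2 uconv_partial_deriv[OF snoc.prems(3) i] smooth_partial_deriv[OF sH i] sF])
    moreover have "\<exists>N. \<forall>n\<ge>N. \<forall>x. (\<forall>i<m. \<bar>x i\<bar> \<le> R) \<longrightarrow> cmod (pds is (\<lambda>x. partial_deriv i F x * H n x) x) \<le> e / 2"
      by (rule snoc.IH[OF "is" e2 snoc.prems(3) sH smooth_partial_deriv[OF sF i]])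
    ultimately show ?case
      using uconv_sum_aux[of "\<lambda>x. \<forall>i<m. \<bar>x i\<bar> \<le> R" "\<lambda>n. pds is (\<lambda>x. F x * partial_deriv i (H n) x)" e] by simp
  qed
qed

lemma smooth_Lop: "smooth m F \<Longrightarrow> i < m \<Longrightarrow> smooth m (Lop i F)"
  unfolding Lop_def by (intro smooth_diff smooth_partial_deriv)

lemma uconv_Lops:
  assumes "uconv m R H" "\<And>n. smooth m (H n)" "set is \<subseteq> {..<m}"
  shows "uconv m R (\<lambda>n. foldr Lop is (H n)) \<and> (\<forall>n. smooth m (foldr Lop is (H n)))"
  using assms(3)
proof (induction "is")
  case (Cons i "is")
  then have i: "i < m" and IH: "uconv m R (\<lambda>n. foldr Lop is (H n))" "\<And>n. smooth m (foldr Lop is (H n))" by auto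
  let ?K = "\<lambda>n. foldr Lop is (H n)"
  have 1: "uconv m R (\<lambda>n. partial_deriv i (partial_deriv i (?K n)))" by (intro uconv_partial_deriv IH i)
  have s: "smooth m (partial_deriv i (partial_deriv i (?K n)))" for n by (intro smooth_partial_deriv IH i)
  have "uconv m R (\<lambda>n x. ?K n x + (-1) * partial_deriv i (partial_deriv i (?K n)) x)"
    by (rule uconv_add[OF IH(1) uconv_mult[OF 1 s smooth_const] IH(2) smooth_cmult[OF s]])
  then have "uconv m R (\<lambda>n. Lop i (?K n))" by (simp add: Lop_def[abs_def])
  then show ?case using smooth_Lop[OF IH(2) i] by simp
qed (use assms in simp)

text \<open>The bound through \<open>fourier_L1_le\<close> involves finitely many derivatives of the
  cut-off functions. They tend to 0 uniformly on the cube of radius \<open>R + 1\<close> and vanish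
  outside it, so their \<open>L^1\<close> norms tend to 0.\<close>

lemma scalc_chi_uconv:
  fixes h :: "'a::cstar_algebra"
  assumes h: "star h = h" and H: "uconv m (R + 1) H" "\<And>n. smooth m (H n)" and R: "0 \<le> R"
  shows "(\<lambda>n. scalc m h (\<lambda>x. chi m R x * H n x) c) \<longlonglongrightarrow> 0"
proof -
  let ?G = "\<lambda>n x. chi m R x * H n x" and ?is = "[0..<m]"
  let ?L = "\<lambda>n. foldr Lop ?is (?G n)"
  \<comment> \<open>On the cube each \<open>1 + (x i)^2\<close> is at most
    \<open>1 + (R + 1)^2\<close>, so \<open>A\<close> times the product of Cauchy kernels dominates
    the indicator of the cube, and its integral is a known finite number.\<close>
  define A where "A = (1 + (R + 1)\<^sup>2) ^ m"
  define I where "I = (LINT x|lborel_n m. (\<Prod>i<m. 1 / (1 + (x i)\<^sup>2)))"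
  have A: "0 \<le> A" unfolding A_def by simp
  have nn: "0 \<le> (\<Prod>i<m. 1 / (1 + (x i)\<^sup>2))" for x :: "nat \<Rightarrow> real" by (intro prod_nonneg) auto
  have I: "0 \<le> I" unfolding I_def by (rule Bochner_Integration.integral_nonneg) (rule nn)
  have G: "schwartz m (?G n)" for n by (rule schwartz_chi_mult[OF H(2)])
  have "uconv m (R + 1) ?G" by (intro uconv_mult H smooth_chi)
  then have L: "uconv m (R + 1) ?L"
    using uconv_Lops[of m "R + 1" ?G ?is] schwartz_smooth[OF G] by (simp add: atLeast0LessThan)
  have LG: "schwartz m (?L n)" for n by (rule schwartz_Lops[OF G]) (simp add: atLeast0LessThan)
  have v: "?L n x = 0" if "i < m" "R + 1 < \<bar>x i\<bar>" for n x i
  proof -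
    have o: "open {t::real. R + 1 < \<bar>t\<bar>}" by (intro open_Collect_less continuous_intros)
    have "foldr Lop is (?G n) x = 0" if "R + 1 < \<bar>x i\<bar>" for "is" x
      using that
    proof (induction "is" arbitrary: x)
      case Nil
      then show ?case using chi_0[OF \<open>i < m\<close>] by simp
    next
      case (Cons l "is")
      have 1: "partial_deriv l (foldr Lop is (?G n)) x = 0" if "R + 1 < \<bar>x i\<bar>" for x
        by (rule partial_deriv_vanish[OF o, of i]) (use Cons.IH that in auto)
      have "partial_deriv l (partial_deriv l (foldr Lop is (?G n))) x = 0"
        by (rule partial_deriv_vanish[OF o, of i]) (use 1 Cons.prems in auto)
      then show ?case using Cons.IH[of x] Cons.prems by (simp add: Lop_def[of l "foldr Lop is (?G n)"])
    qed
    then show ?thesis using that by blast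
  qed
  have main: "norm (scalc m h (?G n) c) \<le> csize m c * (fl1_const m * (e * (A * I)))"
    if e: "0 \<le> e" and b: "\<forall>x. (\<forall>i<m. \<bar>x i\<bar> \<le> R + 1) \<longrightarrow> cmod (?L n x) \<le> e" for n e
  proof -
    have le: "cmod (?L n x) \<le> e * (A * (\<Prod>i<m. 1 / (1 + (x i)\<^sup>2)))" for x
    proof (cases "\<forall>i<m. \<bar>x i\<bar> \<le> R + 1")
      case True
      have "1 = (\<Prod>i<m. (1 + (x i)\<^sup>2) * (1 / (1 + (x i)\<^sup>2)))"
        by (rule prod.neutral[symmetric]) (auto simp: add_nonneg_eq_0_iff)
      also have "\<dots> \<le> (\<Prod>i<m. (1 + (R + 1)\<^sup>2) * (1 / (1 + (x i)\<^sup>2)))"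
      proof (rule prod_mono, safe)
        fix i assume "i < m"
        then have "(x i)\<^sup>2 \<le> (R + 1)\<^sup>2" using True R abs_le_square_iff[of "x i" "R + 1"] by simp
        then show "(1 + (x i)\<^sup>2) * (1 / (1 + (x i)\<^sup>2)) \<le> (1 + (R + 1)\<^sup>2) * (1 / (1 + (x i)\<^sup>2))"
          by (intro mult_right_mono) auto
      qed auto
      also have "\<dots> = A * (\<Prod>i<m. 1 / (1 + (x i)\<^sup>2))" by (simp only: A_def prod.distrib prod_constant card_lessThan)
      finally have "e * 1 \<le> e * (A * (\<Prod>i<m. 1 / (1 + (x i)\<^sup>2)))" using e by (rule mult_left_mono)
      then show ?thesis using b True by fastforce
    next
      case False
      then have "?L n x = 0" using v[of _ x n] by (auto simp: not_le)
      then show ?thesis using e A nn[of x] by simp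
    qed
    have "norm (scalc m h (?G n) c) \<le> csize m c * (fl1_const m * (LINT x|lborel_n m. cmod (?L n x)))"
      by (rule order_trans[OF norm_scalc_le[OF h G] mult_left_mono[OF fourier_L1_le[OF G] csize_nonneg]]) auto
    also have "\<dots> \<le> csize m c * (fl1_const m * (LINT x|lborel_n m. e * (A * (\<Prod>i<m. 1 / (1 + (x i)\<^sup>2)))))"
      by (intro mult_left_mono integral_mono csize_nonneg fl1_const_nonneg integrable_norm schwartz_integrable LG
          integrable_mult_right integrable_cauchy_n le)
    also have "\<dots> = csize m c * (fl1_const m * (e * (A * I)))" by (simp only: integral_mult_right_zero I_def)
    finally show ?thesis .
  qed
  define C where "C = csize m c * fl1_const m * A * I"
  have C: "0 \<le> C" unfolding C_def using A I fl1_const_nonneg by simp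
  show ?thesis
  proof (rule LIMSEQ_I)
    fix r :: real assume r: "0 < r"
    define e where "e = r / (2 * (1 + C))"
    have e: "0 < e" using r C by (simp add: e_def)
    obtain N where N: "\<forall>n\<ge>N. \<forall>x. (\<forall>i<m. \<bar>x i\<bar> \<le> R + 1) \<longrightarrow> cmod (?L n x) \<le> e"
      using L[unfolded uconv_def, rule_format, of "[]" e] e by auto
    have "norm (scalc m h (?G n) c) < r" if "n \<ge> N" for n
    proof -
      have "norm (scalc m h (?G n) c) \<le> e * C" using main[of e n] e N that by (simp add: C_def mult_ac)
      also have "\<dots> \<le> e * (1 + C)" using e by simp
      also have "\<dots> = r / 2" using C by (simp add: e_def field_simps)
      finally show ?thesis using r by simp
    qed
    then show "\<exists>N. \<forall>n\<ge>N. norm (scalc m h (?G n) c - 0) < r" by auto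
  qed
qed

section \<open>Partial divided differences\<close>

text \<open>The variables \<open>j\<close> and \<open>j + 1\<close> merge into a point of the
  segment between them; later variables move down by one.\<close>

definition ddpt :: "nat \<Rightarrow> real \<Rightarrow> (nat \<Rightarrow> real) \<Rightarrow> nat \<Rightarrow> real" where
  "ddpt j s t = (\<lambda>i. if i < j then t i else if i = j then s * t j + (1 - s) * t (Suc j) else t (Suc i))"

text \<open>With the weight \<open>p\<close> the family is closed under partial derivatives:
  differentiating in a merged variable produces a factor \<open>s\<close> or \<open>1 - s\<close>
  under the integral.\<close>

definition ddint :: "nat \<Rightarrow> (real \<Rightarrow> complex) \<Rightarrow> ((nat \<Rightarrow> real) \<Rightarrow> complex) \<Rightarrow> (nat \<Rightarrow> real) \<Rightarrow> complex" where
  "ddint j p K t = integral {0..1} (\<lambda>s. p s * K (ddpt j s t))"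

definition ddweight :: "nat \<Rightarrow> nat \<Rightarrow> real \<Rightarrow> real" where
  "ddweight j i s = (if i = j then s else if i = Suc j then 1 - s else 1)"

text \<open>Variable \<open>i\<close> of \<open>t\<close> influences exactly one coordinate
  \<open>k\<close> of the merged point, and affinely with slope \<open>ddweight j i s\<close>. Both
  \<open>i = j\<close> and \<open>i = Suc j\<close> lead to \<open>k = j\<close>.\<close>

lemma ddpt_upd:
  "ddpt j s (t(i := u)) = (let k = (if i \<le> j then i else i - 1) in
    (ddpt j s t)(k := ddpt j s t k + ddweight j i s * (u - t i)))"
proof -
  consider "i < j" | "i = j" | "i = Suc j" | "Suc j < i" by linarith
  then show ?thesis
  proof cases
    case 4
    then have "Suc (i - 1) = i" by simp
    then show ?thesis using 4 by (auto simp: ddpt_def ddweight_def Let_def fun_eq_iff)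
  qed (auto simp: ddpt_def ddweight_def Let_def fun_eq_iff algebra_simps)
qed

lemma continuous_on_ddpt: "continuous_on S (\<lambda>p. ddpt j (snd p) (fst p))"
proof (rule continuous_on_coordinatewise_then_product)
  fix i
  have c: "continuous_on S (\<lambda>p :: (nat \<Rightarrow> real) \<times> real. fst p l)" for l
    by (rule continuous_on_product_then_coordinatewise) (intro continuous_intros)
  show "continuous_on S (\<lambda>p. ddpt j (snd p) (fst p) i)"
    unfolding ddpt_def by (cases "i < j"; cases "i = j") (auto intro!: continuous_intros c)
qed

lemma continuous_on_ddint_integrand:
  assumes "continuous_on UNIV p" "smooth m K"
  shows "continuous_on S (\<lambda>q. p (snd q) * K (ddpt j (snd q) (fst q)))"
proof (rule continuous_on_mult)
  show "continuous_on S (\<lambda>q :: (nat \<Rightarrow> real) \<times> real. p (snd q))"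
    by (rule continuous_on_compose2[OF assms(1)]) (auto intro!: continuous_intros)
  show "continuous_on S (\<lambda>q. K (ddpt j (snd q) (fst q)))"
    by (rule continuous_on_compose2[OF smooth_continuous[OF assms(2)] continuous_on_ddpt]) auto
qed

lemma continuous_on_ddint_slice:
  assumes "continuous_on UNIV p" "smooth m K"
  shows "continuous_on S (\<lambda>s. p s * K (ddpt j s t))"
proof -
  have "continuous_on S (\<lambda>s. (t, s))" by (intro continuous_intros)
  from continuous_on_compose2[OF continuous_on_ddint_integrand[OF assms, of UNIV j] this] show ?thesis by simp
qed

lemma continuous_on_ddint:
  assumes "continuous_on UNIV p" "smooth m K"
  shows "continuous_on UNIV (ddint j p K)"
proof -
  have "continuous_on (UNIV \<times> cbox 0 1) (\<lambda>(t, s). p s * K (ddpt j s t))"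
    using continuous_on_ddint_integrand[OF assms] by (simp add: case_prod_unfold)
  from integral_continuous_on_param[OF this] show ?thesis by (simp add: ddint_def[abs_def])
qed

lemma ddint_has_vector_derivative:
  assumes p: "continuous_on UNIV p" and K: "smooth m K" and j: "j < m" and i: "i < Suc m"
  shows "((\<lambda>u. ddint j p K (t(i := u))) has_vector_derivative
    ddint j (\<lambda>s. complex_of_real (ddweight j i s) * p s) (partial_deriv (if i \<le> j then i else i - 1) K) t) (at (t i))"
proof -
  let ?k = "if i \<le> j then i else i - 1"
  let ?p = "\<lambda>s. complex_of_real (ddweight j i s) * p s" and ?K = "partial_deriv ?k K"
  have k: "?k < m" using i j by auto
  note sK = smooth_partial_deriv[OF K k]
  have p': "continuous_on UNIV ?p"
    unfolding ddweight_def by (cases "i = j"; cases "i = Suc j") (auto intro!: continuous_intros p)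
  have "((\<lambda>u. integral (cbox 0 1) (\<lambda>s. p s * K (ddpt j s (t(i := u))))) has_vector_derivative
      integral (cbox 0 1) (\<lambda>s. ?p s * ?K (ddpt j s (t(i := t i))))) (at (t i) within UNIV)"
  proof (rule leibniz_rule_vector_derivative[where fx="\<lambda>u s. ?p s * ?K (ddpt j s (t(i := u)))"])
    fix u s
    let ?y = "ddpt j s t" and ?a = "ddpt j s t ?k" and ?w = "ddweight j i s"
    have e: "ddpt j s (t(i := u)) = ?y(?k := ?a + ?w * (u - t i))" for u by (simp add: ddpt_upd Let_def)
    have "((\<lambda>v. K (?y(?k := v))) has_vector_derivative ?K (?y(?k := ?a + ?w * (u - t i)))) (at (?a + ?w * (u - t i)))"
      by (rule smooth_has_vector_derivative[OF K k])
    moreover have "((\<lambda>u. ?a + ?w * (u - t i)) has_vector_derivative ?w) (at u)"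
      by (auto intro!: derivative_eq_intros simp flip: has_real_derivative_iff_has_vector_derivative)
    ultimately have "((\<lambda>u. K (?y(?k := ?a + ?w * (u - t i)))) has_vector_derivative ?w *\<^sub>R ?K (?y(?k := ?a + ?w * (u - t i)))) (at u)"
      using vector_diff_chain_at[of "\<lambda>u. ?a + ?w * (u - t i)" ?w u "\<lambda>v. K (?y(?k := v))"] by (simp only: comp_def)
    from has_vector_derivative_mult_right[OF this, of "p s"]
    show "((\<lambda>u. p s * K (ddpt j s (t(i := u)))) has_vector_derivative ?p s * ?K (ddpt j s (t(i := u)))) (at u within UNIV)"
      unfolding e by (simp only: scaleR_conv_of_real mult_ac)
  next
    fix u show "(\<lambda>s. p s * K (ddpt j s (t(i := u)))) integrable_on cbox 0 1"
      unfolding cbox_interval by (rule integrable_continuous_real[OF continuous_on_ddint_slice[OF p K]])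
  next
    have "continuous_on (UNIV \<times> cbox 0 1) (\<lambda>q. (t(i := fst q), snd q) :: (nat \<Rightarrow> real) \<times> real)"
      by (intro continuous_intros continuous_on_compose2[OF continuous_on_fun_upd[of UNIV t i] continuous_on_fst[OF continuous_on_id]]) auto
    from continuous_on_compose2[OF continuous_on_ddint_integrand[OF p' sK, of UNIV j] this]
    show "continuous_on (UNIV \<times> cbox 0 1) (\<lambda>(u, s). ?p s * ?K (ddpt j s (t(i := u))))"
      by (simp add: case_prod_unfold)
  qed auto
  then show ?thesis unfolding ddint_def by (simp only: cbox_interval fun_upd_triv)
qed

lemma continuous_ddweight: "continuous_on UNIV p \<Longrightarrow> continuous_on UNIV (\<lambda>s. complex_of_real (ddweight j i s) * p s)"
  unfolding ddweight_def by (cases "i = j"; cases "i = Suc j") (auto intro!: continuous_intros)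

lemma smooth_ddint:
  assumes p: "continuous_on UNIV p" and K: "smooth m K" and j: "j < m"
  shows "smooth (Suc m) (ddint j p K)"
proof (rule smooth_coinduct)
  let ?X = "{ddint j p K | p K. continuous_on UNIV p \<and> smooth m K}"
  show "ddint j p K \<in> ?X" using p K by blast
  fix H assume "H \<in> ?X"
  then obtain p K where H: "H = ddint j p K" and p: "continuous_on UNIV p" and K: "smooth m K" by blast
  have "H x = H y" if "\<forall>i<Suc m. x i = y i" for x y
  proof -
    have "K (ddpt j s x) = K (ddpt j s y)" for s
      by (rule depends_onD[OF smooth_depends_on[OF K]]) (use that j in \<open>auto simp: ddpt_def\<close>)
    then show ?thesis by (simp add: H ddint_def)
  qed
  then show "depends_on (Suc m) H \<and> continuous_on UNIV H"
    using continuous_on_ddint[OF p K] by (auto simp: depends_on_def H)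
  fix i assume i: "i < Suc m"
  let ?k = "if i \<le> j then i else i - 1"
  have k: "?k < m" using i j by auto
  have "ddint j (\<lambda>s. complex_of_real (ddweight j i s) * p s) (partial_deriv ?k K) \<in> ?X"
    using continuous_ddweight[OF p] smooth_partial_deriv[OF K k] by blast
  then show "\<exists>G\<in>?X. \<forall>x. ((\<lambda>t. H (x(i := t))) has_vector_derivative G x) (at (x i))"
    unfolding H using ddint_has_vector_derivative[OF p K j i]
    by (intro bexI[of _ "ddint j (\<lambda>s. complex_of_real (ddweight j i s) * p s) (partial_deriv ?k K)"] allI)
qed

text \<open>Each differentiation multiplies the weight by a \<open>ddweight\<close>, of modulus at
  most 1 on the unit interval. Weight and list are independent of \<open>K\<close>, so they serve a
  whole sequence of functions.\<close>

lemma pds_ddint: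
  assumes p: "continuous_on UNIV p" and j: "j < m" and "is": "set is \<subseteq> {..<Suc m}"
  shows "\<exists>p' is'. continuous_on UNIV p' \<and> (\<forall>s\<in>{0..1}. cmod (p' s) \<le> cmod (p s)) \<and> set is' \<subseteq> {..<m} \<and>
    (\<forall>K. smooth m K \<longrightarrow> pds is (ddint j p K) = ddint j p' (pds is' K))"
  using "is"
proof (induction "is")
  case Nil
  show ?case using p by (intro exI[of _ p] exI[of _ "[]"]) auto
next
  case (Cons i "is")
  then have i: "i < Suc m" by simp
  obtain p' is' where IH: "continuous_on UNIV p'" "\<forall>s\<in>{0..1}. cmod (p' s) \<le> cmod (p s)" "set is' \<subseteq> {..<m}"
    "\<forall>K. smooth m K \<longrightarrow> pds is (ddint j p K) = ddint j p' (pds is' K)"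
    using Cons by auto
  let ?k = "if i \<le> j then i else i - 1"
  let ?p = "\<lambda>s. complex_of_real (ddweight j i s) * p' s"
  have k: "?k < m" using i j by auto
  show ?case
  proof (intro exI[of _ ?p] exI[of _ "?k # is'"] conjI ballI allI impI)
    show "continuous_on UNIV ?p" by (rule continuous_ddweight[OF IH(1)])
    show "set (?k # is') \<subseteq> {..<m}" using k IH(3) by simp
    fix s :: real assume s: "s \<in> {0..1}"
    have "\<bar>ddweight j i s\<bar> \<le> 1" using s by (auto simp: ddweight_def)
    then have "\<bar>ddweight j i s\<bar> * cmod (p' s) \<le> 1 * cmod (p s)" using IH(2) s by (intro mult_mono) auto
    then show "cmod (?p s) \<le> cmod (p s)" by (simp add: norm_mult)
  next
    fix K assume K: "smooth m K"
    have "pds (i # is) (ddint j p K) = partial_deriv i (ddint j p' (pds is' K))" using IH(4) K by simp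
    also have "\<dots> = ddint j ?p (partial_deriv ?k (pds is' K))"
      by (intro ext partial_derivI ddint_has_vector_derivative[OF IH(1) smooth_pds[OF K IH(3)] j i])
    finally show "pds (i # is) (ddint j p K) = ddint j ?p (pds (?k # is') K)" by simp
  qed
qed

lemma ddint_add:
  assumes "continuous_on UNIV p" "smooth m K" "smooth m L"
  shows "ddint j p (\<lambda>x. K x + L x) t = ddint j p K t + ddint j p L t"
  unfolding ddint_def distrib_left
  by (rule Henstock_Kurzweil_Integration.integral_add;
      rule integrable_continuous_real[OF continuous_on_ddint_slice[OF assms(1)]]; rule assms)

lemma partial_divided_diff_eq:
  assumes F: "smooth m F" and j: "j < m"
  shows "partial_divided_diff j F = ddint j (\<lambda>_. 1) (partial_deriv j F)"
proof
  fix t :: "nat \<Rightarrow> real"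
  \<comment> \<open>The 0 in slot \<open>j\<close> is a placeholder that every use
    overwrites.\<close>
  define y where "y = (\<lambda>i. if i < j then t i else if i = j then 0 else t (Suc i))"
  have y: "(\<lambda>i. if i < j then t i else if i = j then s else t (Suc i)) = y(j := s)" for s
    by (auto simp: y_def)
  have dp: "ddpt j s t = y(j := s * t j + (1 - s) * t (Suc j))" for s
    by (auto simp: y_def ddpt_def)
  note D = smooth_has_vector_derivative[OF F j, of y]
  show "partial_divided_diff j F t = ddint j (\<lambda>_. 1) (partial_deriv j F) t"
  proof (cases "t j = t (Suc j)")
    case True
    have "vector_derivative (\<lambda>s. F (y(j := s))) (at (t j)) = partial_deriv j F (y(j := t j))"
      by (rule vector_derivative_at[OF D])
    moreover have "s * t j + (1 - s) * t (Suc j) = t j" for s by (simp add: True[symmetric] algebra_simps)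
    ultimately show ?thesis
      using True by (simp add: partial_divided_diff_def divided_diff_def y ddint_def dp)
  next
    case False
    let ?d = "t j - t (Suc j)" and ?g = "\<lambda>s. s * t j + (1 - s) * t (Suc j)"
    have dv: "((\<lambda>s. F (y(j := ?g s))) has_vector_derivative ?d *\<^sub>R partial_deriv j F (y(j := ?g s))) (at s within {0..1})" for s
    proof -
      have "(?g has_vector_derivative ?d) (at s)"
        by (auto intro!: derivative_eq_intros simp: algebra_simps simp flip: has_real_derivative_iff_has_vector_derivative)
      from vector_diff_chain_at[OF this D] show ?thesis
        by (simp only: comp_def has_vector_derivative_at_within)
    qed
    have "((\<lambda>s. ?d *\<^sub>R partial_deriv j F (y(j := ?g s))) has_integral (F (y(j := ?g 1)) - F (y(j := ?g 0)))) {0..1}"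
      by (rule fundamental_theorem_of_calculus[OF _ dv]) simp
    from integral_unique[OF this]
    have "integral {0..1} (\<lambda>s. ?d *\<^sub>R partial_deriv j F (y(j := ?g s))) = F (y(j := t j)) - F (y(j := t (Suc j)))"
      by (simp only: mult_1 mult_zero_left add_0 add_0_right diff_self diff_zero)
    then have "?d *\<^sub>R integral {0..1} (\<lambda>s. partial_deriv j F (y(j := ?g s))) = F (y(j := t j)) - F (y(j := t (Suc j)))"
      by (simp only: integral_cmul)
    then have "complex_of_real ?d * ddint j (\<lambda>_. 1) (partial_deriv j F) t = F (y(j := t j)) - F (y(j := t (Suc j)))"
      by (simp add: ddint_def dp scaleR_conv_of_real)
    then show ?thesis
      using False by (simp add: partial_divided_diff_def divided_diff_def y field_simps)
  qed
qed

lemma smooth_partial_divided_diff: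
  "smooth m F \<Longrightarrow> j < m \<Longrightarrow> smooth (Suc m) (partial_divided_diff j F)"
  by (simp add: partial_divided_diff_eq smooth_ddint smooth_partial_deriv)

lemma partial_divided_diff_add:
  assumes "smooth m F" "smooth m G" "j < m"
  shows "partial_divided_diff j (\<lambda>x. F x + G x) = (\<lambda>x. partial_divided_diff j F x + partial_divided_diff j G x)"
  using ddint_add[OF continuous_on_const smooth_partial_deriv[OF assms(1,3)] smooth_partial_deriv[OF assms(2,3)]]
  by (simp add: partial_divided_diff_eq[OF _ assms(3)] assms smooth_add partial_deriv_add[OF assms] fun_eq_iff)

lemma partial_divided_diff_diff:
  assumes "smooth m F" "smooth m G" "j < m"
  shows "partial_divided_diff j (\<lambda>x. F x - G x) = (\<lambda>x. partial_divided_diff j F x - partial_divided_diff j G x)"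
  using partial_divided_diff_add[OF smooth_diff[OF assms(1,2)] assms(2,3)] by (simp add: fun_eq_iff)

text \<open>A derivative of the divided difference is a weighted mean, with weights of modulus at
  most 1, of one fixed derivative of \<open>H n\<close> over a segment that stays in the convex
  cube.\<close>

lemma uconv_partial_divided_diff:
  assumes H: "uconv m R H" "\<And>n. smooth m (H n)" and j: "j < m"
  shows "uconv (Suc m) R (\<lambda>n. partial_divided_diff j (H n))"
  unfolding uconv_def
proof (intro allI impI)
  fix "is" and e :: real assume "is": "set is \<subseteq> {..<Suc m}" and e: "0 < e"
  obtain p is' where p: "continuous_on UNIV p" "\<forall>s\<in>{0..1}. cmod (p s) \<le> cmod 1" "set is' \<subseteq> {..<m}"
    "\<forall>K. smooth m K \<longrightarrow> pds is (ddint j (\<lambda>_. 1) K) = ddint j p (pds is' K)"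
    using pds_ddint[OF continuous_on_const j "is", of 1] by blast
  have "set (is' @ [j]) \<subseteq> {..<m}" using p(3) j by simp
  with H(1) e obtain N where N: "\<forall>n\<ge>N. \<forall>x. (\<forall>i<m. \<bar>x i\<bar> \<le> R) \<longrightarrow> cmod (pds (is' @ [j]) (H n) x) \<le> e"
    unfolding uconv_def by meson
  show "\<exists>N. \<forall>n\<ge>N. \<forall>x. (\<forall>i<Suc m. \<bar>x i\<bar> \<le> R) \<longrightarrow> cmod (pds is (partial_divided_diff j (H n)) x) \<le> e"
  proof (intro exI[of _ N] allI impI)
    fix n t assume n: "N \<le> n" and t: "\<forall>i<Suc m. \<bar>t i\<bar> \<le> R"
    note s = smooth_partial_deriv[OF H(2) j, of n]
    have "pds is (partial_divided_diff j (H n)) t = integral {0..1} (\<lambda>s. p s * pds is' (partial_deriv j (H n)) (ddpt j s t))"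
      using p(4) s by (simp add: partial_divided_diff_eq[OF H(2) j] ddint_def)
    also have "cmod \<dots> \<le> e * (1 - 0)"
    proof (rule integral_bound)
      show "continuous_on {0..1} (\<lambda>s. p s * pds is' (partial_deriv j (H n)) (ddpt j s t))"
        by (rule continuous_on_ddint_slice[OF p(1) smooth_pds[OF s p(3)]])
      fix s :: real assume s: "s \<in> {0..1}"
      have "\<forall>i<m. \<bar>ddpt j s t i\<bar> \<le> R"
      proof (intro allI impI)
        fix i assume i: "i < m"
        have "\<bar>s * t j + (1 - s) * t (Suc j)\<bar> \<le> s * R + (1 - s) * R"
        proof -
          have "\<bar>s * t j + (1 - s) * t (Suc j)\<bar> \<le> s * \<bar>t j\<bar> + (1 - s) * \<bar>t (Suc j)\<bar>"
            using s abs_triangle_ineq[of "s * t j" "(1 - s) * t (Suc j)"] by (simp add: abs_mult)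
          also have "\<dots> \<le> s * R + (1 - s) * R" using s t j by (intro add_mono mult_left_mono) auto
          finally show ?thesis .
        qed
        then show "\<bar>ddpt j s t i\<bar> \<le> R" using t i by (auto simp: ddpt_def algebra_simps)
      qed
      then have 1: "cmod (pds is' (partial_deriv j (H n)) (ddpt j s t)) \<le> e" using N n by simp
      have "cmod (p s) \<le> 1" using p(2) s by simp
      then have "cmod (p s) * cmod (pds is' (partial_deriv j (H n)) (ddpt j s t)) \<le> 1 * e"
        using 1 by (intro mult_mono) auto
      then show "cmod (p s * pds is' (partial_deriv j (H n)) (ddpt j s t)) \<le> e" by (simp add: norm_mult)
    qed simp
    finally show "cmod (pds is (partial_divided_diff j (H n)) t) \<le> e" by simp
  qed
qed

section \<open>Divided differences of monomials\<close>

lemma prod_lessThan_split: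
  fixes g :: "nat \<Rightarrow> 'a::comm_monoid_mult"
  assumes "j < m"
  shows "(\<Prod>i<m. g i) = (\<Prod>i<j. g i) * (g j * (\<Prod>i=Suc j..<m. g i))"
proof -
  have "(\<Prod>i<m. g i) = (\<Prod>i=0..<j. g i) * (\<Prod>i=j..<m. g i)"
    unfolding lessThan_atLeast0 by (rule prod.atLeastLessThan_concat[symmetric]) (use assms in auto)
  then show ?thesis using assms by (simp add: prod.atLeast_Suc_lessThan lessThan_atLeast0)
qed

text \<open>The exponents of the summand with index \<open>p\<close> in the divided difference of a
  monomial, where the power \<open>\<alpha> j\<close> is shared as \<open>p\<close> and
  \<open>\<alpha> j - 1 - p\<close> by two adjacent variables.\<close>

definition split_exp :: "nat \<Rightarrow> (nat \<Rightarrow> nat) \<Rightarrow> nat \<Rightarrow> nat \<Rightarrow> nat" where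
  "split_exp j \<alpha> p = (\<lambda>i. if i < j then \<alpha> i else if i = j then p else if i = Suc j then \<alpha> j - Suc p else \<alpha> (i - 1))"

text \<open>For distinct points this is the factorisation of \<open>x^k - y^k\<close>; for equal
  points all \<open>k\<close> summands coincide and give the derivative.\<close>

lemma divided_diff_power:
  "divided_diff x y (\<lambda>s. C * complex_of_real (s ^ k)) =
    (\<Sum>p<k. C * (complex_of_real (x ^ p) * complex_of_real (y ^ (k - Suc p))))"
proof (cases "x = y")
  case True
  have "((\<lambda>s. s ^ k) has_real_derivative real k * x ^ (k - Suc 0)) (at x)" by (rule DERIV_pow)
  from has_vector_derivative_mult_right[OF of_real_has_vector_derivative[OF this], of C]
  have "vector_derivative (\<lambda>s. C * complex_of_real (s ^ k)) (at x) = C * complex_of_real (real k * x ^ (k - Suc 0))"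
    by (rule vector_derivative_at)
  moreover have "(\<Sum>p<k. C * (complex_of_real (x ^ p) * complex_of_real (x ^ (k - Suc p)))) = (\<Sum>p<k. C * complex_of_real (x ^ (k - Suc 0)))"
    by (intro sum.cong refl) (simp flip: power_add)
  ultimately show ?thesis using True by (simp add: divided_diff_def)
next
  case False
  have "x ^ k - y ^ k = (x - y) * (\<Sum>p<k. y ^ (k - Suc p) * x ^ p)" by (rule power_diff_sumr2)
  then have "x ^ k - y ^ k = (x - y) * (\<Sum>p<k. x ^ p * y ^ (k - Suc p))" by (simp only: mult.commute)
  from arg_cong[where f=complex_of_real, OF this]
  have "complex_of_real (x ^ k) - complex_of_real (y ^ k) =
      complex_of_real (x - y) * (\<Sum>p<k. complex_of_real (x ^ p) * complex_of_real (y ^ (k - Suc p)))"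
    by (simp only: of_real_mult of_real_sum of_real_diff)
  then have "C * complex_of_real (x ^ k) - C * complex_of_real (y ^ k) =
      complex_of_real (x - y) * (\<Sum>p<k. C * (complex_of_real (x ^ p) * complex_of_real (y ^ (k - Suc p))))"
    by (simp only: right_diff_distrib[symmetric] sum_distrib_left[symmetric] mult.left_commute)
  then show ?thesis using False unfolding divided_diff_def by (simp del: of_real_diff)
qed

lemma partial_divided_diff_monomial:
  assumes j: "j < m"
  shows "partial_divided_diff j (\<lambda>x. a * monomial m \<alpha> x) t = (\<Sum>p<\<alpha> j. a * monomial (Suc m) (split_exp j \<alpha> p) t)"
proof -
  let ?A = "\<Prod>i<j. complex_of_real (t i ^ \<alpha> i)" and ?B = "\<Prod>i=Suc j..<m. complex_of_real (t (Suc i) ^ \<alpha> i)"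
  have 1: "a * monomial m \<alpha> (\<lambda>i. if i < j then t i else if i = j then s else t (Suc i)) = (a * ?A * ?B) * complex_of_real (s ^ \<alpha> j)" for s
    unfolding monomial_def prod_lessThan_split[OF j] by (simp add: mult_ac)
  have 2: "a * monomial (Suc m) (split_exp j \<alpha> p) t =
      (a * ?A * ?B) * (complex_of_real (t j ^ p) * complex_of_real (t (Suc j) ^ (\<alpha> j - Suc p)))" for p
  proof -
    have j': "j < Suc m" "Suc j < Suc m" using j by auto
    have "(\<Prod>i=Suc (Suc j)..<Suc m. complex_of_real (t i ^ split_exp j \<alpha> p i)) = ?B"
      unfolding prod.shift_bounds_Suc_ivl by (intro prod.cong) (auto simp: split_exp_def)
    moreover have "(\<Prod>i<j. complex_of_real (t i ^ split_exp j \<alpha> p i)) = ?A"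
      by (intro prod.cong) (auto simp: split_exp_def)
    ultimately show ?thesis
      unfolding monomial_def prod_lessThan_split[OF j'(1)] prod.atLeast_Suc_lessThan[OF j'(2)]
      by (simp add: split_exp_def mult_ac)
  qed
  show ?thesis unfolding partial_divided_diff_def 1 2 by (rule divided_diff_power)
qed

section \<open>Closed derivations\<close>

text \<open>The new coefficient has index \<open>Suc j\<close>, since coefficient \<open>j\<close>
  precedes the copy of \<open>h\<close> in slot \<open>j\<close>, which the derivation splits in
  two. In list terms, where slot 0 is not listed, this is an insertion after \<open>j\<close>
  entries.\<close>

definition insert_slot :: "'a \<Rightarrow> nat \<Rightarrow> (nat \<Rightarrow> 'a) \<Rightarrow> nat \<Rightarrow> 'a" where
  "insert_slot d j c = (\<lambda>i. if i \<le> j then c i else if i = Suc j then d else c (i - 1))"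

lemma wmono_cong:
  "(\<And>k. k < m \<Longrightarrow> c k = c' k) \<Longrightarrow> (\<And>k. k < m \<Longrightarrow> \<alpha> k = \<alpha>' k) \<Longrightarrow> wmono m h \<alpha> c = wmono m h \<alpha>' c'"
  by (induction m) simp_all

context closed_derivation
begin

lemma diff_mem: "x \<in> D \<Longrightarrow> y \<in> D \<Longrightarrow> x - y \<in> D"
  using add_mem[of x "(-1) *\<^sub>C y"] scaleC_mem[of y "-1"] by (simp add: scaleC.minus_left)

lemma derivation_diff: "x \<in> D \<Longrightarrow> y \<in> D \<Longrightarrow> \<delta> (x - y) = \<delta> x - \<delta> y"
  using add[of x "(-1) *\<^sub>C y"] scaleC_mem[of y "-1"] scaleC[of y "-1"] by (simp add: scaleC.minus_left)

lemma derivation_zero: "\<delta> 0 = 0"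
  using scaleC[OF zero_mem, of 0] by (simp add: scaleC.zero_left)

lemma graph_limit:
  assumes "\<And>n. X n \<in> D" "X \<longlonglongrightarrow> x" "(\<lambda>n. \<delta> (X n)) \<longlonglongrightarrow> y"
  shows "x \<in> D \<and> \<delta> x = y"
proof -
  have "(x, y) \<in> {(x, \<delta> x) | x. x \<in> D}"
    by (rule closed_sequentially[OF closed_graph _ tendsto_Pair[OF assms(2,3)]]) (use assms(1) in blast)
  then show ?thesis by blast
qed

text \<open>If \<open>x \<in> D\<close> is close to \<open>1\<close>, then the elements \<open>1 - (1 - x)\<^sup>n\<close> of \<open>D\<close> tend to \<open>1\<close> and their
  derivatives tend to \<open>0\<close>.\<close>

lemma one_mem: "1 \<in> D \<and> \<delta> 1 = 0"
proof -
  have "(1::'a) \<in> closure D" by (simp add: dense)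
  then obtain x where x: "x \<in> D" "dist x 1 < 1 / 2" unfolding closure_approachable by (meson half_gt_zero zero_less_one)
  define d where "d = 1 - x"
  have d: "norm d \<le> 1 / 2" using x(2) by (simp add: d_def dist_norm norm_minus_commute)
  define y where "y n = 1 - d ^ n" for n
  \<comment> \<open>This form of the recursion does not mention the unit, so it shows membership in
    \<open>D\<close> before \<open>1 \<in> D\<close> is known.\<close>
  have y_Suc: "y (Suc n) = x + y n - x * y n" for n
    by (simp add: y_def d_def algebra_simps)
  have yD: "y n \<in> D" for n
  proof (induction n)
    case (Suc n)
    then show ?case unfolding y_Suc by (intro diff_mem add_mem mult_mem x)
  qed (simp add: y_def zero_mem)
  have dn: "norm (d ^ n) \<le> (1 / 2) ^ n" for n
    using norm_power_ineq[of d n] power_mono[OF d norm_ge_zero, of n] by linarith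
  \<comment> \<open>The recursion multiplies the old derivative by \<open>d\<close>, of norm at most
    1/2, and adds a term of size \<open>(1/2)^n\<close>; this produces the bound
    \<open>n * (1/2)^n\<close> up to a constant.\<close>
  have \<delta>y: "norm (\<delta> (y n)) \<le> 2 * norm (\<delta> x) * (real n * (1 / 2) ^ n)" for n
  proof (induction n)
    case 0
    then show ?case by (simp add: y_def derivation_zero)
  next
    case (Suc n)
    have "\<delta> (y (Suc n)) = \<delta> x + \<delta> (y n) - (\<delta> x * y n + x * \<delta> (y n))"
      unfolding y_Suc by (simp add: derivation_diff add leibniz x yD add_mem mult_mem)
    also have "\<dots> = \<delta> x * d ^ n + d * \<delta> (y n)"
      by (simp add: y_def d_def algebra_simps)
    finally have "norm (\<delta> (y (Suc n))) \<le> norm (\<delta> x) * norm (d ^ n) + norm d * norm (\<delta> (y n))"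
      using norm_triangle_ineq[of "\<delta> x * d ^ n" "d * \<delta> (y n)"] norm_mult_ineq[of "\<delta> x" "d ^ n"] norm_mult_ineq[of d "\<delta> (y n)"]
      by simp
    also have "\<dots> \<le> norm (\<delta> x) * (1 / 2) ^ n + 1 / 2 * (2 * norm (\<delta> x) * (real n * (1 / 2) ^ n))"
      using d dn[of n] Suc by (intro add_mono mult_left_mono mult_mono) auto
    also have "\<dots> = 2 * norm (\<delta> x) * (real (Suc n) * (1 / 2) ^ Suc n)" by (simp add: algebra_simps)
    finally show ?case .
  qed
  have "(\<lambda>n. d ^ n) \<longlonglongrightarrow> 0"
    by (rule Lim_null_comparison[OF always_eventually[OF allI[OF dn]]]) (rule LIMSEQ_realpow_zero; simp)
  then have ylim: "y \<longlonglongrightarrow> 1" unfolding y_def using tendsto_diff[OF tendsto_const[of 1]] by fastforce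
  have "(\<lambda>n. real n * (1 / 2 :: real) ^ n) \<longlonglongrightarrow> 0" by (rule powser_times_n_limit_0) simp
  then have "(\<lambda>n. 2 * norm (\<delta> x) * (real n * (1 / 2) ^ n)) \<longlonglongrightarrow> 0" by (rule tendsto_mult_right_zero)
  then have "(\<lambda>n. \<delta> (y n)) \<longlonglongrightarrow> 0" by (rule Lim_null_comparison[OF always_eventually[OF allI[OF \<delta>y]]])
  then show ?thesis using graph_limit[OF yD ylim] by blast
qed

lemma power_mem:
  assumes "h \<in> D"
  shows "h ^ n \<in> D \<and> \<delta> (h ^ n) = (\<Sum>p<n. h ^ p * \<delta> h * h ^ (n - Suc p))"
proof (induction n)
  case 0
  then show ?case using one_mem by simp
next
  case (Suc n)
  have "\<delta> (h ^ Suc n) = \<delta> (h ^ n) * h + h ^ n * \<delta> h"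
    unfolding power_Suc2 using Suc assms by (intro leibniz) auto
  also have "\<delta> (h ^ n) * h = (\<Sum>p<n. h ^ p * \<delta> h * h ^ (Suc n - Suc p))"
  proof -
    have "(\<Sum>p<n. h ^ p * \<delta> h * h ^ (n - Suc p)) * h = (\<Sum>p<n. h ^ p * \<delta> h * (h ^ (n - Suc p) * h))"
      by (simp add: sum_distrib_right mult.assoc)
    also have "\<dots> = (\<Sum>p<n. h ^ p * \<delta> h * h ^ (Suc n - Suc p))"
    proof (rule sum.cong[OF refl])
      fix p assume "p \<in> {..<n}"
      then have "Suc n - Suc p = Suc (n - Suc p)" by auto
      then show "h ^ p * \<delta> h * (h ^ (n - Suc p) * h) = h ^ p * \<delta> h * h ^ (Suc n - Suc p)"
        by (simp only: power_Suc2)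
    qed
    finally show ?thesis using Suc by simp
  qed
  finally have "\<delta> (h ^ Suc n) = (\<Sum>p<Suc n. h ^ p * \<delta> h * h ^ (Suc n - Suc p))" by simp
  then show ?case using Suc assms mult_mem[of h "h ^ n"] by simp
qed

text \<open>The Leibniz rule hits either a coefficient or one factor \<open>h\<close> of some power
  \<open>h ^ \<alpha> j\<close>. In the second case the power breaks into \<open>h ^ p\<close>,
  \<open>\<delta> h\<close> and the rest, which is a word with one slot more and exponents
  \<open>split_exp j \<alpha> p\<close>.\<close>

lemma wmono_mem:
  assumes h: "h \<in> D" and c: "\<And>k. k < m \<Longrightarrow> c k \<in> D"
  shows "wmono m h \<alpha> c \<in> D \<and> \<delta> (wmono m h \<alpha> c) = (\<Sum>k<m. wmono m h \<alpha> (c(k := \<delta> (c k)))) +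
    (\<Sum>j<m. \<Sum>p<\<alpha> j. wmono (Suc m) h (split_exp j \<alpha> p) (insert_slot (\<delta> h) j c))"
  using c
proof (induction m)
  case 0
  then show ?case using one_mem by simp
next
  case (Suc m)
  let ?W = "wmono m h \<alpha> c" and ?T = "c m * h ^ \<alpha> m" and ?I = "\<lambda>j. insert_slot (\<delta> h) j c"
  have IH0: "?W \<in> D \<and> \<delta> ?W = (\<Sum>k<m. wmono m h \<alpha> (c(k := \<delta> (c k)))) + (\<Sum>j<m. \<Sum>p<\<alpha> j. wmono (Suc m) h (split_exp j \<alpha> p) (?I j))"
    by (rule Suc.IH) (rule Suc.prems[OF less_SucI])
  have IH: "?W \<in> D" "\<delta> ?W = (\<Sum>k<m. wmono m h \<alpha> (c(k := \<delta> (c k)))) + (\<Sum>j<m. \<Sum>p<\<alpha> j. wmono (Suc m) h (split_exp j \<alpha> p) (?I j))"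
    by (rule conjunct1[OF IH0], rule conjunct2[OF IH0])
  have cm: "c m \<in> D" using Suc.prems[OF lessI] .
  note hp = power_mem[OF h, of "\<alpha> m"]
  have T: "?T \<in> D" using cm hp mult_mem by blast
  have mem: "wmono (Suc m) h \<alpha> c \<in> D" using IH(1) T mult_mem by simp
  have dT: "\<delta> ?T = \<delta> (c m) * h ^ \<alpha> m + c m * (\<Sum>p<\<alpha> m. h ^ p * \<delta> h * h ^ (\<alpha> m - Suc p))"
    using leibniz[OF cm, of "h ^ \<alpha> m"] hp by simp
  have A: "(\<Sum>k<Suc m. wmono (Suc m) h \<alpha> (c(k := \<delta> (c k)))) =
      (\<Sum>k<m. wmono m h \<alpha> (c(k := \<delta> (c k)))) * ?T + ?W * (\<delta> (c m) * h ^ \<alpha> m)"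
  proof -
    have "wmono (Suc m) h \<alpha> (c(k := \<delta> (c k))) = wmono m h \<alpha> (c(k := \<delta> (c k))) * ?T" if "k < m" for k
      using that by simp
    moreover have "wmono (Suc m) h \<alpha> (c(m := \<delta> (c m))) = ?W * (\<delta> (c m) * h ^ \<alpha> m)"
    proof -
      have "wmono m h \<alpha> (c(m := \<delta> (c m))) = ?W" by (rule wmono_cong) auto
      then show ?thesis by (simp only: wmono.simps fun_upd_same)
    qed
    ultimately show ?thesis by (simp only: sum.lessThan_Suc sum_distrib_right) (intro arg_cong2[where f="(+)"] sum.cong refl, auto)
  qed
  \<comment> \<open>For \<open>j < m\<close> the insertion moves the last coefficient and exponent
    to index \<open>m + 1\<close> unchanged, so the last factor splits off.\<close>
  have B1: "wmono (Suc (Suc m)) h (split_exp j \<alpha> p) (?I j) = wmono (Suc m) h (split_exp j \<alpha> p) (?I j) * ?T" if "j < m" for j p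
  proof -
    have "?I j (Suc m) = c m" "split_exp j \<alpha> p (Suc m) = \<alpha> m" using that by (auto simp: insert_slot_def split_exp_def)
    then show ?thesis by (simp only: wmono.simps(2)[of "Suc m"])
  qed
  \<comment> \<open>For \<open>j = m\<close> it is the last power that is broken up, and the word
    before it stays as it was.\<close>
  have B2: "wmono (Suc (Suc m)) h (split_exp m \<alpha> p) (?I m) = ?W * (c m * (h ^ p * \<delta> h * h ^ (\<alpha> m - Suc p)))" for p
  proof -
    have "wmono m h (split_exp m \<alpha> p) (?I m) = ?W" by (rule wmono_cong) (auto simp: insert_slot_def split_exp_def)
    moreover have "?I m m = c m" "?I m (Suc m) = \<delta> h" "split_exp m \<alpha> p m = p" "split_exp m \<alpha> p (Suc m) = \<alpha> m - Suc p"
      by (auto simp: insert_slot_def split_exp_def)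
    ultimately show ?thesis by (simp only: wmono.simps mult.assoc)
  qed
  have B: "(\<Sum>j<Suc m. \<Sum>p<\<alpha> j. wmono (Suc (Suc m)) h (split_exp j \<alpha> p) (?I j)) =
     (\<Sum>j<m. \<Sum>p<\<alpha> j. wmono (Suc m) h (split_exp j \<alpha> p) (?I j)) * ?T +
     ?W * (c m * (\<Sum>p<\<alpha> m. h ^ p * \<delta> h * h ^ (\<alpha> m - Suc p)))"
  proof -
    have "(\<Sum>j<m. \<Sum>p<\<alpha> j. wmono (Suc (Suc m)) h (split_exp j \<alpha> p) (?I j)) =
        (\<Sum>j<m. \<Sum>p<\<alpha> j. wmono (Suc m) h (split_exp j \<alpha> p) (?I j)) * ?T"
      unfolding sum_distrib_right by (intro sum.cong refl B1) simp
    moreover have "(\<Sum>p<\<alpha> m. wmono (Suc (Suc m)) h (split_exp m \<alpha> p) (?I m)) =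
        ?W * (c m * (\<Sum>p<\<alpha> m. h ^ p * \<delta> h * h ^ (\<alpha> m - Suc p)))"
      unfolding B2 by (simp only: sum_distrib_left)
    ultimately show ?thesis by (simp only: sum.lessThan_Suc)
  qed
  have "\<delta> (wmono (Suc m) h \<alpha> c) = \<delta> ?W * ?T + ?W * \<delta> ?T"
    unfolding wmono.simps by (rule leibniz[OF IH(1) T])
  also have "\<dots> = (\<Sum>k<Suc m. wmono (Suc m) h \<alpha> (c(k := \<delta> (c k)))) +
      (\<Sum>j<Suc m. \<Sum>p<\<alpha> j. wmono (Suc (Suc m)) h (split_exp j \<alpha> p) (?I j))"
    unfolding A B IH(2) dT by (simp only: distrib_right distrib_left add_ac)
  finally show ?case using mem by blast
qed

text \<open>The assertion with an explicit cutoff and with coefficients in all slots, slot 0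
  included. In this form it is additive in \<open>F\<close> and passes to limits.\<close>

definition leibniz_formula :: "'a \<Rightarrow> real \<Rightarrow> nat \<Rightarrow> (nat \<Rightarrow> 'a) \<Rightarrow> ((nat \<Rightarrow> real) \<Rightarrow> complex) \<Rightarrow> bool" where
  "leibniz_formula h R m c F \<longleftrightarrow> scalc m h (\<lambda>x. chi m R x * F x) c \<in> D \<and>
    \<delta> (scalc m h (\<lambda>x. chi m R x * F x) c) =
      (\<Sum>k<m. scalc m h (\<lambda>x. chi m R x * F x) (c(k := \<delta> (c k)))) +
      (\<Sum>j<m. scalc (Suc m) h (\<lambda>x. chi (Suc m) R x * partial_divided_diff j F x) (insert_slot (\<delta> h) j c))"

lemma scalc_chi_add:
  assumes "star h = h" "smooth m F" "smooth m G"
  shows "scalc m h (\<lambda>x. chi m R x * (F x + G x)) c = scalc m h (\<lambda>x. chi m R x * F x) c + scalc m h (\<lambda>x. chi m R x * G x) c"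
  using scalc_add[OF assms(1) schwartz_chi_mult[OF assms(2)] schwartz_chi_mult[OF assms(3)], of R R c]
  by (simp add: distrib_left)

lemma scalc_chi_cmult_monomial:
  assumes "star h = h" "norm h < R"
  shows "scalc m h (\<lambda>x. chi m R x * (a * monomial m \<alpha> x)) c = a *\<^sub>C wmono m h \<alpha> c"
  using scalc_cmult[OF assms(1) schwartz_chi_mult[OF smooth_monomial[of m \<alpha>], of R], of a c] scalc_chi_monomial[OF assms, of m \<alpha> c]
  by (simp add: mult_ac)

lemma scalc_chi_sum:
  assumes "star h = h" "\<And>p. smooth m (F p)"
  shows "scalc m h (\<lambda>x. chi m R x * (\<Sum>p<(k::nat). F p x)) c = (\<Sum>p<k. scalc m h (\<lambda>x. chi m R x * F p x) c) \<and>
    smooth m (\<lambda>x. \<Sum>p<k. F p x)"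
proof (induction k)
  case 0
  then show ?case using scalc_zero[OF assms(1), of m c] by simp
next
  case (Suc k)
  then show ?case using scalc_chi_add[OF assms(1) _ assms(2)] smooth_add[OF _ assms(2)] by simp
qed

lemma leibniz_formula_polyfun:
  assumes h: "star h = h" "h \<in> D" and R: "norm h < R" and c: "\<And>k. k < m \<Longrightarrow> c k \<in> D" and P: "P \<in> polyfun m"
  shows "leibniz_formula h R m c P"
  using P
proof (induction rule: polyfun.induct)
  case (mono a \<alpha>)
  have W: "wmono m h \<alpha> c \<in> D" "\<delta> (wmono m h \<alpha> c) = (\<Sum>k<m. wmono m h \<alpha> (c(k := \<delta> (c k)))) +
    (\<Sum>j<m. \<Sum>p<\<alpha> j. wmono (Suc m) h (split_exp j \<alpha> p) (insert_slot (\<delta> h) j c))"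
    using wmono_mem[where m=m and \<alpha>=\<alpha> and c=c, OF h(2) c] by blast+
  have S: "scalc (Suc m) h (\<lambda>x. chi (Suc m) R x * partial_divided_diff j (\<lambda>x. a * monomial m \<alpha> x) x) c' =
      a *\<^sub>C (\<Sum>p<\<alpha> j. wmono (Suc m) h (split_exp j \<alpha> p) c')" if "j < m" for j c'
    using scalc_chi_sum[OF h(1), of "Suc m" "\<lambda>p x. a * monomial (Suc m) (split_exp j \<alpha> p) x" R "\<alpha> j" c']
    by (simp only: partial_divided_diff_monomial[OF that] scalc_chi_cmult_monomial[OF h(1) R] smooth_cmult[OF smooth_monomial] scaleC.sum_right)
  have S': "(\<Sum>j<m. scalc (Suc m) h (\<lambda>x. chi (Suc m) R x * partial_divided_diff j (\<lambda>x. a * monomial m \<alpha> x) x) (insert_slot (\<delta> h) j c)) =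
      (\<Sum>j<m. a *\<^sub>C (\<Sum>p<\<alpha> j. wmono (Suc m) h (split_exp j \<alpha> p) (insert_slot (\<delta> h) j c)))"
    by (intro sum.cong refl S) simp
  show ?case
    unfolding leibniz_formula_def S' scalc_chi_cmult_monomial[OF h(1) R]
    using W scaleC_mem[OF W(1), of a] scaleC[OF W(1), of a]
    by (simp add: scaleC_add_right scaleC.sum_right)
next
  case (add P Q)
  note sP = smooth_polyfun[OF add.hyps(1)] and sQ = smooth_polyfun[OF add.hyps(2)]
  have S: "(\<Sum>j<m. scalc (Suc m) h (\<lambda>x. chi (Suc m) R x * partial_divided_diff j (\<lambda>x. P x + Q x) x) (insert_slot (\<delta> h) j c)) =
      (\<Sum>j<m. scalc (Suc m) h (\<lambda>x. chi (Suc m) R x * partial_divided_diff j P x) (insert_slot (\<delta> h) j c) +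
        scalc (Suc m) h (\<lambda>x. chi (Suc m) R x * partial_divided_diff j Q x) (insert_slot (\<delta> h) j c))"
  proof (intro sum.cong refl)
    fix j assume "j \<in> {..<m}"
    then have j: "j < m" by simp
    show "scalc (Suc m) h (\<lambda>x. chi (Suc m) R x * partial_divided_diff j (\<lambda>x. P x + Q x) x) (insert_slot (\<delta> h) j c) =
      scalc (Suc m) h (\<lambda>x. chi (Suc m) R x * partial_divided_diff j P x) (insert_slot (\<delta> h) j c) +
        scalc (Suc m) h (\<lambda>x. chi (Suc m) R x * partial_divided_diff j Q x) (insert_slot (\<delta> h) j c)"
      unfolding partial_divided_diff_add[OF sP sQ j]
      by (rule scalc_chi_add[OF h(1) smooth_partial_divided_diff[OF sP j] smooth_partial_divided_diff[OF sQ j]])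
  qed
  show ?case
    using add.IH unfolding leibniz_formula_def S scalc_chi_add[OF h(1) sP sQ]
    by (simp add: add_mem closed_derivation.add[OF closed_derivation_axioms] sum.distrib)
qed

lemma leibniz_formula_smooth:
  assumes h: "star h = h" "h \<in> D" and R: "norm h < R" and c: "\<And>k. k < m \<Longrightarrow> c k \<in> D" and F: "smooth m F"
  shows "leibniz_formula h R m c F"
proof -
  have R0: "0 \<le> R" using R norm_ge_zero[of h] by linarith
  \<comment> \<open>The radius is \<open>R + 1\<close> because convergence is needed on the whole
    support of the cutoff.\<close>
  obtain P where P: "\<And>n. P n \<in> polyfun m" and u: "uconv m (R + 1) (\<lambda>n x. P n x - F x)"
    using polyfun_uconv[of "R + 1" m F] R0 F by auto
  note sP = smooth_polyfun[OF P]
  have conv: "(\<lambda>n. scalc l h (\<lambda>x. chi l R x * A n x) c') \<longlonglongrightarrow> scalc l h (\<lambda>x. chi l R x * B x) c'"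
    if "uconv l (R + 1) (\<lambda>n x. A n x - B x)" "\<And>n. smooth l (A n)" "smooth l B" for l A B c'
  proof -
    have "scalc l h (\<lambda>x. chi l R x * (A n x - B x)) c' = scalc l h (\<lambda>x. chi l R x * A n x) c' - scalc l h (\<lambda>x. chi l R x * B x) c'" for n
      using scalc_diff[OF h(1) schwartz_chi_mult[OF that(2), of R] schwartz_chi_mult[OF that(3), of R]]
      by (simp add: right_diff_distrib)
    moreover have "(\<lambda>n. scalc l h (\<lambda>x. chi l R x * (A n x - B x)) c') \<longlonglongrightarrow> 0"
      by (rule scalc_chi_uconv[OF h(1) that(1) smooth_diff[OF that(2,3)] R0])
    ultimately show ?thesis by (simp add: LIM_zero_iff)
  qed
  note form = leibniz_formula_polyfun[OF h R c P, unfolded leibniz_formula_def]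
  have 1: "(\<lambda>n. scalc m h (\<lambda>x. chi m R x * P n x) c') \<longlonglongrightarrow> scalc m h (\<lambda>x. chi m R x * F x) c'" for c'
    by (rule conv[OF u sP F])
  have 2: "(\<lambda>n. scalc (Suc m) h (\<lambda>x. chi (Suc m) R x * partial_divided_diff j (P n) x) c') \<longlonglongrightarrow>
      scalc (Suc m) h (\<lambda>x. chi (Suc m) R x * partial_divided_diff j F x) c'" if j: "j < m" for j c'
  proof (rule conv)
    show "uconv (Suc m) (R + 1) (\<lambda>n x. partial_divided_diff j (P n) x - partial_divided_diff j F x)"
      using uconv_partial_divided_diff[OF u smooth_diff[OF sP F] j] by (simp add: partial_divided_diff_diff[OF sP F j])
  qed (intro smooth_partial_divided_diff sP F j)+
  have "(\<lambda>n. (\<Sum>k<m. scalc m h (\<lambda>x. chi m R x * P n x) (c(k := \<delta> (c k)))) +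
      (\<Sum>j<m. scalc (Suc m) h (\<lambda>x. chi (Suc m) R x * partial_divided_diff j (P n) x) (insert_slot (\<delta> h) j c)))
    \<longlonglongrightarrow> (\<Sum>k<m. scalc m h (\<lambda>x. chi m R x * F x) (c(k := \<delta> (c k)))) +
      (\<Sum>j<m. scalc (Suc m) h (\<lambda>x. chi (Suc m) R x * partial_divided_diff j F x) (insert_slot (\<delta> h) j c))"
    by (intro tendsto_add tendsto_sum 1 2) simp
  then show ?thesis
    unfolding leibniz_formula_def using form by (intro graph_limit[OF _ 1]) auto
qed

text \<open>Translates slots into lists. The case \<open>n = 0\<close> is included and gives the
  first part of the theorem.\<close>

lemma derivation_func_calc:
  assumes h: "star h = h" "h \<in> D" and bs: "set bs \<subseteq> D" "length bs = n" and F: "smooth (Suc n) F"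
  shows "func_calc F h bs \<in> D \<and>
    \<delta> (func_calc F h bs) = (\<Sum>j<n. func_calc F h (bs[j := \<delta> (bs ! j)])) +
      (\<Sum>j\<le>n. func_calc (partial_divided_diff j F) h (take j bs @ \<delta> h # drop j bs))"
proof -
  define R where "R = norm h + 1"
  have R: "norm h < R" by (simp add: R_def)
  let ?m = "Suc n" and ?c = "slot_coeffs bs"
  have c: "?c k \<in> D" if "k < ?m" for k
    using that bs one_mem by (cases k) (auto simp: slot_coeffs_def)
  have "leibniz_formula h R ?m ?c F" by (rule leibniz_formula_smooth[OF h R _ F]) (rule c)
  note form = this[unfolded leibniz_formula_def]
  have f0: "func_calc F h bs = scalc ?m h (\<lambda>x. chi ?m R x * F x) ?c"
    using func_calc_chi[OF h(1) R, of bs F] F bs(2) by simp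
  have fk: "func_calc F h (bs[j := \<delta> (bs ! j)]) = scalc ?m h (\<lambda>x. chi ?m R x * F x) (?c(Suc j := \<delta> (?c (Suc j))))" if "j < n" for j
  proof -
    have "func_calc F h (bs[j := \<delta> (bs ! j)]) = scalc ?m h (\<lambda>x. chi ?m R x * F x) (slot_coeffs (bs[j := \<delta> (bs ! j)]))"
      using func_calc_chi[OF h(1) R, of "bs[j := \<delta> (bs ! j)]" F] F bs(2) by simp
    also have "\<dots> = scalc ?m h (\<lambda>x. chi ?m R x * F x) (?c(Suc j := \<delta> (?c (Suc j))))"
    proof (rule scalc_cong[OF h(1)])
      fix k assume "k < ?m"
      then show "slot_coeffs (bs[j := \<delta> (bs ! j)]) k = (?c(Suc j := \<delta> (?c (Suc j)))) k"
        using that bs(2) by (cases k) (auto simp: slot_coeffs_def nth_list_update)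
    qed
    finally show ?thesis .
  qed
  \<comment> \<open>The sum over slots has one term more than the sum over the list; it vanishes
    because slot 0 carries the unit and \<open>\<delta> 1 = 0\<close>.\<close>
  have z: "scalc ?m h (\<lambda>x. chi ?m R x * F x) (?c(0 := \<delta> (?c 0))) = 0"
    by (rule scalc_zero_coeff[OF h(1) schwartz_chi_mult[OF F], of 0]) (use one_mem in \<open>auto simp: slot_coeffs_def\<close>)
  have S1: "(\<Sum>k<?m. scalc ?m h (\<lambda>x. chi ?m R x * F x) (?c(k := \<delta> (?c k)))) = (\<Sum>j<n. func_calc F h (bs[j := \<delta> (bs ! j)]))"
    unfolding sum.lessThan_Suc_shift z by (simp add: fk)
  have S2: "(\<Sum>j<?m. scalc (Suc ?m) h (\<lambda>x. chi (Suc ?m) R x * partial_divided_diff j F x) (insert_slot (\<delta> h) j ?c)) =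
      (\<Sum>j\<le>n. func_calc (partial_divided_diff j F) h (take j bs @ \<delta> h # drop j bs))"
    unfolding lessThan_Suc_atMost
  proof (intro sum.cong refl)
    fix j assume "j \<in> {..n}"
    then have j: "j \<le> n" "j < ?m" by auto
    let ?bs = "take j bs @ \<delta> h # drop j bs"
    have len: "length ?bs = ?m" using j bs(2) by simp
    have "func_calc (partial_divided_diff j F) h ?bs = scalc (Suc ?m) h (\<lambda>x. chi (Suc ?m) R x * partial_divided_diff j F x) (slot_coeffs ?bs)"
      using func_calc_chi[OF h(1) R, of ?bs "partial_divided_diff j F"] smooth_partial_divided_diff[OF F j(2)] unfolding len by blast
    also have "\<dots> = scalc (Suc ?m) h (\<lambda>x. chi (Suc ?m) R x * partial_divided_diff j F x) (insert_slot (\<delta> h) j ?c)"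
    proof (rule scalc_cong[OF h(1)])
      fix k assume k: "k < Suc ?m"
      show "slot_coeffs ?bs k = insert_slot (\<delta> h) j ?c k"
      proof (cases k)
        case 0
        then show ?thesis by (simp add: slot_coeffs_def insert_slot_def)
      next
        case (Suc l)
        consider "l < j" | "l = j" | "j < l" by linarith
        then show ?thesis
        proof cases
          case 3
          then obtain i where i: "l = Suc (j + i)" using less_iff_Suc_add by auto
          then show ?thesis using Suc j k bs(2) by (simp add: slot_coeffs_def insert_slot_def nth_append)
        qed (use Suc j bs(2) in \<open>auto simp: slot_coeffs_def insert_slot_def nth_append\<close>)
      qed
    qed
    finally show "scalc (Suc ?m) h (\<lambda>x. chi (Suc ?m) R x * partial_divided_diff j F x) (insert_slot (\<delta> h) j ?c) =
      func_calc (partial_divided_diff j F) h ?bs" ..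
  qed
  show ?thesis using form unfolding S1 S2 f0[symmetric] .
qed

end

theorem theorem2p2:
  fixes D :: "'a::cstar_algebra set" and \<delta> :: "'a \<Rightarrow> 'a" and h :: 'a
  assumes "closed_derivation D \<delta>" and "h \<in> D" and "star h = h"
  shows
    "(\<forall>f :: real \<Rightarrow> complex. smooth 1 (\<lambda>t. f (t 0)) \<longrightarrow>
        func_calc (\<lambda>t. f (t 0)) h [] \<in> D \<and>
        \<delta> (func_calc (\<lambda>t. f (t 0)) h []) =
          func_calc (\<lambda>t. divided_diff (t 0) (t 1) f) h [\<delta> h])
     \<and>
     (\<forall>(n :: nat) (bs :: 'a list) (f :: (nat \<Rightarrow> real) \<Rightarrow> complex).
        n \<ge> 1 \<and> length bs = n \<and> set bs \<subseteq> D \<and> smooth (n + 1) f \<longrightarrow>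
        func_calc f h bs \<in> D \<and>
        \<delta> (func_calc f h bs) =
          (\<Sum>j<n. func_calc f h (bs[j := \<delta> (bs ! j)])) +
          (\<Sum>j\<le>n. func_calc (partial_divided_diff j f) h (take j bs @ \<delta> h # drop j bs)))"
proof (intro conjI allI impI)
  fix f :: "real \<Rightarrow> complex" assume f: "smooth 1 (\<lambda>t. f (t 0))"
  have pd: "partial_divided_diff 0 (\<lambda>t. f (t 0)) = (\<lambda>t. divided_diff (t 0) (t 1) f)"
    by (simp add: partial_divided_diff_def fun_eq_iff)
  \<comment> \<open>For the empty list the first sum is empty and the second has the single term
    \<open>j = 0\<close>.\<close>
  have *: "func_calc (\<lambda>t. f (t 0)) h [] \<in> D \<and>
      \<delta> (func_calc (\<lambda>t. f (t 0)) h []) = func_calc (partial_divided_diff 0 (\<lambda>t. f (t 0))) h [\<delta> h]"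
    using closed_derivation.derivation_func_calc[OF assms(1,3,2), of "[]" 0 "\<lambda>t. f (t 0)"] f by simp
  show "func_calc (\<lambda>t. f (t 0)) h [] \<in> D" using * by blast
  show "\<delta> (func_calc (\<lambda>t. f (t 0)) h []) = func_calc (\<lambda>t. divided_diff (t 0) (t 1) f) h [\<delta> h]"
    using * unfolding pd by blast
next
  fix n and bs :: "'a list" and f :: "(nat \<Rightarrow> real) \<Rightarrow> complex"
  assume a: "n \<ge> 1 \<and> length bs = n \<and> set bs \<subseteq> D \<and> smooth (n + 1) f"
  note * = closed_derivation.derivation_func_calc[OF assms(1,3,2), of bs n f]
  show "func_calc f h bs \<in> D" using * a by simp
  show "\<delta> (func_calc f h bs) = (\<Sum>j<n. func_calc f h (bs[j := \<delta> (bs ! j)])) +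
          (\<Sum>j\<le>n. func_calc (partial_divided_diff j f) h (take j bs @ \<delta> h # drop j bs))"
    using * a by simp
qed

end
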